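(* Let $\mathsf{k}$ be a field of characteristic $0$, $n\ge1$, and let $G$ be a finite group of symplectic automorphisms of the Weyl algebra $A_n(\mathsf{k})$. Then: (1) $fdim\,A_n(\mathsf{k})^G=1$, $h_{A_n(\mathsf{k})^G}=n$, and every nonzero finitely generated $A_n(\mathsf{k})^G$-module $M$ satisfies the Bernstein inequality $GK(M)\ge n$. (2) If $M$ is a nonzero holonomic $A_n(\mathsf{k})^G$-module, then $M$ is a cyclic torsion module of finite length bounded by $e(M)$. In particular, $M$ is simple if $e(M)=1$.
   Context: All modules are left modules; $GK$ denotes Gelfand-Kirillov dimension. $A_n(\mathsf{k})$ is generated by $x_1,\dots,x_n,y_1,\dots,y_n$ with relations $[x_i,x_j]=[y_i,y_j]=0$, $[y_i,x_j]=\delta_{ij}$. A symplectic automorphism is an algebra automorphism mapping $\mathrm{span}\langle x_1,\dots,x_n,y_1,\dots,y_n\rangle$ to itself. The holonomic number $h_B$ of an algebra $B$ is the infimum of $GK(M)$ over nonzero finitely generated $B$-modules; a holonomic $B$-module is a finitely generated one with $GK(M)=h_B$. $M$ is torsion if every element of $M$ is annihilated by a nonzero element of $B$. Multiplicity: $B=A_n(\mathsf{k})^G$ is an algebra with multiplicity, i.e. $GK(M)$ is a non-negative integer for each nonzero finitely generated module $M$, and there is a function $e$ assigning to each finitely generated module a non-negative integer, with $e(M)\ge1$ for $M\neq0$, such that for every short exact sequence $0\to M'\to M\to M''\to0$ of finitely generated modules $GK(M)=\max\{GK(M'),GK(M'')\}$, and $e(M)=e(M')+e(M'')$ whenever $GK(M)=GK(M')=GK(M'')$.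 In (2), $e$ is any such function. Filter dimension. Let $R$ be a finitely generated infinite-dimensional $\mathsf{k}$-algebra with generators $a_1,\dots,a_s$; put $R_0=\mathsf{k}$, $R_1=\mathrm{span}\langle 1,a_1,\dots,a_s\rangle$, $R_i=R_1^i$. Let $M$ be a finitely generated left $R$-module with finite-dimensional generating subspace $M_0$, and $M_i=R_iM_0$. The return function is $f(i)=\min\{j\in\mathbb{N}\cup\{\infty\}: R_jM'\supseteq M_0$ for every finite-dimensional subspace $M'\subseteq M_i$ that generates $M$ as an $R$-module$\}$ (equal to $\infty$ if no finite $j$ works). For $f:\mathbb{N}\to\mathbb{N}\cup\{\infty\}$ put $\Gamma(f)=\inf\{r\in\mathbb{R}: f(i)\le i^r \text{ for all sufficiently large } i\}$. The filter dimension of $M$ is $\Gamma(f)$ (independent of choices). $fdim(B)$ is the filter dimension of $B$ as a left $B\otimes_{\mathsf{k}}B^{op}$-module. *)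

theory Defs
  imports
    "Jordan_Normal_Form.VS_Connect"
    "HOL-Algebra.QuotRing"
    "HOL-Algebra.Bij"
    "HOL-Algebra.Subrings"
    "HOL-Library.Extended_Real"
begin

text \<open>
  Conventions. The base field is a type \<^typ>\<open>'k::field\<close>, viewed as a ring record through
  \<^const>\<open>class_ring\<close>. A k-algebra is a record of type \<^typ>\<open>('k, 'a) module\<close>: its ring
  fields are the ring operations and \<^const>\<open>smult\<close> is the scalar multiplication. A left module over
  an algebra \<open>R\<close> is a record of type \<^typ>\<open>('a, 'm) module\<close>; only the fields \<open>carrier\<close>,
  \<open>zero\<close>, \<open>add\<close> and \<open>smult\<close> are relevant there.
\<close>

section \<open>Algebras given by generators and relations\<close>

definition monoid_algebra :: "('g, 'x) monoid_scheme \<Rightarrow> ('k::field, 'g \<Rightarrow> 'k) module"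
  where "monoid_algebra P =
    \<lparr>carrier = {f. finite {g. f g \<noteq> 0} \<and> {g. f g \<noteq> 0} \<subseteq> carrier P},
     mult = (\<lambda>f h w. \<Sum>(u, v) \<in> {(u, v). f u \<noteq> 0 \<and> h v \<noteq> 0 \<and> u \<otimes>\<^bsub>P\<^esub> v = w}. f u * h v),
     one = (\<lambda>w. if w = \<one>\<^bsub>P\<^esub> then 1 else 0),
     zero = (\<lambda>w. 0),
     add = (\<lambda>f h w. f w + h w),
     smult = (\<lambda>c f w. c * f w)\<rparr>"

definition basis_elt :: "'g \<Rightarrow> 'g \<Rightarrow> 'k::field"
  where "basis_elt g = (\<lambda>w. if w = g then 1 else 0)"

definition quotient_algebra :: "('k, 'a) module \<Rightarrow> 'a set \<Rightarrow> ('k, 'a set) module"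
  where "quotient_algebra F S =
    ring.extend (F Quot (Idl\<^bsub>F\<^esub> S))
      (module.fields (\<lambda>c C. \<Union>f\<in>C. (Idl\<^bsub>F\<^esub> S) +>\<^bsub>F\<^esub> (c \<odot>\<^bsub>F\<^esub> f)))"

definition free_monoid :: "'g set \<Rightarrow> 'g list monoid"
  where "free_monoid S = \<lparr>carrier = lists S, mult = (@), one = []\<rparr>"

definition free_algebra :: "'g set \<Rightarrow> ('k::field, 'g list \<Rightarrow> 'k) module"
  where "free_algebra S = monoid_algebra (free_monoid S)"

section \<open>The Weyl algebra, symplectic automorphisms and invariants\<close>

datatype weyl_gen = WX nat | WY nat

type_synonym 'k weyl = "(weyl_gen list \<Rightarrow> 'k) set"

definition weyl_gens :: "nat \<Rightarrow> weyl_gen set"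
  where "weyl_gens n = WX ` {..<n} \<union> WY ` {..<n}"

definition commutator :: "('a, 'b) ring_scheme \<Rightarrow> 'a \<Rightarrow> 'a \<Rightarrow> 'a"
  where "commutator R a b = (a \<otimes>\<^bsub>R\<^esub> b) \<ominus>\<^bsub>R\<^esub> (b \<otimes>\<^bsub>R\<^esub> a)"

definition weyl_relations :: "nat \<Rightarrow> (weyl_gen list \<Rightarrow> 'k::field) set"
  where "weyl_relations n =
    (let F = (free_algebra (weyl_gens n) :: ('k, weyl_gen list \<Rightarrow> 'k) module);
         x = (\<lambda>i. basis_elt [WX i]);
         y = (\<lambda>i. basis_elt [WY i])
     in {commutator F (x i) (x j) | i j. i < n \<and> j < n}
      \<union> {commutator F (y i) (y j) | i j. i < n \<and> j < n}
      \<union> {commutator F (y i) (x j) \<ominus>\<^bsub>F\<^esub> (if i = j then \<one>\<^bsub>F\<^esub> else \<zero>\<^bsub>F\<^esub>) | i j. i < n \<and> j < n})"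

definition weyl_algebra :: "nat \<Rightarrow> ('k::field, 'k weyl) module"
  where "weyl_algebra n = quotient_algebra (free_algebra (weyl_gens n)) (weyl_relations n)"

definition weyl_elt :: "nat \<Rightarrow> weyl_gen \<Rightarrow> 'k::field weyl"
  where "weyl_elt n g =
    (let F = (free_algebra (weyl_gens n) :: ('k, weyl_gen list \<Rightarrow> 'k) module)
     in (Idl\<^bsub>F\<^esub> (weyl_relations n)) +>\<^bsub>F\<^esub> basis_elt [g])"

definition weyl_linear_part :: "nat \<Rightarrow> 'k::field weyl set"
  where "weyl_linear_part n = LinearCombinations.module.span class_ring (weyl_algebra n) (weyl_elt n ` weyl_gens n)"

definition algebra_automorphism :: "('k, 'a) module \<Rightarrow> ('a \<Rightarrow> 'a) \<Rightarrow> bool"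
  where "algebra_automorphism A \<sigma> \<longleftrightarrow>
    \<sigma> \<in> ring_iso A A \<and> (\<forall>c. \<forall>a\<in>carrier A. \<sigma> (c \<odot>\<^bsub>A\<^esub> a) = c \<odot>\<^bsub>A\<^esub> \<sigma> a)"

definition symplectic :: "nat \<Rightarrow> ('k::field weyl \<Rightarrow> 'k weyl) \<Rightarrow> bool"
  where "symplectic n \<sigma> \<longleftrightarrow>
    algebra_automorphism (weyl_algebra n) \<sigma> \<and> \<sigma> ` weyl_linear_part n \<subseteq> weyl_linear_part n"

definition invariant_algebra :: "('k, 'a) module \<Rightarrow> ('a \<Rightarrow> 'a) set \<Rightarrow> ('k, 'a) module"
  where "invariant_algebra A G = A\<lparr>carrier := {a \<in> carrier A. \<forall>\<sigma>\<in>G. \<sigma> a = a}\<rparr>"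

section \<open>Left modules over noncommutative rings\<close>

text \<open>The library locale \<^locale>\<open>module\<close> requires a commutative ring of scalars.\<close>

locale left_module = R?: ring R + M?: abelian_group M
  for R :: "('a, 'b) ring_scheme" (structure) and M :: "('a, 'm, 'c) module_scheme" (structure) +
  assumes smult_closed:
      "\<lbrakk>a \<in> carrier R; x \<in> carrier M\<rbrakk> \<Longrightarrow> a \<odot>\<^bsub>M\<^esub> x \<in> carrier M"
    and smult_l_distr:
      "\<lbrakk>a \<in> carrier R; b \<in> carrier R; x \<in> carrier M\<rbrakk> \<Longrightarrow>
        (a \<oplus>\<^bsub>R\<^esub> b) \<odot>\<^bsub>M\<^esub> x = (a \<odot>\<^bsub>M\<^esub> x) \<oplus>\<^bsub>M\<^esub> (b \<odot>\<^bsub>M\<^esub> x)"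
    and smult_r_distr:
      "\<lbrakk>a \<in> carrier R; x \<in> carrier M; y \<in> carrier M\<rbrakk> \<Longrightarrow>
        a \<odot>\<^bsub>M\<^esub> (x \<oplus>\<^bsub>M\<^esub> y) = (a \<odot>\<^bsub>M\<^esub> x) \<oplus>\<^bsub>M\<^esub> (a \<odot>\<^bsub>M\<^esub> y)"
    and smult_assoc:
      "\<lbrakk>a \<in> carrier R; b \<in> carrier R; x \<in> carrier M\<rbrakk> \<Longrightarrow>
        (a \<otimes>\<^bsub>R\<^esub> b) \<odot>\<^bsub>M\<^esub> x = a \<odot>\<^bsub>M\<^esub> (b \<odot>\<^bsub>M\<^esub> x)"
    and smult_one: "x \<in> carrier M \<Longrightarrow> \<one>\<^bsub>R\<^esub> \<odot>\<^bsub>M\<^esub> x = x"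

definition submodule_gen :: "('a, 'b) ring_scheme \<Rightarrow> ('a, 'm) module \<Rightarrow> 'm set \<Rightarrow> 'm set"
  where "submodule_gen R M S = \<Inter>{N. Module.submodule N R M \<and> S \<subseteq> N}"

definition fg_module :: "('a, 'b) ring_scheme \<Rightarrow> ('a, 'm) module \<Rightarrow> bool"
  where "fg_module R M \<longleftrightarrow> left_module R M \<and>
    (\<exists>S. finite S \<and> S \<subseteq> carrier M \<and> submodule_gen R M S = carrier M)"

definition nonzero_module :: "('a, 'm) module \<Rightarrow> bool"
  where "nonzero_module M \<longleftrightarrow> carrier M \<noteq> {\<zero>\<^bsub>M\<^esub>}"

definition simple_module :: "('a, 'b) ring_scheme \<Rightarrow> ('a, 'm) module \<Rightarrow> bool"
  where "simple_module R M \<longleftrightarrow> left_module R M \<and> nonzero_module M \<and>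
    (\<forall>N. Module.submodule N R M \<longrightarrow> N = {\<zero>\<^bsub>M\<^esub>} \<or> N = carrier M)"

definition cyclic_module :: "('a, 'b) ring_scheme \<Rightarrow> ('a, 'm) module \<Rightarrow> bool"
  where "cyclic_module R M \<longleftrightarrow> left_module R M \<and>
    (\<exists>m\<in>carrier M. submodule_gen R M {m} = carrier M)"

definition torsion_module :: "('a, 'b) ring_scheme \<Rightarrow> ('a, 'm) module \<Rightarrow> bool"
  where "torsion_module R M \<longleftrightarrow> left_module R M \<and>
    (\<forall>m\<in>carrier M. \<exists>b\<in>carrier R. b \<noteq> \<zero>\<^bsub>R\<^esub> \<and> b \<odot>\<^bsub>M\<^esub> m = \<zero>\<^bsub>M\<^esub>)"

definition module_length :: "('a, 'b) ring_scheme \<Rightarrow> ('a, 'm) module \<Rightarrow> enat"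
  where "module_length R M =
    (SUP l \<in> {l. \<exists>N. (\<forall>i\<le>l. Module.submodule (N i) R M) \<and> (\<forall>i<l. N i \<subset> N (Suc i))}. enat l)"

definition short_exact ::
    "('a, 'b) ring_scheme \<Rightarrow> ('a, 'm1) module \<Rightarrow> ('m1 \<Rightarrow> 'm2) \<Rightarrow> ('a, 'm2) module
      \<Rightarrow> ('m2 \<Rightarrow> 'm3) \<Rightarrow> ('a, 'm3) module \<Rightarrow> bool"
  where "short_exact R M' f M g M'' \<longleftrightarrow>
    f \<in> LinearCombinations.module_hom R M' M \<and> g \<in> LinearCombinations.module_hom R M M'' \<and>
    inj_on f (carrier M') \<and> g ` carrier M = carrier M'' \<and>
    f ` carrier M' = {m \<in> carrier M. g m = \<zero>\<^bsub>M''\<^esub>}"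

section \<open>Growth and Gelfand-Kirillov dimension\<close>

definition base_space :: "('k, 'a) module \<Rightarrow> ('a, 'm) module \<Rightarrow> ('k, 'm) module"
  where "base_space R M =
    \<lparr>carrier = carrier M, mult = mult M, one = one M, zero = zero M, add = add M,
     smult = (\<lambda>c m. (c \<odot>\<^bsub>R\<^esub> \<one>\<^bsub>R\<^esub>) \<odot>\<^bsub>M\<^esub> m)\<rparr>"

definition fd_subspace :: "('k::field, 'v) module \<Rightarrow> 'v set \<Rightarrow> bool"
  where "fd_subspace V W \<longleftrightarrow>
    VectorSpace.subspace class_ring W V \<and> vectorspace.fin_dim class_ring (V\<lparr>carrier := W\<rparr>)"

definition subspace_dim :: "('k::field, 'v) module \<Rightarrow> 'v set \<Rightarrow> nat"
  where "subspace_dim V W = vectorspace.dim class_ring (V\<lparr>carrier := W\<rparr>)"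

fun space_power :: "('k::field, 'a) module \<Rightarrow> 'a set \<Rightarrow> nat \<Rightarrow> 'a set"
  where
    "space_power R V 0 = LinearCombinations.module.span class_ring R {\<one>\<^bsub>R\<^esub>}"
  | "space_power R V (Suc i) =
       LinearCombinations.module.span class_ring R {a \<otimes>\<^bsub>R\<^esub> b | a b. a \<in> V \<and> b \<in> space_power R V i}"

definition space_act :: "('k::field, 'a) module \<Rightarrow> ('a, 'm) module \<Rightarrow> 'a set \<Rightarrow> 'm set \<Rightarrow> 'm set"
  where "space_act R M V W =
    LinearCombinations.module.span class_ring (base_space R M) {a \<odot>\<^bsub>M\<^esub> m | a m. a \<in> V \<and> m \<in> W}"

text \<open>
  The exponent \<open>\<Gamma>(f)\<close>, with values in the extended reals: it is \<open>\<infinity>\<close> if no real exponent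
  works, and \<open>-\<infinity>\<close> if \<open>f\<close> is eventually zero.
\<close>

definition growth_exponent :: "(nat \<Rightarrow> enat) \<Rightarrow> ereal"
  where "growth_exponent f =
    Inf (ereal ` {r::real. \<forall>\<^sub>F i in sequentially. ereal_of_enat (f i) \<le> ereal (real i powr r)})"

text \<open>
  Gelfand-Kirillov dimension: the supremum, over finite-dimensional subspaces \<open>V\<close> of \<open>R\<close>
  containing 1 and finite-dimensional subspaces \<open>W\<close> of \<open>M\<close>, of the growth exponent of
  \<open>dim (V\<^sup>i W)\<close>. The zero module gets dimension \<open>-\<infinity>\<close>.
\<close>

definition GK :: "('k::field, 'a) module \<Rightarrow> ('a, 'm) module \<Rightarrow> ereal"
  where "GK R M =
    (SUP (V, W) \<in> {(V, W). fd_subspace R V \<and> \<one>\<^bsub>R\<^esub> \<in> V \<and> fd_subspace (base_space R M) W}.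
       growth_exponent
         (\<lambda>i. enat (subspace_dim (base_space R M) (space_act R M (space_power R V i) W))))"

text \<open>
  The infimum in the holonomic number ranges over modules whose elements are sets of functions
  \<^typ>\<open>nat \<Rightarrow> 'a\<close>. This loses no isomorphism class: a finitely generated \<open>R\<close>-module is a quotient
  of some free module of finite rank, and the elements of that quotient are cosets of tuples
  over \<open>R\<close>.
\<close>

definition holonomic_number :: "('k::field, 'a) module \<Rightarrow> ereal"
  where "holonomic_number R =
    (INF M \<in> {M :: ('a, (nat \<Rightarrow> 'a) set) module. fg_module R M \<and> nonzero_module M}. GK R M)"

definition holonomic :: "('k::field, 'a) module \<Rightarrow> ('a, 'm) module \<Rightarrow> bool"
  where "holonomic R M \<longleftrightarrow> fg_module R M \<and> GK R M = holonomic_number R"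

text \<open>
  The function \<open>e\<close> is only required to be defined, and additive, on modules with elements in
  the type \<^typ>\<open>'m\<close>; a multiplicity on all finitely generated modules restricts to such a function.
\<close>

definition multiplicity_function ::
    "('k::field, 'a) module \<Rightarrow> (('a, 'm) module \<Rightarrow> nat) \<Rightarrow> bool"
  where "multiplicity_function R e \<longleftrightarrow>
    (\<forall>M. fg_module R M \<and> nonzero_module M \<longrightarrow> 1 \<le> e M) \<and>
    (\<forall>M' f M g M''. fg_module R M' \<and> fg_module R M \<and> fg_module R M'' \<and>
       short_exact R M' f M g M'' \<and> GK R M = GK R M' \<and> GK R M = GK R M'' \<longrightarrow>
       e M = e M' + e M'')"

section \<open>Filter dimension\<close>

definition algebra_generated_by :: "('k::field, 'a) module \<Rightarrow> 'a set \<Rightarrow> bool"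
  where "algebra_generated_by R S \<longleftrightarrow> S \<subseteq> carrier R \<and>
    (\<forall>T. subring T R \<and> (\<forall>c. \<forall>a\<in>T. c \<odot>\<^bsub>R\<^esub> a \<in> T) \<and> S \<subseteq> T \<longrightarrow> carrier R \<subseteq> T)"

definition return_function ::
    "('k::field, 'a) module \<Rightarrow> ('a, 'm) module \<Rightarrow> 'a set \<Rightarrow> 'm set \<Rightarrow> nat \<Rightarrow> enat"
  where "return_function R M R1 M0 i =
    Inf {enat j | j. \<forall>M'. fd_subspace (base_space R M) M' \<and>
           M' \<subseteq> space_act R M (space_power R R1 i) M0 \<and>
           submodule_gen R M M' = carrier M \<longrightarrow>
           M0 \<subseteq> space_act R M (space_power R R1 j) M'}"

definition filter_dim_data ::
    "('k::field, 'a) module \<Rightarrow> ('a, 'm) module \<Rightarrow> 'a set \<Rightarrow> 'm set \<Rightarrow> bool"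
  where "filter_dim_data R M S M0 \<longleftrightarrow>
    finite S \<and> algebra_generated_by R S \<and>
    fd_subspace (base_space R M) M0 \<and> submodule_gen R M M0 = carrier M"

text \<open>
  \<open>has_filter_dimension R M d\<close>: the filter dimension of \<open>M\<close> is defined and every choice of
  algebra generators of \<open>R\<close> and of a generating subspace of \<open>M\<close> yields the value \<open>d\<close>.
\<close>

definition has_filter_dimension ::
    "('k::field, 'a) module \<Rightarrow> ('a, 'm) module \<Rightarrow> ereal \<Rightarrow> bool"
  where "has_filter_dimension R M d \<longleftrightarrow>
    left_module R M \<and> \<not> vectorspace.fin_dim class_ring R \<and>
    (\<exists>S M0. filter_dim_data R M S M0) \<and>
    (\<forall>S M0. filter_dim_data R M S M0 \<longrightarrow>
       growth_exponent
         (return_function R M (LinearCombinations.module.span class_ring R (insert \<one>\<^bsub>R\<^esub> S)) M0) = d)"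

definition opposite_algebra :: "('k, 'a) module \<Rightarrow> ('k, 'a) module"
  where "opposite_algebra B = B\<lparr>mult := (\<lambda>a b. b \<otimes>\<^bsub>B\<^esub> a)\<rparr>"

text \<open>
  The tensor product of two algebras: the algebra with basis the pairs \<open>(a, b)\<close>, multiplied
  componentwise, modulo the relations making the class of \<open>(a, b)\<close> bilinear in \<open>a\<close> and \<open>b\<close>.
\<close>

definition bilinear_relations ::
    "('k::field, 'a) module \<Rightarrow> ('k, 'b) module \<Rightarrow> ('a \<times> 'b \<Rightarrow> 'k) set"
  where "bilinear_relations A B =
    (let F = (monoid_algebra (A \<times>\<times> B) :: ('k, 'a \<times> 'b \<Rightarrow> 'k) module);
         t = (\<lambda>a b. basis_elt (a, b))
     in {(t (a \<oplus>\<^bsub>A\<^esub> a') b \<ominus>\<^bsub>F\<^esub> t a b) \<ominus>\<^bsub>F\<^esub> t a' b | a a' b.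
           a \<in> carrier A \<and> a' \<in> carrier A \<and> b \<in> carrier B}
      \<union> {(t a (b \<oplus>\<^bsub>B\<^esub> b') \<ominus>\<^bsub>F\<^esub> t a b) \<ominus>\<^bsub>F\<^esub> t a b' | a b b'.
           a \<in> carrier A \<and> b \<in> carrier B \<and> b' \<in> carrier B}
      \<union> {t (c \<odot>\<^bsub>A\<^esub> a) b \<ominus>\<^bsub>F\<^esub> (c \<odot>\<^bsub>F\<^esub> t a b) | c a b. a \<in> carrier A \<and> b \<in> carrier B}
      \<union> {t a (c \<odot>\<^bsub>B\<^esub> b) \<ominus>\<^bsub>F\<^esub> (c \<odot>\<^bsub>F\<^esub> t a b) | c a b. a \<in> carrier A \<and> b \<in> carrier B})"

definition tensor_algebra ::
    "('k::field, 'a) module \<Rightarrow> ('k, 'b) module \<Rightarrow> ('k, ('a \<times> 'b \<Rightarrow> 'k) set) module"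
  where "tensor_algebra A B = quotient_algebra (monoid_algebra (A \<times>\<times> B)) (bilinear_relations A B)"

definition enveloping_algebra ::
    "('k::field, 'a) module \<Rightarrow> ('k, ('a \<times> 'a \<Rightarrow> 'k) set) module"
  where "enveloping_algebra B = tensor_algebra B (opposite_algebra B)"

text \<open>
  \<open>B\<close> as a left module over its enveloping algebra, \<open>(a \<otimes> b) \<cdot> x = a x b\<close>. The action of a
  coset is computed on any of its representatives, all of which act in the same way.
\<close>

definition regular_bimodule ::
    "('k::field, 'a) module \<Rightarrow> (('a \<times> 'a \<Rightarrow> 'k) set, 'a) module"
  where "regular_bimodule B =
    \<lparr>carrier = carrier B, mult = mult B, one = one B, zero = zero B, add = add B,
     smult = (\<lambda>C x. the_elem
       ((\<lambda>f. \<Oplus>\<^bsub>B\<^esub>p\<in>{p. f p \<noteq> 0}. f p \<odot>\<^bsub>B\<^esub> ((fst p \<otimes>\<^bsub>B\<^esub> x) \<otimes>\<^bsub>B\<^esub> snd p)) ` C))\<rparr>"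

definition has_fdim :: "('k::field, 'a) module \<Rightarrow> ereal \<Rightarrow> bool"
  where "has_fdim B d \<longleftrightarrow> has_filter_dimension (enveloping_algebra B) (regular_bimodule B) d"

end

theory Submission
  imports Defs "Jordan_Normal_Form.DL_Rank" "HOL-Real_Asymp.Real_Asymp" "HOL-Library.Multiset_Order"
begin

text \<open>
  Let \<open>A = A\<^sub>n(k)\<close> carry the Bernstein filtration and \<open>B = A\<^sup>G\<close> the induced one, \<open>B\<^sub>i\<close>; then \<open>dim B\<^sub>i\<close>
  grows like \<open>i\<^sup>2\<^sup>n\<close>. Commutators with generators lower the degree, and commutators twisted by
  \<open>g \<noteq> 1\<close> are injective, so that a nonzero \<open>b \<in> B\<^sub>d\<close> satisfies \<open>1 \<in> B\<^sub>p b B\<^sub>p\<close> for some \<open>p\<close> linear in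
  \<open>d\<close>. This bounds the filter dimension by 1 from above. It also embeds \<open>B\<^sub>i\<close> into the linear maps
  from \<open>B\<^sub>p u\<close> to \<open>B\<^sub>p\<^sub>+\<^sub>i u\<close> for every nonzero element \<open>u\<close> of a module, whence \<open>GK \<ge> n\<close>, with lower bounds
  for \<open>dim B\<^sub>j u\<close> that are uniform in \<open>u\<close>.

  Conversely \<open>B\<^sub>i\<close> acts on the polynomials of degree at most \<open>p\<close> in each variable by matrices with
  \<open>(p + 1)\<^sup>n (p + i + 1)\<^sup>n\<close> entries. If \<open>p\<close> is small compared with \<open>i\<close>, some nonzero \<open>b \<in> B\<^sub>i\<close> kills these
  polynomials, so that \<open>1 \<notin> B\<^sub>p b B\<^sub>p\<close> and the filter dimension is at least 1. The cyclic module generated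
  by the polynomial 1 has \<open>GK \<le> n\<close>.

  If \<open>GK(M) = n\<close>, then \<open>dim B\<^sub>j u = O(j\<^sup>n)\<close>. Compared with the uniform lower bounds this limits the
  length of chains of submodules, and compared with \<open>dim B\<^sub>j\<close> it makes \<open>M\<close> torsion. Simplicity of \<open>B\<close>,
  torsion and finite length make \<open>M\<close> cyclic by Stafford's argument, and every proper step in a chain
  of submodules costs at least 1 in the multiplicity.
\<close>

section \<open>Linear algebra in record-based vector spaces\<close>

text \<open>The algebra B comes without explicit generators or a known graded ring, so most
  arguments run in A and return through the trace \<open>tr\<close>, which is B-bilinear and
  multiplies B by |G|. The engine is \<open>galois_identity\<close>: every nonzero b admits pairs u,
  v in A such that the sum of u b g(v) is 1 for the identity and 0 for every other g. For b = 1 it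
  yields dual bases of A over B; for b in B, applying \<open>tr\<close> yields the simplicity of B.
  Clearing one group element doubles the degree, so the cost is 2^|G| times the degree of b: linear
  in it, as all later bounds require. A second obstacle: GK(M) = n is an infimum of exponents and
  gives only j^(n + eps) as a bound for the growth of a cyclic submodule, while bounding chains
  needs O(j^n). The gap closes because standard monomials of a left ideal grow with an integral
  exponent; monomials exist in A, so the left ideal is taken there. Third, GK and the filter
  dimension are measured by powers of finite-dimensional generating spaces, not by degree. An
  Artin-Tate argument compares the two at linear cost.\<close>

inductive_set kspan :: "('k::field, 'v) module \<Rightarrow> 'v set \<Rightarrow> 'v set" for V S where
  kspan_zero: "\<zero>\<^bsub>V\<^esub> \<in> kspan V S"
| kspan_base: "x \<in> S \<Longrightarrow> x \<in> kspan V S"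
| kspan_add: "x \<in> kspan V S \<Longrightarrow> y \<in> kspan V S \<Longrightarrow> x \<oplus>\<^bsub>V\<^esub> y \<in> kspan V S"
| kspan_smult: "x \<in> kspan V S \<Longrightarrow> c \<odot>\<^bsub>V\<^esub> x \<in> kspan V S"

definition ksub :: "('k::field, 'v) module \<Rightarrow> 'v set \<Rightarrow> bool" where
  "ksub V W \<longleftrightarrow> W \<subseteq> carrier V \<and> \<zero>\<^bsub>V\<^esub> \<in> W \<and> (\<forall>x\<in>W. \<forall>y\<in>W. x \<oplus>\<^bsub>V\<^esub> y \<in> W) \<and>
     (\<forall>c. \<forall>x\<in>W. c \<odot>\<^bsub>V\<^esub> x \<in> W)"

lemma ksubD:
  assumes "ksub V W"
  shows "x \<in> W \<Longrightarrow> x \<in> carrier V" "\<zero>\<^bsub>V\<^esub> \<in> W"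
    "x \<in> W \<Longrightarrow> y \<in> W \<Longrightarrow> x \<oplus>\<^bsub>V\<^esub> y \<in> W" "x \<in> W \<Longrightarrow> c \<odot>\<^bsub>V\<^esub> x \<in> W"
  using assms by (auto simp: ksub_def)

lemma kspan_least: "S \<subseteq> W \<Longrightarrow> ksub V W \<Longrightarrow> kspan V S \<subseteq> W"
proof
  fix x assume "S \<subseteq> W" "ksub V W" "x \<in> kspan V S"
  from this(3,1,2) show "x \<in> W" by induction (auto dest: ksubD)
qed

lemma kspan_mono: "S \<subseteq> T \<Longrightarrow> kspan V S \<subseteq> kspan V T"
proof
  fix x assume "S \<subseteq> T" "x \<in> kspan V S"
  from this(2,1) show "x \<in> kspan V T" by induction (auto intro: kspan.intros)
qed

lemma kspan_trans: "S \<subseteq> kspan V T \<Longrightarrow> kspan V S \<subseteq> kspan V T"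
proof
  fix x assume "S \<subseteq> kspan V T" "x \<in> kspan V S"
  from this(2,1) show "x \<in> kspan V T" by induction (auto intro: kspan.intros)
qed

text \<open>No carrier enters the inductive rules, so spans are the same sets in a space, in its
  subspaces, and in the invariant subalgebra obtained by shrinking the carrier.\<close>

lemma kspan_cong_ops:
  assumes "zero V = zero V'" "add V = add V'" "smult V = smult V'"
  shows "kspan V S = kspan (V' :: ('a::field, 'b) module) S"
proof -
  have "kspan U S \<subseteq> kspan U' S"
    if "zero U = zero U'" "add U = add U'" "smult U = smult U'" for U U' :: "('a, 'b) module"
  proof
    fix x assume "x \<in> kspan U S"
    then show "x \<in> kspan U' S"
      by induction (auto simp: that intro: kspan_zero kspan_base kspan_add[where V=U'] kspan_smult[where V=U'])
  qed
  from this[of V V'] this[of V' V] show ?thesis using assms by auto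
qed

lemma kspan_carrier_update[simp]: "kspan (V\<lparr>carrier := W\<rparr>) S = kspan V S"
  by (rule kspan_cong_ops) auto

lemma kspan_ksub: "ksub V W \<Longrightarrow> kspan V W = W"
  using kspan_least[of W W V] by (auto intro: kspan_base)

lemma class_ring_sel[simp]:
  "carrier (class_ring :: 'k::field ring) = UNIV" "monoid.mult (class_ring :: 'k ring) = (*)"
  "one (class_ring :: 'k ring) = 1" "zero (class_ring :: 'k ring) = 0" "add (class_ring :: 'k ring) = (+)"
  by (simp_all add: class_ring_simps)

locale kspace =
  fixes V :: "('k::field, 'v) module" (structure)
  assumes vs: "vectorspace (class_ring :: 'k ring) V"

sublocale kspace \<subseteq> vectorspace "class_ring :: 'k ring" V
  by (rule vs)

lemma kspaceI:
  fixes V :: "('k::field, 'v) module" (structure)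
  assumes "\<zero> \<in> carrier V"
    and "\<And>v w. v \<in> carrier V \<Longrightarrow> w \<in> carrier V \<Longrightarrow> v \<oplus> w \<in> carrier V"
    and "\<And>v. v \<in> carrier V \<Longrightarrow> \<exists>w\<in>carrier V. v \<oplus> w = \<zero>"
    and "\<And>c v. v \<in> carrier V \<Longrightarrow> c \<odot> v \<in> carrier V"
    and "\<And>v w. v \<in> carrier V \<Longrightarrow> w \<in> carrier V \<Longrightarrow> v \<oplus> w = w \<oplus> v"
    and "\<And>u v w. u \<in> carrier V \<Longrightarrow> v \<in> carrier V \<Longrightarrow> w \<in> carrier V \<Longrightarrow> (u \<oplus> v) \<oplus> w = u \<oplus> (v \<oplus> w)"
    and "\<And>v. v \<in> carrier V \<Longrightarrow> v \<oplus> \<zero> = v"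
    and "\<And>a b v. v \<in> carrier V \<Longrightarrow> (a * b) \<odot> v = a \<odot> (b \<odot> v)"
    and "\<And>v. v \<in> carrier V \<Longrightarrow> 1 \<odot> v = v"
    and "\<And>a b v. v \<in> carrier V \<Longrightarrow> (a + b) \<odot> v = a \<odot> v \<oplus> b \<odot> v"
    and "\<And>a v w. v \<in> carrier V \<Longrightarrow> w \<in> carrier V \<Longrightarrow> a \<odot> (v \<oplus> w) = a \<odot> v \<oplus> a \<odot> w"
  shows "kspace V"
  unfolding kspace_def
  apply (rule vs_criteria[OF class_field]; (unfold class_ring_sel)?)
  subgoal by (rule assms(1))
  subgoal using assms(2) by blast
  subgoal using assms(3) by blast
  subgoal using assms(4) by blast
  subgoal using assms(5) by blast
  subgoal using assms(6) by blast
  subgoal using assms(7) by blast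
  subgoal using assms(8) by blast
  subgoal using assms(9) by blast
  subgoal using assms(10) by blast
  subgoal using assms(11) by blast
  done

context kspace
begin

lemma smult_in[simp, intro]: "x \<in> carrier V \<Longrightarrow> c \<odot> x \<in> carrier V"
  by (rule smult_closed) auto

lemma smult_assoc: "x \<in> carrier V \<Longrightarrow> (a * b) \<odot> x = a \<odot> (b \<odot> x)"
  using smult_assoc1[of a b x] by simp

lemma smult_add_l: "x \<in> carrier V \<Longrightarrow> (a + b) \<odot> x = a \<odot> x \<oplus> b \<odot> x"
  using smult_l_distr[of a b x] by simp

lemma smult_add_r: "x \<in> carrier V \<Longrightarrow> y \<in> carrier V \<Longrightarrow> a \<odot> (x \<oplus> y) = a \<odot> x \<oplus> a \<odot> y"
  using smult_r_distr[of a x y] by simp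

lemma smult_1[simp]: "x \<in> carrier V \<Longrightarrow> 1 \<odot> x = x"
  using smult_one[of x] by simp

lemma smult_0[simp]: "x \<in> carrier V \<Longrightarrow> 0 \<odot> x = \<zero>"
  using smult_l_null[of x] by simp

lemma smult_zero[simp]: "c \<odot> \<zero> = \<zero>"
  using smult_r_null[of c] by simp

lemma smult_neg1: "x \<in> carrier V \<Longrightarrow> (-1) \<odot> x = \<ominus> x"
proof -
  assume x: "x \<in> carrier V"
  have "(-1) \<odot> x \<oplus> x = (-1 + 1) \<odot> x" using x by (subst smult_add_l) auto
  also have "\<dots> = \<zero>" using x by simp
  finally show ?thesis using x by (simp add: minus_equality)
qed

lemma smult_eq_0: "x \<in> carrier V \<Longrightarrow> c \<odot> x = \<zero> \<Longrightarrow> c \<noteq> 0 \<Longrightarrow> x = \<zero>"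
proof -
  assume a: "x \<in> carrier V" "c \<odot> x = \<zero>" "c \<noteq> 0"
  have "x = (inverse c * c) \<odot> x" using a by simp
  also have "\<dots> = \<zero>" using a by (simp only: smult_assoc) simp
  finally show ?thesis .
qed

lemma ksub_neg: "ksub V W \<Longrightarrow> x \<in> W \<Longrightarrow> \<ominus> x \<in> W"
  using smult_neg1[of x] ksubD(4)[of V W x "-1"] ksubD(1)[of V W x] by simp

lemma ksub_minus: "ksub V W \<Longrightarrow> x \<in> W \<Longrightarrow> y \<in> W \<Longrightarrow> x \<ominus> y \<in> W"
  using ksub_neg[of W y] by (simp add: a_minus_def ksubD(3))

lemma ksub_carrier: "ksub V (carrier V)"
  by (auto simp: ksub_def)

lemma ksub_zero: "ksub V {\<zero>}"
  by (auto simp: ksub_def)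

lemma kspan_sub: "S \<subseteq> carrier V \<Longrightarrow> ksub V (kspan V S)"
  using kspan_least[OF _ ksub_carrier, of S] by (auto simp: ksub_def intro: kspan.intros)

lemma ksub_iff: "ksub V W \<longleftrightarrow> VectorSpace.subspace class_ring W V"
  using vectorspace_axioms module_axioms
  by (auto simp: ksub_def VectorSpace.subspace_def LinearCombinations.submodule_def)

lemma ksub_Int: "ksub V W \<Longrightarrow> ksub V W' \<Longrightarrow> ksub V (W \<inter> W')"
  by (auto simp: ksub_def)

lemma kspan_eq: "S \<subseteq> carrier V \<Longrightarrow> span S = kspan V S"
proof
  assume S: "S \<subseteq> carrier V"
  have "LinearCombinations.submodule class_ring (kspan V S) V"
    using kspan_sub[OF S] by (simp add: ksub_iff VectorSpace.subspace_def)
  then show "span S \<subseteq> kspan V S"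
    by (intro span_is_subset) (auto intro: kspan_base)
  have "ksub V (span S)"
    unfolding ksub_iff using S span_is_subspace by blast
  then show "kspan V S \<subseteq> span S"
    using S span_mem by (intro kspan_least) auto
qed

lemma kspace_sub: "ksub V W \<Longrightarrow> kspace (V\<lparr>carrier := W\<rparr>)"
  unfolding kspace_def ksub_iff by (rule subspace_is_vs)

text \<open>\<open>fd_subspace\<close> speaks of a record with a shrunken carrier; a finite spanning
  set inside W, with spans taken in V, avoids changing the space.\<close>

lemma fd_iff: "fd_subspace V W \<longleftrightarrow> ksub V W \<and> (\<exists>S. finite S \<and> S \<subseteq> W \<and> kspan V S = W)"
proof -
  { assume W: "ksub V W"
    then interpret W: kspace "V\<lparr>carrier := W\<rparr>" by (rule kspace_sub)
    have "W.fin_dim \<longleftrightarrow> (\<exists>S. finite S \<and> S \<subseteq> W \<and> kspan V S = W)"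
      unfolding W.fin_dim_def using W.kspan_eq by auto }
  then show ?thesis unfolding fd_subspace_def ksub_iff by auto
qed

lemma fd_ksub: "fd_subspace V W \<Longrightarrow> ksub V W"
  by (simp add: fd_iff)

lemma fd_kspan:
  assumes "finite S" "S \<subseteq> carrier V"
  shows "fd_subspace V (kspan V S)" "subspace_dim V (kspan V S) \<le> card S"
proof -
  have W: "ksub V (kspan V S)" by (rule kspan_sub[OF assms(2)])
  show "fd_subspace V (kspan V S)" unfolding fd_iff
    using W assms by (auto intro!: exI[of _ S] kspan_base)
  interpret W: kspace "V\<lparr>carrier := kspan V S\<rparr>" using W by (rule kspace_sub)
  have "W.dim \<le> card S"
    using assms W.kspan_eq[of S] by (intro W.gen_ge_dim) (auto intro: kspan_base)
  then show "subspace_dim V (kspan V S) \<le> card S" by (simp add: subspace_dim_def)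
qed

lemma fd_basis:
  assumes "fd_subspace V W"
  obtains S where "finite S" "S \<subseteq> W" "kspan V S = W" "card S = subspace_dim V W"
proof -
  have W: "ksub V W" using assms by (rule fd_ksub)
  then interpret W: kspace "V\<lparr>carrier := W\<rparr>" by (rule kspace_sub)
  have "W.fin_dim" using assms by (simp add: fd_subspace_def)
  then obtain S where S: "finite S" "W.basis S" using W.finite_basis_exists by blast
  then have "S \<subseteq> W" "W.span S = W" by (auto simp: W.basis_def)
  then have "kspan V S = W" using W.kspan_eq[of S] by simp
  with S \<open>S \<subseteq> W\<close> show thesis
    by (intro that[of S]) (auto simp: subspace_dim_def W.dim_basis)
qed

text \<open>Sets independent in U stay independent in W, so they have at most dim W elements; hence
  a maximal one exists, and it is a basis of U.\<close>

lemma fd_mono: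
  assumes "fd_subspace V W" "ksub V U" "U \<subseteq> W"
  shows "fd_subspace V U" "subspace_dim V U \<le> subspace_dim V W"
proof -
  have W: "ksub V W" using assms by (simp add: fd_ksub)
  then interpret W: kspace "V\<lparr>carrier := W\<rparr>" by (rule kspace_sub)
  interpret U: kspace "V\<lparr>carrier := U\<rparr>" using assms(2) by (rule kspace_sub)
  have fd: "W.fin_dim" using assms by (simp add: fd_subspace_def)
  have UW: "VectorSpace.subspace class_ring U (V\<lparr>carrier := W\<rparr>)"
    using assms W unfolding ksub_iff by (intro nested_subspaces) auto
  have subm: "LinearCombinations.submodule class_ring U (V\<lparr>carrier := W\<rparr>)" using UW by (simp add: VectorSpace.subspace_def)
  have li: "U.lin_dep S = W.lin_dep S" if "S \<subseteq> U" for S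
    using W.span_li_not_depend(2)[OF that subm] by simp
  have "\<exists>S. finite S \<and> maximal S (\<lambda>S. S \<subseteq> carrier (V\<lparr>carrier := U\<rparr>) \<and> \<not> U.lin_dep S)"
  proof (rule maximal_exists)
    fix S assume "S \<subseteq> carrier (V\<lparr>carrier := U\<rparr>) \<and> \<not> U.lin_dep S"
    then have "S \<subseteq> U" "\<not> W.lin_dep S" by (auto simp: li)
    then show "finite S \<and> card S \<le> W.dim"
      using W.li_le_dim[OF fd, of S] assms(3) by auto
  next
    have "\<not> U.lin_dep {}" unfolding U.lin_dep_def by auto
    then show "{} \<subseteq> carrier (V\<lparr>carrier := U\<rparr>) \<and> \<not> U.lin_dep {}" by simp
  qed
  then obtain S where S: "finite S" "U.basis S"
    using U.max_li_is_basis by blast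
  then have fdU: "U.fin_dim" by (auto simp: U.fin_dim_def U.basis_def)
  then show "fd_subspace V U" using assms(2) by (simp add: fd_subspace_def ksub_iff)
  have "\<not> W.lin_dep S" "S \<subseteq> U" using S li by (auto simp: U.basis_def)
  then have "card S \<le> W.dim" using W.li_le_dim[OF fd, of S] assms(3) by auto
  then show "subspace_dim V U \<le> subspace_dim V W"
    using U.dim_basis[OF S] by (simp add: subspace_dim_def)
qed

lemma fd_Un:
  assumes "fd_subspace V W" "fd_subspace V W'"
  shows "fd_subspace V (kspan V (W \<union> W'))"
proof -
  obtain S where S: "finite S" "S \<subseteq> W" "kspan V S = W" using assms(1) by (auto simp: fd_iff)
  obtain S' where S': "finite S'" "S' \<subseteq> W'" "kspan V S' = W'" using assms(2) by (auto simp: fd_iff)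
  have "kspan V (S \<union> S') = kspan V (W \<union> W')"
  proof
    show "kspan V (S \<union> S') \<subseteq> kspan V (W \<union> W')" using S S' by (intro kspan_mono) auto
    show "kspan V (W \<union> W') \<subseteq> kspan V (S \<union> S')"
      using S S' kspan_mono[of S "S \<union> S'" V] kspan_mono[of S' "S \<union> S'" V] by (intro kspan_trans) auto
  qed
  moreover have "S \<union> S' \<subseteq> carrier V"
    using S(2) S'(2) ksubD(1)[OF fd_ksub[OF assms(1)]] ksubD(1)[OF fd_ksub[OF assms(2)]] by auto
  ultimately show ?thesis using fd_kspan(1)[of "S \<union> S'"] S S' by simp
qed

end

section \<open>Linear maps, rank-nullity and common kernels\<close>

definition klin :: "('k::field, 'v) module \<Rightarrow> 'v set \<Rightarrow> ('k, 'w) module \<Rightarrow> ('v \<Rightarrow> 'w) \<Rightarrow> bool" where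
  "klin V W U f \<longleftrightarrow> (\<forall>x\<in>W. f x \<in> carrier U) \<and> (\<forall>x\<in>W. \<forall>y\<in>W. f (x \<oplus>\<^bsub>V\<^esub> y) = f x \<oplus>\<^bsub>U\<^esub> f y) \<and>
     (\<forall>c. \<forall>x\<in>W. f (c \<odot>\<^bsub>V\<^esub> x) = c \<odot>\<^bsub>U\<^esub> f x)"

lemma klinI:
  assumes "\<And>x. x \<in> W \<Longrightarrow> f x \<in> carrier U"
    "\<And>x y. x \<in> W \<Longrightarrow> y \<in> W \<Longrightarrow> f (x \<oplus>\<^bsub>V\<^esub> y) = f x \<oplus>\<^bsub>U\<^esub> f y"
    "\<And>c x. x \<in> W \<Longrightarrow> f (c \<odot>\<^bsub>V\<^esub> x) = c \<odot>\<^bsub>U\<^esub> f x"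
  shows "klin V W U f"
  using assms by (simp add: klin_def)

lemma klinD:
  assumes "klin V W U f"
  shows "x \<in> W \<Longrightarrow> f x \<in> carrier U" "x \<in> W \<Longrightarrow> y \<in> W \<Longrightarrow> f (x \<oplus>\<^bsub>V\<^esub> y) = f x \<oplus>\<^bsub>U\<^esub> f y"
    "x \<in> W \<Longrightarrow> f (c \<odot>\<^bsub>V\<^esub> x) = c \<odot>\<^bsub>U\<^esub> f x"
  using assms by (simp_all add: klin_def)

lemma klin_mono: "klin V W U f \<Longrightarrow> W' \<subseteq> W \<Longrightarrow> klin V W' U f"
  by (rule klinI) (simp_all add: klinD subset_iff)

lemma klin_kspan:
  assumes "klin V (carrier V) U f" "kspace V" "kspace U" "S \<subseteq> carrier V"
  shows "f ` kspan V S = kspan U (f ` S)"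
proof -
  interpret V: kspace V by fact
  interpret U: kspace U by fact
  have f0: "f \<zero>\<^bsub>V\<^esub> = \<zero>\<^bsub>U\<^esub>"
    using klinD[OF assms(1), of "\<zero>\<^bsub>V\<^esub>"] klinD(3)[OF assms(1), of "\<zero>\<^bsub>V\<^esub>" 0] U.smult_0[of "f \<zero>\<^bsub>V\<^esub>"] by simp
  have c: "x \<in> kspan V S \<Longrightarrow> x \<in> carrier V" for x
    using V.kspan_sub[OF assms(4)] by (rule ksubD(1))
  have "f x \<in> kspan U (f ` S)" if "x \<in> kspan V S" for x
    using that
    by induction (use assms(4) in \<open>auto simp: f0 c klinD[OF assms(1)] intro: kspan.intros\<close>)
  moreover have "y \<in> f ` kspan V S" if "y \<in> kspan U (f ` S)" for y
    using that
  proof induction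
    case kspan_zero
    then show ?case using f0 kspan.kspan_zero[of V S] by (metis imageI)
  next
    case (kspan_base y)
    then show ?case by (auto intro: kspan.kspan_base)
  next
    case (kspan_add y y')
    then obtain x x' where "x \<in> kspan V S" "x' \<in> kspan V S" "y = f x" "y' = f x'" by auto
    then show ?case using c kspan.kspan_add[of x V S x']
      by (auto simp: klinD[OF assms(1)] image_iff intro!: bexI[of _ "x \<oplus>\<^bsub>V\<^esub> x'"])
  next
    case (kspan_smult y a)
    then obtain x where "x \<in> kspan V S" "y = f x" by auto
    then show ?case using c kspan.kspan_smult[of x V S a]
      by (auto simp: klinD[OF assms(1)] image_iff intro!: bexI[of _ "a \<odot>\<^bsub>V\<^esub> x"])
  qed
  ultimately show ?thesis by blast
qed

lemma rank_nullity_sub: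
  assumes "kspace V" "kspace U" "fd_subspace V W" "klin V W U f"
  shows "fd_subspace U (f ` W)" "ksub V {x \<in> W. f x = \<zero>\<^bsub>U\<^esub>}"
    "subspace_dim V W = subspace_dim U (f ` W) + subspace_dim V {x \<in> W. f x = \<zero>\<^bsub>U\<^esub>}"
proof -
  interpret V: kspace V by fact
  interpret U: kspace U by fact
  have W: "ksub V W" using assms(3) by (rule V.fd_ksub)
  interpret W: kspace "V\<lparr>carrier := W\<rparr>" by (rule V.kspace_sub[OF W])
  interpret f: linear_map class_ring "V\<lparr>carrier := W\<rparr>" U f
  proof (unfold_locales)
    show "f \<in> LinearCombinations.module_hom class_ring (V\<lparr>carrier := W\<rparr>) U"
      using klinD[OF assms(4)] by (simp add: LinearCombinations.module_hom_def)
  qed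
  have im: "f.im = f ` W" by (simp add: f.im_def)
  have ker: "f.ker = {x \<in> W. f x = \<zero>\<^bsub>U\<^esub>}" by (simp add: f.ker_def)
  have fd: "W.fin_dim" using assms(3) by (simp add: fd_subspace_def)
  show "subspace_dim V W = subspace_dim U (f ` W) + subspace_dim V {x \<in> W. f x = \<zero>\<^bsub>U\<^esub>}"
    using f.rank_nullity[OF fd] by (simp add: im ker subspace_dim_def)
  have "VectorSpace.subspace class_ring {x \<in> W. f x = \<zero>\<^bsub>U\<^esub>} (V\<lparr>carrier := W\<rparr>)"
    using f.kerT_is_subspace by (simp add: ker)
  then show "ksub V {x \<in> W. f x = \<zero>\<^bsub>U\<^esub>}"
    using ksubD[OF W] unfolding W.ksub_iff[symmetric] ksub_def by auto
  obtain S where S: "finite S" "S \<subseteq> W" "kspan V S = W" using assms(3) by (auto simp: V.fd_iff)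
  have "f ` kspan (V\<lparr>carrier := W\<rparr>) S = kspan U (f ` S)"
    using klinD[OF assms(4)] S W.kspace_axioms assms(2)
    by (intro klin_kspan[where V="V\<lparr>carrier := W\<rparr>"] klinI) auto
  then have "f ` W = kspan U (f ` S)" using S by simp
  moreover have "f ` S \<subseteq> carrier U" using S klinD(1)[OF assms(4)] by auto
  ultimately show "fd_subspace U (f ` W)" using U.fd_kspan(1)[of "f ` S"] S by simp
qed

context kspace
begin

lemma dim_zero: "subspace_dim V {\<zero>} = 0"
proof -
  have "kspan V {} = {\<zero>}" using kspan_least[OF _ ksub_zero, of "{}"] kspan_zero[of V "{}"] by auto
  then show ?thesis using fd_kspan(2)[of "{}"] by simp
qed

lemma dim_0_iff:
  assumes "fd_subspace V W"
  shows "subspace_dim V W = 0 \<longleftrightarrow> W = {\<zero>}"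
proof
  assume "subspace_dim V W = 0"
  with assms obtain S where "finite S" "kspan V S = W" "card S = 0" by (metis fd_basis)
  then have "W = kspan V {}" by simp
  then show "W = {\<zero>}" using kspan_least[OF _ ksub_zero, of "{}"] kspan_zero[of V "{}"] by auto
qed (simp add: dim_zero)

lemma dim_insert:
  assumes "fd_subspace V W" "v \<in> carrier V" "v \<notin> W"
  shows "fd_subspace V (kspan V (insert v W))" "subspace_dim V W < subspace_dim V (kspan V (insert v W))"
proof -
  have W: "ksub V W" using assms(1) by (rule fd_ksub)
  let ?U = "kspan V (insert v W)"
  obtain S where S: "finite S" "S \<subseteq> W" "kspan V S = W" "card S = subspace_dim V W" using assms(1) by (rule fd_basis)
  have fdu: "fd_subspace V (kspan V {v})" using assms by (intro fd_kspan) auto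
  have "?U = kspan V (kspan V {v} \<union> W)"
  proof
    show "?U \<subseteq> kspan V (kspan V {v} \<union> W)"
      by (intro kspan_mono) (auto intro: kspan_base)
    show "kspan V (kspan V {v} \<union> W) \<subseteq> ?U"
      using kspan_mono[of "{v}" "insert v W" V] by (intro kspan_trans) (auto intro: kspan_base)
  qed
  then show fd: "fd_subspace V ?U" using fd_Un[OF fdu assms(1)] by simp
  have UW: "W \<subseteq> ?U" by (auto intro: kspan_base)
  interpret U: kspace "V\<lparr>carrier := ?U\<rparr>" by (rule kspace_sub[OF fd_ksub[OF fd]])
  interpret W: kspace "V\<lparr>carrier := W\<rparr>" by (rule kspace_sub[OF W])
  obtain T where T: "finite T" "W.basis T"
    using assms(1) W.finite_basis_exists by (auto simp: fd_subspace_def)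
  have TW: "T \<subseteq> W" "\<not> W.lin_dep T" "kspan V T = W" using T W.kspan_eq[of T] by (auto simp: W.basis_def)
  have "LinearCombinations.submodule class_ring W (V\<lparr>carrier := ?U\<rparr>)"
    using nested_subspaces[of ?U W] fd_ksub[OF fd] W UW by (simp add: ksub_iff VectorSpace.subspace_def)
  then have li: "\<not> U.lin_dep T" using TW U.span_li_not_depend(2)[of T W] by simp
  have TU: "T \<subseteq> ?U" using TW UW by auto
  have "v \<in> ?U" by (auto intro: kspan_base)
  have "v \<notin> T" using TW assms by auto
  have "v \<notin> U.span T" using U.kspan_eq[of T] TU TW assms by simp
  then have "\<not> U.lin_dep (T \<union> {v})"
    using U.lin_dep_iff_in_span[of T v] TU li \<open>v \<in> ?U\<close> \<open>v \<notin> T\<close> by simp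
  moreover have "U.fin_dim" using fd by (simp add: fd_subspace_def)
  ultimately have "card (T \<union> {v}) \<le> U.dim" using TU \<open>v \<in> ?U\<close> by (intro U.li_le_dim) auto
  moreover have "card (T \<union> {v}) = Suc (card T)" using T \<open>v \<notin> T\<close> by simp
  ultimately show "subspace_dim V W < subspace_dim V ?U"
    using W.dim_basis[OF T] by (simp add: subspace_dim_def)
qed

end

lemma dim_image_le:
  assumes "kspace V" "kspace U" "fd_subspace V W" "klin V W U f"
  shows "subspace_dim U (f ` W) \<le> subspace_dim V W"
  using rank_nullity_sub[OF assms] by simp

text \<open>Restricting to the kernel of one map costs at most dim X, so a nonzero vector survives
  \<open>card T\<close> restrictions. Contraposed, it bounds dim W whenever the maps jointly detect
  nonzero vectors; all dimension comparisons below use it this way.\<close>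

lemma common_kernel:
  assumes "kspace V" "kspace U" "finite T" "fd_subspace V W" "fd_subspace U X"
    and "\<And>t. t \<in> T \<Longrightarrow> klin V W U (\<phi> t)" "\<And>t x. t \<in> T \<Longrightarrow> x \<in> W \<Longrightarrow> \<phi> t x \<in> X"
    and "card T * subspace_dim U X < subspace_dim V W"
  shows "\<exists>w\<in>W. w \<noteq> \<zero>\<^bsub>V\<^esub> \<and> (\<forall>t\<in>T. \<phi> t w = \<zero>\<^bsub>U\<^esub>)"
  using assms(3-8)
proof (induction T arbitrary: W rule: finite_induct)
  case empty
  interpret V: kspace V by fact
  have "W \<noteq> {\<zero>\<^bsub>V\<^esub>}" using V.dim_0_iff[OF empty(1)] empty(5) by simp
  moreover have "\<zero>\<^bsub>V\<^esub> \<in> W" using V.fd_ksub[OF empty(1)] by (rule ksubD(2))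
  ultimately show ?case by blast
next
  case (insert t T)
  interpret V: kspace V by fact
  interpret U: kspace U by fact
  let ?W = "{x \<in> W. \<phi> t x = \<zero>\<^bsub>U\<^esub>}"
  note rn = rank_nullity_sub[OF assms(1,2) insert.prems(1) insert.prems(3)[OF insertI1]]
  have "subspace_dim U (\<phi> t ` W) \<le> subspace_dim U X"
    by (rule U.fd_mono(2)[OF insert.prems(2) U.fd_ksub[OF rn(1)]]) (use insert.prems(4)[of t] in blast)
  then have *: "card T * subspace_dim U X < subspace_dim V ?W"
    using rn(3) insert.prems(5) insert.hyps by simp
  have "\<exists>w\<in>?W. w \<noteq> \<zero>\<^bsub>V\<^esub> \<and> (\<forall>t\<in>T. \<phi> t w = \<zero>\<^bsub>U\<^esub>)"
  proof (rule insert.IH)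
    show "fd_subspace V ?W" by (rule V.fd_mono[OF insert.prems(1) rn(2)]) auto
    show "fd_subspace U X" by fact
    show "klin V ?W U (\<phi> s)" if "s \<in> T" for s
      using insert.prems(3)[of s] that by (auto intro: klin_mono[of V W])
    show "\<phi> s x \<in> X" if "s \<in> T" "x \<in> ?W" for s x
      using insert.prems(4)[of s x] that by auto
  qed (rule *)
  then show ?case by auto
qed

definition field_space :: "('k::field, 'k) module" where
  "field_space = \<lparr>carrier = UNIV, monoid.mult = (*), one = 1, zero = 0, add = (+), smult = (*)\<rparr>"

lemma kspace_field_space: "kspace field_space"
  by (rule kspaceI) (auto simp: field_space_def algebra_simps intro: exI[of _ "- x" for x])

lemma common_kernel_functionals:
  fixes V :: "('k::field, 'v) module"
  assumes "kspace V" "finite T" "fd_subspace V W"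
    and "\<And>t. t \<in> T \<Longrightarrow> klin V W field_space (\<phi> t)"
    and "card T < subspace_dim V W"
  shows "\<exists>w\<in>W. w \<noteq> \<zero>\<^bsub>V\<^esub> \<and> (\<forall>t\<in>T. \<phi> t w = 0)"
proof -
  interpret K: kspace "field_space :: ('k,'k) module" by (rule kspace_field_space)
  have U: "kspan field_space {1::'k} = UNIV"
    using kspan_smult[OF kspan_base[of 1 "{1::'k}" field_space]] by (auto simp: field_space_def)
  have fd: "fd_subspace field_space (UNIV :: 'k set)" "subspace_dim field_space (UNIV :: 'k set) \<le> 1"
    using K.fd_kspan[of "{1}"] unfolding U by (auto simp: field_space_def)
  have "card T * subspace_dim field_space (UNIV :: 'k set) < subspace_dim V W"
    by (rule le_less_trans[OF mult_le_mono2[OF fd(2)]]) (use assms(5) in simp)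
  then show ?thesis
    using common_kernel[OF assms(1) kspace_field_space assms(2,3) fd(1) assms(4)]
    by (auto simp: field_space_def)
qed

section \<open>Growth exponents\<close>

lemma growth_exponent_mono:
  assumes "\<And>i. f i \<le> g i"
  shows "growth_exponent f \<le> growth_exponent g"
  unfolding growth_exponent_def
proof (rule Inf_superset_mono, rule image_mono, safe)
  fix r assume "\<forall>\<^sub>F i in sequentially. ereal_of_enat (g i) \<le> ereal (real i powr r)"
  then show "\<forall>\<^sub>F i in sequentially. ereal_of_enat (f i) \<le> ereal (real i powr r)"
    by eventually_elim (use assms order_trans ereal_of_enat_le_iff in blast)
qed

text \<open>For i \<ge> 1 the bound is at most C 2^d i^d, and the constant is absorbed by i^e for
  every e > 0, which suffices for an infimum of exponents.\<close>

lemma growth_exponent_le: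
  assumes "\<And>i. g i \<le> enat (C * (i + 1) ^ d)"
  shows "growth_exponent g \<le> ereal (real d)"
proof (rule ereal_le_epsilon2)
  fix e :: real assume e: "0 < e"
  have "\<forall>\<^sub>F i in sequentially. real (C * 2 ^ d) \<le> real i powr e"
    using e by real_asymp
  then have "\<forall>\<^sub>F i in sequentially. ereal_of_enat (g i) \<le> ereal (real i powr (real d + e))"
    using eventually_ge_at_top[of 1]
  proof eventually_elim
    case (elim i)
    have "real (C * (i + 1) ^ d) \<le> real (C * (2 * i) ^ d)"
      using elim by (intro of_nat_mono mult_le_mono2 power_mono) auto
    also have "\<dots> = real (C * 2 ^ d) * real i powr real d"
      using elim by (simp add: power_mult_distrib powr_realpow)
    also have "\<dots> \<le> real i powr e * real i powr real d"
      using elim by (intro mult_right_mono) auto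
    also have "\<dots> = real i powr (real d + e)" by (simp add: powr_add)
    finally have "ereal_of_enat (enat (C * (i + 1) ^ d)) \<le> ereal (real i powr (real d + e))"
      by simp
    with assms[of i] show ?case by (meson ereal_of_enat_le_iff order_trans)
  qed
  then have "growth_exponent g \<le> ereal (real d + e)"
    unfolding growth_exponent_def by (intro Inf_lower) auto
  then show "growth_exponent g \<le> ereal (real d) + ereal e" by simp
qed

text \<open>Lower bounds along the progression C (j + 1) are enough: an exponent that works
  eventually also works along this subsequence.\<close>

lemma growth_exponent_ge:
  assumes "\<And>j. (j + 1) ^ d \<le> K * f (C * (j + 1))" "C \<ge> 1"
  shows "ereal (real d) \<le> growth_exponent (\<lambda>i. enat (f i))"
  unfolding growth_exponent_def
proof (rule Inf_greatest, safe)
  fix r assume r: "\<forall>\<^sub>F i in sequentially. ereal_of_enat (enat (f i)) \<le> ereal (real i powr r)"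
  show "ereal (real d) \<le> ereal r"
  proof (rule ccontr)
    assume "\<not> ereal (real d) \<le> ereal r"
    then have rd: "real d - r > 0" by simp
    have lim: "filterlim (\<lambda>j. C * (j + 1)) at_top sequentially"
      using assms(2) by (intro filterlim_at_top_mono[OF filterlim_ident] always_eventually) (simp add: add_increasing)
    have "\<forall>\<^sub>F j in sequentially. real (f (C * (j + 1))) \<le> real (C * (j + 1)) powr r"
      using eventually_compose_filterlim[OF r lim] by simp
    moreover have "\<forall>\<^sub>F j in sequentially. real K * real C powr r < real (j + 1) powr (real d - r)"
      using rd by real_asymp
    ultimately have "\<forall>\<^sub>F j :: nat in sequentially. False"
    proof eventually_elim
      case (elim j)
      have "real (j + 1) powr real d = real ((j + 1) ^ d)"
        by (subst powr_realpow) auto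
      also have "\<dots> \<le> real (K * f (C * (j + 1)))"
        using assms(1)[of j] of_nat_mono by blast
      also have "\<dots> \<le> real K * (real (C * (j + 1)) powr r)"
        using elim(1) by (simp add: mult_left_mono)
      also have "\<dots> = real K * real C powr r * real (j + 1) powr r"
        by (simp only: of_nat_mult powr_mult[of "real C" "real (j + 1)" r] mult.assoc)
      also have "\<dots> < real (j + 1) powr (real d - r) * real (j + 1) powr r"
        using elim(2) by (intro mult_strict_right_mono) auto
      also have "\<dots> = real (j + 1) powr real d" by (simp flip: powr_add)
      finally show ?case by simp
    qed
    then show False by simp
  qed
qed

text \<open>The inequality must be strict because the infimum need not itself be an admissible
  exponent.\<close>

lemma growth_exponent_less:
  assumes "growth_exponent g < ereal s"
  shows "\<forall>\<^sub>F i in sequentially. ereal_of_enat (g i) \<le> ereal (real i powr s)"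
proof -
  obtain r where r: "r < s" "\<forall>\<^sub>F i in sequentially. ereal_of_enat (g i) \<le> ereal (real i powr r)"
    using assms unfolding growth_exponent_def Inf_less_iff by auto
  show ?thesis using r(2) eventually_ge_at_top[of 1]
  proof eventually_elim
    case (elim i)
    then have "real i powr r \<le> real i powr s" using r(1) by (intro powr_mono) auto
    with elim(1) show ?case by (metis ereal_less_eq(3) order_trans)
  qed
qed

section \<open>Algebras and left modules\<close>

lemma ksub_subset: "ksub V W \<Longrightarrow> W \<subseteq> carrier V"
  by (simp add: ksub_def)

lemma (in kspace) fd_subset: "fd_subspace V W \<Longrightarrow> W \<subseteq> carrier V"
  using fd_ksub ksub_subset by blast

definition kbilin ::
    "('k::field, 'u) module \<Rightarrow> ('k, 'v) module \<Rightarrow> ('k, 'w) module \<Rightarrow> ('u \<Rightarrow> 'v \<Rightarrow> 'w) \<Rightarrow> bool" where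
  "kbilin U V W \<beta> \<longleftrightarrow> (\<forall>x\<in>carrier U. klin V (carrier V) W (\<beta> x)) \<and>
     (\<forall>y\<in>carrier V. klin U (carrier U) W (\<lambda>x. \<beta> x y))"

lemma kspan_kbilin:
  assumes "kspace U" "kspace V" "kspace W" "kbilin U V W \<beta>" "S \<subseteq> carrier U" "T \<subseteq> carrier V"
    and "x \<in> kspan U S" "y \<in> kspan V T"
  shows "\<beta> x y \<in> kspan W {\<beta> s t | s t. s \<in> S \<and> t \<in> T}" (is "_ \<in> kspan W ?Z")
proof -
  have y: "\<beta> x y \<in> kspan W {\<beta> x t | t. t \<in> T}" if "x \<in> carrier U" for x
  proof -
    have "klin V (carrier V) W (\<beta> x)" using assms(4) that by (simp add: kbilin_def)
    from klin_kspan[OF this assms(2,3,6)] have "\<beta> x y \<in> kspan W (\<beta> x ` T)" using assms(8) by blast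
    moreover have "\<beta> x ` T = {\<beta> x t | t. t \<in> T}" by auto
    ultimately show ?thesis by simp
  qed
  have "x \<in> carrier U" using ksubD(1)[OF kspace.kspan_sub[OF assms(1,5)] assms(7)] .
  have "\<beta> x t \<in> kspan W ?Z" if "t \<in> T" for t
  proof -
    have "klin U (carrier U) W (\<lambda>x. \<beta> x t)" using assms(4,6) that by (auto simp: kbilin_def)
    from klin_kspan[OF this assms(1,3,5)] assms(7) have "\<beta> x t \<in> kspan W ((\<lambda>x. \<beta> x t) ` S)" by auto
    then show ?thesis using that by (elim subsetD[OF kspan_mono, rotated]) auto
  qed
  then have "{\<beta> x t | t. t \<in> T} \<subseteq> kspan W ?Z" by auto
  with y[OF \<open>x \<in> carrier U\<close>] kspan_trans show ?thesis by blast
qed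

locale kalg =
  fixes R :: "('k::field, 'a) module" (structure)
  assumes is_ring: "ring R" and is_vs: "vectorspace (class_ring :: 'k ring) R"
    and smult_mult_l: "x \<in> carrier R \<Longrightarrow> y \<in> carrier R \<Longrightarrow> (c \<odot> x) \<otimes> y = c \<odot> (x \<otimes> y)"
    and smult_mult_r: "x \<in> carrier R \<Longrightarrow> y \<in> carrier R \<Longrightarrow> x \<otimes> (c \<odot> y) = c \<odot> (x \<otimes> y)"

sublocale kalg \<subseteq> ks: kspace R by (rule kspace.intro[OF is_vs])
sublocale kalg \<subseteq> ring R by (rule is_ring)

context kalg
begin

lemma kbilin_mult: "kbilin R R R (\<otimes>)"
  unfolding kbilin_def
  by (auto intro!: klinI simp: l_distr r_distr smult_mult_l smult_mult_r)

lemma mult_kspan: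
  assumes "S \<subseteq> carrier R" "T \<subseteq> carrier R" "x \<in> kspan R S" "y \<in> kspan R T"
  shows "x \<otimes> y \<in> kspan R {s \<otimes> t | s t. s \<in> S \<and> t \<in> T}"
  using kspan_kbilin[OF ks.kspace_axioms ks.kspace_axioms ks.kspace_axioms kbilin_mult assms] .

lemma klin_mult_l: "a \<in> carrier R \<Longrightarrow> W \<subseteq> carrier R \<Longrightarrow> klin R W R (\<lambda>x. a \<otimes> x)"
  using kbilin_mult by (auto simp: kbilin_def intro: klin_mono)

lemma klin_mult_r: "a \<in> carrier R \<Longrightarrow> W \<subseteq> carrier R \<Longrightarrow> klin R W R (\<lambda>x. x \<otimes> a)"
  using kbilin_mult by (auto simp: kbilin_def intro: klin_mono)

lemma space_power_eq:
  assumes "V \<subseteq> carrier R"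
  shows "space_power R V 0 = kspan R {\<one>}"
    "space_power R V (Suc i) = kspan R {a \<otimes> b | a b. a \<in> V \<and> b \<in> space_power R V i}"
    "ksub R (space_power R V i)"
proof -
  show "space_power R V 0 = kspan R {\<one>}" by (simp add: ks.kspan_eq)
  have sub: "ksub R (space_power R V i) \<and>
     space_power R V (Suc i) = kspan R {a \<otimes> b | a b. a \<in> V \<and> b \<in> space_power R V i}" for i
  proof (induction i)
    case 0
    have "ksub R (space_power R V 0)" by (simp add: ks.kspan_eq ks.kspan_sub)
    moreover have "{a \<otimes> b | a b. a \<in> V \<and> b \<in> space_power R V 0} \<subseteq> carrier R"
      using assms ksub_subset[OF calculation] by auto
    ultimately show ?case using ks.kspan_eq by simp
  next
    case (Suc i)
    have s: "{a \<otimes> b | a b. a \<in> V \<and> b \<in> space_power R V i} \<subseteq> carrier R"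
      using assms ksub_subset[of R "space_power R V i"] Suc by auto
    have sub: "ksub R (space_power R V (Suc i))" using Suc ks.kspan_sub[OF s] by simp
    then have "{a \<otimes> b | a b. a \<in> V \<and> b \<in> space_power R V (Suc i)} \<subseteq> carrier R"
      using assms ksub_subset[OF sub] by auto
    then show ?case using ks.kspan_eq[of "{a \<otimes> b | a b. a \<in> V \<and> b \<in> space_power R V (Suc i)}"] sub
      by (simp only: space_power.simps simp_thms)
  qed
  then show "space_power R V (Suc i) = kspan R {a \<otimes> b | a b. a \<in> V \<and> b \<in> space_power R V i}"
    "ksub R (space_power R V i)" by blast+
qed

declare space_power.simps[simp del]

lemma space_power_subset: "V \<subseteq> carrier R \<Longrightarrow> space_power R V i \<subseteq> carrier R"
  by (rule ksub_subset[OF space_power_eq(3)])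

lemma space_power_mult:
  assumes "V \<subseteq> carrier R" "x \<in> space_power R V i" "y \<in> space_power R V j"
  shows "x \<otimes> y \<in> space_power R V (i + j)"
  using assms(2)
proof (induction i arbitrary: x)
  case 0
  have y: "y \<in> carrier R" using assms space_power_subset[of V j] by blast
  have "x \<in> kspan R {\<one>}" using 0 space_power_eq(1)[OF assms(1)] by blast
  then have "x \<otimes> y \<in> kspan R {\<one> \<otimes> y}"
    using klin_kspan[OF klin_mult_r[OF y subset_refl] ks.kspace_axioms ks.kspace_axioms, of "{\<one>}"] by auto
  also have "\<dots> \<subseteq> space_power R V j"
    using y assms(3) by (intro kspan_least space_power_eq(3) assms(1)) auto
  finally show ?case by simp
next
  case (Suc i)
  have y: "y \<in> carrier R" using assms space_power_subset[of V j] by blast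
  let ?S = "{a \<otimes> b | a b. a \<in> V \<and> b \<in> space_power R V i}"
  have S: "?S \<subseteq> carrier R" using assms space_power_subset[of V i] by auto
  have "x \<in> kspan R ?S" using Suc(2) space_power_eq(2)[OF assms(1)] by blast
  then have "x \<otimes> y \<in> kspan R ((\<lambda>x. x \<otimes> y) ` ?S)"
    using klin_kspan[OF klin_mult_r[OF y subset_refl] ks.kspace_axioms ks.kspace_axioms S] by auto
  also have "\<dots> \<subseteq> kspan R {a \<otimes> b | a b. a \<in> V \<and> b \<in> space_power R V (i + j)}"
  proof (rule kspan_mono, safe)
    fix a b assume ab: "a \<in> V" "b \<in> space_power R V i"
    then have "b \<in> carrier R" using assms space_power_subset[of V i] by blast
    then have "a \<otimes> b \<otimes> y = a \<otimes> (b \<otimes> y)" using ab assms y by (auto simp: m_assoc)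
    then show "\<exists>a' b'. a \<otimes> b \<otimes> y = a' \<otimes> b' \<and> a' \<in> V \<and> b' \<in> space_power R V (i + j)"
      using ab Suc.IH[of b] by blast
  qed
  finally show ?case using space_power_eq(2)[OF assms(1)] by simp
qed

lemma space_power_base: "V \<subseteq> carrier R \<Longrightarrow> x \<in> V \<Longrightarrow> x \<in> space_power R V (Suc 0)"
proof -
  assume a: "V \<subseteq> carrier R" "x \<in> V"
  have "\<one> \<in> space_power R V 0" using space_power_eq(1)[OF a(1)] by (simp only:) (rule kspan_base, simp)
  then have "x \<otimes> \<one> \<in> kspan R {a \<otimes> b | a b. a \<in> V \<and> b \<in> space_power R V 0}"
    using a by (intro kspan_base) blast
  then show "x \<in> space_power R V (Suc 0)" using a space_power_eq(2)[OF a(1)] by auto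
qed

lemma space_power_mono:
  assumes "V \<subseteq> carrier R" "\<one> \<in> V" "i \<le> j"
  shows "space_power R V i \<subseteq> space_power R V j"
  using assms(3)
proof (induction j)
  case (Suc j)
  have "space_power R V j \<subseteq> space_power R V (Suc j)"
  proof
    fix x assume x: "x \<in> space_power R V j"
    then have "x \<in> carrier R" using space_power_subset[OF assms(1)] by blast
    then have "x = \<one> \<otimes> x" by simp
    then show "x \<in> space_power R V (Suc j)"
      using space_power_mult[OF assms(1) space_power_base[OF assms(1,2)] x] by simp
  qed
  with Suc show ?case by (cases "i \<le> j") (auto simp: le_Suc_eq)
qed simp

lemma space_power_fd:
  assumes "fd_subspace R V"
  shows "fd_subspace R (space_power R V i)"
proof (induction i)
  case 0
  have "V \<subseteq> carrier R" using ks.fd_subset[OF assms] .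
  then show ?case using space_power_eq(1) ks.fd_kspan(1)[of "{\<one>}"] by simp
next
  case (Suc i)
  have V: "V \<subseteq> carrier R" using ks.fd_subset[OF assms] .
  obtain S where S: "finite S" "S \<subseteq> V" "kspan R S = V" using assms by (auto simp: ks.fd_iff)
  obtain T where T: "finite T" "T \<subseteq> space_power R V i" "kspan R T = space_power R V i"
    using Suc by (auto simp: ks.fd_iff)
  let ?Z = "{s \<otimes> t | s t. s \<in> S \<and> t \<in> T}"
  have ST: "S \<subseteq> carrier R" "T \<subseteq> carrier R" using S T V space_power_subset[OF V, of i] by blast+
  have "?Z = (\<lambda>(s,t). s \<otimes> t) ` (S \<times> T)" by auto
  then have "finite ?Z" using S T by simp
  moreover have "?Z \<subseteq> carrier R" using ST by auto
  moreover have "kspan R ?Z = space_power R V (Suc i)"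
  proof
    show "kspan R ?Z \<subseteq> space_power R V (Suc i)"
      unfolding space_power_eq(2)[OF V] using S T by (intro kspan_mono) blast
    show "space_power R V (Suc i) \<subseteq> kspan R ?Z"
      unfolding space_power_eq(2)[OF V]
    proof (rule kspan_trans, safe)
      fix a b assume "a \<in> V" "b \<in> space_power R V i"
      then show "a \<otimes> b \<in> kspan R ?Z" using S(3) T(3) mult_kspan[OF ST] by auto
    qed
  qed
  ultimately show ?case using ks.fd_kspan(1)[of ?Z] by simp
qed

end

lemma base_space_sel[simp]:
  "carrier (base_space R M) = carrier M" "zero (base_space R M) = zero M"
  "add (base_space R M) = add M"
  "c \<odot>\<^bsub>base_space R M\<^esub> x = (c \<odot>\<^bsub>R\<^esub> \<one>\<^bsub>R\<^esub>) \<odot>\<^bsub>M\<^esub> x"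
  by (simp_all add: base_space_def)

lemma base_space_carrier_update: "base_space R (M\<lparr>carrier := N\<rparr>) = (base_space R M)\<lparr>carrier := N\<rparr>"
  by (simp add: base_space_def)

lemma subspace_dim_carrier_update[simp]: "subspace_dim (V\<lparr>carrier := N\<rparr>) W = subspace_dim V W"
  by (simp add: subspace_dim_def)

locale kmod = A: kalg R for R :: "('k::field, 'a) module" +
  fixes M :: "('a, 'm) module"
  assumes is_left_module: "left_module R M"

sublocale kmod \<subseteq> lm: left_module R M by (rule is_left_module)

context kmod
begin

abbreviation bs where "bs \<equiv> base_space R M"

lemma act_closed[simp, intro]: "a \<in> carrier R \<Longrightarrow> x \<in> carrier M \<Longrightarrow> a \<odot>\<^bsub>M\<^esub> x \<in> carrier M"
  by (rule lm.smult_closed)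

lemma scal_closed[simp]: "c \<odot>\<^bsub>R\<^esub> \<one>\<^bsub>R\<^esub> \<in> carrier R"
  by simp

lemma act_zero[simp]: "a \<in> carrier R \<Longrightarrow> a \<odot>\<^bsub>M\<^esub> \<zero>\<^bsub>M\<^esub> = \<zero>\<^bsub>M\<^esub>"
  using lm.smult_r_distr[of a "\<zero>\<^bsub>M\<^esub>" "\<zero>\<^bsub>M\<^esub>"]
  by (metis act_closed lm.M.add.r_cancel_one' lm.M.l_zero lm.M.zero_closed)

lemma zero_act[simp]: "x \<in> carrier M \<Longrightarrow> \<zero>\<^bsub>R\<^esub> \<odot>\<^bsub>M\<^esub> x = \<zero>\<^bsub>M\<^esub>"
  using lm.smult_l_distr[of "\<zero>\<^bsub>R\<^esub>" "\<zero>\<^bsub>R\<^esub>" x]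
  by (metis A.ks.l_zero A.ks.zero_closed act_closed lm.M.add.r_cancel_one')

lemma kspace_bs: "kspace bs"
proof (rule kspaceI)
  show "\<exists>w\<in>carrier bs. v \<oplus>\<^bsub>bs\<^esub> w = \<zero>\<^bsub>bs\<^esub>" if "v \<in> carrier bs" for v
    using that lm.M.r_neg[of v] by auto
  show "(a * b) \<odot>\<^bsub>bs\<^esub> v = a \<odot>\<^bsub>bs\<^esub> (b \<odot>\<^bsub>bs\<^esub> v)" if "v \<in> carrier bs" for a b v
    using that by (simp add: lm.smult_assoc[symmetric] A.smult_mult_l A.ks.smult_assoc)
  show "(a + b) \<odot>\<^bsub>bs\<^esub> v = a \<odot>\<^bsub>bs\<^esub> v \<oplus>\<^bsub>bs\<^esub> b \<odot>\<^bsub>bs\<^esub> v" if "v \<in> carrier bs" for a b v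
    using that by (simp add: A.ks.smult_add_l lm.smult_l_distr)
qed (simp_all add: lm.M.a_ac lm.smult_one lm.smult_r_distr)

sublocale bs: kspace bs by (rule kspace_bs)

lemma scal_act: "a \<in> carrier R \<Longrightarrow> x \<in> carrier M \<Longrightarrow> (c \<odot>\<^bsub>R\<^esub> a) \<odot>\<^bsub>M\<^esub> x = c \<odot>\<^bsub>bs\<^esub> (a \<odot>\<^bsub>M\<^esub> x)"
  by (simp add: lm.smult_assoc[symmetric] A.smult_mult_l)

lemma act_scal: "a \<in> carrier R \<Longrightarrow> x \<in> carrier M \<Longrightarrow> a \<odot>\<^bsub>M\<^esub> (c \<odot>\<^bsub>bs\<^esub> x) = c \<odot>\<^bsub>bs\<^esub> (a \<odot>\<^bsub>M\<^esub> x)"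
  by (simp add: lm.smult_assoc[symmetric] A.smult_mult_l A.smult_mult_r)

lemma kbilin_act: "kbilin R bs bs (\<lambda>a x. a \<odot>\<^bsub>M\<^esub> x)"
  unfolding kbilin_def
proof (intro conjI ballI klinI)
  show "a \<odot>\<^bsub>M\<^esub> (c \<odot>\<^bsub>bs\<^esub> x) = c \<odot>\<^bsub>bs\<^esub> (a \<odot>\<^bsub>M\<^esub> x)" if "a \<in> carrier R" "x \<in> carrier bs" for a x c
    using act_scal that by simp
  show "(c \<odot>\<^bsub>R\<^esub> a) \<odot>\<^bsub>M\<^esub> x = c \<odot>\<^bsub>bs\<^esub> (a \<odot>\<^bsub>M\<^esub> x)" if "x \<in> carrier bs" "a \<in> carrier R" for a x c
    using scal_act that by simp
qed (simp_all add: lm.smult_r_distr lm.smult_l_distr)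

lemma klin_act_l: "a \<in> carrier R \<Longrightarrow> W \<subseteq> carrier M \<Longrightarrow> klin bs W bs (\<lambda>x. a \<odot>\<^bsub>M\<^esub> x)"
  using kbilin_act by (auto simp: kbilin_def intro: klin_mono)

lemma klin_act_r: "x \<in> carrier M \<Longrightarrow> W \<subseteq> carrier R \<Longrightarrow> klin R W bs (\<lambda>a. a \<odot>\<^bsub>M\<^esub> x)"
  using kbilin_act by (auto simp: kbilin_def intro: klin_mono)

lemma act_kspan:
  assumes "S \<subseteq> carrier R" "T \<subseteq> carrier M" "a \<in> kspan R S" "x \<in> kspan bs T"
  shows "a \<odot>\<^bsub>M\<^esub> x \<in> kspan bs {s \<odot>\<^bsub>M\<^esub> t | s t. s \<in> S \<and> t \<in> T}"
  using kspan_kbilin[OF A.ks.kspace_axioms kspace_bs kspace_bs kbilin_act] assms by simp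

lemma space_act_eq:
  assumes "V \<subseteq> carrier R" "W \<subseteq> carrier M"
  shows "space_act R M V W = kspan bs {a \<odot>\<^bsub>M\<^esub> m | a m. a \<in> V \<and> m \<in> W}"
    "ksub bs (space_act R M V W)"
proof -
  have "{a \<odot>\<^bsub>M\<^esub> m | a m. a \<in> V \<and> m \<in> W} \<subseteq> carrier bs" using assms by auto
  then show "space_act R M V W = kspan bs {a \<odot>\<^bsub>M\<^esub> m | a m. a \<in> V \<and> m \<in> W}"
    "ksub bs (space_act R M V W)"
    unfolding space_act_def using bs.kspan_eq bs.kspan_sub by simp_all
qed

lemma space_act_fd:
  assumes "fd_subspace R V" "fd_subspace bs W"
  shows "fd_subspace bs (space_act R M V W)"
proof -
  have V: "V \<subseteq> carrier R" using A.ks.fd_subset[OF assms(1)] .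
  have W: "W \<subseteq> carrier M" using bs.fd_subset[OF assms(2)] by simp
  obtain S where S: "finite S" "S \<subseteq> V" "kspan R S = V" using assms by (auto simp: A.ks.fd_iff)
  obtain T where T: "finite T" "T \<subseteq> W" "kspan bs T = W" using assms by (auto simp: bs.fd_iff)
  let ?Z = "{s \<odot>\<^bsub>M\<^esub> t | s t. s \<in> S \<and> t \<in> T}"
  have ST: "S \<subseteq> carrier R" "T \<subseteq> carrier M" using S T V W by auto
  have "?Z = (\<lambda>(s,t). s \<odot>\<^bsub>M\<^esub> t) ` (S \<times> T)" by auto
  then have "finite ?Z" using S T by simp
  moreover have "?Z \<subseteq> carrier bs" using ST by auto
  moreover have "kspan bs ?Z = space_act R M V W"
    unfolding space_act_eq[OF V W]
  proof
    show "kspan bs ?Z \<subseteq> kspan bs {a \<odot>\<^bsub>M\<^esub> m | a m. a \<in> V \<and> m \<in> W}"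
      using S T by (intro kspan_mono) blast
    show "kspan bs {a \<odot>\<^bsub>M\<^esub> m | a m. a \<in> V \<and> m \<in> W} \<subseteq> kspan bs ?Z"
    proof (rule kspan_trans, safe)
      fix a b assume "a \<in> V" "b \<in> W"
      then show "a \<odot>\<^bsub>M\<^esub> b \<in> kspan bs ?Z" using S(3) T(3) act_kspan[OF ST] by auto
    qed
  qed
  ultimately show ?thesis using bs.fd_kspan(1)[of ?Z] by simp
qed

lemma smod_iff: "Module.submodule N R M \<longleftrightarrow>
    N \<subseteq> carrier M \<and> \<zero>\<^bsub>M\<^esub> \<in> N \<and> (\<forall>x\<in>N. \<forall>y\<in>N. x \<oplus>\<^bsub>M\<^esub> y \<in> N) \<and> (\<forall>a\<in>carrier R. \<forall>x\<in>N. a \<odot>\<^bsub>M\<^esub> x \<in> N)"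
    (is "_ \<longleftrightarrow> ?r")
proof
  assume "Module.submodule N R M"
  then interpret N: Module.submodule N R M .
  show ?r using N.subset N.one_closed N.m_closed N.smult_closed by auto
next
  assume r: ?r
  have "\<ominus>\<^bsub>M\<^esub> x \<in> N" if "x \<in> N" for x
  proof -
    have x: "x \<in> carrier M" using r that by auto
    have "(\<ominus>\<^bsub>R\<^esub> \<one>\<^bsub>R\<^esub>) \<odot>\<^bsub>M\<^esub> x \<oplus>\<^bsub>M\<^esub> x = (\<ominus>\<^bsub>R\<^esub> \<one>\<^bsub>R\<^esub> \<oplus>\<^bsub>R\<^esub> \<one>\<^bsub>R\<^esub>) \<odot>\<^bsub>M\<^esub> x"
      using x by (subst lm.smult_l_distr) (auto simp: lm.smult_one)
    then have "(\<ominus>\<^bsub>R\<^esub> \<one>\<^bsub>R\<^esub>) \<odot>\<^bsub>M\<^esub> x = \<ominus>\<^bsub>M\<^esub> x"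
      using x by (simp add: A.ks.l_neg lm.M.minus_equality)
    then show ?thesis using r that by (metis A.ks.a_inv_closed A.one_closed)
  qed
  then show "Module.submodule N R M"
    using r by (intro Module.submodule.intro lm.M.add.subgroupI submodule_axioms.intro)
      (auto simp: a_inv_def)
qed

lemma smodD:
  assumes "Module.submodule N R M"
  shows "x \<in> N \<Longrightarrow> x \<in> carrier M" "\<zero>\<^bsub>M\<^esub> \<in> N" "x \<in> N \<Longrightarrow> y \<in> N \<Longrightarrow> x \<oplus>\<^bsub>M\<^esub> y \<in> N"
    "a \<in> carrier R \<Longrightarrow> x \<in> N \<Longrightarrow> a \<odot>\<^bsub>M\<^esub> x \<in> N" "ksub bs N"
  using assms unfolding smod_iff ksub_def by auto

lemma smod_minus: "Module.submodule N R M \<Longrightarrow> x \<in> N \<Longrightarrow> y \<in> N \<Longrightarrow> x \<ominus>\<^bsub>M\<^esub> y \<in> N"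
  using bs.ksub_minus[OF smodD(5), of N x y] by (simp add: a_minus_def a_inv_def m_inv_def)

lemma smod_module:
  assumes "Module.submodule N R M"
  shows "kmod R (M\<lparr>carrier := N\<rparr>)"
proof -
  interpret N: Module.submodule N R M by fact
  have "abelian_group (M\<lparr>carrier := N\<rparr>)"
  proof (rule abelian_groupI)
    fix x assume x: "x \<in> carrier (M\<lparr>carrier := N\<rparr>)"
    then have "\<ominus>\<^bsub>M\<^esub> x \<in> N" using N.m_inv_closed by (simp add: a_inv_def)
    then show "\<exists>y\<in>carrier (M\<lparr>carrier := N\<rparr>). y \<oplus>\<^bsub>M\<lparr>carrier := N\<rparr>\<^esub> x = \<zero>\<^bsub>M\<lparr>carrier := N\<rparr>\<^esub>"
      using x smodD(1)[OF assms] lm.M.l_neg by auto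
  qed (simp_all add: smodD[OF assms] lm.M.a_ac)
  then have "left_module R (M\<lparr>carrier := N\<rparr>)"
    by (intro left_module.intro left_module_axioms.intro A.is_ring)
      (simp_all add: smodD[OF assms] lm.smult_l_distr lm.smult_r_distr lm.smult_assoc lm.smult_one)
  then show ?thesis by (intro kmod.intro kmod_axioms.intro A.kalg_axioms)
qed

lemma submodule_gen_eq:
  assumes "S \<subseteq> carrier M"
  shows "submodule_gen R M S = kspan bs {a \<odot>\<^bsub>M\<^esub> m | a m. a \<in> carrier R \<and> m \<in> S}" (is "_ = kspan bs ?Z")
    "Module.submodule (submodule_gen R M S) R M" "S \<subseteq> submodule_gen R M S"
proof -
  have Z: "?Z \<subseteq> carrier bs" using assms by auto
  have sub: "Module.submodule (kspan bs ?Z) R M"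
  proof -
    have "a \<odot>\<^bsub>M\<^esub> x \<in> kspan bs ?Z" if "a \<in> carrier R" "x \<in> kspan bs ?Z" for a x
    proof -
      have "a \<odot>\<^bsub>M\<^esub> x \<in> kspan bs ((\<lambda>x. a \<odot>\<^bsub>M\<^esub> x) ` ?Z)"
        using klin_kspan[OF klin_act_l[OF that(1)] kspace_bs kspace_bs Z] that(2) by auto
      also have "\<dots> \<subseteq> kspan bs ?Z"
      proof (rule kspan_mono, safe)
        fix b m assume "b \<in> carrier R" "m \<in> S"
        then show "\<exists>a' m'. a \<odot>\<^bsub>M\<^esub> (b \<odot>\<^bsub>M\<^esub> m) = a' \<odot>\<^bsub>M\<^esub> m' \<and> a' \<in> carrier R \<and> m' \<in> S"
          using that(1) assms by (intro exI[of _ "a \<otimes>\<^bsub>R\<^esub> b"] exI[of _ m]) (auto simp: lm.smult_assoc)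
      qed
      finally show ?thesis .
    qed
    then show ?thesis using bs.kspan_sub[OF Z] unfolding smod_iff ksub_def by auto
  qed
  have SZ: "S \<subseteq> kspan bs ?Z"
  proof
    fix x assume "x \<in> S"
    then have "x = \<one>\<^bsub>R\<^esub> \<odot>\<^bsub>M\<^esub> x" using assms by (auto simp: lm.smult_one)
    then show "x \<in> kspan bs ?Z" using \<open>x \<in> S\<close> by (intro kspan_base) blast
  qed
  show eq: "submodule_gen R M S = kspan bs ?Z"
  proof
    show "submodule_gen R M S \<subseteq> kspan bs ?Z" unfolding submodule_gen_def using sub SZ by blast
    have "kspan bs ?Z \<subseteq> N" if "Module.submodule N R M" "S \<subseteq> N" for N
      using smodD[OF that(1)] that(2) by (intro kspan_least) auto
    then show "kspan bs ?Z \<subseteq> submodule_gen R M S" unfolding submodule_gen_def by blast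
  qed
  show "Module.submodule (submodule_gen R M S) R M" "S \<subseteq> submodule_gen R M S"
    unfolding eq using sub SZ by auto
qed

lemma submodule_gen_least: "Module.submodule N R M \<Longrightarrow> S \<subseteq> N \<Longrightarrow> submodule_gen R M S \<subseteq> N"
  unfolding submodule_gen_def by blast

lemma submodule_gen_single:
  assumes "m \<in> carrier M"
  shows "submodule_gen R M {m} = {a \<odot>\<^bsub>M\<^esub> m | a. a \<in> carrier R}"
proof -
  have "ksub bs ((\<lambda>a. a \<odot>\<^bsub>M\<^esub> m) ` carrier R)"
    using klin_kspan[OF klin_act_r[OF assms subset_refl] A.ks.kspace_axioms kspace_bs subset_refl]
      bs.kspan_sub[of "(\<lambda>a. a \<odot>\<^bsub>M\<^esub> m) ` carrier R"] assms kspan_ksub[OF A.ks.ksub_carrier] by auto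
  then have "kspan bs ((\<lambda>a. a \<odot>\<^bsub>M\<^esub> m) ` carrier R) = (\<lambda>a. a \<odot>\<^bsub>M\<^esub> m) ` carrier R"
    by (rule kspan_ksub)
  moreover have "{a \<odot>\<^bsub>M\<^esub> m' | a m'. a \<in> carrier R \<and> m' \<in> {m}} = (\<lambda>a. a \<odot>\<^bsub>M\<^esub> m) ` carrier R" by auto
  ultimately show ?thesis using submodule_gen_eq(1)[of "{m}"] assms by auto
qed

end

section \<open>Quotient modules on representatives, and monotonicity of the Gelfand-Kirillov dimension\<close>

text \<open>The quotient of M on the values of a function \<rho> whose fibres are the cosets of a
  submodule. Leaving \<rho> open gives a choice of element type: representatives in the type of M,
  as \<open>multiplicity_function\<close> demands, or sets of functions, as
  \<open>holonomic_number\<close> demands.\<close>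

definition image_module :: "('a, 'm) module \<Rightarrow> ('m \<Rightarrow> 'w) \<Rightarrow> ('a, 'w) module" where
  "image_module M \<rho> = \<lparr>carrier = \<rho> ` carrier M, monoid.mult = (\<lambda>x y. x), one = \<rho> \<zero>\<^bsub>M\<^esub>, zero = \<rho> \<zero>\<^bsub>M\<^esub>,
     add = (\<lambda>x y. \<rho> (inv_into (carrier M) \<rho> x \<oplus>\<^bsub>M\<^esub> inv_into (carrier M) \<rho> y)),
     smult = (\<lambda>a x. \<rho> (a \<odot>\<^bsub>M\<^esub> inv_into (carrier M) \<rho> x))\<rparr>"

locale kmod_image = kmod R M for R :: "('k::field, 'a) module" and M :: "('a, 'm) module" +
  fixes N :: "'m set" and \<rho> :: "'m \<Rightarrow> 'w"
  assumes N_sub: "Module.submodule N R M"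
    and rho_eq: "x \<in> carrier M \<Longrightarrow> y \<in> carrier M \<Longrightarrow> \<rho> x = \<rho> y \<longleftrightarrow> x \<ominus>\<^bsub>M\<^esub> y \<in> N"
begin

abbreviation Q where "Q \<equiv> image_module M \<rho>"

lemma Q_carrier: "carrier Q = \<rho> ` carrier M" and Q_zero: "\<zero>\<^bsub>Q\<^esub> = \<rho> \<zero>\<^bsub>M\<^esub>"
  by (simp_all add: image_module_def)

lemma rho_in[simp]: "x \<in> carrier M \<Longrightarrow> \<rho> x \<in> carrier Q"
  by (simp add: Q_carrier)

lemma sel: "x \<in> carrier M \<Longrightarrow> inv_into (carrier M) \<rho> (\<rho> x) \<in> carrier M"
  "x \<in> carrier M \<Longrightarrow> inv_into (carrier M) \<rho> (\<rho> x) \<ominus>\<^bsub>M\<^esub> x \<in> N"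
  by (simp_all add: inv_into_into f_inv_into_f flip: rho_eq)

lemma rho_add: "x \<in> carrier M \<Longrightarrow> y \<in> carrier M \<Longrightarrow> \<rho> x \<oplus>\<^bsub>Q\<^esub> \<rho> y = \<rho> (x \<oplus>\<^bsub>M\<^esub> y)"
proof -
  assume xy: "x \<in> carrier M" "y \<in> carrier M"
  let ?x = "inv_into (carrier M) \<rho> (\<rho> x)" and ?y = "inv_into (carrier M) \<rho> (\<rho> y)"
  have "(?x \<oplus>\<^bsub>M\<^esub> ?y) \<ominus>\<^bsub>M\<^esub> (x \<oplus>\<^bsub>M\<^esub> y) = (?x \<ominus>\<^bsub>M\<^esub> x) \<oplus>\<^bsub>M\<^esub> (?y \<ominus>\<^bsub>M\<^esub> y)"
    using xy sel(1) by (simp add: a_minus_def lm.M.minus_add lm.M.a_ac)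
  also have "\<dots> \<in> N" using xy sel(2) smodD(3)[OF N_sub] by blast
  finally have "\<rho> (?x \<oplus>\<^bsub>M\<^esub> ?y) = \<rho> (x \<oplus>\<^bsub>M\<^esub> y)" using xy sel(1) by (subst rho_eq) auto
  then show ?thesis by (simp add: image_module_def)
qed

lemma rho_act: "a \<in> carrier R \<Longrightarrow> x \<in> carrier M \<Longrightarrow> a \<odot>\<^bsub>Q\<^esub> \<rho> x = \<rho> (a \<odot>\<^bsub>M\<^esub> x)"
proof -
  assume ax: "a \<in> carrier R" "x \<in> carrier M"
  let ?x = "inv_into (carrier M) \<rho> (\<rho> x)"
  have "a \<odot>\<^bsub>M\<^esub> (\<ominus>\<^bsub>M\<^esub> x) \<oplus>\<^bsub>M\<^esub> a \<odot>\<^bsub>M\<^esub> x = \<zero>\<^bsub>M\<^esub>"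
    using ax by (simp add: lm.smult_r_distr[symmetric] lm.M.l_neg)
  then have "a \<odot>\<^bsub>M\<^esub> (\<ominus>\<^bsub>M\<^esub> x) = \<ominus>\<^bsub>M\<^esub> (a \<odot>\<^bsub>M\<^esub> x)"
    using ax by (simp add: lm.M.minus_equality)
  then have "(a \<odot>\<^bsub>M\<^esub> ?x) \<ominus>\<^bsub>M\<^esub> (a \<odot>\<^bsub>M\<^esub> x) = a \<odot>\<^bsub>M\<^esub> (?x \<ominus>\<^bsub>M\<^esub> x)"
    using ax sel(1) by (simp add: a_minus_def lm.smult_r_distr)
  also have "\<dots> \<in> N" using ax sel(2) smodD(4)[OF N_sub] by blast
  finally have "\<rho> (a \<odot>\<^bsub>M\<^esub> ?x) = \<rho> (a \<odot>\<^bsub>M\<^esub> x)" using ax sel(1) by (subst rho_eq) auto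
  then show ?thesis by (simp add: image_module_def)
qed

lemma rho_zero_iff: "x \<in> carrier M \<Longrightarrow> \<rho> x = \<zero>\<^bsub>Q\<^esub> \<longleftrightarrow> x \<in> N"
  using rho_eq[of x "\<zero>\<^bsub>M\<^esub>"] lm.M.minus_equality[of "\<zero>\<^bsub>M\<^esub>" "\<zero>\<^bsub>M\<^esub>"] by (simp add: Q_zero a_minus_def)

lemma image_kmod: "kmod R Q"
proof -
  have ex: "x \<in> carrier Q \<Longrightarrow> \<exists>y\<in>carrier M. x = \<rho> y" for x by (auto simp: Q_carrier)
  have "abelian_group Q"
  proof (rule abelian_groupI)
    fix x y assume "x \<in> carrier Q" "y \<in> carrier Q"
    then show "x \<oplus>\<^bsub>Q\<^esub> y \<in> carrier Q" "x \<oplus>\<^bsub>Q\<^esub> y = y \<oplus>\<^bsub>Q\<^esub> x"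
      by (auto dest!: ex simp: rho_add lm.M.a_ac)
  next
    fix x y z assume "x \<in> carrier Q" "y \<in> carrier Q" "z \<in> carrier Q"
    then show "x \<oplus>\<^bsub>Q\<^esub> y \<oplus>\<^bsub>Q\<^esub> z = x \<oplus>\<^bsub>Q\<^esub> (y \<oplus>\<^bsub>Q\<^esub> z)"
      by (auto dest!: ex simp: rho_add lm.M.a_ac)
  next
    fix x assume "x \<in> carrier Q"
    then obtain u where u: "u \<in> carrier M" "x = \<rho> u" using ex by blast
    show "\<zero>\<^bsub>Q\<^esub> \<oplus>\<^bsub>Q\<^esub> x = x" using u by (simp add: Q_zero rho_add)
    show "\<exists>y\<in>carrier Q. y \<oplus>\<^bsub>Q\<^esub> x = \<zero>\<^bsub>Q\<^esub>"
      using u by (intro bexI[of _ "\<rho> (\<ominus>\<^bsub>M\<^esub> u)"]) (simp_all add: Q_zero rho_add lm.M.l_neg)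
  qed (simp add: Q_zero Q_carrier)
  moreover have "left_module_axioms R Q"
    by (rule left_module_axioms.intro)
      (auto dest!: ex simp: rho_add rho_act lm.smult_l_distr lm.smult_r_distr lm.smult_assoc lm.smult_one)
  ultimately have "left_module R Q" by (intro left_module.intro A.is_ring)
  then show ?thesis by (intro kmod.intro kmod_axioms.intro A.kalg_axioms)
qed

lemma klin_rho: "klin bs (carrier M) (base_space R Q) \<rho>"
  by (rule klinI) (simp_all add: rho_add rho_act)

end

definition module_map :: "('a, 'b) ring_scheme \<Rightarrow> ('a, 'm) module \<Rightarrow> ('a, 'w) module \<Rightarrow> ('m \<Rightarrow> 'w) \<Rightarrow> bool" where
  "module_map R M M' f \<longleftrightarrow> (\<forall>x\<in>carrier M. f x \<in> carrier M') \<and>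
     (\<forall>x\<in>carrier M. \<forall>y\<in>carrier M. f (x \<oplus>\<^bsub>M\<^esub> y) = f x \<oplus>\<^bsub>M'\<^esub> f y) \<and>
     (\<forall>a\<in>carrier R. \<forall>x\<in>carrier M. f (a \<odot>\<^bsub>M\<^esub> x) = a \<odot>\<^bsub>M'\<^esub> f x)"

lemma module_map_hom: "module_map R M M' f \<longleftrightarrow> f \<in> LinearCombinations.module_hom R M M'"
  by (auto simp: module_map_def LinearCombinations.module_hom_def)

lemma (in kmod_image) module_map_rho: "module_map R M Q \<rho>"
  by (simp add: module_map_def rho_add rho_act)

text \<open>Choosing a representative of each coset keeps the quotient in the element type of M,
  where a multiplicity function can be applied to it.\<close>

lemma (in kmod) quotient_rep_exists:
  assumes "Module.submodule N R M"
  shows "\<exists>\<rho> :: 'm \<Rightarrow> 'm. kmod_image R M N \<rho>"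
proof -
  define \<rho> where "\<rho> x = (SOME y. y \<in> carrier M \<and> x \<ominus>\<^bsub>M\<^esub> y \<in> N)" for x
  have r: "\<rho> x \<in> carrier M" "x \<ominus>\<^bsub>M\<^esub> \<rho> x \<in> N" if "x \<in> carrier M" for x
  proof -
    have "x \<ominus>\<^bsub>M\<^esub> x \<in> N" using that smodD(2)[OF assms] by (simp add: a_minus_def lm.M.r_neg)
    with that have "\<exists>y. y \<in> carrier M \<and> x \<ominus>\<^bsub>M\<^esub> y \<in> N" by blast
    from someI_ex[OF this] show "\<rho> x \<in> carrier M" "x \<ominus>\<^bsub>M\<^esub> \<rho> x \<in> N" by (auto simp: \<rho>_def)
  qed
  have tr: "x \<ominus>\<^bsub>M\<^esub> z \<in> N"
    if "x \<in> carrier M" "y \<in> carrier M" "z \<in> carrier M" "x \<ominus>\<^bsub>M\<^esub> y \<in> N" "y \<ominus>\<^bsub>M\<^esub> z \<in> N" for x y z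
  proof -
    have "x \<ominus>\<^bsub>M\<^esub> z = (x \<ominus>\<^bsub>M\<^esub> y) \<oplus>\<^bsub>M\<^esub> (y \<ominus>\<^bsub>M\<^esub> z)"
      using that(1-3) by (simp add: a_minus_def lm.M.a_assoc lm.M.r_neg2 lm.M.r_neg1)
    then show ?thesis using smodD(3)[OF assms] that by simp
  qed
  have sy: "y \<ominus>\<^bsub>M\<^esub> x \<in> N" if "x \<in> carrier M" "y \<in> carrier M" "x \<ominus>\<^bsub>M\<^esub> y \<in> N" for x y
  proof -
    have "y \<ominus>\<^bsub>M\<^esub> x = \<zero>\<^bsub>M\<^esub> \<ominus>\<^bsub>M\<^esub> (x \<ominus>\<^bsub>M\<^esub> y)"
      using that(1-2) by (simp add: a_minus_def lm.M.minus_add lm.M.a_ac)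
    then show ?thesis using smod_minus[OF assms smodD(2)[OF assms] that(3)] by simp
  qed
  have "\<rho> x = \<rho> y \<longleftrightarrow> x \<ominus>\<^bsub>M\<^esub> y \<in> N" if "x \<in> carrier M" "y \<in> carrier M" for x y
  proof
    assume "\<rho> x = \<rho> y"
    then show "x \<ominus>\<^bsub>M\<^esub> y \<in> N" using tr[of x "\<rho> x" y] sy[of y "\<rho> y"] r that by metis
  next
    assume "x \<ominus>\<^bsub>M\<^esub> y \<in> N"
    then have "x \<ominus>\<^bsub>M\<^esub> u \<in> N \<longleftrightarrow> y \<ominus>\<^bsub>M\<^esub> u \<in> N" if "u \<in> carrier M" for u
      using tr[of x y u] tr[of y x u] sy[of x y] that \<open>x \<in> _\<close> \<open>y \<in> _\<close> by blast
    then have "(\<lambda>u. u \<in> carrier M \<and> x \<ominus>\<^bsub>M\<^esub> u \<in> N) = (\<lambda>u. u \<in> carrier M \<and> y \<ominus>\<^bsub>M\<^esub> u \<in> N)" by auto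
    then show "\<rho> x = \<rho> y" by (simp add: \<rho>_def)
  qed
  then have "kmod_image R M N \<rho>"
    by (intro kmod_image.intro kmod_image_axioms.intro kmod_axioms assms)
  then show ?thesis by blast
qed

context kmod
begin

lemma GK_ge:
  "fd_subspace R V \<Longrightarrow> \<one>\<^bsub>R\<^esub> \<in> V \<Longrightarrow> fd_subspace bs W \<Longrightarrow>
    growth_exponent (\<lambda>i. enat (subspace_dim bs (space_act R M (space_power R V i) W))) \<le> GK R M"
  unfolding GK_def by (rule SUP_upper2[where i = "(V, W)"]) auto

lemma GK_le:
  "(\<And>V W. fd_subspace R V \<Longrightarrow> \<one>\<^bsub>R\<^esub> \<in> V \<Longrightarrow> fd_subspace bs W \<Longrightarrow>
    growth_exponent (\<lambda>i. enat (subspace_dim bs (space_act R M (space_power R V i) W))) \<le> d) \<Longrightarrow> GK R M \<le> d"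
  unfolding GK_def by (rule SUP_least) auto

lemma GK_sub:
  assumes N: "Module.submodule N R M"
  shows "GK R (M\<lparr>carrier := N\<rparr>) \<le> GK R M"
proof -
  let ?N = "M\<lparr>carrier := N\<rparr>"
  interpret N: kmod R ?N by (rule smod_module[OF N])
  have Nc: "N \<subseteq> carrier M" using N by (simp add: smod_iff)
  show ?thesis
  proof (rule N.GK_le)
    fix V W assume V: "fd_subspace R V" "\<one>\<^bsub>R\<^esub> \<in> V" and W: "fd_subspace (base_space R ?N) W"
    have bN: "base_space R ?N = bs\<lparr>carrier := N\<rparr>" by (rule base_space_carrier_update)
    have WN: "W \<subseteq> N" using N.bs.fd_subset[OF W] by simp
    have W': "fd_subspace bs W"
      using W Nc WN unfolding N.bs.fd_iff unfolding bN bs.fd_iff by (auto simp: ksub_def)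
    have V': "space_power R V i \<subseteq> carrier R" for i
      using V A.ks.fd_subset A.space_power_subset by blast
    have "space_act R ?N (space_power R V i) W = space_act R M (space_power R V i) W" for i
      using N.space_act_eq(1)[OF V', of W i] space_act_eq(1)[OF V', of W i] WN Nc
      by (simp add: bN)
    then show "growth_exponent (\<lambda>i. enat (subspace_dim (base_space R ?N)
        (space_act R ?N (space_power R V i) W))) \<le> GK R M"
      using GK_ge[OF V W'] by (simp add: bN)
  qed
qed

end

text \<open>A finite-dimensional W' in the image is spanned by images of finitely many elements of
  M; with their span as W, the spaces that measure M' are the images of those that measure M, power
  by power.\<close>

lemma GK_image:
  assumes "kmod R M" "kmod R M'" "module_map R M M' f" "f ` carrier M = carrier M'"
  shows "GK R M' \<le> GK R M"
proof -
  interpret M: kmod R M by fact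
  interpret M': kmod R M' by fact
  have f: "f x \<in> carrier M'" "f (x \<oplus>\<^bsub>M\<^esub> y) = f x \<oplus>\<^bsub>M'\<^esub> f y" "a \<in> carrier R \<Longrightarrow> f (a \<odot>\<^bsub>M\<^esub> x) = a \<odot>\<^bsub>M'\<^esub> f x"
    if "x \<in> carrier M" "y \<in> carrier M" for x y a
    using assms(3) that by (simp_all add: module_map_def)
  have klin: "klin M.bs (carrier M) M'.bs f" by (rule klinI) (simp_all add: f)
  show ?thesis
  proof (rule M'.GK_le)
    fix V W' assume V: "fd_subspace R V" "\<one>\<^bsub>R\<^esub> \<in> V" and W': "fd_subspace M'.bs W'"
    obtain S' where S': "finite S'" "S' \<subseteq> W'" "kspan M'.bs S' = W'" using W' by (auto simp: M'.bs.fd_iff)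
    have "S' \<subseteq> f ` carrier M" using S'(2) M'.bs.fd_subset[OF W'] assms(4) by auto
    then obtain S where S: "S \<subseteq> carrier M" "finite S" "S' = f ` S"
      using finite_subset_image[OF S'(1)] by metis
    let ?W = "kspan M.bs S"
    have W: "fd_subspace M.bs ?W" using S M.bs.fd_kspan(1)[of S] by simp
    have fW: "f ` ?W = W'"
      using klin_kspan[of M.bs M'.bs f S] klin S S'(3) M.kspace_bs M'.kspace_bs by simp
    have Wc: "?W \<subseteq> carrier M" using M.bs.fd_subset[OF W] by simp
    have Wc': "W' \<subseteq> carrier M'" using M'.bs.fd_subset[OF W'] by simp
    have V': "space_power R V i \<subseteq> carrier R" for i
      using V M.A.ks.fd_subset M.A.space_power_subset by blast
    have "f ` space_act R M (space_power R V i) ?W = space_act R M' (space_power R V i) W'" for i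
    proof -
      let ?Z = "{a \<odot>\<^bsub>M\<^esub> m | a m. a \<in> space_power R V i \<and> m \<in> ?W}"
      have "f (a \<odot>\<^bsub>M\<^esub> m) = a \<odot>\<^bsub>M'\<^esub> f m" if "a \<in> space_power R V i" "m \<in> ?W" for a m
        using that V' Wc f(3) by blast
      then have "f ` ?Z = {a \<odot>\<^bsub>M'\<^esub> m | a m. a \<in> space_power R V i \<and> m \<in> W'}"
        unfolding fW[symmetric] image_def by (auto 0 4)
      moreover have "?Z \<subseteq> carrier M.bs" using V' Wc by auto
      ultimately show ?thesis
        unfolding M.space_act_eq(1)[OF V' Wc] M'.space_act_eq(1)[OF V' Wc']
        using klin_kspan[of M.bs M'.bs f ?Z] klin M.kspace_bs M'.kspace_bs by simp
    qed
    moreover have "subspace_dim M'.bs (f ` space_act R M (space_power R V i) ?W)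
        \<le> subspace_dim M.bs (space_act R M (space_power R V i) ?W)" for i
    proof (rule dim_image_le[OF M.kspace_bs M'.kspace_bs])
      show fd: "fd_subspace M.bs (space_act R M (space_power R V i) ?W)"
        by (rule M.space_act_fd[OF M.A.space_power_fd[OF V(1)] W])
      show "klin M.bs (space_act R M (space_power R V i) ?W) M'.bs f"
        using klin_mono[OF klin] M.bs.fd_subset[OF fd] by simp
    qed
    ultimately have "growth_exponent (\<lambda>i. enat (subspace_dim M'.bs (space_act R M' (space_power R V i) W')))
       \<le> growth_exponent (\<lambda>i. enat (subspace_dim M.bs (space_act R M (space_power R V i) ?W)))"
      by (intro growth_exponent_mono) simp
    also have "\<dots> \<le> GK R M" by (rule M.GK_ge[OF V W])
    finally show "growth_exponent (\<lambda>i. enat (subspace_dim M'.bs (space_act R M' (space_power R V i) W'))) \<le> GK R M" .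
  qed
qed

section \<open>Monoid algebras and quotient algebras\<close>

lemma monoid_algebra_sel:
  "carrier (monoid_algebra P) = {f. finite {g. f g \<noteq> 0} \<and> {g. f g \<noteq> 0} \<subseteq> carrier P}"
  "\<one>\<^bsub>monoid_algebra P\<^esub> = basis_elt \<one>\<^bsub>P\<^esub>" "\<zero>\<^bsub>monoid_algebra P\<^esub> = (\<lambda>w. 0)"
  "f \<oplus>\<^bsub>monoid_algebra P\<^esub> h = (\<lambda>w. f w + h w)" "c \<odot>\<^bsub>monoid_algebra P\<^esub> f = (\<lambda>w. c * f w)"
  by (simp_all add: monoid_algebra_def basis_elt_def)

lemma supp_add: "{g. (f g :: 'k::field) + h g \<noteq> 0} \<subseteq> {g. f g \<noteq> 0} \<union> {g. h g \<noteq> 0}"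
  by auto

lemma kspace_monoid_algebra: "kspace (monoid_algebra P :: ('k::field, 'g \<Rightarrow> 'k) module)"
proof (rule kspaceI)
  fix f h :: "'g \<Rightarrow> 'k" and c :: 'k
  assume f: "f \<in> carrier (monoid_algebra P)"
  show "\<exists>w\<in>carrier (monoid_algebra P). f \<oplus>\<^bsub>monoid_algebra P\<^esub> w = \<zero>\<^bsub>monoid_algebra P\<^esub>"
    using f by (intro bexI[of _ "\<lambda>g. - f g"]) (auto simp: monoid_algebra_sel)
  have "{g. c * f g \<noteq> 0} \<subseteq> {g. f g \<noteq> 0}" by auto
  then show "c \<odot>\<^bsub>monoid_algebra P\<^esub> f \<in> carrier (monoid_algebra P)"
    using f by (auto simp: monoid_algebra_sel intro: finite_subset)
  assume h: "h \<in> carrier (monoid_algebra P)"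
  show "f \<oplus>\<^bsub>monoid_algebra P\<^esub> h \<in> carrier (monoid_algebra P)"
    using f h finite_subset[OF supp_add[of f h]] supp_add[of f h] by (auto simp: monoid_algebra_sel)
qed (auto simp: monoid_algebra_sel algebra_simps)

lemma monoid_algebra_mult:
  assumes "finite S" "finite T" "{g. f g \<noteq> 0} \<subseteq> S" "{g. h g \<noteq> 0} \<subseteq> T"
  shows "(f \<otimes>\<^bsub>monoid_algebra P\<^esub> h) w = (\<Sum>u\<in>S. \<Sum>v\<in>T. if u \<otimes>\<^bsub>P\<^esub> v = w then f u * h v else (0::'k::field))"
proof -
  have "(f \<otimes>\<^bsub>monoid_algebra P\<^esub> h) w =
      (\<Sum>(u, v) \<in> {(u, v). f u \<noteq> 0 \<and> h v \<noteq> 0 \<and> u \<otimes>\<^bsub>P\<^esub> v = w}. f u * h v)"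
    by (simp add: monoid_algebra_def)
  also have "\<dots> = (\<Sum>(u, v) \<in> S \<times> T. if u \<otimes>\<^bsub>P\<^esub> v = w then f u * h v else 0)"
    using assms by (intro sum.mono_neutral_cong_left) (auto split: if_splits)
  also have "\<dots> = (\<Sum>u\<in>S. \<Sum>v\<in>T. if u \<otimes>\<^bsub>P\<^esub> v = w then f u * h v else 0)"
    by (simp add: sum.cartesian_product)
  finally show ?thesis .
qed

lemma basis_elt_in: "p \<in> carrier P \<Longrightarrow> basis_elt p \<in> carrier (monoid_algebra P :: ('k::field, 'g \<Rightarrow> 'k) module)"
proof -
  have "{g. basis_elt p g \<noteq> (0::'k)} = {p}" by (auto simp: basis_elt_def)
  then show "p \<in> carrier P \<Longrightarrow> basis_elt p \<in> carrier (monoid_algebra P :: ('k::field, 'g \<Rightarrow> 'k) module)"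
    by (simp add: monoid_algebra_sel)
qed

lemma basis_elt_mult: "basis_elt p \<otimes>\<^bsub>monoid_algebra P\<^esub> basis_elt q = basis_elt (p \<otimes>\<^bsub>P\<^esub> q)"
proof
  fix w
  show "(basis_elt p \<otimes>\<^bsub>monoid_algebra P\<^esub> basis_elt q) w = basis_elt (p \<otimes>\<^bsub>P\<^esub> q) w"
    by (subst monoid_algebra_mult[of "{p}" "{q}"]) (auto simp: basis_elt_def)
qed

lemma monoid_algebra_span:
  "carrier (monoid_algebra P :: ('k::field, 'g \<Rightarrow> 'k) module) = kspan (monoid_algebra P) (basis_elt ` carrier P)"
proof
  let ?F = "monoid_algebra P :: ('k, 'g \<Rightarrow> 'k) module"
  interpret F: kspace ?F by (rule kspace_monoid_algebra)
  have "basis_elt ` carrier P \<subseteq> carrier ?F" by (auto intro: basis_elt_in)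
  then show "kspan ?F (basis_elt ` carrier P) \<subseteq> carrier ?F"
    by (rule kspan_least) (rule F.ksub_carrier)
  have "finite S \<Longrightarrow> S \<subseteq> carrier P \<Longrightarrow> {g. f g \<noteq> 0} \<subseteq> S \<Longrightarrow> f \<in> kspan ?F (basis_elt ` carrier P)" for S f
  proof (induction S arbitrary: f rule: finite_induct)
    case empty
    then have "f = \<zero>\<^bsub>?F\<^esub>" by (auto simp: monoid_algebra_sel)
    then show ?case by (simp only: kspan_zero)
  next
    case (insert p S)
    have "f(p := 0) \<in> kspan ?F (basis_elt ` carrier P)" using insert.prems by (intro insert.IH) auto
    moreover have "f p \<odot>\<^bsub>?F\<^esub> basis_elt p \<in> kspan ?F (basis_elt ` carrier P)"
      using insert.prems by (intro kspan_smult kspan_base) auto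
    ultimately have "f p \<odot>\<^bsub>?F\<^esub> basis_elt p \<oplus>\<^bsub>?F\<^esub> f(p := 0) \<in> kspan ?F (basis_elt ` carrier P)"
      by (intro kspan_add)
    also have "f p \<odot>\<^bsub>?F\<^esub> basis_elt p \<oplus>\<^bsub>?F\<^esub> f(p := 0) = f"
      by (auto simp: monoid_algebra_sel basis_elt_def fun_eq_iff)
    finally show ?case .
  qed
  then show "carrier ?F \<subseteq> kspan ?F (basis_elt ` carrier P)"
    by (auto simp: monoid_algebra_sel)
qed

text \<open>The unit and associativity laws hold on basis elements and extend by linearity;
  associativity does so in three passes, one argument at a time.\<close>

lemma kalg_monoid_algebra:
  assumes "monoid P"
  shows "kalg (monoid_algebra P :: ('k::field, 'g \<Rightarrow> 'k) module)"
proof -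
  let ?F = "monoid_algebra P :: ('k, 'g \<Rightarrow> 'k) module"
  interpret P: monoid P by fact
  interpret F: kspace ?F by (rule kspace_monoid_algebra)
  have fin: "finite {g. f g \<noteq> 0}" if "f \<in> carrier ?F" for f using that by (simp add: monoid_algebra_sel)
  have closed: "f \<otimes>\<^bsub>?F\<^esub> h \<in> carrier ?F" if "f \<in> carrier ?F" "h \<in> carrier ?F" for f h
  proof -
    let ?S = "{g. f g \<noteq> 0}" and ?T = "{g. h g \<noteq> 0}"
    have "{w. (f \<otimes>\<^bsub>?F\<^esub> h) w \<noteq> 0} \<subseteq> (\<lambda>(u, v). u \<otimes>\<^bsub>P\<^esub> v) ` (?S \<times> ?T)"
    proof
      fix w assume "w \<in> {w. (f \<otimes>\<^bsub>?F\<^esub> h) w \<noteq> 0}"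
      then have "(\<Sum>u\<in>?S. \<Sum>v\<in>?T. if u \<otimes>\<^bsub>P\<^esub> v = w then f u * h v else 0) \<noteq> 0"
        using monoid_algebra_mult[OF fin fin subset_refl subset_refl, of f h P w] that by simp
      then obtain u where u: "u \<in> ?S" "(\<Sum>v\<in>?T. if u \<otimes>\<^bsub>P\<^esub> v = w then f u * h v else 0) \<noteq> 0"
        by (rule sum.not_neutral_contains_not_neutral)
      from u(2) obtain v where "v \<in> ?T" "(if u \<otimes>\<^bsub>P\<^esub> v = w then f u * h v else 0) \<noteq> 0"
        by (rule sum.not_neutral_contains_not_neutral)
      with u(1) have "u \<in> ?S" "v \<in> ?T" "u \<otimes>\<^bsub>P\<^esub> v = w" by (auto split: if_splits)
      then show "w \<in> (\<lambda>(u, v). u \<otimes>\<^bsub>P\<^esub> v) ` (?S \<times> ?T)" by force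
    qed
    moreover have "finite ((\<lambda>(u, v). u \<otimes>\<^bsub>P\<^esub> v) ` (?S \<times> ?T))" using fin that by simp
    moreover have "(\<lambda>(u, v). u \<otimes>\<^bsub>P\<^esub> v) ` (?S \<times> ?T) \<subseteq> carrier P"
      using that by (auto simp: monoid_algebra_sel)
    ultimately show ?thesis by (auto simp: monoid_algebra_sel(1) intro: finite_subset)
  qed
  have ldistr: "(f \<oplus>\<^bsub>?F\<^esub> f') \<otimes>\<^bsub>?F\<^esub> h = f \<otimes>\<^bsub>?F\<^esub> h \<oplus>\<^bsub>?F\<^esub> f' \<otimes>\<^bsub>?F\<^esub> h"
    and rdistr: "h \<otimes>\<^bsub>?F\<^esub> (f \<oplus>\<^bsub>?F\<^esub> f') = h \<otimes>\<^bsub>?F\<^esub> f \<oplus>\<^bsub>?F\<^esub> h \<otimes>\<^bsub>?F\<^esub> f'"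
    if "f \<in> carrier ?F" "f' \<in> carrier ?F" "h \<in> carrier ?F" for f f' h
  proof -
    let ?S = "{g. f g \<noteq> 0} \<union> {g. f' g \<noteq> 0}" and ?T = "{g. h g \<noteq> 0}"
    have fS: "finite ?S" and fT: "finite ?T" using fin that by auto
    have ff: "f \<oplus>\<^bsub>?F\<^esub> f' = (\<lambda>w. f w + f' w)" by (simp add: monoid_algebra_sel)
    have l: "(k \<otimes>\<^bsub>?F\<^esub> h) w = (\<Sum>u\<in>?S. \<Sum>v\<in>?T. if u \<otimes>\<^bsub>P\<^esub> v = w then k u * h v else 0)"
      and r: "(h \<otimes>\<^bsub>?F\<^esub> k) w = (\<Sum>u\<in>?T. \<Sum>v\<in>?S. if u \<otimes>\<^bsub>P\<^esub> v = w then h u * k v else 0)"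
      if "{g. k g \<noteq> 0} \<subseteq> ?S" for k w
      by (rule monoid_algebra_mult[OF fS fT that subset_refl], rule monoid_algebra_mult[OF fT fS subset_refl that])
    have S: "{g. f g \<noteq> 0} \<subseteq> ?S" "{g. f' g \<noteq> 0} \<subseteq> ?S" "{g. f g + f' g \<noteq> 0} \<subseteq> ?S" by auto
    show "(f \<oplus>\<^bsub>?F\<^esub> f') \<otimes>\<^bsub>?F\<^esub> h = f \<otimes>\<^bsub>?F\<^esub> h \<oplus>\<^bsub>?F\<^esub> f' \<otimes>\<^bsub>?F\<^esub> h"
    proof
      fix w
      have "((f \<oplus>\<^bsub>?F\<^esub> f') \<otimes>\<^bsub>?F\<^esub> h) w = (f \<otimes>\<^bsub>?F\<^esub> h) w + (f' \<otimes>\<^bsub>?F\<^esub> h) w"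
        unfolding ff l[OF S(1)] l[OF S(2)] l[OF S(3)] sum.distrib[symmetric]
        by (intro sum.cong) (simp_all add: algebra_simps)
      then show "((f \<oplus>\<^bsub>?F\<^esub> f') \<otimes>\<^bsub>?F\<^esub> h) w = (f \<otimes>\<^bsub>?F\<^esub> h \<oplus>\<^bsub>?F\<^esub> f' \<otimes>\<^bsub>?F\<^esub> h) w"
        by (simp add: monoid_algebra_sel(4))
    qed
    show "h \<otimes>\<^bsub>?F\<^esub> (f \<oplus>\<^bsub>?F\<^esub> f') = h \<otimes>\<^bsub>?F\<^esub> f \<oplus>\<^bsub>?F\<^esub> h \<otimes>\<^bsub>?F\<^esub> f'"
    proof
      fix w
      have "(h \<otimes>\<^bsub>?F\<^esub> (f \<oplus>\<^bsub>?F\<^esub> f')) w = (h \<otimes>\<^bsub>?F\<^esub> f) w + (h \<otimes>\<^bsub>?F\<^esub> f') w"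
        unfolding ff r[OF S(1)] r[OF S(2)] r[OF S(3)] sum.distrib[symmetric]
        by (intro sum.cong) (simp_all add: algebra_simps)
      then show "(h \<otimes>\<^bsub>?F\<^esub> (f \<oplus>\<^bsub>?F\<^esub> f')) w = (h \<otimes>\<^bsub>?F\<^esub> f \<oplus>\<^bsub>?F\<^esub> h \<otimes>\<^bsub>?F\<^esub> f') w"
        by (simp add: monoid_algebra_sel(4))
    qed
  qed
  have sml: "(c \<odot>\<^bsub>?F\<^esub> f) \<otimes>\<^bsub>?F\<^esub> h = c \<odot>\<^bsub>?F\<^esub> (f \<otimes>\<^bsub>?F\<^esub> h)"
    and smr: "h \<otimes>\<^bsub>?F\<^esub> (c \<odot>\<^bsub>?F\<^esub> f) = c \<odot>\<^bsub>?F\<^esub> (h \<otimes>\<^bsub>?F\<^esub> f)"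
    if "f \<in> carrier ?F" "h \<in> carrier ?F" for f h c
  proof -
    let ?S = "{g. f g \<noteq> 0}" and ?T = "{g. h g \<noteq> 0}"
    have fS: "finite ?S" and fT: "finite ?T" using fin that by auto
    have cf: "c \<odot>\<^bsub>?F\<^esub> f = (\<lambda>w. c * f w)" by (simp add: monoid_algebra_sel)
    have l: "(k \<otimes>\<^bsub>?F\<^esub> h) w = (\<Sum>u\<in>?S. \<Sum>v\<in>?T. if u \<otimes>\<^bsub>P\<^esub> v = w then k u * h v else 0)"
      and r: "(h \<otimes>\<^bsub>?F\<^esub> k) w = (\<Sum>u\<in>?T. \<Sum>v\<in>?S. if u \<otimes>\<^bsub>P\<^esub> v = w then h u * k v else 0)"
      if "{g. k g \<noteq> 0} \<subseteq> ?S" for k w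
      by (rule monoid_algebra_mult[OF fS fT that subset_refl], rule monoid_algebra_mult[OF fT fS subset_refl that])
    have S: "{g. f g \<noteq> 0} \<subseteq> ?S" "{g. c * f g \<noteq> 0} \<subseteq> ?S" by auto
    show "(c \<odot>\<^bsub>?F\<^esub> f) \<otimes>\<^bsub>?F\<^esub> h = c \<odot>\<^bsub>?F\<^esub> (f \<otimes>\<^bsub>?F\<^esub> h)"
    proof
      fix w
      have "((c \<odot>\<^bsub>?F\<^esub> f) \<otimes>\<^bsub>?F\<^esub> h) w = c * (f \<otimes>\<^bsub>?F\<^esub> h) w"
        unfolding cf l[OF S(1)] l[OF S(2)] sum_distrib_left
        by (intro sum.cong) (simp_all add: algebra_simps)
      then show "((c \<odot>\<^bsub>?F\<^esub> f) \<otimes>\<^bsub>?F\<^esub> h) w = (c \<odot>\<^bsub>?F\<^esub> (f \<otimes>\<^bsub>?F\<^esub> h)) w"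
        by (simp add: monoid_algebra_sel(5))
    qed
    show "h \<otimes>\<^bsub>?F\<^esub> (c \<odot>\<^bsub>?F\<^esub> f) = c \<odot>\<^bsub>?F\<^esub> (h \<otimes>\<^bsub>?F\<^esub> f)"
    proof
      fix w
      have "(h \<otimes>\<^bsub>?F\<^esub> (c \<odot>\<^bsub>?F\<^esub> f)) w = c * (h \<otimes>\<^bsub>?F\<^esub> f) w"
        unfolding cf r[OF S(1)] r[OF S(2)] sum_distrib_left
        by (intro sum.cong) (simp_all add: algebra_simps)
      then show "(h \<otimes>\<^bsub>?F\<^esub> (c \<odot>\<^bsub>?F\<^esub> f)) w = (c \<odot>\<^bsub>?F\<^esub> (h \<otimes>\<^bsub>?F\<^esub> f)) w"
        by (simp add: monoid_algebra_sel(5))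
    qed
  qed
  let ?B = "basis_elt ` carrier P"
  have Bc: "?B \<subseteq> carrier ?F" by (auto intro: basis_elt_in)
  have bil: "kbilin ?F ?F ?F (\<otimes>\<^bsub>?F\<^esub>)"
    unfolding kbilin_def by (auto intro!: klinI simp: closed ldistr rdistr sml smr)
  have one: "\<one>\<^bsub>?F\<^esub> \<in> carrier ?F" by (simp add: monoid_algebra_sel(2) basis_elt_in)
  have indF: "Pr f" if "f \<in> carrier ?F" "\<And>p. p \<in> carrier P \<Longrightarrow> Pr (basis_elt p)"
    "ksub ?F {f \<in> carrier ?F. Pr f}" for Pr f
    using kspan_least[OF _ that(3), of ?B] that(1,2) Bc unfolding monoid_algebra_span by (auto simp: image_subset_iff)
  have ids: "\<one>\<^bsub>?F\<^esub> \<otimes>\<^bsub>?F\<^esub> f = f \<and> f \<otimes>\<^bsub>?F\<^esub> \<one>\<^bsub>?F\<^esub> = f" if "f \<in> carrier ?F" for f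
  proof (rule indF[OF that])
    show "ksub ?F {f \<in> carrier ?F. \<one>\<^bsub>?F\<^esub> \<otimes>\<^bsub>?F\<^esub> f = f \<and> f \<otimes>\<^bsub>?F\<^esub> \<one>\<^bsub>?F\<^esub> = f}"
      using one sml[of "\<zero>\<^bsub>?F\<^esub>" "\<one>\<^bsub>?F\<^esub>" 0] smr[of "\<zero>\<^bsub>?F\<^esub>" "\<one>\<^bsub>?F\<^esub>" 0] closed
      by (auto simp: ksub_def ldistr rdistr sml smr)
  qed (auto simp: monoid_algebra_sel(2) basis_elt_mult)
  have assoc: "f \<otimes>\<^bsub>?F\<^esub> h \<otimes>\<^bsub>?F\<^esub> k = f \<otimes>\<^bsub>?F\<^esub> (h \<otimes>\<^bsub>?F\<^esub> k)"
    if "f \<in> carrier ?F" "h \<in> carrier ?F" "k \<in> carrier ?F" for f h k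
  proof -
    have z: "\<zero>\<^bsub>?F\<^esub> \<otimes>\<^bsub>?F\<^esub> x = \<zero>\<^bsub>?F\<^esub>" "x \<otimes>\<^bsub>?F\<^esub> \<zero>\<^bsub>?F\<^esub> = \<zero>\<^bsub>?F\<^esub>" if "x \<in> carrier ?F" for x
      using sml[of "\<zero>\<^bsub>?F\<^esub>" x 0] smr[of "\<zero>\<^bsub>?F\<^esub>" x 0] that closed by auto
    have 1: "basis_elt p \<otimes>\<^bsub>?F\<^esub> basis_elt q \<otimes>\<^bsub>?F\<^esub> k = basis_elt p \<otimes>\<^bsub>?F\<^esub> (basis_elt q \<otimes>\<^bsub>?F\<^esub> k)"
      if pq: "p \<in> carrier P" "q \<in> carrier P" and k: "k \<in> carrier ?F" for p q k
    proof (rule indF[OF k])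
      show "ksub ?F {k \<in> carrier ?F. basis_elt p \<otimes>\<^bsub>?F\<^esub> basis_elt q \<otimes>\<^bsub>?F\<^esub> k = basis_elt p \<otimes>\<^bsub>?F\<^esub> (basis_elt q \<otimes>\<^bsub>?F\<^esub> k)}"
        using pq by (auto simp: ksub_def ldistr rdistr sml smr closed basis_elt_in z)
    qed (use pq in \<open>simp add: basis_elt_mult P.m_assoc\<close>)
    have 2: "basis_elt p \<otimes>\<^bsub>?F\<^esub> h \<otimes>\<^bsub>?F\<^esub> k = basis_elt p \<otimes>\<^bsub>?F\<^esub> (h \<otimes>\<^bsub>?F\<^esub> k)"
      if p: "p \<in> carrier P" and h: "h \<in> carrier ?F" and k: "k \<in> carrier ?F" for p h k
    proof (rule indF[OF h])
      show "ksub ?F {h \<in> carrier ?F. basis_elt p \<otimes>\<^bsub>?F\<^esub> h \<otimes>\<^bsub>?F\<^esub> k = basis_elt p \<otimes>\<^bsub>?F\<^esub> (h \<otimes>\<^bsub>?F\<^esub> k)}"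
        using p k by (auto simp: ksub_def ldistr rdistr sml smr closed basis_elt_in z)
    qed (use p k 1 in simp)
    show ?thesis
    proof (rule indF[OF that(1)])
      show "ksub ?F {f \<in> carrier ?F. f \<otimes>\<^bsub>?F\<^esub> h \<otimes>\<^bsub>?F\<^esub> k = f \<otimes>\<^bsub>?F\<^esub> (h \<otimes>\<^bsub>?F\<^esub> k)}"
        using that by (auto simp: ksub_def ldistr rdistr sml smr closed z)
    qed (use that 2 in simp)
  qed
  have "ring ?F"
    by (rule ringI) (auto intro!: F.abelian_group_axioms monoidI simp: closed one assoc ids ldistr rdistr)
  then show ?thesis
    by (intro kalg.intro F.vs) (auto simp: sml smr)
qed

locale kquot = F: kalg F for F :: "('k::field, 'a) module" +
  fixes S :: "'a set"
  assumes S_sub: "S \<subseteq> carrier F"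
begin

abbreviation I where "I \<equiv> genideal F S"
abbreviation A where "A \<equiv> quotient_algebra F S"

sublocale I: ideal I F by (rule F.genideal_ideal[OF S_sub])

definition proj where "proj f = I +>\<^bsub>F\<^esub> f"

lemma A_sel:
  "carrier A = proj ` carrier F" "\<zero>\<^bsub>A\<^esub> = proj \<zero>\<^bsub>F\<^esub>" "\<one>\<^bsub>A\<^esub> = proj \<one>\<^bsub>F\<^esub>"
  "add A = add (F Quot I)" "monoid.mult A = monoid.mult (F Quot I)" "carrier (F Quot I) = proj ` carrier F"
  "\<zero>\<^bsub>F Quot I\<^esub> = proj \<zero>\<^bsub>F\<^esub>" "\<one>\<^bsub>F Quot I\<^esub> = proj \<one>\<^bsub>F\<^esub>"
  "c \<odot>\<^bsub>A\<^esub> C = (\<Union>f\<in>C. proj (c \<odot>\<^bsub>F\<^esub> f))"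
  using abelian_group.a_coset_add_zero[OF F.ks.abelian_group_axioms I.a_subset]
  by (auto simp: quotient_algebra_def ring.defs module.defs FactRing_def A_RCOSETS_def' proj_def)

lemma proj_hom: "proj \<in> Ring.ring_hom F (F Quot I)"
  using I.rcos_ring_hom by (simp add: proj_def[abs_def])

lemma proj_eq: "x \<in> carrier F \<Longrightarrow> y \<in> carrier F \<Longrightarrow> proj x = proj y \<longleftrightarrow> x \<ominus>\<^bsub>F\<^esub> y \<in> I"
  unfolding proj_def by (rule F.quotient_eq_iff_same_a_r_cos[OF I.ideal_axioms, symmetric])

lemma proj_add: "x \<in> carrier F \<Longrightarrow> y \<in> carrier F \<Longrightarrow> proj x \<oplus>\<^bsub>A\<^esub> proj y = proj (x \<oplus>\<^bsub>F\<^esub> y)"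
  and proj_mult: "x \<in> carrier F \<Longrightarrow> y \<in> carrier F \<Longrightarrow> proj x \<otimes>\<^bsub>A\<^esub> proj y = proj (x \<otimes>\<^bsub>F\<^esub> y)"
  using ring_hom_add[OF proj_hom] ring_hom_mult[OF proj_hom] by (simp_all add: A_sel)

lemma I_ksub: "ksub F I"
proof -
  have "c \<odot>\<^bsub>F\<^esub> x \<in> I" if "x \<in> I" for c x
  proof -
    have x: "x \<in> carrier F" using that by (rule I.a_Hcarr)
    then have "(c \<odot>\<^bsub>F\<^esub> \<one>\<^bsub>F\<^esub>) \<otimes>\<^bsub>F\<^esub> x = c \<odot>\<^bsub>F\<^esub> x" by (simp add: F.smult_mult_l)
    then show ?thesis using I.I_l_closed[OF that, of "c \<odot>\<^bsub>F\<^esub> \<one>\<^bsub>F\<^esub>"] by simp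
  qed
  then show ?thesis using I.a_subset by (auto simp: ksub_def)
qed

text \<open>\<open>quotient_algebra\<close> defines scalar multiplication as a union over the
  members of a coset. All members contribute the same coset, because the ideal is closed under
  scalars.\<close>

lemma proj_smult: "x \<in> carrier F \<Longrightarrow> c \<odot>\<^bsub>A\<^esub> proj x = proj (c \<odot>\<^bsub>F\<^esub> x)"
proof -
  assume x: "x \<in> carrier F"
  have xp: "x \<in> proj x" using x I.a_rcos_self unfolding proj_def by blast
  have "proj (c \<odot>\<^bsub>F\<^esub> f) = proj (c \<odot>\<^bsub>F\<^esub> x)" if fp: "f \<in> proj x" for f
  proof -
    obtain i where i: "i \<in> I" "f = i \<oplus>\<^bsub>F\<^esub> x" using fp unfolding proj_def a_r_coset_def' by blast
    have ic: "i \<in> carrier F" using i I.a_Hcarr by blast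
    have "c \<odot>\<^bsub>F\<^esub> f \<ominus>\<^bsub>F\<^esub> c \<odot>\<^bsub>F\<^esub> x = c \<odot>\<^bsub>F\<^esub> i"
      using i x ic by (simp add: F.ks.smult_add_r a_minus_def F.ks.a_assoc F.ks.r_neg)
    then show ?thesis using i ic x ksubD(4)[OF I_ksub, of i c] by (subst proj_eq) auto
  qed
  then show ?thesis unfolding A_sel(9) using xp by blast
qed

lemma kalg_A: "kalg A"
proof -
  have ex: "x \<in> carrier A \<Longrightarrow> \<exists>y\<in>carrier F. x = proj y" for x by (auto simp: A_sel)
  have ks: "kspace A"
  proof (rule kspaceI)
    fix v assume "v \<in> carrier A"
    then obtain y where y: "y \<in> carrier F" "v = proj y" using ex by blast
    show "\<exists>w\<in>carrier A. v \<oplus>\<^bsub>A\<^esub> w = \<zero>\<^bsub>A\<^esub>"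
      using y by (intro bexI[of _ "proj (\<ominus>\<^bsub>F\<^esub> y)"]) (simp_all add: proj_add F.ks.r_neg A_sel(1,2))
    show "v \<oplus>\<^bsub>A\<^esub> \<zero>\<^bsub>A\<^esub> = v" using y by (simp add: A_sel(2) proj_add)
    show "1 \<odot>\<^bsub>A\<^esub> v = v" using y by (simp add: proj_smult)
    show "c \<odot>\<^bsub>A\<^esub> v \<in> carrier A" for c using y by (simp add: proj_smult A_sel(1))
    show "(a * b) \<odot>\<^bsub>A\<^esub> v = a \<odot>\<^bsub>A\<^esub> (b \<odot>\<^bsub>A\<^esub> v)" for a b using y by (simp add: proj_smult F.ks.smult_assoc)
    show "(a + b) \<odot>\<^bsub>A\<^esub> v = a \<odot>\<^bsub>A\<^esub> v \<oplus>\<^bsub>A\<^esub> b \<odot>\<^bsub>A\<^esub> v" for a b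
      using y by (simp add: proj_smult proj_add F.ks.smult_add_l)
    fix w assume "w \<in> carrier A"
    then obtain z where z: "z \<in> carrier F" "w = proj z" using ex by blast
    show "v \<oplus>\<^bsub>A\<^esub> w \<in> carrier A" using y z by (simp add: proj_add A_sel(1))
    show "v \<oplus>\<^bsub>A\<^esub> w = w \<oplus>\<^bsub>A\<^esub> v" using y z by (simp add: proj_add F.ks.a_comm)
    show "a \<odot>\<^bsub>A\<^esub> (v \<oplus>\<^bsub>A\<^esub> w) = a \<odot>\<^bsub>A\<^esub> v \<oplus>\<^bsub>A\<^esub> a \<odot>\<^bsub>A\<^esub> w" for a
      using y z by (simp add: proj_add proj_smult F.ks.smult_add_r)
    fix u assume "u \<in> carrier A"
    then obtain x where x: "x \<in> carrier F" "u = proj x" using ex by blast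
    show "u \<oplus>\<^bsub>A\<^esub> v \<oplus>\<^bsub>A\<^esub> w = u \<oplus>\<^bsub>A\<^esub> (v \<oplus>\<^bsub>A\<^esub> w)" using x y z by (simp add: proj_add F.ks.a_assoc)
  qed (simp add: A_sel)
  then interpret A: kspace A .
  have "ring A"
  proof (rule ringI)
    show "monoid A"
      by (rule monoidI) (auto dest!: ex simp: proj_mult F.m_assoc A_sel(1,3))
  qed (auto dest!: ex intro: A.abelian_group_axioms simp: proj_mult proj_add F.l_distr F.r_distr)
  then show ?thesis
    using A.vs by (intro kalg.intro) (auto dest!: ex simp: proj_mult proj_smult F.smult_mult_l F.smult_mult_r)
qed

lemma klin_proj: "klin F (carrier F) A proj"
  by (rule klinI) (auto simp: A_sel(1) proj_add proj_smult)

lemma I_least: "ideal J F \<Longrightarrow> S \<subseteq> J \<Longrightarrow> I \<subseteq> J"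
  unfolding genideal_def by blast

lemma proj_gen: "x \<in> carrier F \<Longrightarrow> y \<in> carrier F \<Longrightarrow> x \<ominus>\<^bsub>F\<^esub> y \<in> S \<Longrightarrow> proj x = proj y"
  using F.genideal_self[OF S_sub] by (subst proj_eq) auto

end

section \<open>Algebras with Weyl-type generators\<close>

lemma (in kspace) klin_zero: "klin V W U f \<Longrightarrow> kspace U \<Longrightarrow> \<zero> \<in> W \<Longrightarrow> W \<subseteq> carrier V \<Longrightarrow> f \<zero> = \<zero>\<^bsub>U\<^esub>"
  using klinD(3)[of V W U f "\<zero>" 0] klinD(1)[of V W U f "\<zero>"] kspace.smult_0[of U "f \<zero>"] by simp

lemma klin_minus:
  assumes "klin V W U f" "kspace V" "kspace U" "ksub V W" "x \<in> W" "y \<in> W"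
  shows "f (x \<ominus>\<^bsub>V\<^esub> y) = f x \<ominus>\<^bsub>U\<^esub> f y"
proof -
  interpret V: kspace V by fact
  interpret U: kspace U by fact
  have y: "(-1) \<odot>\<^bsub>V\<^esub> y \<in> W" using ksubD(4)[OF assms(4,6)] .
  have c: "y \<in> carrier V" "f y \<in> carrier U" using ksubD(1)[OF assms(4,6)] klinD(1)[OF assms(1,6)] by auto
  have "x \<ominus>\<^bsub>V\<^esub> y = x \<oplus>\<^bsub>V\<^esub> (-1) \<odot>\<^bsub>V\<^esub> y" using c by (simp add: a_minus_def V.smult_neg1)
  then have "f (x \<ominus>\<^bsub>V\<^esub> y) = f x \<oplus>\<^bsub>U\<^esub> (-1) \<odot>\<^bsub>U\<^esub> f y"
    using klinD[OF assms(1)] assms(5,6) y by simp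
  then show ?thesis using c by (simp add: a_minus_def U.smult_neg1)
qed

lemma klin_kspan_in:
  assumes "klin V (carrier V) U f" "kspace V" "ksub U X" "S \<subseteq> carrier V" "\<And>s. s \<in> S \<Longrightarrow> f s \<in> X" "x \<in> kspan V S"
    "kspace U"
  shows "f x \<in> X"
proof -
  have "f x \<in> kspan U (f ` S)" using klin_kspan[OF assms(1,2,7,4)] assms(6) by blast
  also have "\<dots> \<subseteq> X" using assms(5) by (intro kspan_least assms(3)) auto
  finally show ?thesis .
qed

section \<open>Monomials as multisets, ordered by degree first, and independence by leading
  terms\<close>

definition mlt :: "nat multiset \<Rightarrow> nat multiset \<Rightarrow> bool" where
  "mlt \<nu> \<mu> \<longleftrightarrow> size \<nu> < size \<mu> \<or> size \<nu> = size \<mu> \<and> \<nu> < \<mu>"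

lemma mlt_wf: "wfP mlt"
proof -
  have "wf (inv_image (less_than <*lex*> {(x :: nat multiset, y). x < y}) (\<lambda>\<mu>. (size \<mu>, \<mu>)))"
    by (intro wf_inv_image wf_lex_prod wf_less_than wf)
  moreover have "{(\<nu>, \<mu>). mlt \<nu> \<mu>} = inv_image (less_than <*lex*> {(x :: nat multiset, y). x < y}) (\<lambda>\<mu>. (size \<mu>, \<mu>))"
    by (auto simp: mlt_def)
  ultimately show ?thesis by (simp add: wfp_def)
qed

lemma mlt_irrefl[simp]: "\<not> mlt \<mu> \<mu>"
  by (simp add: mlt_def)

lemma mlt_total: "mlt \<mu> \<nu> \<or> \<mu> = \<nu> \<or> mlt \<nu> \<mu>"
  by (auto simp: mlt_def)

lemma mlt_trans: "mlt \<mu> \<nu> \<Longrightarrow> mlt \<nu> \<rho> \<Longrightarrow> mlt \<mu> \<rho>"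
  by (auto simp: mlt_def)

lemma mlt_add: "mlt \<nu> \<mu> \<Longrightarrow> mlt (add_mset i \<nu>) (add_mset i \<mu>)"
  by (auto simp: mlt_def)

lemma mlt_max_exists:
  assumes "finite S" "S \<noteq> {}"
  shows "\<exists>\<mu>\<in>S. \<forall>\<nu>\<in>S. \<nu> \<noteq> \<mu> \<longrightarrow> mlt \<nu> \<mu>"
  using assms
proof (induction S rule: finite_ne_induct)
  case (insert \<rho> S)
  then obtain \<mu> where "\<mu> \<in> S" "\<forall>\<nu>\<in>S. \<nu> \<noteq> \<mu> \<longrightarrow> mlt \<nu> \<mu>" by blast
  then show ?case using mlt_total[of \<mu> \<rho>] mlt_trans by (metis insert_iff)
qed simp

text \<open>Triangularity modulo K. The largest \<mu> is split off: its vector lies outside the span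
  of K and of the other vectors, so it raises the dimension and creates no new intersection with
  K.\<close>

lemma (in kspace) chain_dim:
  assumes "ksub V K" "finite S" "\<And>\<mu>. \<mu> \<in> S \<Longrightarrow> v \<mu> \<in> carrier V"
    and "\<And>\<mu>. \<mu> \<in> S \<Longrightarrow> v \<mu> \<notin> kspan V (K \<union> v ` {\<nu> \<in> S. mlt \<nu> \<mu>})"
  shows "card S \<le> subspace_dim V (kspan V (v ` S)) \<and> kspan V (v ` S) \<inter> K = {\<zero>}"
  using assms(2-4)
proof (induction "card S" arbitrary: S)
  case 0
  then have "kspan V (v ` S) = {\<zero>}"
    using kspan_least[OF _ ksub_zero, of "{}"] kspan_zero[of V "{}"] by auto
  then show ?case using 0 ksubD(2)[OF assms(1)] by auto
next
  case (Suc n)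
  obtain \<mu> where \<mu>: "\<mu> \<in> S" "\<And>\<nu>. \<nu> \<in> S \<Longrightarrow> \<nu> \<noteq> \<mu> \<Longrightarrow> mlt \<nu> \<mu>"
    using mlt_max_exists[of S] Suc by force
  let ?S = "S - {\<mu>}"
  have lt: "{\<nu> \<in> S. mlt \<nu> \<mu>} = ?S" using \<mu> by auto
  let ?W = "kspan V (v ` ?S)"
  have vS: "v ` S \<subseteq> carrier V" using Suc.prems by auto
  have Kc: "K \<subseteq> carrier V" by (rule ksub_subset[OF assms(1)])
  have "v \<rho> \<notin> kspan V (K \<union> v ` {\<nu> \<in> ?S. mlt \<nu> \<rho>})" if "\<rho> \<in> ?S" for \<rho>
    using Suc.prems(3)[of \<rho>] that kspan_mono[of "K \<union> v ` {\<nu> \<in> ?S. mlt \<nu> \<rho>}" "K \<union> v ` {\<nu> \<in> S. mlt \<nu> \<rho>}" V] by auto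
  then have IH: "card ?S \<le> subspace_dim V ?W" "?W \<inter> K = {\<zero>}"
    using Suc.hyps(1)[of ?S] Suc.hyps(2) Suc.prems \<mu>(1) by auto
  have fdW: "fd_subspace V ?W" using Suc.prems vS by (intro fd_kspan) auto
  have nK: "v \<mu> \<notin> kspan V (K \<union> v ` ?S)" using Suc.prems(3)[OF \<mu>(1)] lt by simp
  have WK: "?W \<subseteq> kspan V (K \<union> v ` ?S)" by (rule kspan_mono) auto
  have eq: "kspan V (v ` S) = kspan V (insert (v \<mu>) ?W)"
  proof
    show "kspan V (v ` S) \<subseteq> kspan V (insert (v \<mu>) ?W)"
      by (rule kspan_mono) (auto intro: kspan_base)
    show "kspan V (insert (v \<mu>) ?W) \<subseteq> kspan V (v ` S)"
      using \<mu>(1) kspan_mono[of "v ` ?S" "v ` S" V] by (intro kspan_trans) (auto intro: kspan_base)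
  qed
  have "v \<mu> \<notin> ?W" using nK WK by blast
  then have "subspace_dim V ?W < subspace_dim V (kspan V (v ` S))"
    using dim_insert(2)[OF fdW, of "v \<mu>"] \<mu>(1) Suc.prems(2) unfolding eq by simp
  then have "card S \<le> subspace_dim V (kspan V (v ` S))"
    using IH(1) card_Diff_singleton[OF \<mu>(1)] by simp
  moreover have "kspan V (v ` S) \<inter> K = {\<zero>}"
  proof -
    have "x = \<zero>" if "x \<in> kspan V (v ` S)" "x \<in> K" for x
    proof -
      have sp: "ksub V {c \<odot> v \<mu> \<oplus> w | c w. w \<in> ?W}" (is "ksub V ?X")
        unfolding ksub_def
      proof (intro conjI ballI allI)
        have Wc: "w \<in> ?W \<Longrightarrow> w \<in> carrier V" for w using fd_subset[OF fdW] by blast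
        have vm: "v \<mu> \<in> carrier V" using \<mu> Suc.prems by blast
        show "?X \<subseteq> carrier V" using vm Wc by auto
        show "\<zero> \<in> ?X" using vm kspan_zero[of V "v ` ?S"] by (auto intro!: exI[of _ 0] exI[of _ "\<zero>"])
        show "c \<odot> x \<in> ?X" if xX: "x \<in> ?X" for c x
        proof -
          obtain a w where "x = a \<odot> v \<mu> \<oplus> w" "w \<in> ?W" using xX by blast
          then have "c \<odot> x = (c * a) \<odot> v \<mu> \<oplus> c \<odot> w" using vm Wc by (simp add: smult_add_r smult_assoc)
          then show ?thesis using kspan_smult[OF \<open>w \<in> ?W\<close>] by blast
        qed
        show "x \<oplus> y \<in> ?X" if xX: "x \<in> ?X" and yX: "y \<in> ?X" for x y
        proof -
          obtain a w where 1: "x = a \<odot> v \<mu> \<oplus> w" "w \<in> ?W" using xX by blast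
          obtain b u where 2: "y = b \<odot> v \<mu> \<oplus> u" "u \<in> ?W" using yX by blast
          have "x \<oplus> y = (a + b) \<odot> v \<mu> \<oplus> (w \<oplus> u)" using 1 2 vm Wc by (simp add: smult_add_l a_ac)
          then show ?thesis using kspan_add[OF 1(2) 2(2)] by blast
        qed
      qed
      have vm: "v \<mu> \<in> carrier V" using \<mu> Suc.prems by blast
      have Wc: "w \<in> ?W \<Longrightarrow> w \<in> carrier V" for w using fd_subset[OF fdW] by blast
      have "v \<mu> \<in> ?X" using vm kspan_zero[of V "v ` ?S"] by (auto intro!: exI[of _ 1] exI[of _ "\<zero>"])
      moreover have "w \<in> ?X" if "w \<in> ?W" for w using that vm Wc by (auto intro!: exI[of _ 0] exI[of _ w])
      ultimately have "insert (v \<mu>) ?W \<subseteq> ?X" by blast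
      from kspan_least[OF this sp] have "x \<in> ?X" using that(1) unfolding eq by blast
      then obtain c w where cw: "x = c \<odot> v \<mu> \<oplus> w" "w \<in> ?W" by blast
      \<comment> \<open>Otherwise v \<mu> = (x - w) / c would lie in the span of K and the smaller
        vectors.\<close>
      have "c = 0"
      proof (rule ccontr)
        assume c: "c \<noteq> 0"
        have "inverse c \<odot> (x \<ominus> w) = v \<mu>"
        proof -
          have "x \<ominus> w = c \<odot> v \<mu>" using cw vm Wc by (simp add: a_minus_def a_assoc r_neg)
          then show ?thesis using c vm smult_assoc[of "v \<mu>" "inverse c" c] by simp
        qed
        moreover have "x \<ominus> w \<in> kspan V (K \<union> v ` ?S)"
          using that(2) cw(2) WK Kc vS by (intro ksub_minus kspan_sub) (auto intro: kspan_base)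
        ultimately show False using nK kspan_smult by metis
      qed
      then have "x \<in> ?W" using cw vm Wc by simp
      then show ?thesis using that(2) IH(2) by blast
    qed
    then show ?thesis using kspan_zero[of V "v ` S"] ksubD(2)[OF assms(1)] by blast
  qed
  ultimately show ?case ..
qed

section \<open>Commutators as derivations, and the filtration by word length\<close>

context kalg
begin

definition ad where "ad a b = a \<otimes> b \<ominus> b \<otimes> a"

lemma ad_closed[simp]: "a \<in> carrier R \<Longrightarrow> b \<in> carrier R \<Longrightarrow> ad a b \<in> carrier R"
  by (simp add: ad_def)

lemma ad_derivation: "a \<in> carrier R \<Longrightarrow> b \<in> carrier R \<Longrightarrow> c \<in> carrier R \<Longrightarrow> ad a (b \<otimes> c) = ad a b \<otimes> c \<oplus> b \<otimes> ad a c"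
  by (simp add: ad_def a_minus_def l_distr r_distr m_assoc l_minus r_minus ks.a_assoc ks.r_neg1 ks.r_neg2)

lemma klin_ad: "a \<in> carrier R \<Longrightarrow> klin R (carrier R) R (ad a)"
  by (rule klinI) (simp_all add: ad_def a_minus_def l_distr r_distr smult_mult_l smult_mult_r ks.minus_add ks.a_ac
      ks.smult_add_r ks.smult_neg1[symmetric] ks.smult_assoc[symmetric])

lemma klin_ad_l: "b \<in> carrier R \<Longrightarrow> klin R (carrier R) R (\<lambda>a. ad a b)"
  by (rule klinI) (simp_all add: ad_def a_minus_def l_distr r_distr smult_mult_l smult_mult_r ks.minus_add ks.a_ac
      ks.smult_add_r ks.smult_neg1[symmetric] ks.smult_assoc[symmetric])

lemma kbilin_ad: "kbilin R R R ad"
  by (simp add: kbilin_def klin_ad klin_ad_l)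

lemma ad_mult_swap: "a \<in> carrier R \<Longrightarrow> b \<in> carrier R \<Longrightarrow> a \<otimes> b = b \<otimes> a \<oplus> ad a b"
proof -
  assume ab: "a \<in> carrier R" "b \<in> carrier R"
  then have "b \<otimes> a \<oplus> ad a b = a \<otimes> b \<oplus> (b \<otimes> a \<oplus> \<ominus> (b \<otimes> a))"
    by (simp add: ad_def a_minus_def ks.a_lcomm)
  then show "a \<otimes> b = b \<otimes> a \<oplus> ad a b" using ab by (simp add: ks.r_neg)
qed

lemma ad_scalar: "a \<in> carrier R \<Longrightarrow> ad a (c \<odot> \<one>) = \<zero>"
  by (simp add: ad_def smult_mult_l smult_mult_r a_minus_def ks.r_neg)

lemma klin_self_minus: "klin R (carrier R) R f \<Longrightarrow> x \<in> carrier R \<Longrightarrow> y \<in> carrier R \<Longrightarrow> f (x \<ominus> y) = f x \<ominus> f y"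
  by (rule klin_minus[OF _ ks.kspace_axioms ks.kspace_axioms ks.ksub_carrier])

end

text \<open>Puts the x and the y on one footing as a single family \<open>z\<close> with scalar
  commutators and a dual family \<open>zs\<close>. The symplectic form and its signs then appear
  only when the Weyl algebra is shown to be an instance.\<close>

locale weyl_like = kalg A for A :: "('k::field_char_0, 'a) module" (structure) +
  fixes m :: nat and z zs :: "nat \<Rightarrow> 'a"
  assumes z_in[simp]: "i < m \<Longrightarrow> z i \<in> carrier A"
    and zs_in_span: "i < m \<Longrightarrow> zs i \<in> kspan A (z ` {..<m})"
    and z_comm: "i < m \<Longrightarrow> j < m \<Longrightarrow> \<exists>c. ad (z i) (z j) = c \<odot> \<one>"
    and zs_comm: "i < m \<Longrightarrow> j < m \<Longrightarrow> ad (zs i) (z j) = (if i = j then \<one> else \<zero>)"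
    and gen: "carrier A \<subseteq> kspan A {foldr (\<lambda>i a. z i \<otimes> a) w \<one> | w. set w \<subseteq> {..<m}}"
    and one_neq_zero: "\<one> \<noteq> \<zero>"
begin

definition word where "word w = foldr (\<lambda>i a. z i \<otimes> a) w \<one>"

lemma word_simps[simp]: "word [] = \<one>" "word (i # w) = z i \<otimes> word w"
  by (simp_all add: word_def)

lemma word_in[simp]: "set w \<subseteq> {..<m} \<Longrightarrow> word w \<in> carrier A"
  by (induction w) auto

lemma word_append: "set w \<subseteq> {..<m} \<Longrightarrow> set w' \<subseteq> {..<m} \<Longrightarrow> word (w @ w') = word w \<otimes> word w'"
  by (induction w) (auto simp: m_assoc)

text \<open>\<open>F\<close> is the Bernstein filtration; \<open>G\<close> is shifted by one, so that \<open>G 0 = 0\<close>.\<close>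

definition G where "G k = kspan A {word w | w. set w \<subseteq> {..<m} \<and> length w < k}"

abbreviation F where "F j \<equiv> G (Suc j)"

definition U where "U = kspan A (z ` {..<m})"

lemma words_carrier: "{word w | w. set w \<subseteq> {..<m} \<and> length w < k} \<subseteq> carrier A"
  by auto

lemma G_ksub: "ksub A (G k)"
  unfolding G_def by (rule ks.kspan_sub[OF words_carrier])

lemma G_in: "a \<in> G k \<Longrightarrow> a \<in> carrier A"
  by (rule ksubD(1)[OF G_ksub])

lemma G_fd: "fd_subspace A (G k)"
proof -
  have "{word w | w. set w \<subseteq> {..<m} \<and> length w < k} \<subseteq> word ` {w. set w \<subseteq> {..<m} \<and> length w \<le> k}"
    by auto
  then have "finite {word w | w. set w \<subseteq> {..<m} \<and> length w < k}"
    using finite_lists_length_le[of "{..<m}" k] finite_subset by blast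
  then show ?thesis unfolding G_def using words_carrier by (rule ks.fd_kspan(1))
qed

lemma G_mono: "j \<le> k \<Longrightarrow> G j \<subseteq> G k"
  unfolding G_def by (rule kspan_mono) auto

lemma word_G: "set w \<subseteq> {..<m} \<Longrightarrow> length w < k \<Longrightarrow> word w \<in> G k"
  unfolding G_def by (rule kspan_base) auto

lemma G_0: "G 0 = {\<zero>}"
  using kspan_least[OF _ ks.ksub_zero, of "{}"] kspan_zero[of A "{}"] by (auto simp: G_def)

lemma F_0: "a \<in> F 0 \<Longrightarrow> \<exists>c. a = c \<odot> \<one>"
proof -
  assume a: "a \<in> F 0"
  have "ksub A (range (\<lambda>c. c \<odot> \<one>))"
    by (auto simp: ksub_def ks.smult_add_l[symmetric] ks.smult_assoc[symmetric] image_iff intro: exI[of _ 0])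
  moreover have "{word w | w. set w \<subseteq> {..<m} \<and> length w < Suc 0} \<subseteq> range (\<lambda>c. c \<odot> \<one>)"
    by (auto intro!: range_eqI[of _ _ 1])
  ultimately have "F 0 \<subseteq> range (\<lambda>c. c \<odot> \<one>)" unfolding G_def by (rule kspan_least[rotated])
  then show ?thesis using a by auto
qed

lemma one_F: "\<one> \<in> F j"
  using word_G[of "[]" "Suc j"] by simp

lemma scalar_F: "c \<odot> \<one> \<in> F j"
  using one_F ksubD(4)[OF G_ksub] by blast

lemma F_exhaust: "a \<in> carrier A \<Longrightarrow> \<exists>j. a \<in> F j"
proof -
  assume a: "a \<in> carrier A"
  have "x \<in> kspan A {word w | w. set w \<subseteq> {..<m}} \<Longrightarrow> \<exists>j. x \<in> F j" for x
  proof (induction rule: kspan.induct)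
    case (kspan_base x)
    then show ?case using word_G by blast
  next
    case (kspan_add x y)
    then obtain i j where "x \<in> F i" "y \<in> F j" by blast
    then have "x \<in> F (max i j)" "y \<in> F (max i j)" using G_mono[of "Suc i" "Suc (max i j)"] G_mono[of "Suc j" "Suc (max i j)"] by auto
    then show ?case using ksubD(3)[OF G_ksub] by blast
  qed (use ksubD(2)[OF G_ksub] ksubD(4)[OF G_ksub] in blast)+
  then show ?thesis using gen a unfolding word_def by blast
qed

lemma F_mult: "a \<in> F i \<Longrightarrow> b \<in> F j \<Longrightarrow> a \<otimes> b \<in> F (i + j)"
proof -
  assume "a \<in> F i" "b \<in> F j"
  then have "a \<otimes> b \<in> kspan A {s \<otimes> t | s t. s \<in> {word w | w. set w \<subseteq> {..<m} \<and> length w < Suc i} \<and>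
      t \<in> {word w | w. set w \<subseteq> {..<m} \<and> length w < Suc j}}"
    unfolding G_def by (intro mult_kspan words_carrier)
  also have "\<dots> \<subseteq> F (i + j)"
  proof (rule kspan_least[OF _ G_ksub], clarsimp)
    fix v w assume "set v \<subseteq> {..<m}" "set w \<subseteq> {..<m}" "length v < Suc i" "length w < Suc j"
    then show "word v \<otimes> word w \<in> F (i + j)"
      using word_G[of "v @ w" "Suc (i + j)"] by (simp add: word_append)
  qed
  finally show ?thesis .
qed

lemma F_mult_G: "a \<in> F i \<Longrightarrow> b \<in> G j \<Longrightarrow> a \<otimes> b \<in> G (i + j)"
proof (cases j)
  case 0
  assume "a \<in> F i" "b \<in> G j"
  then have "a \<otimes> b = \<zero>" using 0 G_0 G_in by auto
  then show ?thesis using ksubD(2)[OF G_ksub] by simp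
qed (use F_mult in auto)

lemma G_mult_F: "a \<in> G i \<Longrightarrow> b \<in> F j \<Longrightarrow> a \<otimes> b \<in> G (i + j)"
proof (cases i)
  case 0
  assume "a \<in> G i" "b \<in> F j"
  then have "a \<otimes> b = \<zero>" using 0 G_0 G_in by auto
  then show ?thesis using ksubD(2)[OF G_ksub] by simp
qed (use F_mult in auto)

lemma U_ksub: "ksub A U"
  unfolding U_def by (rule ks.kspan_sub) auto

lemma z_F: "i < m \<Longrightarrow> z i \<in> F 1"
  using word_G[of "[i]" 2] by (simp add: numeral_2_eq_2)

lemma U_F: "u \<in> U \<Longrightarrow> u \<in> F 1"
  using kspan_least[OF _ G_ksub, of "z ` {..<m}"] z_F unfolding U_def by blast

lemma U_in[simp]: "u \<in> U \<Longrightarrow> u \<in> carrier A"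
  using U_F G_in by blast

lemma z_U: "i < m \<Longrightarrow> z i \<in> U"
  unfolding U_def by (rule kspan_base) auto

lemma zs_U: "i < m \<Longrightarrow> zs i \<in> U"
  using zs_in_span by (simp add: U_def)

lemma zs_in[simp]: "i < m \<Longrightarrow> zs i \<in> carrier A"
  using zs_U by simp

lemma ad_z_word:
  assumes "i < m" "set w \<subseteq> {..<m}"
  shows "ad (z i) (word w) \<in> G (length w)"
  using assms(2)
proof (induction w)
  case Nil
  then show ?case using ad_scalar[of "z i" 1] assms G_0 by simp
next
  case (Cons h w)
  then obtain c where c: "ad (z i) (z h) = c \<odot> \<one>" using z_comm[OF assms(1), of h] by auto
  have "ad (z i) (z h \<otimes> word w) = c \<odot> word w \<oplus> z h \<otimes> ad (z i) (word w)"
    using Cons.prems assms c by (simp add: ad_derivation smult_mult_l)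
  moreover have "c \<odot> word w \<in> G (length (h # w))"
    using Cons.prems ksubD(4)[OF G_ksub word_G] by simp
  moreover have "z h \<otimes> ad (z i) (word w) \<in> G (length (h # w))"
    using F_mult_G[OF z_F Cons.IH] Cons.prems by simp
  ultimately show ?case using ksubD(3)[OF G_ksub] by simp
qed

text \<open>In the Leibniz rule each term replaces one letter of a word by a scalar, so the degree
  drops by one. As \<open>G (Suc k)\<close> is \<open>F k\<close>, the statement also covers degree
  0, where the commutator vanishes.\<close>

lemma ad_U: "u \<in> U \<Longrightarrow> a \<in> G (Suc k) \<Longrightarrow> ad u a \<in> G k"
proof -
  assume "u \<in> U" "a \<in> G (Suc k)"
  then have "ad u a \<in> kspan A {ad s t | s t. s \<in> z ` {..<m} \<and> t \<in> {word w | w. set w \<subseteq> {..<m} \<and> length w < Suc k}}"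
    unfolding U_def G_def
    by (intro kspan_kbilin[OF ks.kspace_axioms ks.kspace_axioms ks.kspace_axioms kbilin_ad]) auto
  also have "\<dots> \<subseteq> G k"
  proof (rule kspan_least[OF _ G_ksub], clarsimp)
    fix i w assume "i < m" "set w \<subseteq> {..<m}" "length w < Suc k"
    then show "ad (z i) (word w) \<in> G k" using ad_z_word[of i w] G_mono[of "length w" k] by auto
  qed
  finally show ?thesis .
qed

lemma ad_U_pow: "u \<in> U \<Longrightarrow> a \<in> G k \<Longrightarrow> (ad u ^^ k) a = \<zero>"
proof (induction k arbitrary: a)
  case (Suc k)
  then show ?case using ad_U[of u a k] by (simp add: funpow_swap1)
qed (use G_0 in auto)

definition D where "D i = ad (zs i)"

lemma D_closed[simp]: "i < m \<Longrightarrow> a \<in> carrier A \<Longrightarrow> D i a \<in> carrier A"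
  by (simp add: D_def)

lemma D_G: "i < m \<Longrightarrow> a \<in> G (Suc k) \<Longrightarrow> D i a \<in> G k"
  unfolding D_def by (rule ad_U[OF zs_U])

lemma klin_D: "i < m \<Longrightarrow> klin A (carrier A) A (D i)"
  unfolding D_def by (rule klin_ad) simp

lemma D_derivation: "i < m \<Longrightarrow> a \<in> carrier A \<Longrightarrow> b \<in> carrier A \<Longrightarrow> D i (a \<otimes> b) = D i a \<otimes> b \<oplus> a \<otimes> D i b"
  by (simp add: D_def ad_derivation)

lemma D_z: "i < m \<Longrightarrow> h < m \<Longrightarrow> D i (z h) = (if i = h then \<one> else \<zero>)"
  by (simp add: D_def zs_comm)

lemma D_one: "i < m \<Longrightarrow> D i \<one> = \<zero>"
  using ad_scalar[of "zs i" 1] by (simp add: D_def)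

text \<open>The Euler operator, which acts on \<open>F d\<close> as multiplication by \<open>d\<close> modulo \<open>F (d - 1)\<close>.\<close>

primrec Es :: "nat \<Rightarrow> 'a \<Rightarrow> 'a" where
  "Es 0 a = \<zero>"
| "Es (Suc k) a = Es k a \<oplus> z k \<otimes> D k a"

lemma Es_closed[simp]: "k \<le> m \<Longrightarrow> a \<in> carrier A \<Longrightarrow> Es k a \<in> carrier A"
  by (induction k) auto

lemma klin_Es: "k \<le> m \<Longrightarrow> klin A (carrier A) A (Es k)"
proof (induction k)
  case (Suc k)
  then have k: "k < m" and IH: "klin A (carrier A) A (Es k)" by auto
  show ?case
    by (rule klinI) (use k in \<open>simp_all add: klinD[OF IH] klinD[OF klin_D[OF k]] r_distr ks.a_ac smult_mult_r ks.smult_add_r\<close>)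
qed (auto intro: klinI)

lemma Es_zero: "k \<le> m \<Longrightarrow> (\<And>i. i < m \<Longrightarrow> D i a = \<zero>) \<Longrightarrow> Es k a = \<zero>"
  by (induction k) auto

lemma Es_G: "k \<le> m \<Longrightarrow> a \<in> G d \<Longrightarrow> Es k a \<in> G d"
proof (induction k)
  case (Suc k)
  have "z k \<otimes> D k a \<in> G d"
  proof (cases d)
    case 0
    then have "a = \<zero>" using Suc G_0 by auto
    then have "D k a = \<zero>" using ks.klin_zero[OF klin_D ks.kspace_axioms, of k] Suc by simp
    then show ?thesis using Suc ksubD(2)[OF G_ksub] by simp
  next
    case (Suc d')
    then show ?thesis using F_mult_G[OF z_F D_G, of k k a d'] Suc.prems \<open>Suc k \<le> m\<close> by simp
  qed
  then show ?case using Suc ksubD(3)[OF G_ksub] by simp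
qed (simp add: ksubD(2)[OF G_ksub])

text \<open>Moving \<open>z k\<close> past \<open>z h\<close> costs a scalar multiple of
  \<open>D k b\<close>, whose degree is below that of \<open>z h \<otimes> b\<close>; these terms
  are collected in r. The term k = h of the Leibniz rule contributes the extra
  \<open>z h \<otimes> b\<close>, which is how the Euler operator counts letters.\<close>

lemma Es_z_mult:
  assumes "k \<le> m" "h < m" "b \<in> F d"
  shows "\<exists>r\<in>F d. Es k (z h \<otimes> b) = ((if h < k then z h \<otimes> b else \<zero>) \<oplus> z h \<otimes> Es k b) \<oplus> r"
  using assms(1)
proof (induction k)
  case 0
  then show ?case using assms G_in[OF assms(3)] ksubD(2)[OF G_ksub, of "Suc d"] by (intro bexI[of _ "\<zero>"]) auto
next
  case (Suc k)
  then have k: "k < m" by simp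
  have b: "b \<in> carrier A" by (rule G_in[OF assms(3)])
  obtain r where r: "r \<in> F d" "Es k (z h \<otimes> b) = ((if h < k then z h \<otimes> b else \<zero>) \<oplus> z h \<otimes> Es k b) \<oplus> r"
    using Suc by auto
  have rc: "r \<in> carrier A" by (rule G_in[OF r(1)])
  obtain c where c: "ad (z k) (z h) = c \<odot> \<one>" using z_comm[OF k assms(2)] by blast
  have Db: "D k b \<in> carrier A" using k b by simp
  have "z k \<otimes> D k (z h \<otimes> b) = (if k = h then z h \<otimes> b else \<zero>) \<oplus> z k \<otimes> (z h \<otimes> D k b)"
    using k b assms(2) by (simp add: D_derivation D_z r_distr)
  also have "z k \<otimes> (z h \<otimes> D k b) = (z k \<otimes> z h) \<otimes> D k b" using k assms(2) Db by (simp add: m_assoc)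
  also have "\<dots> = z h \<otimes> (z k \<otimes> D k b) \<oplus> c \<odot> D k b"
    using k assms(2) Db ad_mult_swap[of "z k" "z h"] c by (simp add: l_distr m_assoc smult_mult_l)
  finally have *: "z k \<otimes> D k (z h \<otimes> b) = (if k = h then z h \<otimes> b else \<zero>) \<oplus> (z h \<otimes> (z k \<otimes> D k b) \<oplus> c \<odot> D k b)" .
  have cD: "c \<odot> D k b \<in> F d"
    using ksubD(4)[OF G_ksub D_G[OF k assms(3)]] G_mono[of d "Suc d"] by auto
  have "Es (Suc k) (z h \<otimes> b) = ((if h < Suc k then z h \<otimes> b else \<zero>) \<oplus> z h \<otimes> Es (Suc k) b) \<oplus> (r \<oplus> c \<odot> D k b)"
    using k b assms(2) Db rc Suc.prems by (auto simp: r(2) * r_distr ks.a_ac less_Suc_eq)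
  then show ?case using ksubD(3)[OF G_ksub r(1) cD] by blast
qed

lemma Euler_word:
  assumes "set w \<subseteq> {..<m}"
  shows "\<exists>r\<in>G (length w). Es m (word w) = of_nat (length w) \<odot> word w \<oplus> r"
  using assms
proof (induction w)
  case Nil
  have "Es m \<one> = \<zero>" by (rule Es_zero) (auto simp: D_one)
  then show ?case using G_0 by auto
next
  case (Cons h w)
  let ?d = "length w"
  have h: "h < m" and w: "set w \<subseteq> {..<m}" using Cons.prems by auto
  obtain r where r: "r \<in> G ?d" "Es m (word w) = of_nat ?d \<odot> word w \<oplus> r" using Cons.IH w by blast
  obtain r' where r': "r' \<in> F ?d" "Es m (z h \<otimes> word w) = ((if h < m then z h \<otimes> word w else \<zero>) \<oplus> z h \<otimes> Es m (word w)) \<oplus> r'"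
    using Es_z_mult[OF le_refl h word_G[OF w, of "Suc ?d"]] by auto
  have c: "r \<in> carrier A" "r' \<in> carrier A" using r r' G_in by auto
  have "Es m (word (h # w)) = of_nat (length (h # w)) \<odot> word (h # w) \<oplus> (z h \<otimes> r \<oplus> r')"
    using h w c by (simp add: r'(2) r(2) r_distr smult_mult_r ks.smult_add_l ks.a_ac)
  moreover have "z h \<otimes> r \<oplus> r' \<in> G (length (h # w))"
    using ksubD(3)[OF G_ksub F_mult_G[OF z_F[OF h] r(1)]] r'(1) by simp
  ultimately show ?case by blast
qed

lemma Euler_F:
  assumes "a \<in> F d"
  shows "Es m a \<ominus> of_nat d \<odot> a \<in> G d"
proof -
  have kl: "klin A (carrier A) A (\<lambda>a. Es m a \<ominus> of_nat d \<odot> a)"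
    by (rule klinI) (simp_all add: klinD[OF klin_Es] a_minus_def ks.minus_add ks.smult_add_r ks.a_ac
      ks.smult_neg1[symmetric] ks.smult_assoc[symmetric] mult.commute)
  show ?thesis
  proof (rule klin_kspan_in[OF kl ks.kspace_axioms G_ksub words_carrier _ assms[unfolded G_def] ks.kspace_axioms])
    fix s assume "s \<in> {word w | w. set w \<subseteq> {..<m} \<and> length w < Suc d}"
    then obtain w where w: "s = word w" "set w \<subseteq> {..<m}" "length w \<le> d" by auto
    show "Es m s \<ominus> of_nat d \<odot> s \<in> G d"
    proof (cases "length w = d")
      case True
      obtain r where "r \<in> G d" "Es m (word w) = of_nat d \<odot> word w \<oplus> r" using Euler_word[OF w(2)] True by auto
      moreover from this have "r \<in> carrier A" using G_in by blast
      ultimately have "Es m s \<ominus> of_nat d \<odot> s = r"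
        using w by (simp add: a_minus_def ks.a_ac ks.r_neg ks.r_neg1 ks.r_neg2)
      then show ?thesis using \<open>r \<in> G d\<close> by simp
    next
      case False
      then have "s \<in> G d" using w word_G by auto
      then show ?thesis using Es_G[of m s d] ksubD(4)[OF G_ksub] ks.ksub_minus[OF G_ksub] by simp
    qed
  qed
qed

text \<open>If all derivatives vanish, so does the Euler operator, and (d + 1) a lies in
  \<open>F d\<close>. Characteristic 0 permits division by d + 1.\<close>

lemma constants:
  assumes "a \<in> F (Suc d)" "\<And>i. i < m \<Longrightarrow> D i a = \<zero>"
  shows "a \<in> F d"
proof -
  have a: "a \<in> carrier A" by (rule G_in[OF assms(1)])
  have "\<zero> \<ominus> of_nat (Suc d) \<odot> a \<in> F d" using Euler_F[OF assms(1)] Es_zero[OF le_refl assms(2)] by simp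
  then have "(- inverse (of_nat (Suc d))) \<odot> (\<zero> \<ominus> of_nat (Suc d) \<odot> a) \<in> F d" by (rule ksubD(4)[OF G_ksub])
  also have "(- inverse (of_nat (Suc d))) \<odot> (\<zero> \<ominus> of_nat (Suc d) \<odot> a) = a"
    using a by (simp add: a_minus_def ks.smult_neg1[symmetric] ks.smult_assoc[symmetric] del: of_nat_Suc)
  finally show ?thesis .
qed

text \<open>Every derivation lowers the degree by one. By \<open>constants\<close>, an element
  killed by all derivations already has lower degree, so the process cannot stall before a nonzero
  scalar is reached.\<close>

lemma reduce_to_scalar:
  assumes "a \<in> F d" "a \<noteq> \<zero>"
  shows "\<exists>is c. set is \<subseteq> {..<m} \<and> length is \<le> d \<and> c \<noteq> 0 \<and> fold D is a = c \<odot> \<one>"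
  using assms
proof (induction d arbitrary: a)
  case 0
  then obtain c where "a = c \<odot> \<one>" using F_0 by blast
  moreover have "c \<noteq> 0" using 0 calculation by auto
  ultimately show ?case by (intro exI[of _ "[]"] exI[of _ c]) auto
next
  case (Suc d)
  show ?case
  proof (cases "\<forall>i<m. D i a = \<zero>")
    case True
    then have "a \<in> F d" using constants Suc by blast
    then show ?thesis using Suc.IH[of a] Suc.prems(2) by (meson le_SucI)
  next
    case False
    then obtain i where i: "i < m" "D i a \<noteq> \<zero>" by blast
    then obtain "is" c where "set is \<subseteq> {..<m}" "length is \<le> d" "c \<noteq> 0" "fold D is (D i a) = c \<odot> \<one>"
      using Suc.IH[OF D_G[OF i(1) Suc.prems(1)]] by blast
    then show ?thesis using i by (intro exI[of _ "i # is"] exI[of _ c]) auto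
  qed
qed

lemma Es_U: "u \<in> U \<Longrightarrow> Es m u = u"
proof -
  assume u: "u \<in> U"
  have "Es k (z h) = (if h < k then z h else \<zero>)" if "k \<le> m" "h < m" for k h
    using that(1) by (induction k) (use that(2) in \<open>auto simp: D_z less_Suc_eq\<close>)
  then have "z ` {..<m} \<subseteq> {u \<in> carrier A. Es m u = u}" by auto
  moreover have "ksub A {u \<in> carrier A. Es m u = u}"
    using ks.klin_zero[OF klin_Es ks.kspace_axioms, of m] by (auto simp: ksub_def klinD[OF klin_Es])
  ultimately show ?thesis using kspan_least u unfolding U_def by blast
qed

text \<open>Two distinct elements of \<open>U\<close> never act alike from the left and from the right: if \<open>w f = f w'\<close>,
  then \<open>w D\<^sup>k f - D\<^sup>k f w' = k c D\<^sup>k\<^sup>-\<^sup>1 f\<close> for a locally nilpotent derivation \<open>D\<close> and a scalar \<open>c \<noteq> 0\<close>.\<close>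

lemma twisted_commutator_nonzero:
  assumes "w \<in> U" "w' \<in> U" "w \<noteq> w'" "f \<in> carrier A" "f \<noteq> \<zero>"
  shows "w \<otimes> f \<ominus> f \<otimes> w' \<noteq> \<zero>"
proof
  assume eq: "w \<otimes> f \<ominus> f \<otimes> w' = \<zero>"
  let ?d = "w' \<ominus> w"
  have c: "w \<in> carrier A" "w' \<in> carrier A" using assms by auto
  have d: "?d \<in> U" "?d \<noteq> \<zero>"
    using ks.ksub_minus[OF U_ksub assms(2,1)] assms(3) c by auto
  \<comment> \<open>The Euler operator is the identity on U, so a nonzero element of U is not killed
    by all \<open>D i\<close>.\<close>
  have "\<exists>i<m. D i ?d \<noteq> \<zero>" using Es_zero[OF le_refl, of ?d] Es_U[OF d(1)] d(2) by auto
  then obtain i where i: "i < m" "D i ?d \<noteq> \<zero>" by blast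
  let ?D = "D i"
  have sc: "\<exists>c. ?D u = c \<odot> \<one>" if "u \<in> U" for u
    using F_0 D_G[OF i(1)] U_F[OF that] by simp
  obtain \<alpha> \<beta> where ab: "?D w = \<alpha> \<odot> \<one>" "?D w' = \<beta> \<odot> \<one>" using sc assms by metis
  have kD: "klin A (carrier A) A ?D" by (rule klin_D[OF i(1)])
  have "?D ?d = \<beta> \<odot> \<one> \<ominus> \<alpha> \<odot> \<one>" using klin_self_minus[OF kD] c ab by simp
  also have "\<dots> = (\<beta> - \<alpha>) \<odot> \<one>"
    by (simp add: a_minus_def ks.smult_neg1[symmetric] ks.smult_assoc[symmetric] ks.smult_add_l[symmetric])
  finally have ne: "\<beta> - \<alpha> \<noteq> 0" using i(2) by auto
  have Dk: "(?D ^^ k) f \<in> carrier A" for k by (induction k) (use assms i in auto)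
  \<comment> \<open>Differentiating the relation w f = f w' repeatedly. For k = 0 the truncated
    \<open>k - 1\<close> is harmless, since its coefficient is 0.\<close>
  have main: "w \<otimes> (?D ^^ k) f \<ominus> (?D ^^ k) f \<otimes> w' = (of_nat k * (\<beta> - \<alpha>)) \<odot> (?D ^^ (k - 1)) f" for k
  proof (induction k)
    case 0
    then show ?case using eq assms by simp
  next
    case (Suc k)
    define x where "x = (?D ^^ k) f"
    have x: "x \<in> carrier A" "?D x \<in> carrier A" using Dk i by (auto simp: x_def)
    have "?D (w \<otimes> x \<ominus> x \<otimes> w') = (\<alpha> \<odot> x \<oplus> w \<otimes> ?D x) \<ominus> (?D x \<otimes> w' \<oplus> \<beta> \<odot> x)"
      using c x i ab by (simp add: klin_self_minus[OF kD] D_derivation smult_mult_l smult_mult_r)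
    also have "\<dots> = (w \<otimes> ?D x \<ominus> ?D x \<otimes> w') \<oplus> (\<alpha> \<odot> x \<oplus> (- \<beta>) \<odot> x)"
      using c x by (simp add: a_minus_def ks.a_ac ks.smult_add_r ks.smult_neg1[symmetric] ks.smult_assoc[symmetric])
    also have "\<alpha> \<odot> x \<oplus> (- \<beta>) \<odot> x = (\<alpha> - \<beta>) \<odot> x" using x by (simp add: ks.smult_add_l[symmetric])
    finally have 1: "?D (w \<otimes> x \<ominus> x \<otimes> w') = (w \<otimes> ?D x \<ominus> ?D x \<otimes> w') \<oplus> (\<alpha> - \<beta>) \<odot> x" .
    have 2: "?D (w \<otimes> x \<ominus> x \<otimes> w') = (of_nat k * (\<beta> - \<alpha>)) \<odot> x"
    proof (cases k)
      case 0
      then show ?thesis using eq ks.klin_zero[OF kD ks.kspace_axioms] x by (simp add: x_def)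
    next
      case (Suc k')
      then have "x = ?D ((?D ^^ (k - 1)) f)" by (simp add: x_def)
      then show ?thesis using Suc.IH Dk klinD(3)[OF kD] unfolding x_def[symmetric] using \<open>w \<otimes> (?D ^^ k) f \<ominus> (?D ^^ k) f \<otimes> w' = _\<close>
        by (simp add: x_def)
    qed
    let ?y = "w \<otimes> ?D x \<ominus> ?D x \<otimes> w'"
    have y: "?y \<in> carrier A" using c x by simp
    have "?y = (?y \<oplus> (\<alpha> - \<beta>) \<odot> x) \<oplus> (\<beta> - \<alpha>) \<odot> x"
      using x y by (simp add: ks.a_assoc ks.smult_add_l[symmetric])
    also have "\<dots> = (of_nat k * (\<beta> - \<alpha>)) \<odot> x \<oplus> (\<beta> - \<alpha>) \<odot> x" using 1 2 by simp
    also have "\<dots> = (of_nat (Suc k) * (\<beta> - \<alpha>)) \<odot> x" using x by (simp add: ks.smult_add_l[symmetric] algebra_simps)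
    finally show ?case by (simp add: x_def)
  qed
  obtain j where "f \<in> F j" using F_exhaust assms by blast
  then have "(?D ^^ Suc j) f = \<zero>" using ad_U_pow[OF zs_U[OF i(1)]] unfolding D_def by blast
  then have "\<exists>k. (?D ^^ k) f = \<zero>" by blast
  \<comment> \<open>For the least k with D^k f = 0, \<open>main\<close> says that a nonzero multiple
    of D^(k - 1) f vanishes, against minimality.\<close>
  then obtain k where k: "(?D ^^ k) f = \<zero>" "\<And>l. l < k \<Longrightarrow> (?D ^^ l) f \<noteq> \<zero>"
    using exists_least_iff[of "\<lambda>k. (?D ^^ k) f = \<zero>"] by auto
  have "k \<noteq> 0" using k(1) assms by (cases k) auto
  have "(of_nat k * (\<beta> - \<alpha>)) \<odot> (?D ^^ (k - 1)) f = \<zero>" using main[of k] k(1) c by (simp add: a_minus_def ks.r_neg)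
  moreover have "of_nat k * (\<beta> - \<alpha>) \<noteq> 0" using \<open>k \<noteq> 0\<close> ne by simp
  ultimately have "(?D ^^ (k - 1)) f = \<zero>" using ks.smult_eq_0[OF Dk] by blast
  then show False using k(2)[of "k - 1"] \<open>k \<noteq> 0\<close> by simp
qed

end

lemma (in kalg) minus_trans:
  "x \<in> carrier R \<Longrightarrow> y \<in> carrier R \<Longrightarrow> u \<in> carrier R \<Longrightarrow> x \<ominus> u = (x \<ominus> y) \<oplus> (y \<ominus> u)"
  by (simp add: a_minus_def ks.a_assoc ks.r_neg1)

lemma (in kalg) minus_add_cancel: "x \<in> carrier R \<Longrightarrow> y \<in> carrier R \<Longrightarrow> x = y \<oplus> (x \<ominus> y)"
  by (simp add: a_minus_def ks.a_lcomm ks.r_neg)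

section \<open>Counting exponent multisets\<close>

definition lst :: "nat multiset \<Rightarrow> nat list" where
  "lst \<mu> = (SOME w. mset w = \<mu>)"

lemma mset_lst[simp]: "mset (lst \<mu>) = \<mu>"
  unfolding lst_def by (rule someI_ex) (rule ex_mset)

lemma set_lst[simp]: "set (lst \<mu>) = set_mset \<mu>"
  by (metis mset_lst set_mset_mset)

lemma length_lst[simp]: "length (lst \<mu>) = size \<mu>"
  by (metis mset_lst size_mset)

lemma finite_multisets_le: "finite T \<Longrightarrow> finite {\<mu> :: nat multiset. set_mset \<mu> \<subseteq> T \<and> size \<mu> \<le> j}"
proof -
  assume "finite T"
  then have "finite (mset ` {w. set w \<subseteq> T \<and> length w \<le> j})" by (intro finite_imageI finite_lists_length_le)
  moreover have "{\<mu>. set_mset \<mu> \<subseteq> T \<and> size \<mu> \<le> j} \<subseteq> mset ` {w. set w \<subseteq> T \<and> length w \<le> j}"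
  proof
    fix \<mu> assume "\<mu> \<in> {\<mu>. set_mset \<mu> \<subseteq> T \<and> size \<mu> \<le> j}"
    then show "\<mu> \<in> mset ` {w. set w \<subseteq> T \<and> length w \<le> j}"
      by (intro image_eqI[of _ mset "lst \<mu>"]) auto
  qed
  ultimately show ?thesis by (rule finite_subset[rotated])
qed

text \<open>Exponents at most q in each of \<open>card T\<close> variables give total degree at most
  \<open>card T * q\<close>, and such exponents form a box.\<close>

lemma card_multisets_ge:
  assumes "finite T"
  shows "(q + 1) ^ card T \<le> card {\<mu> :: nat multiset. set_mset \<mu> \<subseteq> T \<and> size \<mu> \<le> card T * q}"
proof -
  let ?P = "T \<rightarrow>\<^sub>E {..q}"
  define \<phi> :: "(nat \<Rightarrow> nat) \<Rightarrow> nat multiset" where "\<phi> f = (\<Sum>i\<in>T. replicate_mset (f i) i)" for f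
  have cnt: "count (\<phi> f) i = f i" if "i \<in> T" for f i
  proof -
    have "count (\<phi> f) i = (\<Sum>j\<in>T. if j = i then f j else 0)"
      unfolding \<phi>_def count_sum by (intro sum.cong) auto
    then show ?thesis using that assms by simp
  qed
  have "inj_on \<phi> ?P"
  proof (rule inj_onI)
    fix f g assume fg: "f \<in> ?P" "g \<in> ?P" "\<phi> f = \<phi> g"
    have "f i = g i" if "i \<in> T" for i
      using cnt[OF that, of f] cnt[OF that, of g] fg(3) by simp
    then show "f = g" by (rule PiE_ext[OF fg(1,2)])
  qed
  moreover have "\<phi> ` ?P \<subseteq> {\<mu>. set_mset \<mu> \<subseteq> T \<and> size \<mu> \<le> card T * q}"
  proof safe
    fix f i assume f: "f \<in> ?P"
    { assume "i \<in># \<phi> f"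
      then show "i \<in> T" using assms unfolding \<phi>_def by (auto simp: set_mset_sum split: if_splits) }
    have "size (\<phi> f) = (\<Sum>i\<in>T. f i)" unfolding \<phi>_def by (simp add: size_multiset_sum)
    also have "\<dots> \<le> (\<Sum>i\<in>T. q)" using f by (intro sum_mono) auto
    finally show "size (\<phi> f) \<le> card T * q" by simp
  qed
  ultimately have "card ?P \<le> card {\<mu>. set_mset \<mu> \<subseteq> T \<and> size \<mu> \<le> card T * q}"
    using card_inj_on_le finite_multisets_le[OF assms] by blast
  then show ?thesis using assms by (simp add: card_PiE)
qed

text \<open>Apply the box count with q = j div t, where t = \<open>card T\<close>; then j + 1 \<le>
  t (q + 1), which accounts for the factor t^t.\<close>

lemma card_multisets_ge':
  assumes "finite T" "card T \<ge> 1"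
  shows "(j + 1) ^ card T \<le> card T ^ card T * card {\<mu> :: nat multiset. set_mset \<mu> \<subseteq> T \<and> size \<mu> \<le> j}"
proof -
  let ?t = "card T" and ?q = "j div card T"
  have "j + 1 \<le> ?t * (?q + 1)"
  proof -
    have "j mod ?t < ?t" using assms(2) by (intro mod_less_divisor) simp
    moreover have "?t * ?q + j mod ?t = j" by simp
    moreover have "?t * (?q + 1) = ?t * ?q + ?t" by simp
    ultimately show ?thesis by linarith
  qed
  then have "(j + 1) ^ ?t \<le> (?t * (?q + 1)) ^ ?t" by (rule power_mono) simp
  also have "\<dots> = ?t ^ ?t * (?q + 1) ^ ?t" by (rule power_mult_distrib)
  also have "\<dots> \<le> ?t ^ ?t * card {\<mu> :: nat multiset. set_mset \<mu> \<subseteq> T \<and> size \<mu> \<le> ?t * ?q}"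
    by (intro mult_le_mono2 card_multisets_ge assms)
  also have "\<dots> \<le> ?t ^ ?t * card {\<mu> :: nat multiset. set_mset \<mu> \<subseteq> T \<and> size \<mu> \<le> j}"
    using order_trans[OF _ times_div_less_eq_dividend[of ?t j]]
    by (intro mult_le_mono2 card_mono finite_multisets_le assms) blast
  finally show ?thesis .
qed

text \<open>At most 2^m choices for the set of coordinates where the exponent is large; there at
  most j + 1 values occur each, and fewer than K at each remaining coordinate is replaced by the
  bound K.\<close>

lemma card_thin_multisets:
  assumes "K \<ge> 1"
  shows "finite {\<mu>. set_mset \<mu> \<subseteq> {..<m} \<and> size \<mu> \<le> j \<and> card {i \<in> {..<m}. K \<le> count \<mu> i} \<le> n}"
    "card {\<mu>. set_mset \<mu> \<subseteq> {..<m} \<and> size \<mu> \<le> j \<and> card {i \<in> {..<m}. K \<le> count \<mu> i} \<le> n}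
      \<le> (2 ^ m * K ^ m) * (j + 1) ^ n" (is "card ?M \<le> _")
proof -
  show "finite ?M" by (rule finite_subset[OF _ finite_multisets_le[of "{..<m}" j]]) auto
  let ?S = "{S. S \<subseteq> {..<m} \<and> card S \<le> n}"
  let ?B = "\<lambda>S. \<Pi>\<^sub>E i\<in>{..<m}. if i \<in> S then {..j} else {..<K}"
  let ?r = "\<lambda>\<mu>. restrict (count \<mu>) {..<m}"
  have finS: "finite ?S" by (rule finite_subset[of _ "Pow {..<m}"]) auto
  have finB: "finite (?B S)" for S by (intro finite_PiE) auto
  have "inj_on ?r ?M"
  proof (rule inj_onI)
    fix \<mu> \<nu> assume a: "\<mu> \<in> ?M" "\<nu> \<in> ?M" "?r \<mu> = ?r \<nu>"
    show "\<mu> = \<nu>"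
    proof (rule multiset_eqI)
      fix i
      show "count \<mu> i = count \<nu> i"
      proof (cases "i < m")
        case True
        then show ?thesis using fun_cong[OF a(3), of i] by simp
      next
        case False
        then have "i \<notin># \<mu>" "i \<notin># \<nu>" using a by auto
        then show ?thesis by (simp add: not_in_iff)
      qed
    qed
  qed
  moreover have "?r ` ?M \<subseteq> (\<Union>S\<in>?S. ?B S)"
  proof safe
    fix \<mu> assume \<mu>: "set_mset \<mu> \<subseteq> {..<m}" "size \<mu> \<le> j" "card {i \<in> {..<m}. K \<le> count \<mu> i} \<le> n"
    have c: "count \<mu> i \<le> j" for i using \<mu>(2) count_le_size[of \<mu> i] by linarith
    have "?r \<mu> \<in> ?B {i \<in> {..<m}. K \<le> count \<mu> i}" by (rule restrict_PiE_iff[THEN iffD2]) (simp add: c)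
    then show "?r \<mu> \<in> (\<Union>S\<in>?S. ?B S)" using \<mu>(3) by (intro UN_I[of "{i \<in> {..<m}. K \<le> count \<mu> i}"]) auto
  qed
  ultimately have "card ?M \<le> card (\<Union>S\<in>?S. ?B S)"
    using finS finB by (intro card_inj_on_le[of ?r]) auto
  also have "\<dots> \<le> (\<Sum>S\<in>?S. card (?B S))" by (rule card_UN_le[OF finS])
  also have "\<dots> \<le> (\<Sum>S\<in>?S. K ^ m * (j + 1) ^ n)"
  proof (rule sum_mono)
    fix S assume S: "S \<in> ?S"
    have "card (?B S) = (\<Prod>i<m. if i \<in> S then j + 1 else K)"
      by (subst card_PiE) (auto intro!: prod.cong)
    also have "\<dots> \<le> (\<Prod>i<m. K * (if i \<in> S then j + 1 else 1))"
      using mult_le_mono[OF assms le_refl, of "Suc j"] by (intro prod_mono) auto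
    also have "\<dots> = K ^ m * (\<Prod>i<m. if i \<in> S then j + 1 else 1)" by (simp add: prod.distrib)
    also have "(\<Prod>i<m. if i \<in> S then j + 1 else 1) = (j + 1) ^ card ({..<m} \<inter> S)"
      by (simp add: prod.If_cases)
    also have "\<dots> = (j + 1) ^ card S" using S by (simp add: Int_absorb1)
    also have "\<dots> \<le> (j + 1) ^ n" using S by (intro power_increasing) auto
    finally show "card (?B S) \<le> K ^ m * (j + 1) ^ n" by simp
  qed
  also have "\<dots> = card ?S * (K ^ m * (j + 1) ^ n)" by simp
  also have "\<dots> \<le> 2 ^ m * (K ^ m * (j + 1) ^ n)"
  proof (rule mult_le_mono1)
    have "card ?S \<le> card (Pow {..<m})" by (rule card_mono) auto
    then show "card ?S \<le> 2 ^ m" by (simp add: card_Pow)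
  qed
  finally show "card ?M \<le> (2 ^ m * K ^ m) * (j + 1) ^ n" by (simp add: mult.assoc)
qed

section \<open>Ordered monomials, leading terms and standard monomials of left ideals\<close>

context weyl_like
begin

text \<open>Moving the head of w to its place in w' changes the product by a commutator with a
  prefix of w', which has lower degree.\<close>

lemma word_perm:
  assumes "set w \<subseteq> {..<m}" "mset w = mset w'"
  shows "word w \<ominus> word w' \<in> G (length w)"
  using assms
proof (induction w arbitrary: w')
  case Nil
  then show ?case using ksubD(2)[OF G_ksub] by (simp add: a_minus_def ks.r_neg)
next
  case (Cons h u)
  have "h \<in> set w'" using Cons.prems(2) by (metis list.set_intros(1) mset_eq_setD)
  then obtain p q where w': "w' = p @ h # q" by (meson split_list)
  have h: "h < m" and u: "set u \<subseteq> {..<m}" using Cons.prems(1) by auto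
  have mu: "mset u = mset (p @ q)" using Cons.prems(2) w' by simp
  have pq: "set p \<subseteq> {..<m}" "set q \<subseteq> {..<m}" using u mset_eq_setD[OF mu] by auto
  have len: "length u = length p + length q" using mset_eq_length[OF mu] by simp
  have "word u \<ominus> word (p @ q) \<in> G (length u)" using Cons.IH[OF u mu] .
  then have 1: "z h \<otimes> (word u \<ominus> word (p @ q)) \<in> G (length (h # u))"
    using F_mult_G[OF z_F[OF h]] by simp
  have "ad (z h) (word p) \<otimes> word q \<in> G (length u)"
    using G_mult_F[OF ad_z_word[OF h pq(1)] word_G[OF pq(2), of "Suc (length q)"]] len by simp
  then have 2: "ad (z h) (word p) \<otimes> word q \<in> G (length (h # u))" using G_mono[of "length u" "length (h # u)"] by auto
  let ?Y = "z h \<otimes> word (p @ q)"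
  have "z h \<otimes> (word u \<ominus> word (p @ q)) = word (h # u) \<ominus> ?Y"
    using h u pq by (simp add: a_minus_def r_distr r_minus)
  moreover have "?Y \<ominus> word w' = ad (z h) (word p) \<otimes> word q"
    using h pq by (simp add: w' word_append ad_def a_minus_def l_distr l_minus m_assoc)
  moreover have "word (h # u) \<ominus> word w' = (word (h # u) \<ominus> ?Y) \<oplus> (?Y \<ominus> word w')"
    using h u pq by (intro minus_trans) (auto simp: w')
  ultimately show ?case using ksubD(3)[OF G_ksub 1 2] by simp
qed

text \<open>The ordered monomial of an exponent multiset. The arbitrary ordering made by
  \<open>lst\<close> affects lower terms only, by \<open>word_perm\<close>.\<close>

definition wd where "wd \<mu> = word (lst \<mu>)"

lemma wd_in[simp]: "set_mset \<mu> \<subseteq> {..<m} \<Longrightarrow> wd \<mu> \<in> carrier A"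
  by (simp add: wd_def)

lemma wd_G: "set_mset \<mu> \<subseteq> {..<m} \<Longrightarrow> size \<mu> < k \<Longrightarrow> wd \<mu> \<in> G k"
  by (simp add: wd_def word_G)

lemma word_wd: "set w \<subseteq> {..<m} \<Longrightarrow> word w \<ominus> wd (mset w) \<in> G (length w)"
  unfolding wd_def by (rule word_perm) auto

lemma G_wd: "G k \<subseteq> kspan A (wd ` {\<mu>. set_mset \<mu> \<subseteq> {..<m} \<and> size \<mu> < k})"
proof (induction k rule: less_induct)
  case (less k)
  have "word w \<in> kspan A (wd ` {\<mu>. set_mset \<mu> \<subseteq> {..<m} \<and> size \<mu> < k})"
    if w: "set w \<subseteq> {..<m}" "length w < k" for w
  proof -
    have "word w \<ominus> wd (mset w) \<in> kspan A (wd ` {\<mu>. set_mset \<mu> \<subseteq> {..<m} \<and> size \<mu> < length w})"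
      using word_wd[OF w(1)] less[OF w(2)] by blast
    also have "\<dots> \<subseteq> kspan A (wd ` {\<mu>. set_mset \<mu> \<subseteq> {..<m} \<and> size \<mu> < k})"
      using w by (intro kspan_mono) auto
    finally have "wd (mset w) \<oplus> (word w \<ominus> wd (mset w)) \<in> kspan A (wd ` {\<mu>. set_mset \<mu> \<subseteq> {..<m} \<and> size \<mu> < k})"
      using w by (intro kspan_add[OF kspan_base]) auto
    then show ?thesis using minus_add_cancel[of "word w" "wd (mset w)"] w by simp
  qed
  then show ?case unfolding G_def by (intro kspan_trans) auto
qed

text \<open>On leading terms \<open>D i\<close> is the partial derivative; equal letters are
  collected by \<open>word_perm\<close>, so the error drops one further degree. For the empty word
  the truncated \<open>length w - 1\<close> gives \<open>G 0\<close>, matching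
  \<open>D i \<one> = \<zero>\<close>.\<close>

lemma D_word:
  assumes "i < m" "set w \<subseteq> {..<m}"
  shows "\<exists>e\<in>G (length w - 1). D i (word w) = of_nat (count (mset w) i) \<odot> word (remove1 i w) \<oplus> e"
  using assms(2)
proof (induction w)
  case Nil
  then show ?case using assms G_0 by (simp add: D_one)
next
  case (Cons h u)
  let ?c = "of_nat (count (mset u) i) :: 'k"
  have h: "h < m" and u: "set u \<subseteq> {..<m}" using Cons.prems by auto
  have ru: "set (remove1 i u) \<subseteq> {..<m}" using u set_remove1_subset[of i u] by blast
  obtain e where e: "e \<in> G (length u - 1)" "D i (word u) = ?c \<odot> word (remove1 i u) \<oplus> e"
    using Cons.IH[OF u] by blast
  have ec: "e \<in> carrier A" using e G_in by blast
  have ze: "z h \<otimes> e \<in> G (length u)"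
  proof (cases u)
    case Nil
    then have "e = \<zero>" using e G_0 by simp
    then show ?thesis using h ksubD(2)[OF G_ksub] by simp
  next
    case (Cons a list)
    then show ?thesis using F_mult_G[OF z_F[OF h] e(1)] by simp
  qed
  have D1: "D i (word (h # u)) = (if i = h then word u else \<zero>) \<oplus> (?c \<odot> (z h \<otimes> word (remove1 i u)) \<oplus> z h \<otimes> e)"
    using assms h u ru ec by (simp add: D_derivation D_z e(2) r_distr smult_mult_r)
  show ?case
  proof (cases "i = h")
    case False
    then show ?thesis using D1 ze h u ru ec by (intro bexI[of _ "z h \<otimes> e"]) auto
  next
    case True
    show ?thesis
    proof (cases "i \<in> set u")
      case False
      then have "?c = 0" by (simp add: count_eq_zero_iff)
      from D1[unfolded this] have "D i (word (h # u)) = word u \<oplus> z h \<otimes> e" using True h u ru ec by simp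
      moreover have "count (mset (h # u)) i = 1" using True False by (simp add: count_eq_zero_iff)
      from arg_cong[OF this, of "\<lambda>q. of_nat q \<odot> word (remove1 i (h # u))"]
      have "of_nat (count (mset (h # u)) i) \<odot> word (remove1 i (h # u)) = word u" using True u by (simp del: mset.simps)
      ultimately show ?thesis using ze by (intro bexI[of _ "z h \<otimes> e"]) simp_all
    next
      case iu: True
      let ?w = "i # remove1 i u"
      have ms: "mset ?w = mset u" using iu by simp
      have sw: "set ?w \<subseteq> {..<m}" using assms ru by simp
      have e2: "word ?w \<ominus> word u \<in> G (length u)"
        using word_perm[OF sw ms] mset_eq_length[OF ms] by simp
      have wu: "z h \<otimes> word (remove1 i u) = word u \<oplus> (word ?w \<ominus> word u)"
        using minus_add_cancel[of "word ?w" "word u"] sw u True by simp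
      have e2c: "word ?w \<ominus> word u \<in> carrier A" using e2 G_in by blast
      have "D i (word (h # u)) = (1 + ?c) \<odot> word u \<oplus> (?c \<odot> (word ?w \<ominus> word u) \<oplus> z h \<otimes> e)"
        using D1 True u e2c ec h unfolding wu by (simp add: ks.smult_add_l ks.smult_add_r ks.a_assoc)
      moreover have "?c \<odot> (word ?w \<ominus> word u) \<oplus> z h \<otimes> e \<in> G (length u)"
        using ksubD(3)[OF G_ksub ksubD(4)[OF G_ksub e2] ze] .
      ultimately show ?thesis using True by (intro bexI[of _ "?c \<odot> (word ?w \<ominus> word u) \<oplus> z h \<otimes> e"]) auto
    qed
  qed
qed

lemma klin_fold_D: "set is \<subseteq> {..<m} \<Longrightarrow> klin A (carrier A) A (fold D is)"
proof (induction "is")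
  case (Cons i "is")
  then have IH: "klin A (carrier A) A (fold D is)" and i: "i < m" by auto
  show ?case by (rule klinI) (use i in \<open>simp_all add: klinD[OF IH] klinD[OF klin_D[OF i]]\<close>)
qed (auto intro: klinI)

lemma fold_D_G: "set is \<subseteq> {..<m} \<Longrightarrow> a \<in> G (length is) \<Longrightarrow> fold D is a = \<zero>"
  by (induction "is" arbitrary: a) (use G_0 D_G in auto)

text \<open>As many derivations as letters leave a scalar, namely the product of the factorials of
  the exponents if the monomials agree and 0 otherwise. Keeping the factor a natural number makes it
  visibly nonzero in characteristic 0.\<close>

lemma fold_D_word:
  assumes "set is \<subseteq> {..<m}" "set w \<subseteq> {..<m}" "length is = length w"
  shows "\<exists>q::nat. fold D is (word w) = of_nat q \<odot> \<one> \<and> (0 < q \<longleftrightarrow> mset is = mset w)"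
  using assms
proof (induction "is" arbitrary: w)
  case Nil
  then show ?case by (intro exI[of _ 1]) auto
next
  case (Cons i "is")
  have i: "i < m" and iss: "set is \<subseteq> {..<m}" using Cons.prems by auto
  obtain e where e: "e \<in> G (length w - 1)" "D i (word w) = of_nat (count (mset w) i) \<odot> word (remove1 i w) \<oplus> e"
    using D_word[OF i Cons.prems(2)] by blast
  have rw: "set (remove1 i w) \<subseteq> {..<m}" using Cons.prems(2) set_remove1_subset[of i w] by blast
  have ec: "e \<in> carrier A" using e G_in by blast
  have kl: "klin A (carrier A) A (fold D is)" by (rule klin_fold_D[OF iss])
  have "fold D is e = \<zero>" using fold_D_G[OF iss] e(1) Cons.prems(3) by (metis diff_Suc_1 length_Cons)
  then have *: "fold D (i # is) (word w) = of_nat (count (mset w) i) \<odot> fold D is (word (remove1 i w))"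
    using rw ec klinD[OF kl] by (simp add: e(2))
  show ?case
  proof (cases "i \<in> set w")
    case False
    then have "count (mset w) i = 0" by (simp add: count_eq_zero_iff)
    note *[unfolded this]
    moreover have "mset (i # is) \<noteq> mset w" using False by (metis list.set_intros(1) mset_eq_setD)
    ultimately show ?thesis using klinD(1)[OF kl] rw by (intro exI[of _ 0]) auto
  next
    case True
    have "length is = length (remove1 i w)" using True Cons.prems(3) by (simp add: length_remove1)
    from Cons.IH[OF iss rw this] obtain q :: nat where
      q: "fold D is (word (remove1 i w)) = of_nat q \<odot> \<one>" "0 < q \<longleftrightarrow> mset is = mset (remove1 i w)" by blast
    have "mset (i # is) = mset w \<longleftrightarrow> mset is = mset (remove1 i w)"
      using True by (auto simp: )
        (metis add_mset_remove_trivial insert_DiffM set_mset_mset)+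
    moreover have "count (mset w) i > 0" using True by (simp add: count_greater_zero_iff)
    ultimately show ?thesis using * q
      by (intro exI[of _ "count (mset w) i * q"]) (auto simp: ks.smult_assoc[symmetric])
  qed
qed

text \<open>Standard monomials in the sense of Groebner bases.\<close>

definition below where "below K \<mu> = kspan A (K \<union> wd ` {\<nu>. set_mset \<nu> \<subseteq> {..<m} \<and> mlt \<nu> \<mu>})"

definition std where "std K \<mu> \<longleftrightarrow> set_mset \<mu> \<subseteq> {..<m} \<and> wd \<mu> \<notin> below K \<mu>"

lemma below_ksub: "K \<subseteq> carrier A \<Longrightarrow> ksub A (below K \<mu>)"
  unfolding below_def by (rule ks.kspan_sub) auto

text \<open>The independence half of the PBW theorem. Iterated derivations along \<mu> kill all
  smaller monomials, by degree or by \<open>fold_D_word\<close>, but not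
  \<open>wd \<mu>\<close>.\<close>

lemma std_zero:
  assumes "set_mset \<mu> \<subseteq> {..<m}"
  shows "std {\<zero>} \<mu>"
proof (rule ccontr)
  assume "\<not> std {\<zero>} \<mu>"
  then have wb: "wd \<mu> \<in> below {\<zero>} \<mu>" using assms by (simp add: std_def)
  let ?f = "fold D (lst \<mu>)"
  have kl: "klin A (carrier A) A ?f" using assms by (intro klin_fold_D) simp
  have "?f (wd \<mu>) \<in> {\<zero>}"
  proof (rule klin_kspan_in[OF kl ks.kspace_axioms ks.ksub_zero _ _ wb[unfolded below_def] ks.kspace_axioms])
    show "{\<zero>} \<union> wd ` {\<nu>. set_mset \<nu> \<subseteq> {..<m} \<and> mlt \<nu> \<mu>} \<subseteq> carrier A" by auto
    fix s assume "s \<in> {\<zero>} \<union> wd ` {\<nu>. set_mset \<nu> \<subseteq> {..<m} \<and> mlt \<nu> \<mu>}"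
    then consider "s = \<zero>" | \<nu> where "s = wd \<nu>" "set_mset \<nu> \<subseteq> {..<m}" "mlt \<nu> \<mu>" by auto
    then show "?f s \<in> {\<zero>}"
    proof cases
      case 1
      then show ?thesis using ks.klin_zero[OF kl ks.kspace_axioms] by simp
    next
      case 2
      show ?thesis
      proof (cases "size \<nu> < size \<mu>")
        case True
        then show ?thesis using fold_D_G[of "lst \<mu>"] wd_G[OF 2(2)] assms 2(1) by simp
      next
        case False
        then have eq: "size \<nu> = size \<mu>" using 2(3) by (auto simp: mlt_def)
        have ne: "\<nu> \<noteq> \<mu>" using 2(3) by auto
        obtain q :: nat where "?f (word (lst \<nu>)) = of_nat q \<odot> \<one>" "0 < q \<longleftrightarrow> mset (lst \<mu>) = mset (lst \<nu>)"
          using fold_D_word[of "lst \<mu>" "lst \<nu>"] assms 2 eq by auto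
        then show ?thesis using ne 2(1) by (auto simp: wd_def)
      qed
    qed
  qed
  moreover obtain q :: nat where "?f (wd \<mu>) = of_nat q \<odot> \<one>" "0 < q"
    using fold_D_word[of "lst \<mu>" "lst \<mu>"] assms by (auto simp: wd_def)
  ultimately show False using ks.smult_eq_0[of \<one> "of_nat q"] one_neq_zero by simp
qed

text \<open>A monomial that is not standard reduces to K and smaller monomials. The order is well
  founded, so reduction ends, and it is graded, so the degree never rises.\<close>

lemma std_span:
  assumes "K \<subseteq> carrier A"
  shows "G k \<subseteq> kspan A (K \<union> wd ` {\<mu>. std K \<mu> \<and> size \<mu> < k})"
proof -
  have *: "set_mset \<mu> \<subseteq> {..<m} \<Longrightarrow> size \<mu> < k \<Longrightarrow> wd \<mu> \<in> kspan A (K \<union> wd ` {\<mu>. std K \<mu> \<and> size \<mu> < k})" for \<mu>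
  proof (induction \<mu> rule: wfp_induct_rule[OF mlt_wf])
    case (1 \<mu>)
    show ?case
    proof (cases "std K \<mu>")
      case True
      then show ?thesis using 1 by (intro kspan_base) auto
    next
      case False
      then have "wd \<mu> \<in> below K \<mu>" using 1 by (simp add: std_def)
      moreover have "wd \<nu> \<in> kspan A (K \<union> wd ` {\<mu>. std K \<mu> \<and> size \<mu> < k})"
        if "set_mset \<nu> \<subseteq> {..<m}" "mlt \<nu> \<mu>" for \<nu>
        using 1(1)[of \<nu>] that 1(3) by (auto simp: mlt_def)
      ultimately show ?thesis
        unfolding below_def by (elim subsetD[OF kspan_trans, rotated]) (auto intro: kspan_base)
    qed
  qed
  show ?thesis
    using * by (intro order_trans[OF G_wd kspan_trans]) auto
qed

lemma std_indep:
  assumes "ksub A K" "finite S" "S \<subseteq> Collect (std K)"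
  shows "card S \<le> subspace_dim A (kspan A (wd ` S)) \<and> kspan A (wd ` S) \<inter> K = {\<zero>}"
proof (rule ks.chain_dim[OF assms(1,2)])
  fix \<mu> assume "\<mu> \<in> S"
  then have std: "std K \<mu>" using assms by auto
  then show "wd \<mu> \<in> carrier A" by (simp add: std_def)
  have "{\<nu> \<in> S. mlt \<nu> \<mu>} \<subseteq> {\<nu>. set_mset \<nu> \<subseteq> {..<m} \<and> mlt \<nu> \<mu>}"
    using assms(3) unfolding std_def by blast
  then have "kspan A (K \<union> wd ` {\<nu> \<in> S. mlt \<nu> \<mu>}) \<subseteq> below K \<mu>"
    unfolding below_def by (intro kspan_mono) auto
  then show "wd \<mu> \<notin> kspan A (K \<union> wd ` {\<nu> \<in> S. mlt \<nu> \<mu>})" using std by (auto simp: std_def)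
qed

lemma dim_F_ge: "card {\<mu>. set_mset \<mu> \<subseteq> {..<m} \<and> size \<mu> \<le> j} \<le> subspace_dim A (F j)" (is "card ?S \<le> _")
proof -
  have fin: "finite ?S" by (rule finite_multisets_le) simp
  have "card ?S \<le> subspace_dim A (kspan A (wd ` ?S))"
    using std_indep[OF ks.ksub_zero fin] std_zero by auto
  also have "\<dots> \<le> subspace_dim A (F j)"
  proof (rule ks.fd_mono(2)[OF G_fd])
    show "ksub A (kspan A (wd ` ?S))" by (rule ks.kspan_sub) auto
    show "kspan A (wd ` ?S) \<subseteq> F j" by (rule kspan_least[OF _ G_ksub]) (auto intro!: wd_G)
  qed
  finally show ?thesis .
qed

text \<open>Multiplying a reduction of \<open>wd \<mu>\<close> by \<open>z i\<close> from the left
  keeps K inside K and, up to lower terms, turns \<open>wd \<nu>\<close> into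
  \<open>wd (add_mset i \<nu>)\<close>. It would thus reduce the monomial of
  \<open>add_mset i \<mu>\<close> as well.\<close>

lemma std_add:
  assumes "ksub A K" "\<And>a k. a \<in> carrier A \<Longrightarrow> k \<in> K \<Longrightarrow> a \<otimes> k \<in> K" "std K (add_mset i \<mu>)"
  shows "std K \<mu>"
proof (rule ccontr)
  assume ns: "\<not> std K \<mu>"
  have i: "i < m" and \<mu>: "set_mset \<mu> \<subseteq> {..<m}" using assms(3) by (auto simp: std_def)
  have Kc: "K \<subseteq> carrier A" by (rule ksub_subset[OF assms(1)])
  let ?\<mu> = "add_mset i \<mu>"
  have bs: "ksub A (below K ?\<mu>)" by (rule below_ksub[OF Kc])
  have Gb: "G (Suc (size \<mu>)) \<subseteq> below K ?\<mu>"
    unfolding below_def by (rule order_trans[OF G_wd kspan_mono]) (auto simp: mlt_def)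
  have zw: "z i \<otimes> wd \<nu> \<ominus> wd (add_mset i \<nu>) \<in> below K ?\<mu>"
    if "set_mset \<nu> \<subseteq> {..<m}" "size \<nu> \<le> size \<mu>" for \<nu>
    using word_wd[of "i # lst \<nu>"] that i G_mono[of "Suc (size \<nu>)" "Suc (size \<mu>)"] Gb by (auto simp: wd_def)
  have kl: "klin A (carrier A) A (\<lambda>x. z i \<otimes> x)" using klin_mult_l[OF z_in[OF i] subset_refl] .
  have "wd \<mu> \<in> below K \<mu>" using ns \<mu> by (simp add: std_def)
  then have 1: "z i \<otimes> wd \<mu> \<in> below K ?\<mu>"
    unfolding below_def[of K \<mu>]
  proof (rule klin_kspan_in[OF kl ks.kspace_axioms bs, rotated 2])
    show "K \<union> wd ` {\<nu>. set_mset \<nu> \<subseteq> {..<m} \<and> mlt \<nu> \<mu>} \<subseteq> carrier A" using Kc by auto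
    fix s assume "s \<in> K \<union> wd ` {\<nu>. set_mset \<nu> \<subseteq> {..<m} \<and> mlt \<nu> \<mu>}"
    then consider "s \<in> K" | \<nu> where "s = wd \<nu>" "set_mset \<nu> \<subseteq> {..<m}" "mlt \<nu> \<mu>" by auto
    then show "z i \<otimes> s \<in> below K ?\<mu>"
    proof cases
      case 1
      then show ?thesis using assms(2) i by (auto simp: below_def intro: kspan_base)
    next
      case 2
      have "wd (add_mset i \<nu>) \<in> below K ?\<mu>"
        using 2 i mlt_add by (auto simp: below_def intro!: kspan_base)
      from ksubD(3)[OF bs this zw[OF 2(2)]] show ?thesis
        using minus_add_cancel[of "z i \<otimes> wd \<nu>" "wd (add_mset i \<nu>)"] 2 i by (auto simp: mlt_def)
    qed
  qed (rule ks.kspace_axioms)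
  have "wd ?\<mu> = z i \<otimes> wd \<mu> \<ominus> (z i \<otimes> wd \<mu> \<ominus> wd ?\<mu>)"
    using i \<mu> by (simp add: a_minus_def ks.minus_add ks.r_neg1 ks.r_neg2 ks.a_assoc[symmetric] ks.r_neg)
  then have "wd ?\<mu> \<in> below K ?\<mu>" using ks.ksub_minus[OF bs 1 zw[OF \<mu> le_refl]] by simp
  then show False using assms(3) by (simp add: std_def)
qed

lemma std_subset:
  assumes "ksub A K" "\<And>a k. a \<in> carrier A \<Longrightarrow> k \<in> K \<Longrightarrow> a \<otimes> k \<in> K" "std K \<mu>" "\<nu> \<subseteq># \<mu>"
  shows "std K \<nu>"
proof -
  have "std K (\<rho> + \<nu>) \<Longrightarrow> std K \<nu>" for \<rho>
    by (induction \<rho>) (use std_add[OF assms(1,2)] in auto)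
  then show ?thesis using assms(3,4) by (metis subset_mset.diff_add)
qed

text \<open>The standard monomials are closed under divisors, and such a set grows with an integral exponent.\<close>

lemma std_growth_dichotomy:
  assumes "ksub A K" "\<And>a k. a \<in> carrier A \<Longrightarrow> k \<in> K \<Longrightarrow> a \<otimes> k \<in> K"
  shows "(\<exists>T. T \<subseteq> {..<m} \<and> card T = Suc n \<and> (\<forall>\<mu>. set_mset \<mu> \<subseteq> T \<longrightarrow> std K \<mu>)) \<or>
    (\<exists>C. \<forall>j. finite {\<mu>. std K \<mu> \<and> size \<mu> \<le> j} \<and> card {\<mu>. std K \<mu> \<and> size \<mu> \<le> j} \<le> C * (j + 1) ^ n)"
proof (cases "\<exists>T. T \<subseteq> {..<m} \<and> card T = Suc n \<and> (\<forall>\<mu>. set_mset \<mu> \<subseteq> T \<longrightarrow> std K \<mu>)")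
  case False
  let ?T = "{T. T \<subseteq> {..<m} \<and> card T = Suc n}"
  have "\<forall>T\<in>?T. \<exists>\<mu>. set_mset \<mu> \<subseteq> T \<and> \<not> std K \<mu>" using False by blast
  then obtain b where b: "\<And>T. T \<in> ?T \<Longrightarrow> set_mset (b T) \<subseteq> T \<and> \<not> std K (b T)" by metis
  \<comment> \<open>Each set T of n + 1 variables has a monomial b T that is not standard, and N
    bounds all their exponents. A \<mu> with n + 1 exponents at least N is divisible by some b T,
    hence not standard. \<open>Suc\<close> guarantees N \<ge> 1 for the count.\<close>
  define N where "N = Suc (\<Sum>T\<in>?T. size (b T))"
  have finT: "finite ?T" by (rule finite_subset[of _ "Pow {..<m}"]) auto
  have N: "size (b T) \<le> N" if "T \<in> ?T" for T
    using member_le_sum[OF that, of "\<lambda>T. size (b T)"] finT by (simp add: N_def)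
  have thin: "card {i \<in> {..<m}. N \<le> count \<mu> i} \<le> n" if "std K \<mu>" for \<mu>
  proof (rule ccontr)
    assume "\<not> card {i \<in> {..<m}. N \<le> count \<mu> i} \<le> n"
    then obtain T where T: "T \<subseteq> {i \<in> {..<m}. N \<le> count \<mu> i}" "card T = Suc n"
      using obtain_subset_with_card_n[of "Suc n" "{i \<in> {..<m}. N \<le> count \<mu> i}"] by (metis not_less_eq_eq)
    then have TT: "T \<in> ?T" by auto
    have "b T \<subseteq># \<mu>"
    proof (rule mset_subset_eqI)
      fix i
      show "count (b T) i \<le> count \<mu> i"
      proof (cases "i \<in> T")
        case True
        then have "N \<le> count \<mu> i" using T by auto
        moreover have "count (b T) i \<le> size (b T)" by (rule count_le_size)
        ultimately show ?thesis using N[OF TT] by linarith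
      next
        case False
        then have "i \<notin># b T" using b[OF TT] by auto
        then show ?thesis by (simp add: not_in_iff)
      qed
    qed
    then show False using std_subset[OF assms that] b[OF TT] by blast
  qed
  have sub: "{\<mu>. std K \<mu> \<and> size \<mu> \<le> j} \<subseteq>
      {\<mu>. set_mset \<mu> \<subseteq> {..<m} \<and> size \<mu> \<le> j \<and> card {i \<in> {..<m}. N \<le> count \<mu> i} \<le> n}" for j
    using thin by (auto simp: std_def)
  then have "finite {\<mu>. std K \<mu> \<and> size \<mu> \<le> j} \<and> card {\<mu>. std K \<mu> \<and> size \<mu> \<le> j} \<le> (2 ^ m * N ^ m) * (j + 1) ^ n" for j
    using card_thin_multisets[of N m j n] finite_subset[OF sub[of j]] card_mono[OF _ sub[of j]]
    by (auto simp: N_def intro: order_trans)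
  then show ?thesis by blast
qed blast

end

section \<open>Finite groups of automorphisms and their invariants\<close>

lemma klin_finsum:
  assumes "klin V (carrier V) U f" "kspace V" "kspace U" "finite S" "x \<in> S \<rightarrow> carrier V"
  shows "f (finsum V x S) = finsum U (\<lambda>s. f (x s)) S"
proof -
  interpret V: kspace V by fact
  interpret U: kspace U by fact
  show ?thesis using assms(4,5)
  proof (induction S rule: finite_induct)
    case empty
    then show ?case using V.klin_zero[OF assms(1,3)] by simp
  next
    case (insert s S)
    then have "x \<in> S \<rightarrow> carrier V" "x s \<in> carrier V" by auto
    moreover have "(\<lambda>s. f (x s)) \<in> S \<rightarrow> carrier U" using calculation klinD(1)[OF assms(1)] by auto
    ultimately show ?case using insert klinD[OF assms(1)] V.finsum_closed[of x S] by simp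
  qed
qed

text \<open>The identity \<open>e0\<close> is only assumed to be the identity on the carrier, since
  members of \<open>BijGroup\<close> are undefined outside it. Left translations permuting the group
  make traces invariant; faithfulness on the generators supplies, for each g \<noteq> 1, a generator
  that it moves.\<close>

locale galois = weyl_like A m z zs for A :: "('k::field_char_0, 'a) module" (structure) and m z zs +
  fixes Gr :: "('a \<Rightarrow> 'a) set" and e0 :: "'a \<Rightarrow> 'a"
  assumes Gr_fin: "finite Gr"
    and klin_g: "g \<in> Gr \<Longrightarrow> klin A (carrier A) A g"
    and g_mult: "g \<in> Gr \<Longrightarrow> a \<in> carrier A \<Longrightarrow> b \<in> carrier A \<Longrightarrow> g (a \<otimes> b) = g a \<otimes> g b"
    and g_one: "g \<in> Gr \<Longrightarrow> g \<one> = \<one>"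
    and g_U: "g \<in> Gr \<Longrightarrow> u \<in> U \<Longrightarrow> g u \<in> U"
    and e0: "e0 \<in> Gr" "a \<in> carrier A \<Longrightarrow> e0 a = a"
    and g_left: "h \<in> Gr \<Longrightarrow> \<exists>\<phi>. bij_betw \<phi> Gr Gr \<and> (\<forall>g\<in>Gr. \<forall>a\<in>carrier A. \<phi> g a = h (g a))"
    and g_faithful: "g \<in> Gr \<Longrightarrow> (\<And>i. i < m \<Longrightarrow> g (z i) = z i) \<Longrightarrow> g = e0"
begin

lemma g_in[simp]: "g \<in> Gr \<Longrightarrow> a \<in> carrier A \<Longrightarrow> g a \<in> carrier A"
  using klinD(1)[OF klin_g] .

lemma g_inverse: "g \<in> Gr \<Longrightarrow> \<exists>g'\<in>Gr. \<forall>a\<in>carrier A. g (g' a) = a"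
proof -
  assume g: "g \<in> Gr"
  obtain \<phi> where \<phi>: "bij_betw \<phi> Gr Gr" "\<And>h a. h \<in> Gr \<Longrightarrow> a \<in> carrier A \<Longrightarrow> \<phi> h a = g (h a)"
    using g_left[OF g] by blast
  obtain g' where "g' \<in> Gr" "\<phi> g' = e0" using \<phi>(1) e0(1) unfolding bij_betw_def by (metis imageE)
  then show ?thesis using \<phi>(2) e0(2) by metis
qed

lemma g_F: "g \<in> Gr \<Longrightarrow> a \<in> F d \<Longrightarrow> g a \<in> F d"
proof -
  assume g: "g \<in> Gr" and a: "a \<in> F d"
  have w: "g (word w) \<in> F (length w)" if "set w \<subseteq> {..<m}" for w
    using that
  proof (induction w)
    case (Cons h w)
    then have "g (z h) \<otimes> g (word w) \<in> F (1 + length w)"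
      using g_U[OF g z_U] U_F by (intro F_mult) auto
    then show ?case using Cons.prems by (simp add: g_mult[OF g])
  qed (use g_one[OF g] one_F in simp)
  show ?thesis
  proof (rule klin_kspan_in[OF klin_g[OF g] ks.kspace_axioms G_ksub words_carrier _ a[unfolded G_def] ks.kspace_axioms])
    fix s assume "s \<in> {word w | w. set w \<subseteq> {..<m} \<and> length w < Suc d}"
    then obtain w' where "s = word w'" "set w' \<subseteq> {..<m}" "length w' \<le> d" by auto
    then show "g s \<in> F d" using w[of w'] G_mono[of "Suc (length w')" "Suc d"] by auto
  qed
qed

definition tr where "tr a = (\<Oplus>g\<in>Gr. g a)"

lemma tr_in[simp]: "a \<in> carrier A \<Longrightarrow> tr a \<in> carrier A"
  unfolding tr_def by (rule ks.finsum_closed) auto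

lemma klin_tr: "klin A (carrier A) A tr"
proof (rule klinI)
  fix x y and c :: 'k assume x: "x \<in> carrier A"
  show "tr (c \<odot> x) = c \<odot> tr x"
  proof -
    have "klin A (carrier A) A (\<lambda>x. c \<odot> x)"
      by (rule klinI) (simp_all add: ks.smult_add_r ks.smult_assoc[symmetric] mult.commute)
    from klin_finsum[OF this ks.kspace_axioms ks.kspace_axioms Gr_fin, of "\<lambda>g. g x"] x
    have "c \<odot> tr x = (\<Oplus>g\<in>Gr. c \<odot> g x)" by (simp add: tr_def)
    also have "\<dots> = tr (c \<odot> x)" unfolding tr_def
      using x by (intro ks.finsum_cong') (auto simp: klinD[OF klin_g])
    finally show ?thesis by simp
  qed
  assume y: "y \<in> carrier A"
  have "tr (x \<oplus> y) = (\<Oplus>g\<in>Gr. g x \<oplus> g y)" unfolding tr_def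
    using x y by (intro ks.finsum_cong') (auto simp: klinD[OF klin_g])
  also have "\<dots> = tr x \<oplus> tr y" unfolding tr_def using x y by (intro ks.finsum_addf) auto
  finally show "tr (x \<oplus> y) = tr x \<oplus> tr y" .
qed simp

lemma tr_F: "a \<in> F d \<Longrightarrow> tr a \<in> F d"
proof -
  assume a: "a \<in> F d"
  have "finite S \<Longrightarrow> S \<subseteq> Gr \<Longrightarrow> (\<Oplus>g\<in>S. g a) \<in> F d" for S
  proof (induction S rule: finite_induct)
    case (insert g S)
    then have "(\<Oplus>g\<in>insert g S. g a) = g a \<oplus> (\<Oplus>g\<in>S. g a)"
      using G_in[OF a] by (intro ks.finsum_insert) auto
    then show ?case using insert g_F[of g a d] a ksubD(3)[OF G_ksub] by simp
  qed (simp add: ksubD(2)[OF G_ksub])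
  then show ?thesis unfolding tr_def using Gr_fin by blast
qed

definition B where "B = {a \<in> carrier A. \<forall>g\<in>Gr. g a = a}"

lemma B_in[simp]: "b \<in> B \<Longrightarrow> b \<in> carrier A"
  unfolding B_def by blast

lemma B_inv: "b \<in> B \<Longrightarrow> g \<in> Gr \<Longrightarrow> g b = b"
  unfolding B_def by blast

lemma B_I: "a \<in> carrier A \<Longrightarrow> (\<And>g. g \<in> Gr \<Longrightarrow> g a = a) \<Longrightarrow> a \<in> B"
  unfolding B_def by blast

lemma tr_B: "a \<in> carrier A \<Longrightarrow> tr a \<in> B"
proof -
  assume a: "a \<in> carrier A"
  have "h (tr a) = tr a" if h: "h \<in> Gr" for h
  proof -
    obtain \<phi> where \<phi>: "bij_betw \<phi> Gr Gr" "\<And>g a. g \<in> Gr \<Longrightarrow> a \<in> carrier A \<Longrightarrow> \<phi> g a = h (g a)"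
      using g_left[OF h] by blast
    have "h (tr a) = (\<Oplus>g\<in>Gr. h (g a))" unfolding tr_def
      using a by (intro klin_finsum[OF klin_g[OF h] ks.kspace_axioms ks.kspace_axioms Gr_fin]) auto
    also have "\<dots> = (\<Oplus>g\<in>Gr. \<phi> g a)" using a h \<phi>(2) by (intro ks.finsum_cong') auto
    also have "\<dots> = (\<Oplus>g\<in>\<phi> ` Gr. g a)"
      using \<phi>(1) a by (subst ks.finsum_reindex) (auto simp: bij_betw_def)
    also have "\<dots> = tr a" using \<phi>(1) by (simp add: bij_betw_def tr_def)
    finally show ?thesis .
  qed
  then show ?thesis using a by (intro B_I tr_in)
qed

lemma tr_mult_l: "b \<in> B \<Longrightarrow> a \<in> carrier A \<Longrightarrow> tr (b \<otimes> a) = b \<otimes> tr a"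
proof -
  assume ab: "b \<in> B" "a \<in> carrier A"
  have "b \<otimes> tr a = (\<Oplus>g\<in>Gr. b \<otimes> g a)"
    unfolding tr_def using ab
    using klin_finsum[OF klin_mult_l[OF B_in[OF ab(1)] subset_refl] ks.kspace_axioms ks.kspace_axioms Gr_fin, of "\<lambda>g. g a"]
    by (simp add: Pi_def)
  also have "\<dots> = tr (b \<otimes> a)" unfolding tr_def
    using ab by (intro ks.finsum_cong') (auto simp: g_mult B_inv)
  finally show "tr (b \<otimes> a) = b \<otimes> tr a" by simp
qed

lemma tr_mult_r: "b \<in> B \<Longrightarrow> a \<in> carrier A \<Longrightarrow> tr (a \<otimes> b) = tr a \<otimes> b"
proof -
  assume ab: "b \<in> B" "a \<in> carrier A"
  have "tr a \<otimes> b = (\<Oplus>g\<in>Gr. g a \<otimes> b)"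
    unfolding tr_def using ab
    using klin_finsum[OF klin_mult_r[OF B_in[OF ab(1)] subset_refl] ks.kspace_axioms ks.kspace_axioms Gr_fin, of "\<lambda>g. g a"]
    by (simp add: Pi_def)
  also have "\<dots> = tr (a \<otimes> b)" unfolding tr_def
    using ab by (intro ks.finsum_cong') (auto simp: g_mult B_inv)
  finally show "tr (a \<otimes> b) = tr a \<otimes> b" by simp
qed

abbreviation NGr where "NGr \<equiv> of_nat (card Gr) :: 'k"

lemma NGr_nonzero: "NGr \<noteq> 0"
  using Gr_fin e0(1) by auto

lemma tr_inv: "b \<in> B \<Longrightarrow> tr b = NGr \<odot> b"
proof -
  assume b: "b \<in> B"
  have "finite S \<Longrightarrow> S \<subseteq> Gr \<Longrightarrow> (\<Oplus>g\<in>S. g b) = of_nat (card S) \<odot> b" for S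
  proof (induction S rule: finite_induct)
    case (insert g S)
    then have "(\<Oplus>g\<in>insert g S. g b) = g b \<oplus> (\<Oplus>g\<in>S. g b)"
      using b by (intro ks.finsum_insert) auto
    then show ?case using insert b by (simp add: B_inv ks.smult_add_l)
  qed (use b in simp)
  then show ?thesis unfolding tr_def using Gr_fin by blast
qed

lemma B_one: "\<one> \<in> B"
  by (rule B_I) (auto intro: g_one)

lemma B_ksub: "ksub A B"
proof -
  have "g \<zero> = \<zero>" if "g \<in> Gr" for g using ks.klin_zero[OF klin_g[OF that] ks.kspace_axioms] by simp
  then show ?thesis
    by (auto simp: ksub_def klinD[OF klin_g] B_inv intro!: B_I)
qed

lemma B_mult: "a \<in> B \<Longrightarrow> b \<in> B \<Longrightarrow> a \<otimes> b \<in> B"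
  by (rule B_I) (simp_all add: g_mult B_inv)

definition Bf where "Bf d = B \<inter> F d"

lemma Bf_ksub: "ksub A (Bf d)"
  unfolding Bf_def by (rule ks.ksub_Int[OF B_ksub G_ksub])

lemma Bf_fd: "fd_subspace A (Bf d)"
  by (rule ks.fd_mono(1)[OF G_fd Bf_ksub, of _ "Suc d"]) (simp add: Bf_def)

lemma Bf_mono: "d \<le> d' \<Longrightarrow> Bf d \<subseteq> Bf d'"
  using G_mono[of "Suc d" "Suc d'"] by (auto simp: Bf_def)

lemma Bf_mult: "a \<in> Bf i \<Longrightarrow> b \<in> Bf j \<Longrightarrow> a \<otimes> b \<in> Bf (i + j)"
  by (simp add: Bf_def B_mult F_mult)

lemma Bf_one: "\<one> \<in> Bf d"
  by (simp add: Bf_def B_one one_F)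

lemma tr_Bf: "a \<in> F d \<Longrightarrow> tr a \<in> Bf d"
  using G_in by (simp add: Bf_def tr_B tr_F)

subsection \<open>Twisted two-sided ideals\<close>

text \<open>The elements \<open>(\<Sum> u b g(v))\<^sub>g\<close> of the product of copies of \<open>A\<close> indexed by the group form a
  sub-bimodule for the right action twisted by \<open>g\<close> in the component \<open>g\<close>. Twisted commutators with
  elements of \<open>U\<close> kill all components but the one at the identity.\<close>

definition tsum :: "'a \<Rightarrow> ('a \<times> 'a) list \<Rightarrow> ('a \<Rightarrow> 'a) \<Rightarrow> 'a" where
  "tsum b ps g = foldr (\<lambda>(u, v) acc. (u \<otimes> b \<otimes> g v) \<oplus> acc) ps \<zero>"

lemma tsum_simps[simp]:
  "tsum b [] g = \<zero>" "tsum b ((u, v) # ps) g = (u \<otimes> b \<otimes> g v) \<oplus> tsum b ps g"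
  by (simp_all add: tsum_def)

text \<open>One list of pairs must serve all components simultaneously, and p bounds the degree of
  its coefficients; keeping track of p is what later gives linear bounds.\<close>

definition reach :: "'a \<Rightarrow> nat \<Rightarrow> (('a \<Rightarrow> 'a) \<Rightarrow> 'a) \<Rightarrow> bool" where
  "reach b p f \<longleftrightarrow> (\<exists>ps. set ps \<subseteq> F p \<times> F p \<and> (\<forall>g\<in>Gr. f g = tsum b ps g))"

lemma tsum_in[simp]: "b \<in> carrier A \<Longrightarrow> set ps \<subseteq> carrier A \<times> carrier A \<Longrightarrow> g \<in> Gr \<Longrightarrow> tsum b ps g \<in> carrier A"
  by (induction ps) auto

lemma tsum_append: "b \<in> carrier A \<Longrightarrow> set ps \<subseteq> carrier A \<times> carrier A \<Longrightarrow> set qs \<subseteq> carrier A \<times> carrier A \<Longrightarrow> g \<in> Gr \<Longrightarrow>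
    tsum b (ps @ qs) g = tsum b ps g \<oplus> tsum b qs g"
  by (induction ps) (auto simp: ks.a_assoc)

lemma tsum_lmul: "b \<in> carrier A \<Longrightarrow> set ps \<subseteq> carrier A \<times> carrier A \<Longrightarrow> g \<in> Gr \<Longrightarrow> w \<in> carrier A \<Longrightarrow>
    tsum b (map (\<lambda>(u, v). (w \<otimes> u, v)) ps) g = w \<otimes> tsum b ps g"
  by (induction ps) (auto simp: m_assoc r_distr)

lemma tsum_rmul: "b \<in> carrier A \<Longrightarrow> set ps \<subseteq> carrier A \<times> carrier A \<Longrightarrow> g \<in> Gr \<Longrightarrow> w \<in> carrier A \<Longrightarrow>
    tsum b (map (\<lambda>(u, v). (u, v \<otimes> w)) ps) g = tsum b ps g \<otimes> g w"
  by (induction ps) (auto simp: m_assoc l_distr g_mult)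

lemma FF_sub: "F p \<times> F q \<subseteq> carrier A \<times> carrier A"
  using G_in by auto

lemma reach_in: "b \<in> carrier A \<Longrightarrow> reach b p f \<Longrightarrow> g \<in> Gr \<Longrightarrow> f g \<in> carrier A"
  unfolding reach_def using tsum_in FF_sub by (metis subset_trans)

lemma reach_mono: "reach b p f \<Longrightarrow> p \<le> q \<Longrightarrow> reach b q f"
  unfolding reach_def using G_mono[of "Suc p" "Suc q"] by (meson Sigma_mono Suc_le_mono subset_trans)

lemma reach_base: "b \<in> carrier A \<Longrightarrow> reach b 0 (\<lambda>g. b)"
  unfolding reach_def using one_F by (intro exI[of _ "[(\<one>, \<one>)]"]) (auto simp: g_one)

lemma reach_lmul:
  assumes "b \<in> carrier A" "reach b p f" "w \<in> F q"
  shows "reach b (p + q) (\<lambda>g. w \<otimes> f g)"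
proof -
  obtain ps where ps: "set ps \<subseteq> F p \<times> F p" "\<forall>g\<in>Gr. f g = tsum b ps g" using assms(2) by (auto simp: reach_def)
  let ?qs = "map (\<lambda>(u, v). (w \<otimes> u, v)) ps"
  have "w \<otimes> u \<in> F (p + q)" "v \<in> F (p + q)" if "(u, v) \<in> set ps" for u v
  proof -
    have uv: "u \<in> F p" "v \<in> F p" using that ps(1) by auto
    show "w \<otimes> u \<in> F (p + q)" using F_mult[OF assms(3) uv(1)] by (simp add: add.commute)
    show "v \<in> F (p + q)" using uv(2) G_mono[of "Suc p" "Suc (p + q)"] by auto
  qed
  then have "set ?qs \<subseteq> F (p + q) \<times> F (p + q)" by auto
  moreover have "w \<otimes> f g = tsum b ?qs g" if "g \<in> Gr" for g
    using that ps(2) tsum_lmul[OF assms(1) order_trans[OF ps(1) FF_sub] that G_in[OF assms(3)]] by simp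
  ultimately show ?thesis unfolding reach_def by blast
qed

lemma reach_rmul:
  assumes "b \<in> carrier A" "reach b p f" "w \<in> F q"
  shows "reach b (p + q) (\<lambda>g. f g \<otimes> g w)"
proof -
  obtain ps where ps: "set ps \<subseteq> F p \<times> F p" "\<forall>g\<in>Gr. f g = tsum b ps g" using assms(2) by (auto simp: reach_def)
  let ?qs = "map (\<lambda>(u, v). (u, v \<otimes> w)) ps"
  have "u \<in> F (p + q)" "v \<otimes> w \<in> F (p + q)" if "(u, v) \<in> set ps" for u v
  proof -
    have uv: "u \<in> F p" "v \<in> F p" using that ps(1) by auto
    show "v \<otimes> w \<in> F (p + q)" using F_mult[OF uv(2) assms(3)] .
    show "u \<in> F (p + q)" using uv(1) G_mono[of "Suc p" "Suc (p + q)"] by auto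
  qed
  then have "set ?qs \<subseteq> F (p + q) \<times> F (p + q)" by auto
  moreover have "f g \<otimes> g w = tsum b ?qs g" if "g \<in> Gr" for g
    using that ps(2) tsum_rmul[OF assms(1) order_trans[OF ps(1) FF_sub] that G_in[OF assms(3)]] by simp
  ultimately show ?thesis unfolding reach_def by blast
qed

lemma reach_minus:
  assumes "b \<in> carrier A" "reach b p f" "reach b p f'"
  shows "reach b p (\<lambda>g. f g \<ominus> f' g)"
proof -
  obtain ps where ps: "set ps \<subseteq> F p \<times> F p" "\<forall>g\<in>Gr. f g = tsum b ps g" using assms(2) by (auto simp: reach_def)
  have "reach b (p + 0) (\<lambda>g. ((-1) \<odot> \<one>) \<otimes> f' g)" by (rule reach_lmul[OF assms(1,3) scalar_F])
  then obtain qs where qs: "set qs \<subseteq> F p \<times> F p" "\<forall>g\<in>Gr. ((-1) \<odot> \<one>) \<otimes> f' g = tsum b qs g" by (auto simp: reach_def)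
  have "f g \<ominus> f' g = tsum b (ps @ qs) g" if "g \<in> Gr" for g
  proof -
    have "f' g \<in> carrier A" using reach_in[OF assms(1,3) that] .
    then have "((-1) \<odot> \<one>) \<otimes> f' g = \<ominus> f' g" by (simp add: ks.smult_neg1 l_minus)
    then show ?thesis
      using tsum_append[OF assms(1) order_trans[OF ps(1) FF_sub] order_trans[OF qs(1) FF_sub] that] ps(2) qs(2) that
      by (simp add: a_minus_def)
  qed
  then show ?thesis unfolding reach_def using ps(1) qs(1) by (intro exI[of _ "ps @ qs"]) auto
qed

text \<open>At \<open>e0\<close> this is w f - f w', while in a component h with
  \<open>h w' = w\<close> it is the plain commutator with w. The contrast between the two drives the
  elimination.\<close>

definition tcomm where "tcomm w w' f = (\<lambda>g. w \<otimes> f g \<ominus> f g \<otimes> g w')"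

lemma reach_tcomm:
  assumes "b \<in> carrier A" "reach b p f" "w \<in> U" "w' \<in> U"
  shows "reach b (Suc p) (tcomm w w' f)"
  using reach_minus[OF assms(1) reach_lmul[OF assms(1,2) U_F[OF assms(3)]] reach_rmul[OF assms(1,2) U_F[OF assms(4)]]]
  by (simp add: tcomm_def)

lemma tcomm_F: "f g \<in> F d \<Longrightarrow> g \<in> Gr \<Longrightarrow> w \<in> U \<Longrightarrow> w' \<in> U \<Longrightarrow> tcomm w w' f g \<in> F (Suc d)"
  using F_mult[OF U_F[of w], of "f g" d] F_mult[of "f g" d, OF _ U_F[OF g_U[of g w']]]
  by (auto simp: tcomm_def intro: ks.ksub_minus[OF G_ksub])

lemma tcomm_zero: "g \<in> Gr \<Longrightarrow> w \<in> U \<Longrightarrow> w' \<in> U \<Longrightarrow> f g = \<zero> \<Longrightarrow> tcomm w w' f g = \<zero>"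
  by (simp add: tcomm_def a_minus_def ks.r_neg)

lemma tcomm_pow:
  assumes "b \<in> carrier A" "reach b p f" "w \<in> U" "w' \<in> U"
  shows "reach b (p + k) ((tcomm w w' ^^ k) f)"
    "(\<And>g. g \<in> Gr \<Longrightarrow> f g \<in> F d) \<Longrightarrow> g \<in> Gr \<Longrightarrow> (tcomm w w' ^^ k) f g \<in> F (d + k)"
    "g \<in> Gr \<Longrightarrow> f g = \<zero> \<Longrightarrow> (tcomm w w' ^^ k) f g = \<zero>"
proof -
  show "reach b (p + k) ((tcomm w w' ^^ k) f)"
    by (induction k) (use assms reach_tcomm in auto)
  show "(tcomm w w' ^^ k) f g \<in> F (d + k)" if "\<And>g. g \<in> Gr \<Longrightarrow> f g \<in> F d" "g \<in> Gr"
    by (induction k) (use that tcomm_F assms(3,4) in auto)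
  show "(tcomm w w' ^^ k) f g = \<zero>" if "g \<in> Gr" "f g = \<zero>"
    by (induction k) (use that tcomm_zero assms(3,4) in auto)
qed

text \<open>Take a generator \<open>z i\<close> moved by h and commute p + 1 times with w =
  \<open>h (z i)\<close> and w' = \<open>z i\<close>. Component h undergoes \<open>ad w\<close>,
  which is nilpotent on \<open>F p\<close>; component \<open>e0\<close> undergoes an injective
  twisted commutator; zero components stay zero. The degree becomes p + (p + 1).\<close>

lemma tcomm_eliminate:
  assumes "b \<in> carrier A" "reach b p f" "\<And>g. g \<in> Gr \<Longrightarrow> f g \<in> F p" "f e0 \<noteq> \<zero>" "h \<in> Gr" "h \<noteq> e0"
  shows "\<exists>f'. reach b (2 * p + 1) f' \<and> (\<forall>g\<in>Gr. f' g \<in> F (2 * p + 1)) \<and> f' e0 \<noteq> \<zero> \<and> f' h = \<zero> \<and>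
    (\<forall>g\<in>Gr. f g = \<zero> \<longrightarrow> f' g = \<zero>)"
proof -
  obtain i where i: "i < m" "h (z i) \<noteq> z i" using g_faithful[OF assms(5)] assms(6) by blast
  let ?w = "h (z i)"
  have w: "?w \<in> U" "z i \<in> U" using g_U[OF assms(5) z_U[OF i(1)]] z_U[OF i(1)] by auto
  let ?f = "\<lambda>k. (tcomm ?w (z i) ^^ k) f"
  have r: "reach b (p + k) (?f k)" for k by (rule tcomm_pow(1)[OF assms(1,2) w])
  have fc: "?f k g \<in> carrier A" if "g \<in> Gr" for k g using reach_in[OF assms(1) r that] .
  have fh: "?f k h = (ad ?w ^^ k) (f h)" for k
    by (induction k) (use fc[OF assms(5)] in \<open>auto simp: tcomm_def ad_def\<close>)
  have "?f (Suc p) h = \<zero>" using fh[of "Suc p"] ad_U_pow[OF w(1) assms(3)[OF assms(5)]] by (simp only:)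
  moreover have "?f k e0 \<noteq> \<zero>" for k
  proof (induction k)
    case (Suc k)
    have "?f (Suc k) e0 = ?w \<otimes> ?f k e0 \<ominus> ?f k e0 \<otimes> z i" using e0 w by (simp add: tcomm_def)
    then show ?case using twisted_commutator_nonzero[OF w i(2) fc[OF e0(1)] Suc.IH] by simp
  qed (use assms(4) in simp)
  moreover have "?f (Suc p) g \<in> F (2 * p + 1)" if "g \<in> Gr" for g
    using tcomm_pow(2)[OF assms(1,2) w assms(3) that, of "Suc p"] by (simp add: mult_2)
  moreover have "?f (Suc p) g = \<zero>" if "g \<in> Gr" "f g = \<zero>" for g
    by (rule tcomm_pow(3)[OF assms(1,2) w that])
  moreover have "reach b (2 * p + 1) (?f (Suc p))" using r[of "Suc p"] by (simp add: mult_2)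
  ultimately show ?thesis by blast
qed

lemma tcomm_eliminate_all:
  assumes "b \<in> F d" "b \<noteq> \<zero>"
  shows "\<exists>f. reach b (2 ^ card Gr * (d + 1)) f \<and> f e0 \<in> F (2 ^ card Gr * (d + 1)) \<and> f e0 \<noteq> \<zero> \<and>
    (\<forall>g\<in>Gr. g \<noteq> e0 \<longrightarrow> f g = \<zero>)"
proof -
  have b: "b \<in> carrier A" using G_in[OF assms(1)] .
  \<comment> \<open>The induction tracks p + 1 because the step from p to 2 p + 1 doubles exactly
    this quantity.\<close>
  have "finite Z \<Longrightarrow> Z \<subseteq> Gr - {e0} \<Longrightarrow> \<exists>f p. p + 1 \<le> 2 ^ card Z * (d + 1) \<and> reach b p f \<and> (\<forall>g\<in>Gr. f g \<in> F p) \<and>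
      f e0 \<noteq> \<zero> \<and> (\<forall>g\<in>Z. f g = \<zero>)" for Z
  proof (induction Z rule: finite_induct)
    case empty
    show ?case using reach_mono[OF reach_base[OF b], of d] assms by (intro exI[of _ "\<lambda>g. b"] exI[of _ d]) auto
  next
    case (insert h Z)
    then obtain f p where f: "p + 1 \<le> 2 ^ card Z * (d + 1)" "reach b p f" "\<And>g. g \<in> Gr \<Longrightarrow> f g \<in> F p"
      "f e0 \<noteq> \<zero>" "\<forall>g\<in>Z. f g = \<zero>" by auto
    have h: "h \<in> Gr" "h \<noteq> e0" using insert.prems by auto
    obtain f' where f': "reach b (2 * p + 1) f'" "\<forall>g\<in>Gr. f' g \<in> F (2 * p + 1)" "f' e0 \<noteq> \<zero>" "f' h = \<zero>"
      "\<forall>g\<in>Gr. f g = \<zero> \<longrightarrow> f' g = \<zero>" using tcomm_eliminate[OF b f(2-4) h] by blast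
    have "2 * p + 1 + 1 \<le> 2 ^ card (insert h Z) * (d + 1)" using f(1) insert.hyps by simp
    moreover have "\<forall>g\<in>insert h Z. f' g = \<zero>" using f' f(5) insert.prems by auto
    ultimately show ?case using f'(1-3) by blast
  qed
  from this[of "Gr - {e0}"] obtain f p where f: "p + 1 \<le> 2 ^ card (Gr - {e0}) * (d + 1)" "reach b p f"
    "\<forall>g\<in>Gr. f g \<in> F p" "f e0 \<noteq> \<zero>" "\<forall>g\<in>Gr - {e0}. f g = \<zero>" using Gr_fin by auto
  have "(2::nat) ^ card (Gr - {e0}) * (d + 1) \<le> 2 ^ card Gr * (d + 1)"
    using Gr_fin by (intro mult_le_mono1 power_increasing card_mono) auto
  then have p: "p \<le> 2 ^ card Gr * (d + 1)" using f(1) by linarith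
  then have "f e0 \<in> F (2 ^ card Gr * (d + 1))" using f(3) e0(1) G_mono[of "Suc p"] by auto
  then show ?thesis using reach_mono[OF f(2) p] f(4,5) by blast
qed

text \<open>One factor 2^|G| (d + 1) pays for clearing the components off the identity, a second one
  for the derivations that then reduce the component at \<open>e0\<close> to a scalar.\<close>

definition cK where "cK = 2 * 2 ^ card Gr"

text \<open>A quantitative simplicity of the skew group ring: with s the sum of the group elements,
  the sum of u b s v equals 1. After \<open>tcomm_eliminate_all\<close>, commuting with the
  \<open>zs i\<close> differentiates the component at \<open>e0\<close> down to a scalar and leaves
  the others zero.\<close>

lemma galois_identity:
  assumes "b \<in> F d" "b \<noteq> \<zero>"
  shows "\<exists>ps. set ps \<subseteq> F (cK * (d + 1)) \<times> F (cK * (d + 1)) \<and>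
    (\<forall>g\<in>Gr. tsum b ps g = (if g = e0 then \<one> else \<zero>))"
proof -
  let ?P = "2 ^ card Gr * (d + 1)"
  have b: "b \<in> carrier A" using G_in[OF assms(1)] .
  obtain f where f: "reach b ?P f" "f e0 \<in> F ?P" "f e0 \<noteq> \<zero>" "\<forall>g\<in>Gr. g \<noteq> e0 \<longrightarrow> f g = \<zero>"
    using tcomm_eliminate_all[OF assms] by blast
  obtain "is" c where iss: "set is \<subseteq> {..<m}" "length is \<le> ?P" "c \<noteq> 0" "fold D is (f e0) = c \<odot> \<one>"
    using reduce_to_scalar[OF f(2,3)] by blast
  have ex: "\<exists>f'. reach b (p + length is) f' \<and> f' e0 = fold D is (f e0) \<and> (\<forall>g\<in>Gr. g \<noteq> e0 \<longrightarrow> f' g = \<zero>)"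
    if "set is \<subseteq> {..<m}" "reach b p f" "\<forall>g\<in>Gr. g \<noteq> e0 \<longrightarrow> f g = \<zero>" for p f "is"
    using that
  proof (induction "is" arbitrary: p f)
    case (Cons i "is")
    have i: "i < m" "zs i \<in> U" using Cons.prems zs_U by auto
    let ?f = "tcomm (zs i) (zs i) f"
    have "reach b (Suc p) ?f" using reach_tcomm[OF b Cons.prems(2) i(2) i(2)] .
    moreover have "\<forall>g\<in>Gr. g \<noteq> e0 \<longrightarrow> ?f g = \<zero>" using Cons.prems(3) tcomm_zero i by blast
    ultimately obtain f' where "reach b (Suc p + length is) f'" "f' e0 = fold D is (?f e0)" "\<forall>g\<in>Gr. g \<noteq> e0 \<longrightarrow> f' g = \<zero>"
      using Cons.IH[of "Suc p" ?f] Cons.prems(1) by auto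
    moreover have "?f e0 = D i (f e0)" using e0 i by (simp add: tcomm_def D_def ad_def)
    ultimately show ?case by auto
  qed auto
  obtain f' where f': "reach b (?P + length is) f'" "f' e0 = c \<odot> \<one>" "\<forall>g\<in>Gr. g \<noteq> e0 \<longrightarrow> f' g = \<zero>"
    using ex[OF iss(1) f(1,4)] unfolding iss(4) by blast
  have le: "?P + length is \<le> cK * (d + 1)" using iss(2) by (simp add: cK_def algebra_simps)
  have "reach b (cK * (d + 1) + 0) (\<lambda>g. (inverse c \<odot> \<one>) \<otimes> f' g)"
    by (rule reach_lmul[OF b reach_mono[OF f'(1) le] scalar_F])
  then obtain ps where ps: "set ps \<subseteq> F (cK * (d + 1)) \<times> F (cK * (d + 1))"
    "\<forall>g\<in>Gr. (inverse c \<odot> \<one>) \<otimes> f' g = tsum b ps g" by (auto simp: reach_def)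
  have "tsum b ps g = (if g = e0 then \<one> else \<zero>)" if "g \<in> Gr" for g
  proof -
    have "tsum b ps g = (inverse c \<odot> \<one>) \<otimes> f' g" using ps(2) that by simp
    also have "\<dots> = (if g = e0 then \<one> else \<zero>)"
      using f'(2,3) that iss(3) by (auto simp: smult_mult_l ks.smult_assoc[symmetric])
    finally show ?thesis .
  qed
  with ps(1) show ?thesis by blast
qed

lemma tsum_tr:
  assumes "b \<in> carrier A" "set ps \<subseteq> carrier A \<times> carrier A" "a \<in> carrier A"
  shows "foldr (\<lambda>(u, v) acc. (u \<otimes> b \<otimes> tr (v \<otimes> a)) \<oplus> acc) ps \<zero> = (\<Oplus>g\<in>Gr. tsum b ps g \<otimes> g a)"
  using assms(2)
proof (induction ps)
  case Nil
  have "(\<Oplus>g\<in>Gr. tsum b [] g \<otimes> g a) = (\<Oplus>g\<in>Gr. \<zero>)"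
    using assms by (intro ks.finsum_cong') auto
  then show ?case by simp
next
  case (Cons p ps)
  obtain u v where p: "p = (u, v)" by force
  have c: "u \<in> carrier A" "v \<in> carrier A" "set ps \<subseteq> carrier A \<times> carrier A" using Cons.prems p by auto
  have "u \<otimes> b \<otimes> tr (v \<otimes> a) = (\<Oplus>g\<in>Gr. u \<otimes> b \<otimes> g (v \<otimes> a))"
    unfolding tr_def using assms c
      klin_finsum[OF klin_mult_l[OF m_closed[OF c(1) assms(1)] subset_refl] ks.kspace_axioms ks.kspace_axioms Gr_fin,
        of "\<lambda>g. g (v \<otimes> a)"]
    by (simp add: Pi_def)
  then have "u \<otimes> b \<otimes> tr (v \<otimes> a) \<oplus> (\<Oplus>g\<in>Gr. tsum b ps g \<otimes> g a) =
      (\<Oplus>g\<in>Gr. u \<otimes> b \<otimes> g (v \<otimes> a) \<oplus> tsum b ps g \<otimes> g a)"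
    using assms c by (simp only:) (rule ks.finsum_addf[symmetric]; simp add: Pi_def)
  also have "\<dots> = (\<Oplus>g\<in>Gr. tsum b (p # ps) g \<otimes> g a)"
    using assms c p by (intro ks.finsum_cong') (auto simp: l_distr m_assoc g_mult)
  finally show ?case using Cons.IH[OF c(3)] p by simp
qed

lemma finsum_delta: "a \<in> carrier A \<Longrightarrow> (\<Oplus>g\<in>Gr. (if g = e0 then \<one> else \<zero>) \<otimes> g a) = a"
proof -
  assume a: "a \<in> carrier A"
  have "(\<Oplus>g\<in>Gr. (if g = e0 then \<one> else \<zero>) \<otimes> g a) = (\<Oplus>g\<in>Gr. if e0 = g then g a else \<zero>)"
    using a by (intro ks.finsum_cong') auto
  also have "\<dots> = e0 a" by (rule ks.finsum_singleton[OF e0(1) Gr_fin]) (use a in auto)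
  finally show ?thesis using e0(2) a by simp
qed

text \<open>Summing the components of \<open>galois_identity\<close> gives 1 as the sum of u b
  tr(v). Since b tr(v) is invariant, applying \<open>tr\<close> gives |G| as the sum of tr(u) b
  tr(v); then divide by |G|.\<close>

lemma sandwich_one:
  assumes "b \<in> Bf d" "b \<noteq> \<zero>"
  shows "\<one> \<in> kspan A {\<beta> \<otimes> b \<otimes> \<beta>' | \<beta> \<beta>'. \<beta> \<in> Bf (cK * (d + 1)) \<and> \<beta>' \<in> Bf (cK * (d + 1))}" (is "_ \<in> kspan A ?Z")
proof -
  have b: "b \<in> B" "b \<in> F d" "b \<in> carrier A" using assms by (auto simp: Bf_def)
  obtain ps where ps: "set ps \<subseteq> F (cK * (d + 1)) \<times> F (cK * (d + 1))"
    "\<forall>g\<in>Gr. tsum b ps g = (if g = e0 then \<one> else \<zero>)" using galois_identity[OF b(2) assms(2)] by blast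
  define S where "S ps = foldr (\<lambda>(u, v) acc. (u \<otimes> b \<otimes> tr (v \<otimes> \<one>)) \<oplus> acc) ps \<zero>" for ps
  have psc: "set ps \<subseteq> carrier A \<times> carrier A" using ps(1) FF_sub by blast
  have "S ps = (\<Oplus>g\<in>Gr. tsum b ps g \<otimes> g \<one>)" unfolding S_def by (rule tsum_tr[OF b(3) psc one_closed])
  also have "\<dots> = (\<Oplus>g\<in>Gr. (if g = e0 then \<one> else \<zero>) \<otimes> g \<one>)"
    using ps(2) by (intro ks.finsum_cong') auto
  also have "\<dots> = \<one>" by (rule finsum_delta) simp
  finally have S1: "S ps = \<one>" .
  have main: "S ps \<in> carrier A \<and> tr (S ps) \<in> kspan A ?Z" if "set ps \<subseteq> F (cK * (d + 1)) \<times> F (cK * (d + 1))" for ps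
    using that
  proof (induction ps)
    case Nil
    then show ?case using ks.klin_zero[OF klin_tr ks.kspace_axioms] kspan_zero by (simp add: S_def)
  next
    case (Cons p ps)
    obtain u v where p: "p = (u, v)" by force
    have uv: "u \<in> F (cK * (d + 1))" "v \<in> F (cK * (d + 1))" using Cons.prems p by auto
    then have c: "u \<in> carrier A" "v \<in> carrier A" using G_in by auto
    have "S (p # ps) = u \<otimes> b \<otimes> tr v \<oplus> S ps" using p c by (simp add: S_def)
    moreover have "u \<otimes> b \<otimes> tr v = u \<otimes> (b \<otimes> tr v)" using c b by (simp add: m_assoc)
    moreover have "tr (u \<otimes> (b \<otimes> tr v)) = tr u \<otimes> b \<otimes> tr v"
      using c b tr_mult_r[OF B_mult[OF b(1) tr_B[OF c(2)]] c(1)] by (simp add: m_assoc)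
    moreover have "tr u \<otimes> b \<otimes> tr v \<in> kspan A ?Z" using uv tr_Bf by (intro kspan_base) blast
    ultimately show ?case using Cons c b klinD(2)[OF klin_tr] kspan_add[of "tr u \<otimes> b \<otimes> tr v" A ?Z "tr (S ps)"] by auto
  qed
  have "tr \<one> \<in> kspan A ?Z" using main[OF ps(1)] S1 by simp
  then have "NGr \<odot> \<one> \<in> kspan A ?Z" using tr_inv[OF B_one] by simp
  then have "inverse NGr \<odot> (NGr \<odot> \<one>) \<in> kspan A ?Z" by (rule kspan_smult)
  then show ?thesis using NGr_nonzero by (simp add: ks.smult_assoc[symmetric])
qed

section \<open>Dual bases of A over the invariants\<close>

definition lsum where "lsum ps a = foldr (\<lambda>(u, v) acc. (u \<otimes> tr (v \<otimes> a)) \<oplus> acc) ps \<zero>"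
definition rsum where "rsum ps a = foldr (\<lambda>(u, v) acc. (tr (a \<otimes> u) \<otimes> v) \<oplus> acc) ps \<zero>"

text \<open>The case b = 1 of \<open>galois_identity\<close>: a is the sum of u tr(v a) and also of
  tr(a u) v. Hence A is finitely generated over B on both sides, with coefficients of controlled
  degree.\<close>

lemma galois_basis:
  "\<exists>ps p. set ps \<subseteq> F p \<times> F p \<and> (\<forall>a\<in>carrier A. lsum ps a = a) \<and> (\<forall>a\<in>carrier A. rsum ps a = a)"
proof -
  let ?p = "cK * (0 + 1)"
  obtain ps where ps: "set ps \<subseteq> F ?p \<times> F ?p"
    "\<forall>g\<in>Gr. tsum \<one> ps g = (if g = e0 then \<one> else \<zero>)" using galois_identity[OF one_F one_neq_zero] by blast
  have psc: "set ps \<subseteq> carrier A \<times> carrier A" using ps(1) FF_sub by blast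
  have "lsum ps a = a" if a: "a \<in> carrier A" for a
  proof -
    have "lsum qs a = foldr (\<lambda>(u, v) acc. (u \<otimes> \<one> \<otimes> tr (v \<otimes> a)) \<oplus> acc) qs \<zero>"
      if "set qs \<subseteq> carrier A \<times> carrier A" for qs
      using that by (induction qs) (auto simp: lsum_def)
    then have "lsum ps a = (\<Oplus>g\<in>Gr. tsum \<one> ps g \<otimes> g a)" using tsum_tr[OF one_closed psc a] psc by simp
    also have "\<dots> = (\<Oplus>g\<in>Gr. (if g = e0 then \<one> else \<zero>) \<otimes> g a)"
      using ps(2) a by (intro ks.finsum_cong') auto
    also have "\<dots> = a" by (rule finsum_delta[OF a])
    finally show ?thesis .
  qed
  moreover have "rsum ps a = a" if a: "a \<in> carrier A" for a
  proof -
    define T where "T qs g = foldr (\<lambda>(u, v) acc. (g u \<otimes> v) \<oplus> acc) qs \<zero>" for qs and g :: "'a \<Rightarrow> 'a"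
    have Tc: "T qs g \<in> carrier A" if "set qs \<subseteq> carrier A \<times> carrier A" "g \<in> Gr" for qs g
      using that by (induction qs) (auto simp: T_def)
    have "rsum qs a = (\<Oplus>g\<in>Gr. g a \<otimes> T qs g)" if "set qs \<subseteq> carrier A \<times> carrier A" for qs
      using that
    proof (induction qs)
      case Nil
      have "(\<Oplus>g\<in>Gr. g a \<otimes> T [] g) = (\<Oplus>g\<in>Gr. \<zero>)" using a by (intro ks.finsum_cong') (auto simp: T_def)
      then show ?case by (simp add: rsum_def)
    next
      case (Cons q qs)
      obtain u v where q: "q = (u, v)" by force
      have c: "u \<in> carrier A" "v \<in> carrier A" "set qs \<subseteq> carrier A \<times> carrier A" using Cons.prems q by auto
      have "tr (a \<otimes> u) \<otimes> v = (\<Oplus>g\<in>Gr. g (a \<otimes> u) \<otimes> v)"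
        unfolding tr_def using a c
          klin_finsum[OF klin_mult_r[OF c(2) subset_refl] ks.kspace_axioms ks.kspace_axioms Gr_fin, of "\<lambda>g. g (a \<otimes> u)"]
        by (simp add: Pi_def)
      then have "tr (a \<otimes> u) \<otimes> v \<oplus> (\<Oplus>g\<in>Gr. g a \<otimes> T qs g) = (\<Oplus>g\<in>Gr. g (a \<otimes> u) \<otimes> v \<oplus> g a \<otimes> T qs g)"
        using a c Tc by (simp only:) (rule ks.finsum_addf[symmetric]; simp add: Pi_def)
      also have "\<dots> = (\<Oplus>g\<in>Gr. g a \<otimes> T (q # qs) g)"
      proof (rule ks.finsum_cong')
        fix g assume g: "g \<in> Gr"
        have "T (q # qs) g = g u \<otimes> v \<oplus> T qs g" by (simp add: T_def q)
        then show "g (a \<otimes> u) \<otimes> v \<oplus> g a \<otimes> T qs g = g a \<otimes> T (q # qs) g"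
          using a c g Tc[OF c(3) g] by (simp add: r_distr m_assoc g_mult)
      qed (use a Tc[OF Cons.prems] in auto)
      finally show ?case using Cons.IH[OF c(3)] q by (simp add: rsum_def)
    qed
    then have "rsum ps a = (\<Oplus>g\<in>Gr. g a \<otimes> T ps g)" using psc by blast
    also have "\<dots> = (\<Oplus>g\<in>Gr. (if g = e0 then \<one> else \<zero>) \<otimes> g a)"
    proof (rule ks.finsum_cong')
      fix g assume g: "g \<in> Gr"
      \<comment> \<open>Applying g to the identity for its inverse g' turns the sum of u g'(v) into
        the sum of g(u) v, the form that \<open>rsum\<close> needs.\<close>
      obtain g' where g': "g' \<in> Gr" "\<And>a. a \<in> carrier A \<Longrightarrow> g (g' a) = a" using g_inverse[OF g] by blast
      have gT: "g (tsum \<one> qs g') = T qs g" if "set qs \<subseteq> carrier A \<times> carrier A" for qs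
        using that
      proof (induction qs)
        case Nil
        then show ?case using ks.klin_zero[OF klin_g[OF g] ks.kspace_axioms] by (simp add: T_def)
      next
        case (Cons q qs)
        then show ?case using g g' by (cases q) (auto simp: T_def klinD[OF klin_g[OF g]] g_mult)
      qed
      have "T ps g = g (if g' = e0 then \<one> else \<zero>)" using gT[OF psc] ps(2) g'(1) by simp
      moreover have "g' = e0 \<longleftrightarrow> g = e0"
      proof
        assume "g' = e0"
        then have "g (z i) = z i" if "i < m" for i using g'(2)[of "z i"] e0(2)[of "z i"] that by simp
        then show "g = e0" using g_faithful[OF g] by blast
      next
        assume "g = e0"
        then have "g' (z i) = z i" if "i < m" for i using g'(2)[of "z i"] e0(2)[of "g' (z i)"] that g'(1) by simp
        then show "g' = e0" using g_faithful[OF g'(1)] by blast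
      qed
      ultimately have "T ps g = (if g = e0 then \<one> else \<zero>)"
        using g_one[OF g] ks.klin_zero[OF klin_g[OF g] ks.kspace_axioms] by (cases "g = e0") auto
      then show "g a \<otimes> T ps g = (if g = e0 then \<one> else \<zero>) \<otimes> g a" using a g e0 by (cases "g = e0") simp_all
    qed (use a in auto)
    also have "\<dots> = a" by (rule finsum_delta[OF a])
    finally show ?thesis .
  qed
  ultimately show ?thesis using ps(1) by blast
qed

end

section \<open>Growth of modules over the invariant algebra\<close>

text \<open>A shift j + c is at most (c + 1) (j + 1), so constant shifts cost only a factor and the
  larger exponent wins.\<close>

lemma powr_growth_contradiction:
  assumes "\<forall>\<^sub>F j in sequentially. real ((j + 1) ^ d) \<le> K * real (j + c) powr r" "0 \<le> r" "r < real d" "K \<ge> 0"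
  shows False
proof -
  have "\<forall>\<^sub>F j in sequentially. K * real (c + 1) powr r < real (j + 1) powr (real d - r)"
    using assms(3) by real_asymp
  with assms(1) have "\<forall>\<^sub>F j :: nat in sequentially. False"
  proof eventually_elim
    case (elim j)
    have "j + c \<le> (c + 1) * (j + 1)" by simp
    then have "real (j + c) \<le> real (c + 1) * real (j + 1)" by (metis of_nat_le_iff of_nat_mult)
    then have "real (j + c) powr r \<le> (real (c + 1) * real (j + 1)) powr r"
      using assms(2) by (intro powr_mono2) auto
    also have "\<dots> = real (c + 1) powr r * real (j + 1) powr r" by (rule powr_mult)
    finally have "real ((j + 1) ^ d) \<le> K * (real (c + 1) powr r * real (j + 1) powr r)"
      using elim(1) assms(4) by (meson mult_left_mono order_trans)
    also have "\<dots> < real (j + 1) powr (real d - r) * real (j + 1) powr r"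
      using elim(2) by (simp add: mult.assoc[symmetric])
    also have "\<dots> = real (j + 1) powr real d" by (simp flip: powr_add)
    also have "\<dots> = real ((j + 1) ^ d)" by (subst powr_realpow) auto
    finally show ?case by simp
  qed
  then show False by simp
qed

lemma (in kspace) fd_carrier_update:
  assumes "ksub V N" "W \<subseteq> N"
  shows "fd_subspace (V\<lparr>carrier := N\<rparr>) W \<longleftrightarrow> fd_subspace V W"
proof -
  interpret N: kspace "V\<lparr>carrier := N\<rparr>" by (rule kspace_sub[OF assms(1)])
  show ?thesis unfolding N.fd_iff fd_iff using assms by (auto simp: ksub_def)
qed

lemma (in kalg) kalg_sub:
  assumes "ksub R S" "\<one> \<in> S" "\<And>a b. a \<in> S \<Longrightarrow> b \<in> S \<Longrightarrow> a \<otimes> b \<in> S"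
  shows "kalg (R\<lparr>carrier := S\<rparr>)"
proof -
  interpret S: kspace "R\<lparr>carrier := S\<rparr>" by (rule ks.kspace_sub[OF assms(1)])
  have c: "a \<in> S \<Longrightarrow> a \<in> carrier R" for a using ksubD(1)[OF assms(1)] .
  have "ring (R\<lparr>carrier := S\<rparr>)"
  proof (rule ringI)
    show "abelian_group (R\<lparr>carrier := S\<rparr>)" by (rule S.abelian_group_axioms)
    show "monoid (R\<lparr>carrier := S\<rparr>)"
      by (rule monoidI) (auto simp: assms c m_assoc)
  qed (auto simp: c l_distr r_distr)
  then show ?thesis
    by (intro kalg.intro S.vs) (auto simp: c smult_mult_l smult_mult_r)
qed

locale inv_alg = galois A m z zs Gr e0 for A :: "('k::field_char_0, 'a) module" (structure) and m z zs Gr e0 +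
  fixes n :: nat
  assumes m_eq: "m = 2 * n" and n_pos: "n \<ge> 1"
begin

abbreviation BB where "BB \<equiv> A\<lparr>carrier := B\<rparr>"

sublocale BB: kalg BB
  by (rule kalg_sub[OF B_ksub B_one B_mult])

lemma Bf_B: "Bf d \<subseteq> B"
  by (simp add: Bf_def)

lemma Bf_fd_BB: "fd_subspace BB (Bf d)"
  using ks.fd_carrier_update[OF B_ksub Bf_B] Bf_fd by blast

lemma Bf_exhaust: "b \<in> B \<Longrightarrow> \<exists>d. b \<in> Bf d"
  using F_exhaust[of b] by (auto simp: Bf_def)

lemma fd_Bf:
  assumes "fd_subspace BB V"
  shows "\<exists>d. V \<subseteq> Bf d"
proof -
  obtain S where S: "finite S" "S \<subseteq> V" "kspan BB S = V" using assms by (auto simp: BB.ks.fd_iff)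
  have "V \<subseteq> B" using BB.ks.fd_subset[OF assms] by simp
  have "finite S' \<Longrightarrow> S' \<subseteq> B \<Longrightarrow> \<exists>d. S' \<subseteq> Bf d" for S'
  proof (induction S' rule: finite_induct)
    case (insert s S')
    then obtain d d' where "S' \<subseteq> Bf d" "s \<in> Bf d'" using Bf_exhaust[of s] by blast
    then have "insert s S' \<subseteq> Bf (max d d')" using Bf_mono[of d "max d d'"] Bf_mono[of d' "max d d'"] by auto
    then show ?case by blast
  qed simp
  then obtain d where "S \<subseteq> Bf d" using S \<open>V \<subseteq> B\<close> by (meson subset_trans)
  then have "kspan A S \<subseteq> Bf d" by (rule kspan_least[OF _ Bf_ksub])
  then show ?thesis using S by auto
qed

lemma power_Bf: "V \<subseteq> Bf d \<Longrightarrow> space_power BB V k \<subseteq> Bf (d * k)"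
proof (induction k)
  case 0
  have "V \<subseteq> carrier BB" using 0 Bf_B by auto
  then have "space_power BB V 0 = kspan A {\<one>}" using BB.space_power_eq(1) by simp
  also have "\<dots> \<subseteq> Bf (d * 0)" using Bf_one by (intro kspan_least[OF _ Bf_ksub]) simp
  finally show ?case .
next
  case (Suc k)
  have V: "V \<subseteq> carrier BB" using Suc.prems Bf_B by auto
  have "space_power BB V (Suc k) = kspan A {a \<otimes> b | a b. a \<in> V \<and> b \<in> space_power BB V k}"
    using BB.space_power_eq(2)[OF V] by simp
  also have "\<dots> \<subseteq> Bf (d * Suc k)"
  proof (rule kspan_least[OF _ Bf_ksub], safe)
    fix a b assume "a \<in> V" "b \<in> space_power BB V k"
    then show "a \<otimes> b \<in> Bf (d * Suc k)" using Suc Bf_mult[of a d b "d * k"] by auto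
  qed
  finally show ?case .
qed

text \<open>The argument of Artin and Tate: the coefficients expressing the products \<open>z\<^sub>i u\<^sub>s\<close> in the right
  \<open>B\<close>-module generators \<open>u\<^sub>t\<close> of \<open>A\<close> generate \<open>B\<close>, at linear cost in the filtration degree.\<close>

lemma Bf_power: "\<exists>d0. \<forall>j. Bf j \<subseteq> space_power BB (Bf d0) (j + 2)"
proof -
  obtain ps p where ps: "set ps \<subseteq> F p \<times> F p" "\<And>a. a \<in> carrier A \<Longrightarrow> lsum ps a = a"
    using galois_basis by blast
  \<comment> \<open>For u, v in \<open>F p\<close>, the coefficients tr(v (z i u)) have degree at
    most 2 p + 1.\<close>
  define d0 where "d0 = 2 * p + 1"
  define V where "V = Bf d0"
  have V: "V \<subseteq> carrier BB" using Bf_B by (simp add: V_def)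
  have V1: "\<one> \<in> V" by (simp add: V_def Bf_one)
  let ?P = "space_power BB V"
  have Pc: "?P k \<subseteq> B" for k using BB.space_power_subset[OF V, of k] by simp
  have Pm: "a \<otimes> b \<in> ?P (Suc k)" if "a \<in> V" "b \<in> ?P k" for a b k
    using BB.space_power_mult[OF V BB.space_power_base[OF V that(1)] that(2)] by simp
  \<comment> \<open>Elements of A whose coefficients in the right B-module generators u lie in the
    k-th power of V. Each letter multiplied from the left raises k by one.\<close>
  define X where "X k = kspan A {u \<otimes> \<beta> | u v \<beta>. (u, v) \<in> set ps \<and> \<beta> \<in> ?P k}" for k
  have Zc: "{u \<otimes> \<beta> | u v \<beta>. (u, v) \<in> set ps \<and> \<beta> \<in> ?P k} \<subseteq> carrier A" for k
    using ps(1) Pc G_in by (fastforce intro!: m_closed)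
  have Xs: "ksub A (X k)" for k unfolding X_def by (rule ks.kspan_sub[OF Zc])
  have lX: "lsum qs y \<otimes> \<beta> \<in> X (Suc k)"
    if "set qs \<subseteq> set ps" "\<And>u v. (u, v) \<in> set qs \<Longrightarrow> tr (v \<otimes> y) \<in> V" "\<beta> \<in> ?P k" "y \<in> carrier A" for qs y \<beta> k
    using that(1,2)
  proof (induction qs)
    case Nil
    have "\<beta> \<in> carrier A" using that(3) Pc B_in by blast
    then show ?case using ksubD(2)[OF Xs] by (simp add: lsum_def)
  next
    case (Cons q qs)
    obtain u v where q: "q = (u, v)" by force
    have uv: "(u, v) \<in> set ps" "u \<in> carrier A" "v \<in> carrier A" using Cons.prems(1) q ps(1) G_in by auto
    have \<beta>: "\<beta> \<in> carrier A" using that(3) Pc B_in by blast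
    have sc: "lsum qs y \<in> carrier A"
    proof -
      have "set qs \<subseteq> set ps" using Cons.prems(1) by simp
      also note ps(1)
      also note FF_sub
      finally have "set qs \<subseteq> carrier A \<times> carrier A" .
      then show ?thesis by (induction qs) (use that(4) in \<open>auto simp: lsum_def\<close>)
    qed
    have "tr (v \<otimes> y) \<in> V" using Cons.prems(2)[of u v] q by simp
    then have "tr (v \<otimes> y) \<otimes> \<beta> \<in> ?P (Suc k)" using Pm that(3) by blast
    then have 1: "u \<otimes> (tr (v \<otimes> y) \<otimes> \<beta>) \<in> X (Suc k)" unfolding X_def using uv by (intro kspan_base) blast
    have 2: "lsum qs y \<otimes> \<beta> \<in> X (Suc k)" using Cons by auto
    have "lsum (q # qs) y \<otimes> \<beta> = u \<otimes> (tr (v \<otimes> y) \<otimes> \<beta>) \<oplus> lsum qs y \<otimes> \<beta>"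
      using uv \<beta> sc that(4) by (simp add: lsum_def q l_distr m_assoc)
    then show ?case using ksubD(3)[OF Xs 1 2] by simp
  qed
  have word: "word w \<in> X (Suc (length w))" if "set w \<subseteq> {..<m}" for w
    using that
  proof (induction w)
    case Nil
    have "tr (v \<otimes> \<one>) \<in> V" if "(u, v) \<in> set ps" for u v
    proof -
      have "v \<in> F p" using that ps(1) by auto
      then show ?thesis using tr_Bf[of v p] Bf_mono[of p d0] G_in by (auto simp: V_def d0_def)
    qed
    moreover have "\<one> \<in> ?P 0" using BB.space_power_eq(1)[OF V] kspan_base[of \<one> "{\<one>}"] by auto
    ultimately have "lsum ps \<one> \<otimes> \<one> \<in> X (Suc 0)" by (intro lX) auto
    then show ?case using ps(2) by simp
  next
    case (Cons i w)
    let ?k = "Suc (length w)"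
    have i: "i < m" using Cons.prems by simp
    have kl: "klin A (carrier A) A (\<lambda>x. z i \<otimes> x)" by (rule klin_mult_l[OF z_in[OF i] subset_refl])
    have "word w \<in> X ?k" using Cons by simp
    then have "z i \<otimes> word w \<in> X (Suc ?k)"
      unfolding X_def[of ?k]
    proof (rule klin_kspan_in[OF kl ks.kspace_axioms Xs Zc, rotated])
      fix s assume "s \<in> {u \<otimes> \<beta> | u v \<beta>. (u, v) \<in> set ps \<and> \<beta> \<in> ?P ?k}"
      then obtain u v \<beta> where s: "s = u \<otimes> \<beta>" "(u, v) \<in> set ps" "\<beta> \<in> ?P ?k" by blast
      have u: "u \<in> F p" using s(2) ps(1) by auto
      have y: "z i \<otimes> u \<in> F (1 + p)" by (rule F_mult[OF z_F[OF i] u])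
      have "tr (v' \<otimes> (z i \<otimes> u)) \<in> V" if "(u', v') \<in> set ps" for u' v'
      proof -
        have "v' \<in> F p" using that ps(1) by auto
        then have "v' \<otimes> (z i \<otimes> u) \<in> F (p + (1 + p))" using y by (rule F_mult)
        from tr_Bf[OF this] show ?thesis using Bf_mono[of "p + (1 + p)" d0] by (auto simp: V_def d0_def mult_2)
      qed
      then have "lsum ps (z i \<otimes> u) \<otimes> \<beta> \<in> X (Suc ?k)" using s(3) G_in[OF y] by (intro lX) auto
      moreover have "\<beta> \<in> carrier A" using s(3) Pc B_in by blast
      ultimately show "z i \<otimes> s \<in> X (Suc ?k)"
        using ps(2)[OF G_in[OF y]] s(1) i G_in[OF u] by (simp add: m_assoc)
    qed (rule ks.kspace_axioms)
    then show ?case by simp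
  qed
  have Xm: "X i \<subseteq> X j" if "i \<le> j" for i j
    unfolding X_def using BB.space_power_mono[OF V _ that] V1 by (intro kspan_mono) auto
  have "Bf j \<subseteq> ?P (j + 2)" for j
  proof
    fix b assume b: "b \<in> Bf j"
    then have "b \<in> F j" "b \<in> B" by (auto simp: Bf_def)
    have "F j \<subseteq> X (Suc j)" unfolding G_def
    proof (rule kspan_least[OF _ Xs], safe)
      fix w assume "set w \<subseteq> {..<m}" "length w < Suc j"
      then show "word w \<in> X (Suc j)" using word Xm[of "Suc (length w)" "Suc j"] by auto
    qed
    then have bX: "b \<in> X (Suc j)" using \<open>b \<in> F j\<close> by blast
    have PP: "ksub A (?P (j + 2))"
      using BB.space_power_eq(3)[OF V, of "j + 2"] B_ksub by (auto simp: ksub_def)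
    \<comment> \<open>The trace replaces u by tr(u), which lies in V. Of the two extra powers, one
      comes from expanding 1 in the generators and one from this tr(u).\<close>
    have "tr b \<in> ?P (j + 2)"
    proof (rule klin_kspan_in[OF klin_tr ks.kspace_axioms PP Zc _ bX[unfolded X_def] ks.kspace_axioms])
      fix s assume "s \<in> {u \<otimes> \<beta> | u v \<beta>. (u, v) \<in> set ps \<and> \<beta> \<in> ?P (Suc j)}"
      then obtain u v \<beta> where s: "s = u \<otimes> \<beta>" "(u, v) \<in> set ps" "\<beta> \<in> ?P (Suc j)" by blast
      have u: "u \<in> F p" using s(2) ps(1) by auto
      have "tr s = tr u \<otimes> \<beta>" using s Pc G_in[OF u] by (auto intro!: tr_mult_r)
      moreover have "tr u \<in> V" using tr_Bf[OF u] Bf_mono[of p d0] by (auto simp: V_def d0_def)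
      ultimately show "tr s \<in> ?P (j + 2)" using Pm s(3) by simp
    qed
    then have "inverse NGr \<odot> tr b \<in> ?P (j + 2)" by (rule ksubD(4)[OF PP])
    then show "b \<in> ?P (j + 2)"
      using tr_inv[OF \<open>b \<in> B\<close>] NGr_nonzero \<open>b \<in> B\<close> by (simp add: ks.smult_assoc[symmetric])
  qed
  then show ?thesis unfolding V_def by blast
qed

lemma lsum_zero: "set ps \<subseteq> carrier A \<times> carrier A \<Longrightarrow> (\<And>u v. (u, v) \<in> set ps \<Longrightarrow> tr (v \<otimes> a) = \<zero>) \<Longrightarrow> lsum ps a = \<zero>"
proof (induction ps)
  case (Cons q qs)
  then have "lsum qs a = \<zero>" "tr (snd q \<otimes> a) = \<zero>" "fst q \<in> carrier A" by (cases q; auto)+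
  then show ?case by (cases q) (simp add: lsum_def)
qed (simp add: lsum_def)

text \<open>By \<open>lsum\<close>, an element a is determined by the finitely many invariants tr(v
  a), so \<open>F j\<close> embeds into finitely many copies of \<open>Bf (j + p)\<close>. The
  growth of \<open>F j\<close> is that of monomials in m = 2 n variables.\<close>

lemma dim_Bf_ge: "\<exists>K c0. K \<ge> 1 \<and> (\<forall>j. (j + 1) ^ (2 * n) \<le> K * subspace_dim A (Bf (j + c0)))"
proof -
  obtain ps p where ps: "set ps \<subseteq> F p \<times> F p" "\<And>a. a \<in> carrier A \<Longrightarrow> lsum ps a = a"
    using galois_basis by blast
  let ?T = "snd ` set ps"
  have "subspace_dim A (F j) \<le> card ?T * subspace_dim A (Bf (p + j))" for j
  proof (rule ccontr)
    assume "\<not> subspace_dim A (F j) \<le> card ?T * subspace_dim A (Bf (p + j))"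
    then have lt: "card ?T * subspace_dim A (Bf (p + j)) < subspace_dim A (F j)" by simp
    have vF: "v \<in> F p" if "v \<in> ?T" for v using that ps(1) by auto
    have "\<exists>a\<in>F j. a \<noteq> \<zero> \<and> (\<forall>v\<in>?T. tr (v \<otimes> a) = \<zero>)"
    proof (rule common_kernel[OF ks.kspace_axioms ks.kspace_axioms _ G_fd Bf_fd _ _ lt])
      fix v assume v: "v \<in> ?T"
      then have vc: "v \<in> carrier A" using vF G_in by blast
      show "klin A (F j) A (\<lambda>a. tr (v \<otimes> a))"
        using G_in vc klinD[OF klin_tr] by (intro klinI) (auto simp: r_distr smult_mult_r)
      show "tr (v \<otimes> x) \<in> Bf (p + j)" if "x \<in> F j" for x
        using tr_Bf[OF F_mult[OF vF[OF v] that]] .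
    qed simp
    then obtain a where a: "a \<in> F j" "a \<noteq> \<zero>" "\<forall>v\<in>?T. tr (v \<otimes> a) = \<zero>" by blast
    have "lsum ps a = \<zero>"
    proof (rule lsum_zero)
      show "set ps \<subseteq> carrier A \<times> carrier A" by (rule order_trans[OF ps(1) FF_sub])
      show "tr (v \<otimes> a) = \<zero>" if "(u, v) \<in> set ps" for u v using a(3) that by force
    qed
    then show False using ps(2)[OF G_in[OF a(1)]] a(2) by simp
  qed
  then have dF: "subspace_dim A (F j) \<le> card ?T * subspace_dim A (Bf (j + p))" for j by (simp add: add.commute)
  have "(j + 1) ^ (2 * n) \<le> (Suc (m ^ m * card ?T)) * subspace_dim A (Bf (j + p))" for j
  proof -
    have "(j + 1) ^ m \<le> m ^ m * card {\<mu> :: nat multiset. set_mset \<mu> \<subseteq> {..<m} \<and> size \<mu> \<le> j}"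
      using card_multisets_ge'[of "{..<m}" j] m_eq n_pos by simp
    also have "\<dots> \<le> m ^ m * (card ?T * subspace_dim A (Bf (j + p)))"
      using order_trans[OF dim_F_ge dF] by (intro mult_le_mono2) auto
    also have "\<dots> \<le> (Suc (m ^ m * card ?T)) * subspace_dim A (Bf (j + p))" by simp
    finally show ?thesis by (simp add: m_eq)
  qed
  then show ?thesis by (intro exI[of _ "Suc (m ^ m * card ?T)"] exI[of _ p]) simp
qed

definition orbit :: "('a, 'm) module \<Rightarrow> 'm \<Rightarrow> nat \<Rightarrow> 'm set" where
  "orbit M u d = (\<lambda>b. b \<odot>\<^bsub>M\<^esub> u) ` Bf d"

end

locale inv_module = inv_alg A m z zs Gr e0 n + M: kmod "A\<lparr>carrier := galois.B A Gr\<rparr>" M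
  for A :: "('k::field_char_0, 'a) module" (structure) and m z zs Gr e0 n and M :: "('a, 'm) module"
begin

lemma Bf_BBc: "b \<in> Bf d \<Longrightarrow> b \<in> carrier BB"
  using Bf_B by auto

lemma klin_orbit: "u \<in> carrier M \<Longrightarrow> klin A (Bf d) M.bs (\<lambda>b. b \<odot>\<^bsub>M\<^esub> u)"
  using M.klin_act_r[of u "Bf d"] Bf_B by (simp add: klin_def)

lemma orbit_fd: "u \<in> carrier M \<Longrightarrow> fd_subspace M.bs (orbit M u d)"
  unfolding orbit_def by (rule rank_nullity_sub(1)[OF ks.kspace_axioms M.kspace_bs Bf_fd klin_orbit])

lemma orbit_in: "u \<in> carrier M \<Longrightarrow> x \<in> orbit M u d \<Longrightarrow> x \<in> carrier M"
  using M.bs.fd_subset[OF orbit_fd] by auto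

lemma orbit_mono: "d \<le> d' \<Longrightarrow> orbit M u d \<subseteq> orbit M u d'"
  unfolding orbit_def using Bf_mono by (intro image_mono) auto

lemma orbit_dim_mono: "u \<in> carrier M \<Longrightarrow> d \<le> d' \<Longrightarrow> subspace_dim M.bs (orbit M u d) \<le> subspace_dim M.bs (orbit M u d')"
  using M.bs.fd_mono(2)[OF orbit_fd M.bs.fd_ksub[OF orbit_fd] orbit_mono] .

lemma orbit_act: "u \<in> carrier M \<Longrightarrow> b \<in> Bf i \<Longrightarrow> x \<in> orbit M u j \<Longrightarrow> b \<odot>\<^bsub>M\<^esub> x \<in> orbit M u (i + j)"
  using Bf_mult[of b i _ j] Bf_BBc M.lm.smult_assoc[of b _ u]
  by (auto simp: orbit_def intro!: image_eqI[of _ _ "b \<otimes> _"])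

text \<open>By simplicity of \<open>B\<close> with linear bounds, an invariant of degree \<open>i\<close> cannot kill \<open>B\<^sub>p u\<close> for
  \<open>p\<close> linear in \<open>i\<close>. Hence \<open>B\<^sub>i\<close> embeds into the linear maps from \<open>B\<^sub>p u\<close> to \<open>B\<^sub>p\<^sub>+\<^sub>i u\<close>.\<close>

lemma orbit_not_killed:
  assumes "u \<in> carrier M" "u \<noteq> \<zero>\<^bsub>M\<^esub>" "b \<in> Bf i" "b \<noteq> \<zero>"
  shows "\<exists>x\<in>orbit M u (cK * (i + 1)). b \<odot>\<^bsub>M\<^esub> x \<noteq> \<zero>\<^bsub>M\<^esub>"
proof (rule ccontr)
  let ?p = "cK * (i + 1)"
  assume "\<not> ?thesis"
  then have kill: "b \<odot>\<^bsub>M\<^esub> (\<beta> \<odot>\<^bsub>M\<^esub> u) = \<zero>\<^bsub>M\<^esub>" if "\<beta> \<in> Bf ?p" for \<beta>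
    using that by (auto simp: orbit_def)
  let ?Z = "{\<beta> \<otimes> b \<otimes> \<beta>' | \<beta> \<beta>'. \<beta> \<in> Bf ?p \<and> \<beta>' \<in> Bf ?p}"
  have bB: "b \<in> B" using assms(3) Bf_B by blast
  have Zc: "?Z \<subseteq> carrier BB" using bB by (auto intro!: B_mult intro: Bf_B[THEN subsetD])
  have "\<one> \<in> kspan BB ?Z" using sandwich_one[OF assms(3,4)] by simp
  have "\<one>\<^bsub>BB\<^esub> \<odot>\<^bsub>M\<^esub> u \<in> {\<zero>\<^bsub>M.bs\<^esub>}"
  proof (rule klin_kspan_in[OF M.klin_act_r[OF assms(1) subset_refl] BB.ks.kspace_axioms M.bs.ksub_zero Zc])
    show "\<one>\<^bsub>BB\<^esub> \<in> kspan BB ?Z" using sandwich_one[OF assms(3,4)] by simp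
    fix s assume "s \<in> ?Z"
    then obtain \<beta> \<beta>' where s: "s = \<beta> \<otimes> b \<otimes> \<beta>'" "\<beta> \<in> Bf ?p" "\<beta>' \<in> Bf ?p" by blast
    have c: "\<beta> \<in> carrier BB" "\<beta>' \<in> carrier BB" "b \<in> carrier BB" using s Bf_B bB by auto
    have "s \<odot>\<^bsub>M\<^esub> u = (\<beta> \<otimes>\<^bsub>BB\<^esub> b \<otimes>\<^bsub>BB\<^esub> \<beta>') \<odot>\<^bsub>M\<^esub> u" using s by simp
    also have "\<dots> = \<beta> \<odot>\<^bsub>M\<^esub> (b \<odot>\<^bsub>M\<^esub> (\<beta>' \<odot>\<^bsub>M\<^esub> u))"
      using c assms(1) M.lm.smult_assoc BB.m_closed by (metis M.act_closed)
    also have "\<dots> = \<zero>\<^bsub>M\<^esub>" using kill[OF s(3)] c by simp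
    finally show "s \<odot>\<^bsub>M\<^esub> u \<in> {\<zero>\<^bsub>M.bs\<^esub>}" by simp
  qed (rule M.kspace_bs)
  then show False using assms(1,2) M.lm.smult_one[of u] by simp
qed

lemma dim_Bf_le_orbit:
  assumes "u \<in> carrier M" "u \<noteq> \<zero>\<^bsub>M\<^esub>"
  shows "subspace_dim A (Bf i) \<le> (subspace_dim M.bs (orbit M u (cK * (i + 1) + i)))\<^sup>2"
proof -
  let ?p = "cK * (i + 1)" and ?d = "\<lambda>j. subspace_dim M.bs (orbit M u j)"
  obtain S where S: "finite S" "S \<subseteq> orbit M u ?p" "kspan M.bs S = orbit M u ?p" "card S = ?d ?p"
    using M.bs.fd_basis[OF orbit_fd[OF assms(1)]] by metis
  have Sc: "S \<subseteq> carrier M" using S(2) orbit_in[OF assms(1)] by blast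
  have "\<not> card S * ?d (?p + i) < subspace_dim A (Bf i)"
  proof
    assume lt: "card S * ?d (?p + i) < subspace_dim A (Bf i)"
    have "\<exists>b\<in>Bf i. b \<noteq> \<zero> \<and> (\<forall>x\<in>S. b \<odot>\<^bsub>M\<^esub> x = \<zero>\<^bsub>M.bs\<^esub>)"
    proof (rule common_kernel[OF ks.kspace_axioms M.kspace_bs S(1) Bf_fd orbit_fd[OF assms(1)] _ _ lt])
      show "klin A (Bf i) M.bs (\<lambda>b. b \<odot>\<^bsub>M\<^esub> x)" if "x \<in> S" for x using klin_orbit that Sc by blast
      show "b \<odot>\<^bsub>M\<^esub> x \<in> orbit M u (?p + i)" if "x \<in> S" "b \<in> Bf i" for x b
        using orbit_act[OF assms(1) that(2), of x ?p] that(1) S(2) by (auto simp only: add.commute subset_eq)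
    qed
    then obtain b where b: "b \<in> Bf i" "b \<noteq> \<zero>" "\<And>x. x \<in> S \<Longrightarrow> b \<odot>\<^bsub>M\<^esub> x = \<zero>\<^bsub>M\<^esub>" by auto
    have "b \<odot>\<^bsub>M\<^esub> x \<in> {\<zero>\<^bsub>M.bs\<^esub>}" if "x \<in> orbit M u ?p" for x
      by (rule klin_kspan_in[OF _ M.kspace_bs M.bs.ksub_zero, of _ S])
        (use M.klin_act_l[OF Bf_BBc[OF b(1)] subset_refl] Sc b(3) that S(3) M.kspace_bs in auto)
    then show False using orbit_not_killed[OF assms b(1,2)] by auto
  qed
  \<comment> \<open>Maps on \<open>orbit M u ?p\<close> are determined on a basis, so the space of
    maps has the product of the two dimensions; monotonicity turns the product into a
    square.\<close>
  then have "subspace_dim A (Bf i) \<le> ?d ?p * ?d (?p + i)" using S(4) by simp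
  also have "\<dots> \<le> ?d (?p + i) * ?d (?p + i)"
    using orbit_dim_mono[OF assms(1)] by (intro mult_le_mono1) simp
  finally show ?thesis by (simp add: power2_eq_square)
qed

lemma orbit_space_act:
  assumes "u \<in> carrier M" "Bf d \<subseteq> V" "V \<subseteq> carrier BB"
  shows "orbit M u d \<subseteq> space_act BB M V (kspan M.bs {u})"
proof
  fix x assume "x \<in> orbit M u d"
  then obtain b where "b \<in> Bf d" "x = b \<odot>\<^bsub>M\<^esub> u" by (auto simp: orbit_def)
  moreover have "kspan M.bs {u} \<subseteq> carrier M"
    using ksub_subset[OF M.bs.kspan_sub, of "{u}"] assms(1) by simp
  ultimately show "x \<in> space_act BB M V (kspan M.bs {u})"
    using assms by (subst M.space_act_eq(1)) (auto intro!: kspan_base)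
qed

text \<open>Passes from degrees to the powers of one subspace that occur in \<open>GK\<close>; the
  offset 2 is that of \<open>Bf_power\<close>.\<close>

lemma orbit_power:
  assumes "u \<in> carrier M"
  shows "\<exists>V. fd_subspace BB V \<and> \<one>\<^bsub>BB\<^esub> \<in> V \<and> (\<forall>j i. j + 2 \<le> i \<longrightarrow>
    subspace_dim M.bs (orbit M u j) \<le> subspace_dim M.bs (space_act BB M (space_power BB V i) (kspan M.bs {u})))"
proof -
  obtain d0 where d0: "\<And>j. Bf j \<subseteq> space_power BB (Bf d0) (j + 2)" using Bf_power by blast
  let ?V = "Bf d0"
  have V: "fd_subspace BB ?V" "?V \<subseteq> carrier BB" "\<one>\<^bsub>BB\<^esub> \<in> ?V" using Bf_fd_BB Bf_B Bf_one by auto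
  have u: "fd_subspace M.bs (kspan M.bs {u})" using assms by (intro M.bs.fd_kspan) auto
  have "subspace_dim M.bs (orbit M u j) \<le> subspace_dim M.bs (space_act BB M (space_power BB ?V i) (kspan M.bs {u}))"
    if "j + 2 \<le> i" for i j
  proof (rule M.bs.fd_mono(2))
    show "fd_subspace M.bs (space_act BB M (space_power BB ?V i) (kspan M.bs {u}))"
      by (rule M.space_act_fd[OF BB.space_power_fd[OF V(1)] u])
    show "ksub M.bs (orbit M u j)" by (rule M.bs.fd_ksub[OF orbit_fd[OF assms]])
    have "Bf j \<subseteq> space_power BB ?V i" using d0[of j] BB.space_power_mono[OF V(2,3) that] by blast
    then show "orbit M u j \<subseteq> space_act BB M (space_power BB ?V i) (kspan M.bs {u})"
      by (rule orbit_space_act[OF assms _ BB.space_power_subset[OF V(2)]])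
  qed
  then show ?thesis using V by blast
qed

text \<open>The exponent must exceed n strictly, since n is only an infimum, and must stay below
  both n + 1 and 2 n for the contradictions that follow; n + 1/2 does so.\<close>

lemma orbit_upper:
  assumes "u \<in> carrier M" "GK BB M \<le> ereal (real n)"
  shows "\<forall>\<^sub>F j in sequentially. real (subspace_dim M.bs (orbit M u j)) \<le> real (j + 2) powr (real n + 1/2)"
proof -
  obtain V where V: "fd_subspace BB V" "\<one>\<^bsub>BB\<^esub> \<in> V" "\<And>j i. j + 2 \<le> i \<Longrightarrow>
    subspace_dim M.bs (orbit M u j) \<le> subspace_dim M.bs (space_act BB M (space_power BB V i) (kspan M.bs {u}))"
    using orbit_power[OF assms(1)] by blast
  let ?f = "\<lambda>i. subspace_dim M.bs (space_act BB M (space_power BB V i) (kspan M.bs {u}))"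
  have u: "fd_subspace M.bs (kspan M.bs {u})" using assms by (intro M.bs.fd_kspan) auto
  have "growth_exponent (\<lambda>i. enat (?f i)) \<le> ereal (real n)"
    using M.GK_ge[OF V(1,2) u] assms(2) by (rule order_trans)
  then have "growth_exponent (\<lambda>i. enat (?f i)) < ereal (real n + 1/2)"
    by (rule le_less_trans) simp
  from growth_exponent_less[OF this]
  have "\<forall>\<^sub>F i in sequentially. real (?f i) \<le> real i powr (real n + 1/2)" by simp
  then have "\<forall>\<^sub>F j in sequentially. real (?f (j + 2)) \<le> real (j + 2) powr (real n + 1/2)"
    by (rule eventually_compose_filterlim) (rule filterlim_add_const_nat_at_top)
  then show ?thesis
  proof eventually_elim
    case (elim j)
    have "real (subspace_dim M.bs (orbit M u j)) \<le> real (?f (j + 2))" using V(3)[of j "j + 2"] by simp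
    then show ?case using elim by linarith
  qed
qed

text \<open>If no nonzero b killed u, the orbit of u would grow as fast as B, with exponent 2 n > n
  + 1/2.\<close>

lemma torsion_element:
  assumes "u \<in> carrier M" "GK BB M \<le> ereal (real n)"
  shows "\<exists>b\<in>B. b \<noteq> \<zero> \<and> b \<odot>\<^bsub>M\<^esub> u = \<zero>\<^bsub>M\<^esub>"
proof (rule ccontr)
  assume no: "\<not> ?thesis"
  obtain K c0 where K: "K \<ge> 1" "\<And>j. (j + 1) ^ (2 * n) \<le> K * subspace_dim A (Bf (j + c0))" using dim_Bf_ge by blast
  have le: "subspace_dim A (Bf j) \<le> subspace_dim M.bs (orbit M u j)" for j
  proof -
    have "{b \<in> Bf j. b \<odot>\<^bsub>M\<^esub> u = \<zero>\<^bsub>M.bs\<^esub>} = {\<zero>}"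
      using no Bf_B ksubD(2)[OF Bf_ksub] M.zero_act[OF assms(1)] by fastforce
    then show ?thesis
      using rank_nullity_sub(3)[OF ks.kspace_axioms M.kspace_bs Bf_fd klin_orbit[OF assms(1)], of j]
      by (simp add: orbit_def ks.dim_zero)
  qed
  have "\<forall>\<^sub>F j in sequentially. real (subspace_dim M.bs (orbit M u (j + c0))) \<le> real (j + c0 + 2) powr (real n + 1/2)"
    using orbit_upper[OF assms] by (rule eventually_compose_filterlim) (rule filterlim_add_const_nat_at_top)
  then have "\<forall>\<^sub>F j in sequentially. real ((j + 1) ^ (2 * n)) \<le> real K * real (j + (c0 + 2)) powr (real n + 1/2)"
  proof eventually_elim
    case (elim j)
    have "real ((j + 1) ^ (2 * n)) \<le> real (K * subspace_dim A (Bf (j + c0)))" using K(2) of_nat_mono by blast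
    also have "\<dots> \<le> real K * real (subspace_dim M.bs (orbit M u (j + c0)))" using le[of "j + c0"] by (simp add: mult_left_mono)
    also have "\<dots> \<le> real K * real (j + c0 + 2) powr (real n + 1/2)" using elim by (simp add: mult_left_mono)
    finally show ?case by (simp add: add.assoc)
  qed
  then show False by (rule powr_growth_contradiction) (use n_pos in auto)
qed

text \<open>Hilbert polynomials are avoided: the left ideal \<open>K\<close> below has the same growth as \<open>B u\<close>, and the
  number of its standard monomials grows with an integral exponent.\<close>

lemma orbit_hilbert:
  assumes "u \<in> carrier M" "GK BB M \<le> ereal (real n)"
  shows "\<exists>C. \<forall>j. subspace_dim M.bs (orbit M u j) \<le> C * (j + 1) ^ n"
proof -
  let ?\<tau> = "\<lambda>a. tr a \<odot>\<^bsub>M\<^esub> u"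
  have trB: "a \<in> carrier A \<Longrightarrow> tr a \<in> carrier BB" for a using tr_B by simp
  have kt: "klin A (carrier A) M.bs ?\<tau>"
    using klinD[OF M.klin_act_r[OF assms(1) subset_refl]] trB
    by (intro klinI) (simp_all add: klinD[OF klin_tr])
  define K where "K = {a \<in> carrier A. \<forall>x\<in>carrier A. ?\<tau> (x \<otimes> a) = \<zero>\<^bsub>M\<^esub>}"
  have t0: "?\<tau> \<zero> = \<zero>\<^bsub>M\<^esub>" using ks.klin_zero[OF kt M.kspace_bs] by simp
  have K: "ksub A K"
    using klinD[OF kt] t0 M.bs.smult_zero by (auto simp: ksub_def K_def r_distr smult_mult_r)
  have Kl: "a \<otimes> k \<in> K" if "a \<in> carrier A" "k \<in> K" for a k
    using that by (auto simp: K_def m_assoc[symmetric])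
  have tK: "?\<tau> k = \<zero>\<^bsub>M\<^esub>" if "k \<in> K" for k
    using that by (auto simp: K_def dest!: bspec[of _ _ \<one>])
  obtain ps p where ps: "set ps \<subseteq> F p \<times> F p" "\<And>a. a \<in> carrier A \<Longrightarrow> rsum ps a = a"
    using galois_basis by blast
  \<comment> \<open>By \<open>rsum\<close>, x a is a combination of the elements v a with
    coefficients tr(x y) from B, so membership in K is tested by finitely many v. Consequently A / K
    embeds, up to a shift of degree, into finitely many copies of B u.\<close>
  have KI: "a \<in> K" if a: "a \<in> carrier A" "\<And>v. v \<in> snd ` set ps \<Longrightarrow> ?\<tau> (v \<otimes> a) = \<zero>\<^bsub>M\<^esub>" for a
  proof -
    have "?\<tau> (x \<otimes> a) = \<zero>\<^bsub>M\<^esub>" if x: "x \<in> carrier A" for x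
    proof -
      have "rsum qs x \<in> carrier A \<and> ?\<tau> (rsum qs x \<otimes> a) = \<zero>\<^bsub>M\<^esub>" if "set qs \<subseteq> set ps" for qs
        using that
      proof (induction qs)
        case Nil
        then show ?case using a(1) t0 by (simp add: rsum_def)
      next
        case (Cons q qs)
        obtain y v where q: "q = (y, v)" by force
        have c: "y \<in> carrier A" "v \<in> carrier A" using Cons.prems q ps(1) G_in by auto
        have v: "?\<tau> (v \<otimes> a) = \<zero>\<^bsub>M\<^esub>" using a(2)[of v] Cons.prems q by force
        have IH: "rsum qs x \<in> carrier A" "?\<tau> (rsum qs x \<otimes> a) = \<zero>\<^bsub>M\<^esub>" using Cons by auto
        have e: "rsum (q # qs) x = tr (x \<otimes> y) \<otimes> v \<oplus> rsum qs x" by (simp add: rsum_def q)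
        have "rsum (q # qs) x \<otimes> a = tr (x \<otimes> y) \<otimes> (v \<otimes> a) \<oplus> rsum qs x \<otimes> a"
          unfolding e using c x a(1) IH(1) by (simp add: l_distr m_assoc)
        moreover have "tr (tr (x \<otimes> y) \<otimes> (v \<otimes> a)) = tr (x \<otimes> y) \<otimes> tr (v \<otimes> a)"
          using c x a(1) by (intro tr_mult_l tr_B) auto
        moreover have "(tr (x \<otimes> y) \<otimes> tr (v \<otimes> a)) \<odot>\<^bsub>M\<^esub> u = tr (x \<otimes> y) \<odot>\<^bsub>M\<^esub> ?\<tau> (v \<otimes> a)"
          using M.lm.smult_assoc[of "tr (x \<otimes> y)" "tr (v \<otimes> a)" u] trB c x a(1) assms(1) by simp
        ultimately have "?\<tau> (rsum (q # qs) x \<otimes> a) = tr (x \<otimes> y) \<odot>\<^bsub>M\<^esub> \<zero>\<^bsub>M\<^esub> \<oplus>\<^bsub>M\<^esub> \<zero>\<^bsub>M\<^esub>"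
          using klinD(2)[OF kt, of "tr (x \<otimes> y) \<otimes> (v \<otimes> a)" "rsum qs x \<otimes> a"] c x a(1) IH v by simp
        also have "\<dots> = \<zero>\<^bsub>M\<^esub>" using trB[of "x \<otimes> y"] c x by simp
        finally show ?case unfolding e using c x IH(1) by simp
      qed
      from this[of ps] ps(2)[OF x] show ?thesis by simp
    qed
    then show ?thesis using a(1) by (simp add: K_def)
  qed
  have "(\<exists>T. T \<subseteq> {..<m} \<and> card T = Suc n \<and> (\<forall>\<mu>. set_mset \<mu> \<subseteq> T \<longrightarrow> std K \<mu>)) \<or>
    (\<exists>C. \<forall>j. finite {\<mu>. std K \<mu> \<and> size \<mu> \<le> j} \<and> card {\<mu>. std K \<mu> \<and> size \<mu> \<le> j} \<le> C * (j + 1) ^ n)"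
    by (rule std_growth_dichotomy[OF K]) (rule Kl)
  then show ?thesis
  proof (elim disjE exE conjE)
    \<comment> \<open>Few standard monomials: \<tau> kills K, so their images span the
      orbit.\<close>
    fix C assume C: "\<forall>j. finite {\<mu>. std K \<mu> \<and> size \<mu> \<le> j} \<and> card {\<mu>. std K \<mu> \<and> size \<mu> \<le> j} \<le> C * (j + 1) ^ n"
    have "subspace_dim M.bs (orbit M u j) \<le> C * (j + 1) ^ n" for j
    proof -
      let ?S = "{\<mu>. std K \<mu> \<and> size \<mu> \<le> j}"
      let ?Y = "kspan M.bs (?\<tau> ` wd ` ?S)"
      have fS: "finite ?S" using C by blast
      have Sc: "wd ` ?S \<subseteq> carrier A" by (auto simp: std_def)
      have Yc: "?\<tau> ` wd ` ?S \<subseteq> carrier M.bs" using klinD(1)[OF kt] Sc by blast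
      have "orbit M u j \<subseteq> ?Y"
      proof
        fix x assume "x \<in> orbit M u j"
        then obtain b where b: "b \<in> Bf j" "x = b \<odot>\<^bsub>M\<^esub> u" by (auto simp: orbit_def)
        then have bF: "b \<in> F j" "b \<in> B" by (auto simp: Bf_def)
        have bS: "b \<in> kspan A (K \<union> wd ` ?S)"
          using std_span[OF ksub_subset[OF K], of "Suc j"] bF(1) by (auto simp: less_Suc_eq_le)
        have tb: "?\<tau> b \<in> ?Y"
        proof (rule klin_kspan_in[OF kt ks.kspace_axioms M.bs.kspan_sub[OF Yc] _ _ bS M.kspace_bs])
          show "K \<union> wd ` ?S \<subseteq> carrier A" using Sc ksub_subset[OF K] by blast
          fix s assume "s \<in> K \<union> wd ` ?S"
          then show "?\<tau> s \<in> ?Y" using tK kspan_zero[of M.bs] by (auto intro: kspan_base)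
        qed
        have "?\<tau> b = NGr \<odot>\<^bsub>M.bs\<^esub> x"
          using tr_inv[OF bF(2)] klinD(3)[OF M.klin_act_r[OF assms(1) subset_refl], of b NGr] bF(2) b(2) by simp
        then have "inverse NGr \<odot>\<^bsub>M.bs\<^esub> ?\<tau> b = inverse NGr \<odot>\<^bsub>M.bs\<^esub> (NGr \<odot>\<^bsub>M.bs\<^esub> x)" by simp
        also have "\<dots> = (inverse NGr * NGr) \<odot>\<^bsub>M.bs\<^esub> x"
          using b bF(2) assms(1) by (subst M.bs.smult_assoc) auto
        also have "\<dots> = x" using NGr_nonzero b bF(2) assms(1) M.bs.smult_1[of x] by simp
        finally show "x \<in> ?Y" using kspan_smult[OF tb, of "inverse NGr"] by (simp only:)
      qed
      then have "subspace_dim M.bs (orbit M u j) \<le> subspace_dim M.bs ?Y"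
        using fS by (intro M.bs.fd_mono(2)[OF M.bs.fd_kspan(1)[OF _ Yc] M.bs.fd_ksub[OF orbit_fd[OF assms(1)]]]) auto
      also have "\<dots> \<le> card (?\<tau> ` wd ` ?S)" using fS by (intro M.bs.fd_kspan(2)[OF _ Yc]) auto
      also have "\<dots> \<le> card ?S" using card_image_le[OF fS, of "\<lambda>\<mu>. ?\<tau> (wd \<mu>)"] by (simp add: image_image)
      also have "\<dots> \<le> C * (j + 1) ^ n" using C by blast
      finally show ?thesis .
    qed
    then show ?thesis by blast
  next
    \<comment> \<open>With n + 1 free variables A / K would grow like j^(n + 1), more than finitely
      many orbits of growth at most j^(n + 1/2) can accommodate.\<close>
    fix T assume T: "T \<subseteq> {..<m}" "card T = Suc n" "\<forall>\<mu>. set_mset \<mu> \<subseteq> T \<longrightarrow> std K \<mu>"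
    have finT: "finite T" using T(1) finite_subset by blast
    let ?L = "card (snd ` set ps)"
    have card_le: "card {\<mu> :: nat multiset. set_mset \<mu> \<subseteq> T \<and> size \<mu> \<le> j} \<le> ?L * subspace_dim M.bs (orbit M u (j + p))" for j
    proof (rule ccontr)
      let ?S = "{\<mu> :: nat multiset. set_mset \<mu> \<subseteq> T \<and> size \<mu> \<le> j}"
      let ?W = "kspan A (wd ` ?S)"
      assume nle: "\<not> card ?S \<le> ?L * subspace_dim M.bs (orbit M u (j + p))"
      have fS: "finite ?S" by (rule finite_multisets_le[OF finT])
      have ind: "card ?S \<le> subspace_dim A ?W" "?W \<inter> K = {\<zero>}" using std_indep[OF K fS] T(3) by auto
      have Sc: "wd ` ?S \<subseteq> carrier A" using T(1) by auto
      have WF: "?W \<subseteq> F j" using T(1) by (intro kspan_least[OF _ G_ksub]) (auto intro!: wd_G)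
      have lt: "?L * subspace_dim M.bs (orbit M u (j + p)) < subspace_dim A ?W" using nle ind(1) by simp
      have fdW: "fd_subspace A ?W" using fS Sc by (intro ks.fd_kspan) auto
      have vF: "v \<in> F p" if "v \<in> snd ` set ps" for v using that ps(1) by auto
      have "\<exists>a\<in>?W. a \<noteq> \<zero> \<and> (\<forall>v\<in>snd ` set ps. ?\<tau> (v \<otimes> a) = \<zero>\<^bsub>M.bs\<^esub>)"
      proof (rule common_kernel[OF ks.kspace_axioms M.kspace_bs _ fdW orbit_fd[OF assms(1)] _ _ lt])
        fix v assume v: "v \<in> snd ` set ps"
        then have vc: "v \<in> carrier A" using vF G_in by blast
        have "klin A (carrier A) M.bs (\<lambda>a. ?\<tau> (v \<otimes> a))"
          using vc klinD[OF kt] by (intro klinI) (simp_all add: r_distr smult_mult_r)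
        then show "klin A ?W M.bs (\<lambda>a. ?\<tau> (v \<otimes> a))"
          by (rule klin_mono) (rule ks.fd_subset[OF fdW])
        show "?\<tau> (v \<otimes> x) \<in> orbit M u (j + p)" if "x \<in> ?W" for x
          using tr_Bf[OF F_mult[OF vF[OF v], of x j]] that WF by (auto simp: orbit_def add.commute)
      qed simp
      then obtain a where a: "a \<in> ?W" "a \<noteq> \<zero>" "\<And>v. v \<in> snd ` set ps \<Longrightarrow> ?\<tau> (v \<otimes> a) = \<zero>\<^bsub>M\<^esub>" by auto
      have "a \<in> K" using KI[OF _ a(3)] a(1) WF G_in by blast
      then show False using ind(2) a(1,2) by blast
    qed
    have "\<forall>\<^sub>F j in sequentially. real (subspace_dim M.bs (orbit M u (j + p))) \<le> real (j + p + 2) powr (real n + 1/2)"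
      using orbit_upper[OF assms] by (rule eventually_compose_filterlim) (rule filterlim_add_const_nat_at_top)
    then have "\<forall>\<^sub>F j in sequentially. real ((j + 1) ^ Suc n) \<le> real (Suc n ^ Suc n * ?L) * real (j + (p + 2)) powr (real n + 1/2)"
    proof eventually_elim
      case (elim j)
      have "(j + 1) ^ Suc n \<le> Suc n ^ Suc n * card {\<mu> :: nat multiset. set_mset \<mu> \<subseteq> T \<and> size \<mu> \<le> j}"
        using card_multisets_ge'[OF finT, of j] T(2) by simp
      also have "\<dots> \<le> Suc n ^ Suc n * (?L * subspace_dim M.bs (orbit M u (j + p)))" using card_le by (rule mult_le_mono2)
      finally have "real ((j + 1) ^ Suc n) \<le> real (Suc n ^ Suc n * (?L * subspace_dim M.bs (orbit M u (j + p))))"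
        by (rule of_nat_mono)
      also have "\<dots> = real (Suc n ^ Suc n * ?L) * real (subspace_dim M.bs (orbit M u (j + p)))" by simp
      also have "\<dots> \<le> real (Suc n ^ Suc n * ?L) * real (j + p + 2) powr (real n + 1/2)"
        using elim by (intro mult_left_mono) auto
      finally show ?case by (simp add: add.assoc)
    qed
    then have False by (rule powr_growth_contradiction) auto
    then show ?thesis ..
  qed
qed

end

section \<open>Bernstein's inequality with uniform constants\<close>

context inv_alg
begin

lemma inv_moduleI: "kmod BB M \<Longrightarrow> inv_module A m z zs Gr e0 n M"
  by (intro inv_module.intro inv_alg_axioms)

text \<open>The square root of the bound in \<open>dim_Bf_le_orbit\<close>. K and C depend neither
  on M nor on u, so the same bound applies to every subquotient in a chain of submodules.\<close>

lemma bernstein_growth: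
  "\<exists>K C. C \<ge> 1 \<and> (\<forall>(M :: ('a, 'm) module) u j. kmod BB M \<and> u \<in> carrier M \<and> u \<noteq> \<zero>\<^bsub>M\<^esub> \<longrightarrow>
     (j + 1) ^ n \<le> K * subspace_dim (base_space BB M) (orbit M u (C * (j + 1))))"
proof -
  obtain K c0 where K: "K \<ge> 1" "\<And>j. (j + 1) ^ (2 * n) \<le> K * subspace_dim A (Bf (j + c0))" using dim_Bf_ge by blast
  \<comment> \<open>Chosen to dominate cK (i + 1) + i at i = j + c0, the radius at which the orbit
    is large enough to detect all of \<open>Bf i\<close>.\<close>
  let ?C = "(cK + 1) * (c0 + 1)"
  have "(j + 1) ^ n \<le> K * subspace_dim (base_space BB M) (orbit M u (?C * (j + 1)))"
    if M: "kmod BB M" and u: "u \<in> carrier M" "u \<noteq> \<zero>\<^bsub>M\<^esub>" for M :: "('a, 'm) module" and u j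
  proof -
    interpret M: inv_module A m z zs Gr e0 n M by (rule inv_moduleI[OF M])
    let ?d = "\<lambda>j. subspace_dim (base_space BB M) (orbit M u j)"
    let ?i = "j + c0"
    have "cK * (?i + 1) + ?i \<le> (cK + 1) * (j + c0 + 1)" by simp
    also have "\<dots> \<le> (cK + 1) * ((c0 + 1) * (j + 1))" by (intro mult_le_mono2) simp
    finally have le: "cK * (?i + 1) + ?i \<le> ?C * (j + 1)" by (simp only: mult.assoc)
    have "((j + 1) ^ n)\<^sup>2 = (j + 1) ^ (2 * n)" by (simp add: power_mult[symmetric] mult.commute)
    also have "\<dots> \<le> K * (?d (cK * (?i + 1) + ?i))\<^sup>2"
      using K(2)[of j] M.dim_Bf_le_orbit[OF u, of ?i] mult_le_mono2 order_trans by blast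
    also have "\<dots> \<le> K\<^sup>2 * (?d (?C * (j + 1)))\<^sup>2"
      using K(1) M.orbit_dim_mono[OF u(1) le] by (intro mult_le_mono power_mono) (auto simp: power2_eq_square)
    also have "\<dots> = (K * ?d (?C * (j + 1)))\<^sup>2" by (simp add: power_mult_distrib)
    finally show ?thesis by (rule power2_le_imp_le) simp
  qed
  then show ?thesis by (intro exI[of _ K] exI[of _ ?C]) auto
qed

lemma bernstein_inequality:
  fixes M :: "('a, 'm) module"
  assumes "kmod BB M" "u \<in> carrier M" "u \<noteq> \<zero>\<^bsub>M\<^esub>"
  shows "ereal (real n) \<le> GK BB M"
proof -
  interpret M: inv_module A m z zs Gr e0 n M by (rule inv_moduleI[OF assms(1)])
  obtain K C where C: "C \<ge> 1" "\<And>j. (j + 1) ^ n \<le> K * subspace_dim M.M.bs (orbit M u (C * (j + 1)))"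
    using bernstein_growth[where 'm='m] assms by blast
  obtain V where V: "fd_subspace BB V" "\<one>\<^bsub>BB\<^esub> \<in> V" "\<And>j i. j + 2 \<le> i \<Longrightarrow>
    subspace_dim M.M.bs (orbit M u j) \<le> subspace_dim M.M.bs (space_act BB M (space_power BB V i) (kspan M.M.bs {u}))"
    using M.orbit_power[OF assms(2)] by blast
  let ?f = "\<lambda>i. subspace_dim M.M.bs (space_act BB M (space_power BB V i) (kspan M.M.bs {u}))"
  have u: "fd_subspace M.M.bs (kspan M.M.bs {u})" using assms by (intro M.M.bs.fd_kspan) auto
  have "(j + 1) ^ n \<le> K * ?f ((C + 2) * (j + 1))" for j
  proof -
    have "C * (j + 1) + 2 \<le> (C + 2) * (j + 1)" by simp
    from V(3)[OF this] show ?thesis using C(2)[of j] mult_le_mono2 order_trans by blast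
  qed
  then have "ereal (real n) \<le> growth_exponent (\<lambda>i. enat (?f i))"
    by (rule growth_exponent_ge) simp
  also have "\<dots> \<le> GK BB M" by (rule M.M.GK_ge[OF V(1,2) u])
  finally show ?thesis .
qed

end

section \<open>Holonomic modules\<close>

lemma (in kspace) dim_kspan_UN_le:
  assumes "finite S" "\<And>s. s \<in> S \<Longrightarrow> fd_subspace V (W s)"
  shows "fd_subspace V (kspan V (\<Union>s\<in>S. W s))"
    "subspace_dim V (kspan V (\<Union>s\<in>S. W s)) \<le> (\<Sum>s\<in>S. subspace_dim V (W s))"
proof -
  have "\<forall>s\<in>S. \<exists>T. finite T \<and> T \<subseteq> W s \<and> kspan V T = W s \<and> card T = subspace_dim V (W s)"
    using fd_basis[OF assms(2)] by metis
  then obtain T where T: "\<And>s. s \<in> S \<Longrightarrow> finite (T s) \<and> T s \<subseteq> W s \<and> kspan V (T s) = W s \<and> card (T s) = subspace_dim V (W s)"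
    by metis
  let ?T = "\<Union>s\<in>S. T s"
  have eq: "kspan V (\<Union>s\<in>S. W s) = kspan V ?T"
  proof
    show "kspan V ?T \<subseteq> kspan V (\<Union>s\<in>S. W s)" using T by (intro kspan_mono) blast
    have "W s \<subseteq> kspan V ?T" if "s \<in> S" for s
      using T[OF that] kspan_mono[of "T s" ?T V] that by auto
    then show "kspan V (\<Union>s\<in>S. W s) \<subseteq> kspan V ?T" by (intro kspan_trans) blast
  qed
  have fin: "finite ?T" using assms(1) T by blast
  have c: "?T \<subseteq> carrier V" using T fd_subset[OF assms(2)] by blast
  show "fd_subspace V (kspan V (\<Union>s\<in>S. W s))" unfolding eq by (rule fd_kspan(1)[OF fin c])
  have "subspace_dim V (kspan V ?T) \<le> card ?T" by (rule fd_kspan(2)[OF fin c])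
  also have "\<dots> \<le> (\<Sum>s\<in>S. card (T s))" by (rule card_UN_le[OF assms(1)])
  also have "\<dots> = (\<Sum>s\<in>S. subspace_dim V (W s))" using T by (intro sum.cong) auto
  finally show "subspace_dim V (kspan V (\<Union>s\<in>S. W s)) \<le> (\<Sum>s\<in>S. subspace_dim V (W s))" unfolding eq .
qed

definition sub_chain :: "('a, 'b) ring_scheme \<Rightarrow> ('a, 'm) module \<Rightarrow> nat \<Rightarrow> (nat \<Rightarrow> 'm set) \<Rightarrow> bool" where
  "sub_chain R M l X \<longleftrightarrow> (\<forall>i\<le>l. Module.submodule (X i) R M) \<and> (\<forall>i<l. X i \<subset> X (Suc i))"

lemma module_length_sub_chain: "module_length R M = (SUP l \<in> {l. \<exists>X. sub_chain R M l X}. enat l)"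
  by (simp add: module_length_def sub_chain_def)

context inv_module
begin

definition gen_space where "gen_space S j = kspan M.bs (\<Union>s\<in>S. orbit M s j)"

lemma gen_space_fd: "finite S \<Longrightarrow> S \<subseteq> carrier M \<Longrightarrow> fd_subspace M.bs (gen_space S j)"
  unfolding gen_space_def using orbit_fd by (intro M.bs.dim_kspan_UN_le(1)) auto

lemma gen_space_mono: "i \<le> j \<Longrightarrow> gen_space S i \<subseteq> gen_space S j"
  unfolding gen_space_def using orbit_mono by (intro kspan_mono) blast

lemma gen_space_act:
  assumes "finite S" "S \<subseteq> carrier M" "b \<in> Bf i" "x \<in> gen_space S j"
  shows "b \<odot>\<^bsub>M\<^esub> x \<in> gen_space S (i + j)"
proof (rule klin_kspan_in[OF _ M.kspace_bs _ _ _ assms(4)[unfolded gen_space_def] M.kspace_bs])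
  show "klin M.bs (carrier M.bs) M.bs (\<lambda>x. b \<odot>\<^bsub>M\<^esub> x)" using M.klin_act_l[OF Bf_BBc[OF assms(3)] subset_refl] by simp
  show "ksub M.bs (gen_space S (i + j))" by (rule M.bs.fd_ksub[OF gen_space_fd[OF assms(1,2)]])
  show "(\<Union>s\<in>S. orbit M s j) \<subseteq> carrier M.bs" using orbit_in assms(2) by auto
  fix y assume "y \<in> (\<Union>s\<in>S. orbit M s j)"
  then obtain s where s: "s \<in> S" "y \<in> orbit M s j" by blast
  then have "b \<odot>\<^bsub>M\<^esub> y \<in> orbit M s (i + j)" using orbit_act[OF _ assms(3)] assms(2) by blast
  then show "b \<odot>\<^bsub>M\<^esub> y \<in> gen_space S (i + j)" unfolding gen_space_def using s(1) by (intro kspan_base) blast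
qed

lemma gen_space_exhaust:
  assumes "finite S" "S \<subseteq> carrier M" "submodule_gen BB M S = carrier M" "x \<in> carrier M"
  shows "\<exists>j. x \<in> gen_space S j"
proof -
  have sub: "ksub M.bs (gen_space S j)" for j by (rule M.bs.fd_ksub[OF gen_space_fd[OF assms(1,2)]])
  have "x \<in> kspan M.bs {a \<odot>\<^bsub>M\<^esub> m | a m. a \<in> carrier BB \<and> m \<in> S}"
    using assms M.submodule_gen_eq(1)[OF assms(2)] by simp
  then show ?thesis
  proof (induction rule: kspan.induct)
    case kspan_zero
    then show ?case using ksubD(2)[OF sub] by blast
  next
    case (kspan_base x)
    then obtain b s where b: "x = b \<odot>\<^bsub>M\<^esub> s" "b \<in> B" "s \<in> S" by auto
    obtain d where "b \<in> Bf d" using Bf_exhaust[OF b(2)] by blast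
    then have "x \<in> gen_space S d" unfolding gen_space_def using b
      by (intro kspan.kspan_base) (auto simp: orbit_def)
    then show ?case by blast
  next
    case (kspan_add x y)
    then obtain i j where "x \<in> gen_space S i" "y \<in> gen_space S j" by blast
    then have "x \<in> gen_space S (max i j)" "y \<in> gen_space S (max i j)"
      using gen_space_mono[of i "max i j"] gen_space_mono[of j "max i j"] by auto
    then show ?case using ksubD(3)[OF sub] by blast
  next
    case (kspan_smult x c)
    then show ?case using ksubD(4)[OF sub] by blast
  qed
qed

text \<open>Inside one filtration piece Y of M, of dimension O(j^n), every proper step of a chain
  occupies at least a fixed fraction of j^n: the orbit of a nonzero element of the quotient by the
  smaller member.\<close>

lemma chain_bound:
  assumes "fg_module BB M" "GK BB M \<le> ereal (real n)"
  shows "\<exists>L. \<forall>l X. sub_chain BB M l X \<longrightarrow> l \<le> L"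
proof -
  obtain S where S: "finite S" "S \<subseteq> carrier M" "submodule_gen BB M S = carrier M"
    using assms(1) by (auto simp: fg_module_def)
  obtain K C where C: "C \<ge> 1" "\<And>(M :: ('a, 'm) module) u j. kmod BB M \<Longrightarrow> u \<in> carrier M \<Longrightarrow> u \<noteq> \<zero>\<^bsub>M\<^esub> \<Longrightarrow>
     (j + 1) ^ n \<le> K * subspace_dim (base_space BB M) (orbit M u (C * (j + 1)))"
    using bernstein_growth[where 'm='m] by blast
  have "\<forall>s\<in>S. \<exists>C. \<forall>j. subspace_dim M.bs (orbit M s j) \<le> C * (j + 1) ^ n"
    using orbit_hilbert[OF _ assms(2)] S(2) by blast
  then obtain Cs where Cs: "\<And>s j. s \<in> S \<Longrightarrow> subspace_dim M.bs (orbit M s j) \<le> Cs s * (j + 1) ^ n" by metis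
  let ?Cs = "\<Sum>s\<in>S. Cs s"
  have dimY: "subspace_dim M.bs (gen_space S j) \<le> ?Cs * (j + 1) ^ n" for j
  proof -
    have "subspace_dim M.bs (gen_space S j) \<le> (\<Sum>s\<in>S. subspace_dim M.bs (orbit M s j))"
      unfolding gen_space_def using orbit_fd S by (intro M.bs.dim_kspan_UN_le(2)) auto
    also have "\<dots> \<le> (\<Sum>s\<in>S. Cs s * (j + 1) ^ n)" using Cs by (rule sum_mono)
    finally show ?thesis by (simp add: sum_distrib_right)
  qed
  have "l \<le> K * ?Cs * (C + 1) ^ n" if ch: "sub_chain BB M l X" for l X
  proof -
    have X: "\<And>i. i \<le> l \<Longrightarrow> Module.submodule (X i) BB M" "\<And>i. i < l \<Longrightarrow> X i \<subset> X (Suc i)"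
      using ch by (auto simp: sub_chain_def)
    have "\<forall>i<l. \<exists>u. u \<in> X (Suc i) \<and> u \<notin> X i" using X(2) by blast
    then obtain u where u: "\<And>i. i < l \<Longrightarrow> u i \<in> X (Suc i) \<and> u i \<notin> X i" by metis
    have uc: "u i \<in> carrier M" if "i < l" for i using u[OF that] M.smodD(1)[OF X(1)[of "Suc i"]] that by auto
    have "\<forall>i<l. \<exists>j. u i \<in> gen_space S j" using gen_space_exhaust[OF S] uc by blast
    then obtain ji where ji: "\<And>i. i < l \<Longrightarrow> u i \<in> gen_space S (ji i)" by metis
    \<comment> \<open>A common degree for all witnesses u i. It depends on the chain, which is why
      the bounds must hold with one constant for all degrees.\<close>
    define j0 where "j0 = (\<Sum>i<l. ji i)"
    have j0: "u i \<in> gen_space S j0" if "i < l" for i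
    proof -
      have "ji i \<le> j0" unfolding j0_def using that by (intro member_le_sum) auto
      then show ?thesis using gen_space_mono ji[OF that] by blast
    qed
    \<comment> \<open>The radius at which \<open>bernstein_growth\<close> guarantees (j0 + 1)^n
      dimensions; acting on elements of degree j0 ends in degree \<open>?j + j0\<close>.\<close>
    let ?j = "C * (j0 + 1)"
    let ?Y = "gen_space S (?j + j0)"
    have Yfd: "fd_subspace M.bs ?Y" by (rule gen_space_fd[OF S(1,2)])
    have Ysub: "ksub M.bs (?Y \<inter> X i)" if "i \<le> l" for i
      by (rule M.bs.ksub_Int[OF M.bs.fd_ksub[OF Yfd] M.smodD(5)[OF X(1)[OF that]]])
    have Wfd: "fd_subspace M.bs (?Y \<inter> X i)" if "i \<le> l" for i
      by (rule M.bs.fd_mono(1)[OF Yfd Ysub[OF that]]) auto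
    have "i * (j0 + 1) ^ n \<le> K * subspace_dim M.bs (?Y \<inter> X i)" if "i \<le> l" for i
      using that
    proof (induction i)
      case (Suc i)
      then have il: "i < l" "i \<le> l" by auto
      obtain \<rho> :: "'m \<Rightarrow> 'm" where "kmod_image BB M (X i) \<rho>"
        using M.quotient_rep_exists[OF X(1)[OF il(2)]] by blast
      then interpret Q: kmod_image BB M "X i" \<rho> .
      interpret QM: inv_module A m z zs Gr e0 n Q.Q by (rule inv_moduleI[OF Q.image_kmod])
      let ?W = "?Y \<inter> X (Suc i)"
      have Wc: "?W \<subseteq> carrier M" using M.bs.fd_subset[OF Yfd] by auto
      have kl: "klin M.bs ?W QM.M.bs \<rho>" by (rule klin_mono[OF Q.klin_rho Wc])
      \<comment> \<open>On Y \<inter> X (i + 1) the kernel of \<rho> is Y \<inter> X i, and the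
        image contains the orbit of the nonzero class of u i.\<close>
      note rn = rank_nullity_sub[OF M.kspace_bs QM.M.kspace_bs Wfd[OF Suc.prems] kl]
      have ker: "{x \<in> ?W. \<rho> x = \<zero>\<^bsub>QM.M.bs\<^esub>} = ?Y \<inter> X i"
        using Wc Q.rho_zero_iff X(2)[OF il(1)] by auto
      have un: "\<rho> (u i) \<in> carrier Q.Q" "\<rho> (u i) \<noteq> \<zero>\<^bsub>Q.Q\<^esub>"
        using uc[OF il(1)] u[OF il(1)] Q.rho_zero_iff by auto
      have "orbit Q.Q (\<rho> (u i)) ?j \<subseteq> \<rho> ` ?W"
      proof
        fix y assume "y \<in> orbit Q.Q (\<rho> (u i)) ?j"
        then obtain b where b: "b \<in> Bf ?j" "y = b \<odot>\<^bsub>Q.Q\<^esub> \<rho> (u i)" by (auto simp: orbit_def)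
        have "b \<odot>\<^bsub>M\<^esub> u i \<in> ?Y" by (rule gen_space_act[OF S(1,2) b(1) j0[OF il(1)]])
        moreover have "b \<odot>\<^bsub>M\<^esub> u i \<in> X (Suc i)"
          using M.smodD(4)[OF X(1)[OF Suc.prems] Bf_BBc[OF b(1)]] u[OF il(1)] by blast
        moreover have "y = \<rho> (b \<odot>\<^bsub>M\<^esub> u i)" using Q.rho_act[OF Bf_BBc[OF b(1)] uc[OF il(1)]] b(2) by simp
        ultimately show "y \<in> \<rho> ` ?W" by blast
      qed
      then have "subspace_dim QM.M.bs (orbit Q.Q (\<rho> (u i)) ?j) \<le> subspace_dim QM.M.bs (\<rho> ` ?W)"
        by (rule QM.M.bs.fd_mono(2)[OF rn(1) QM.M.bs.fd_ksub[OF QM.orbit_fd[OF un(1)]]])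
      then have "(j0 + 1) ^ n \<le> K * subspace_dim QM.M.bs (\<rho> ` ?W)"
        using C(2)[OF Q.image_kmod un, of j0] mult_le_mono2 order_trans by blast
      then show ?case using Suc.IH[OF il(2)] rn(3) unfolding ker by (simp add: distrib_left)
    qed simp
    then have "l * (j0 + 1) ^ n \<le> K * subspace_dim M.bs (?Y \<inter> X l)" by blast
    also have "\<dots> \<le> K * subspace_dim M.bs ?Y"
      by (intro mult_le_mono2 M.bs.fd_mono(2)[OF Yfd Ysub]) auto
    also have "\<dots> \<le> K * (?Cs * (?j + j0 + 1) ^ n)" using dimY by (rule mult_le_mono2)
    also have "?j + j0 + 1 = (C + 1) * (j0 + 1)" by simp
    \<comment> \<open>The factor (j0 + 1)^n now cancels, and with it the dependence on the
      chain.\<close>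
    also have "K * (?Cs * ((C + 1) * (j0 + 1)) ^ n) = (K * ?Cs * (C + 1) ^ n) * (j0 + 1) ^ n"
      by (simp only: power_mult_distrib mult.assoc)
    finally show ?thesis by simp
  qed
  then show ?thesis by blast
qed

end

section \<open>Finite length, cyclicity and multiplicity\<close>

locale holonomic_module = inv_module A m z zs Gr e0 n M
  for A :: "('k::field_char_0, 'a) module" (structure) and m z zs Gr e0 n and M :: "('a, 'm) module" +
  assumes fg: "fg_module BB M" and GK_M: "GK BB M \<le> ereal (real n)"
begin

lemma sub_chain_bounded: obtains L where "\<And>l X. sub_chain BB M l X \<Longrightarrow> l \<le> L"
  using chain_bound[OF fg GK_M] by blast

lemma module_length_finite: "module_length BB M < \<infinity>"
proof -
  obtain L where "\<And>l X. sub_chain BB M l X \<Longrightarrow> l \<le> L" using sub_chain_bounded by blast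
  then have "module_length BB M \<le> enat L" unfolding module_length_sub_chain by (intro SUP_least) auto
  then show ?thesis using enat_ord_simps(4) le_less_trans by blast
qed

abbreviation smod where "smod N \<equiv> Module.submodule N BB M"

text \<open>The length of N as a submodule, finite because chains are bounded. It is the induction
  measure that replaces composition series.\<close>

definition height where "height N = Max {l. \<exists>X. sub_chain BB M l X \<and> X l = N}"

lemma height_chain:
  assumes "smod N"
  shows "\<exists>X. sub_chain BB M (height N) X \<and> X (height N) = N"
    "sub_chain BB M l X \<Longrightarrow> X l = N \<Longrightarrow> l \<le> height N"
proof -
  let ?S = "{l. \<exists>X. sub_chain BB M l X \<and> X l = N}"
  obtain L where "\<And>l X. sub_chain BB M l X \<Longrightarrow> l \<le> L" using sub_chain_bounded by blast
  then have "?S \<subseteq> {..L}" by auto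
  then have fin: "finite ?S" by (rule finite_subset) simp
  have "sub_chain BB M 0 (\<lambda>i. N)" using assms by (simp add: sub_chain_def)
  then have "?S \<noteq> {}" by blast
  from Max_in[OF fin this] show "\<exists>X. sub_chain BB M (height N) X \<and> X (height N) = N" by (simp add: height_def)
  show "sub_chain BB M l X \<Longrightarrow> X l = N \<Longrightarrow> l \<le> height N"
    unfolding height_def by (rule Max_ge[OF fin]) blast
qed

lemma sub_chain_append:
  assumes "sub_chain BB M l X" "X l \<subset> N" "smod N"
  shows "sub_chain BB M (Suc l) (X(Suc l := N))"
  using assms by (auto simp: sub_chain_def le_Suc_eq less_Suc_eq)

lemma height_strict: "smod N \<Longrightarrow> smod N' \<Longrightarrow> N \<subset> N' \<Longrightarrow> height N < height N'"
proof -
  assume a: "smod N" "smod N'" "N \<subset> N'"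
  obtain X where X: "sub_chain BB M (height N) X" "X (height N) = N" using height_chain(1)[OF a(1)] by blast
  have "sub_chain BB M (Suc (height N)) (X(Suc (height N) := N'))"
    using X a by (intro sub_chain_append) auto
  from height_chain(2)[OF a(2) this] show ?thesis by simp
qed

lemma smod_zero: "smod {\<zero>\<^bsub>M\<^esub>}" and smod_all: "smod (carrier M)"
  by (auto simp: M.smod_iff)

text \<open>The last but one member of a longest chain ending at N: a submodule strictly in between
  would lengthen the chain.\<close>

lemma maximal_submodule:
  assumes "smod N" "N \<noteq> {\<zero>\<^bsub>M\<^esub>}"
  shows "\<exists>N'. smod N' \<and> N' \<subset> N \<and> (\<forall>P. smod P \<longrightarrow> N' \<subset> P \<longrightarrow> P \<subseteq> N \<longrightarrow> P = N)"
proof -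
  have "{\<zero>\<^bsub>M\<^esub>} \<subset> N" using assms M.smodD(2)[OF assms(1)] by auto
  from height_strict[OF smod_zero assms(1) this] have h: "height N > 0" by simp
  then obtain k where k: "height N = Suc k" using gr0_implies_Suc by blast
  obtain X where X: "sub_chain BB M (Suc k) X" "X (Suc k) = N" using height_chain(1)[OF assms(1)] k by auto
  have X': "sub_chain BB M k X" "smod (X k)" "X k \<subset> N" using X by (auto simp: sub_chain_def)
  have "P = N" if "smod P" "X k \<subset> P" "P \<subseteq> N" for P
  proof (rule ccontr)
    assume "P \<noteq> N"
    have "sub_chain BB M (Suc k) (X(Suc k := P))" by (rule sub_chain_append[OF X'(1) that(2,1)])
    from sub_chain_append[OF this _ assms(1)]
    have "sub_chain BB M (Suc (Suc k)) (X(Suc k := P, Suc (Suc k) := N))"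
      using \<open>P \<noteq> N\<close> that(3) by auto
    from height_chain(2)[OF assms(1) this] k show False by simp
  qed
  then show ?thesis using X' by blast
qed

definition plus_cyclic where "plus_cyclic N u = {b \<odot>\<^bsub>M\<^esub> u \<oplus>\<^bsub>M\<^esub> y | b y. b \<in> carrier BB \<and> y \<in> N}"

lemma smod_plus_cyclic:
  assumes "smod N" "u \<in> carrier M"
  shows "smod (plus_cyclic N u)" "N \<subseteq> plus_cyclic N u" "u \<in> plus_cyclic N u"
proof -
  note N = M.smodD[OF assms(1)]
  have zu: "\<zero>\<^bsub>BB\<^esub> \<odot>\<^bsub>M\<^esub> u = \<zero>\<^bsub>M\<^esub>" using M.zero_act[OF assms(2)] .
  show NP: "N \<subseteq> plus_cyclic N u"
  proof
    fix y assume "y \<in> N"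
    then have "y = \<zero>\<^bsub>BB\<^esub> \<odot>\<^bsub>M\<^esub> u \<oplus>\<^bsub>M\<^esub> y" using N(1) zu by simp
    then show "y \<in> plus_cyclic N u" unfolding plus_cyclic_def using \<open>y \<in> N\<close> BB.ks.zero_closed by blast
  qed
  have "u = \<one>\<^bsub>BB\<^esub> \<odot>\<^bsub>M\<^esub> u \<oplus>\<^bsub>M\<^esub> \<zero>\<^bsub>M\<^esub>" using assms(2) M.lm.smult_one[of u] by simp
  then show "u \<in> plus_cyclic N u" unfolding plus_cyclic_def using N(2) BB.one_closed by blast
  show "smod (plus_cyclic N u)"
    unfolding M.smod_iff
  proof (intro conjI ballI)
    show "plus_cyclic N u \<subseteq> carrier M"
      using assms(2) N(1) M.act_closed by (auto simp: plus_cyclic_def)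
    show "\<zero>\<^bsub>M\<^esub> \<in> plus_cyclic N u" using NP N(2) by blast
    show "x \<oplus>\<^bsub>M\<^esub> y \<in> plus_cyclic N u" if xp: "x \<in> plus_cyclic N u" and yp: "y \<in> plus_cyclic N u" for x y
    proof -
      obtain b w where 1: "x = b \<odot>\<^bsub>M\<^esub> u \<oplus>\<^bsub>M\<^esub> w" "b \<in> carrier BB" "w \<in> N" using xp by (auto simp: plus_cyclic_def)
      obtain b' w' where 2: "y = b' \<odot>\<^bsub>M\<^esub> u \<oplus>\<^bsub>M\<^esub> w'" "b' \<in> carrier BB" "w' \<in> N" using yp by (auto simp: plus_cyclic_def)
      have "x \<oplus>\<^bsub>M\<^esub> y = (b \<oplus>\<^bsub>BB\<^esub> b') \<odot>\<^bsub>M\<^esub> u \<oplus>\<^bsub>M\<^esub> (w \<oplus>\<^bsub>M\<^esub> w')"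
        using 1 2 assms(2) N(1) M.lm.smult_l_distr[of b b' u] M.act_closed[of _ u] by (simp add: M.lm.M.a_ac)
      then show ?thesis unfolding plus_cyclic_def using N(3)[OF 1(3) 2(3)] BB.ks.a_closed[OF 1(2) 2(2)] by blast
    qed
    show "a \<odot>\<^bsub>M\<^esub> x \<in> plus_cyclic N u" if a: "a \<in> carrier BB" and xp: "x \<in> plus_cyclic N u" for a x
    proof -
      obtain b w where 1: "x = b \<odot>\<^bsub>M\<^esub> u \<oplus>\<^bsub>M\<^esub> w" "b \<in> carrier BB" "w \<in> N" using xp by (auto simp: plus_cyclic_def)
      have "a \<odot>\<^bsub>M\<^esub> x = (a \<otimes>\<^bsub>BB\<^esub> b) \<odot>\<^bsub>M\<^esub> u \<oplus>\<^bsub>M\<^esub> a \<odot>\<^bsub>M\<^esub> w"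
        unfolding M.lm.smult_assoc[OF a 1(2) assms(2)] 1(1)
        by (rule M.lm.smult_r_distr[OF a M.act_closed[OF 1(2) assms(2)] N(1)[OF 1(3)]])
      then show ?thesis unfolding plus_cyclic_def using N(4)[OF a 1(3)] BB.m_closed[OF a 1(2)] by blast
    qed
  qed
qed

text \<open>If \<open>M = N + B u\<close> with \<open>N \<noteq> 0\<close> and \<open>N'\<close> is maximal in \<open>N\<close>, choose \<open>b \<noteq> 0\<close> with \<open>b u = 0\<close> and, by
  simplicity of \<open>B\<close>, some \<open>a\<close> and \<open>v \<in> N\<close> with \<open>b a v \<notin> N'\<close>. Then \<open>M = N' + B (u + a v)\<close>.\<close>

lemma shrink:
  assumes "smod N" "N \<noteq> {\<zero>\<^bsub>M\<^esub>}" "u \<in> carrier M" "plus_cyclic N u = carrier M"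
  shows "\<exists>N' u'. smod N' \<and> N' \<subset> N \<and> u' \<in> carrier M \<and> plus_cyclic N' u' = carrier M"
proof -
  obtain N' where N': "smod N'" "N' \<subset> N" "\<And>P. smod P \<Longrightarrow> N' \<subset> P \<Longrightarrow> P \<subseteq> N \<Longrightarrow> P = N"
    using maximal_submodule[OF assms(1,2)] by blast
  obtain v where v: "v \<in> N" "v \<notin> N'" using N'(2) by blast
  have vc: "v \<in> carrier M" using M.smodD(1)[OF assms(1) v(1)] .
  obtain b where b: "b \<in> B" "b \<noteq> \<zero>" "b \<odot>\<^bsub>M\<^esub> u = \<zero>\<^bsub>M\<^esub>" using torsion_element[OF assms(3) GK_M] by blast
  obtain d where d: "b \<in> Bf d" using Bf_exhaust[OF b(1)] by blast
  let ?p = "cK * (d + 1)"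
  let ?Z = "{\<beta> \<otimes> b \<otimes> \<beta>' | \<beta> \<beta>'. \<beta> \<in> Bf ?p \<and> \<beta>' \<in> Bf ?p}"
  have bc: "b \<in> carrier BB" using b(1) by simp
  \<comment> \<open>If b a v were in N' for all these a, then so would 1 v be, since 1 is a
    combination of products \<beta> b \<beta>'.\<close>
  have "\<exists>a\<in>Bf ?p. b \<odot>\<^bsub>M\<^esub> (a \<odot>\<^bsub>M\<^esub> v) \<notin> N'"
  proof (rule ccontr)
    assume no: "\<not> ?thesis"
    have Zc: "?Z \<subseteq> carrier BB" using b(1) by (auto intro!: B_mult intro: Bf_B[THEN subsetD])
    have "\<one>\<^bsub>BB\<^esub> \<odot>\<^bsub>M\<^esub> v \<in> N'"
    proof (rule klin_kspan_in[OF M.klin_act_r[OF vc subset_refl] BB.ks.kspace_axioms M.smodD(5)[OF N'(1)] Zc])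
      show "\<one>\<^bsub>BB\<^esub> \<in> kspan BB ?Z" using sandwich_one[OF d b(2)] by simp
      fix s assume "s \<in> ?Z"
      then obtain \<beta> \<beta>' where s: "s = \<beta> \<otimes> b \<otimes> \<beta>'" "\<beta> \<in> Bf ?p" "\<beta>' \<in> Bf ?p" by blast
      have c: "\<beta> \<in> carrier BB" "\<beta>' \<in> carrier BB" using s Bf_BBc by auto
      have "s \<odot>\<^bsub>M\<^esub> v = (\<beta> \<otimes>\<^bsub>BB\<^esub> b \<otimes>\<^bsub>BB\<^esub> \<beta>') \<odot>\<^bsub>M\<^esub> v" using s by simp
      also have "\<dots> = \<beta> \<odot>\<^bsub>M\<^esub> (b \<odot>\<^bsub>M\<^esub> (\<beta>' \<odot>\<^bsub>M\<^esub> v))"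
        using c bc vc M.lm.smult_assoc BB.m_closed by (metis M.act_closed)
      finally show "s \<odot>\<^bsub>M\<^esub> v \<in> N'" using no s(3) M.smodD(4)[OF N'(1) c(1)] by simp
    qed (rule M.kspace_bs)
    then show False using v(2) M.lm.smult_one[OF vc] by simp
  qed
  then obtain a where a: "a \<in> Bf ?p" "b \<odot>\<^bsub>M\<^esub> (a \<odot>\<^bsub>M\<^esub> v) \<notin> N'" by blast
  define w where "w = a \<odot>\<^bsub>M\<^esub> v"
  have w: "w \<in> N" "b \<odot>\<^bsub>M\<^esub> w \<notin> N'" using a M.smodD(4)[OF assms(1) Bf_BBc[OF a(1)] v(1)] by (auto simp: w_def)
  have wc: "w \<in> carrier M" using M.smodD(1)[OF assms(1) w(1)] .
  let ?u = "u \<oplus>\<^bsub>M\<^esub> w"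
  have uc: "?u \<in> carrier M" using assms(3) wc by simp
  note P = smod_plus_cyclic[OF N'(1) uc]
  let ?P = "plus_cyclic N' ?u"
  \<comment> \<open>As b kills u, the submodule generated by N' and u + w contains b w, which lies
    in N but not in N'. Maximality of N' puts all of N into it, hence also u.\<close>
  have "b \<odot>\<^bsub>M\<^esub> ?u = b \<odot>\<^bsub>M\<^esub> w" using M.lm.smult_r_distr[OF bc assms(3) wc] b(3) M.act_closed[OF bc wc] by simp
  then have bw: "b \<odot>\<^bsub>M\<^esub> w \<in> ?P" using M.smodD(4)[OF P(1) bc P(3)] by simp
  have "smod (?P \<inter> N)" using P(1) assms(1) unfolding M.smod_iff by blast
  moreover have "N' \<subset> ?P \<inter> N"
    using P(2) N'(2) bw w(2) M.smodD(4)[OF assms(1) bc w(1)] by blast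
  ultimately have "?P \<inter> N = N" using N'(3)[of "?P \<inter> N"] by blast
  then have NP: "N \<subseteq> ?P" by blast
  have "?u \<ominus>\<^bsub>M\<^esub> w = u" using assms(3) wc by (simp add: a_minus_def M.lm.M.a_assoc M.lm.M.r_neg)
  moreover have "?u \<ominus>\<^bsub>M\<^esub> w \<in> ?P" using M.smod_minus[OF P(1) P(3)] NP w(1) by blast
  ultimately have uP: "u \<in> ?P" by (simp only:)
  have "plus_cyclic N u \<subseteq> ?P"
    using NP uP M.smodD(3,4)[OF P(1)] unfolding plus_cyclic_def[of N u] by blast
  then have "?P = carrier M" using assms(4) M.smodD(1)[OF P(1)] by blast
  then show ?thesis using N'(1,2) uc by blast
qed

text \<open>Start with N = M and u = 0, and shrink N by \<open>shrink\<close> until it is zero; the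
  height decreases at each step.\<close>

lemma cyclic: "cyclic_module BB M"
proof -
  have "smod N \<Longrightarrow> u \<in> carrier M \<Longrightarrow> plus_cyclic N u = carrier M \<Longrightarrow> \<exists>u\<in>carrier M. plus_cyclic {\<zero>\<^bsub>M\<^esub>} u = carrier M" for N u
  proof (induction "height N" arbitrary: N u rule: less_induct)
    case less
    show ?case
    proof (cases "N = {\<zero>\<^bsub>M\<^esub>}")
      case False
      then obtain N' u' where "smod N'" "N' \<subset> N" "u' \<in> carrier M" "plus_cyclic N' u' = carrier M"
        using shrink[OF less.prems(1) _ less.prems(2,3)] by blast
      then show ?thesis using less.hyps[of N' u'] height_strict[OF _ less.prems(1)] by blast
    qed (use less.prems in auto)
  qed
  moreover have "plus_cyclic (carrier M) \<zero>\<^bsub>M\<^esub> = carrier M"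
    using M.smodD(1)[OF smod_plus_cyclic(1)[OF smod_all]] smod_plus_cyclic(2)[OF smod_all] M.lm.M.zero_closed by blast
  ultimately obtain u where u: "u \<in> carrier M" "plus_cyclic {\<zero>\<^bsub>M\<^esub>} u = carrier M"
    using smod_all M.lm.M.zero_closed by blast
  have r: "b \<odot>\<^bsub>M\<^esub> u \<oplus>\<^bsub>M\<^esub> \<zero>\<^bsub>M\<^esub> = b \<odot>\<^bsub>M\<^esub> u" if "b \<in> carrier BB" for b
    using M.act_closed[OF that u(1)] by simp
  have "carrier M \<subseteq> {b \<odot>\<^bsub>M\<^esub> u | b. b \<in> carrier BB}"
  proof
    fix x assume "x \<in> carrier M"
    then obtain b y where b: "x = b \<odot>\<^bsub>M\<^esub> u \<oplus>\<^bsub>M\<^esub> y" "b \<in> carrier BB" "y \<in> {\<zero>\<^bsub>M\<^esub>}"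
      using u(2) unfolding plus_cyclic_def by blast
    then have "x = b \<odot>\<^bsub>M\<^esub> u" using r[OF b(2)] by simp
    then show "x \<in> {b \<odot>\<^bsub>M\<^esub> u | b. b \<in> carrier BB}" using b(2) by blast
  qed
  then have "carrier M \<subseteq> submodule_gen BB M {u}" by (simp only: M.submodule_gen_single[OF u(1)])
  moreover have "{u} \<subseteq> carrier M" using u(1) by simp
  then have "submodule_gen BB M {u} \<subseteq> carrier M" by (rule M.submodule_gen_least[OF smod_all])
  ultimately have "submodule_gen BB M {u} = carrier M" by (rule subset_antisym[rotated])
  then show ?thesis unfolding cyclic_module_def using u(1) M.is_left_module by blast
qed

lemma torsion: "torsion_module BB M"
  unfolding torsion_module_def using M.is_left_module torsion_element[OF _ GK_M] by auto

text \<open>Adjoining a missing element raises the height of the generated submodule, which cannot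
  exceed that of N. Finite generation is needed before a multiplicity function may be applied to
  N.\<close>

lemma smod_fg:
  assumes "smod N"
  shows "fg_module BB (M\<lparr>carrier := N\<rparr>)"
proof -
  interpret N: kmod BB "M\<lparr>carrier := N\<rparr>" by (rule M.smod_module[OF assms])
  have Nc: "N \<subseteq> carrier M" using M.smodD(1)[OF assms] by blast
  have "finite S \<Longrightarrow> S \<subseteq> N \<Longrightarrow> \<exists>S. finite S \<and> S \<subseteq> N \<and> submodule_gen BB M S = N" for S
  proof (induction "height N - height (submodule_gen BB M S)" arbitrary: S rule: less_induct)
    case less
    let ?G = "submodule_gen BB M S"
    have Sc: "S \<subseteq> carrier M" using less.prems Nc by blast
    note G = M.submodule_gen_eq(2,3)[OF Sc]
    have GN: "?G \<subseteq> N" by (rule M.submodule_gen_least[OF assms less.prems(2)])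
    show ?case
    proof (cases "?G = N")
      case False
      then obtain x where x: "x \<in> N" "x \<notin> ?G" using GN by blast
      let ?S = "insert x S"
      have Sc': "?S \<subseteq> carrier M" using Sc x Nc by blast
      note G' = M.submodule_gen_eq(2,3)[OF Sc']
      have "?G \<subset> submodule_gen BB M ?S"
        using M.submodule_gen_least[OF G'(1), of S] G'(2) x(2) by blast
      then have "height ?G < height (submodule_gen BB M ?S)" by (rule height_strict[OF G(1) G'(1)])
      moreover have "height ?G < height N" using False GN by (intro height_strict[OF G(1) assms]) auto
      ultimately have "height N - height (submodule_gen BB M ?S) < height N - height ?G" by linarith
      then show ?thesis using less.hyps[of ?S] less.prems x(1) by auto
    qed (use less.prems in blast)
  qed
  then obtain S where S: "finite S" "S \<subseteq> N" "submodule_gen BB M S = N" by blast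
  have "submodule_gen BB (M\<lparr>carrier := N\<rparr>) S = N"
    using N.submodule_gen_eq(1)[of S] M.submodule_gen_eq(1)[of S] S(2,3) Nc
    by (simp add: base_space_carrier_update)
  then show ?thesis unfolding fg_module_def using N.is_left_module S(1,2) by auto
qed

lemma GK_sub_eq:
  assumes "smod N" "N \<noteq> {\<zero>\<^bsub>M\<^esub>}"
  shows "GK BB (M\<lparr>carrier := N\<rparr>) = ereal (real n)"
proof (rule antisym)
  show "GK BB (M\<lparr>carrier := N\<rparr>) \<le> ereal (real n)" using M.GK_sub[OF assms(1)] GK_M by (rule order_trans)
  obtain u where "u \<in> N" "u \<noteq> \<zero>\<^bsub>M\<^esub>" using assms M.smodD(2)[OF assms(1)] by blast
  then show "ereal (real n) \<le> GK BB (M\<lparr>carrier := N\<rparr>)"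
    by (intro bernstein_inequality[OF M.smod_module[OF assms(1)], of u]) auto
qed

text \<open>N, N' and the quotient N' / N all have dimension exactly n: Bernstein's inequality from
  below, monotonicity from above. So e is additive on this sequence, and the nonzero quotient
  contributes at least 1.\<close>

lemma multiplicity_strict:
  assumes e: "multiplicity_function BB e" and N: "smod N" "smod N'" "N \<subset> N'" "N \<noteq> {\<zero>\<^bsub>M\<^esub>}"
  shows "e (M\<lparr>carrier := N\<rparr>) < e (M\<lparr>carrier := N'\<rparr>)"
proof -
  let ?N = "M\<lparr>carrier := N\<rparr>" and ?N' = "M\<lparr>carrier := N'\<rparr>"
  have N'0: "N' \<noteq> {\<zero>\<^bsub>M\<^esub>}" using N M.smodD(2)[OF N(1)] by blast
  interpret N: kmod BB ?N by (rule M.smod_module[OF N(1)])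
  interpret N': kmod BB ?N' by (rule M.smod_module[OF N(2)])
  have NN': "Module.submodule N BB ?N'"
    using N(1,3) unfolding N'.smod_iff M.smod_iff by auto
  obtain \<rho> :: "'m \<Rightarrow> 'm" where "kmod_image BB ?N' N \<rho>" using N'.quotient_rep_exists[OF NN'] by blast
  then interpret Q: kmod_image BB ?N' N \<rho> .
  have fgN: "fg_module BB ?N" "fg_module BB ?N'" using smod_fg N by auto
  obtain S where S: "finite S" "S \<subseteq> N'" "submodule_gen BB ?N' S = N'" using fgN(2) by (auto simp: fg_module_def)
  interpret QM: kmod BB Q.Q by (rule Q.image_kmod)
  have Qc: "carrier Q.Q = \<rho> ` N'" using Q.Q_carrier by simp
  have "submodule_gen BB Q.Q (\<rho> ` S) = carrier Q.Q"
  proof -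
    have "\<rho> ` S \<subseteq> carrier Q.Q" using S(2) Qc by blast
    note g = QM.submodule_gen_eq[OF this]
    let ?P = "{x \<in> N'. \<rho> x \<in> submodule_gen BB Q.Q (\<rho> ` S)}"
    have N'c: "x \<in> N' \<Longrightarrow> x \<in> carrier ?N'" for x by simp
    have "\<rho> \<zero>\<^bsub>M\<^esub> = \<zero>\<^bsub>Q.Q\<^esub>" using Q.Q_zero by simp
    moreover have "\<rho> (x \<oplus>\<^bsub>M\<^esub> y) = \<rho> x \<oplus>\<^bsub>Q.Q\<^esub> \<rho> y" if "x \<in> N'" "y \<in> N'" for x y
      using Q.rho_add[of x y] that by simp
    moreover have "\<rho> (b \<odot>\<^bsub>M\<^esub> x) = b \<odot>\<^bsub>Q.Q\<^esub> \<rho> x" if "b \<in> carrier BB" "x \<in> N'" for b x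
      using Q.rho_act[of b x] that by simp
    ultimately have "Module.submodule ?P BB ?N'"
      unfolding N'.smod_iff using QM.smodD[OF g(2)] M.smodD[OF N(2)] by simp
    then have NP: "N' \<subseteq> ?P" using N'.submodule_gen_least[of ?P S] S(2,3) g(3) by auto
    show ?thesis
    proof (rule equalityI)
      show "submodule_gen BB Q.Q (\<rho> ` S) \<subseteq> carrier Q.Q" using QM.smodD(1)[OF g(2)] by (rule subsetI)
      show "carrier Q.Q \<subseteq> submodule_gen BB Q.Q (\<rho> ` S)" unfolding Qc
      proof (rule image_subsetI)
        fix x assume "x \<in> N'"
        from subsetD[OF NP this] show "\<rho> x \<in> submodule_gen BB Q.Q (\<rho> ` S)" by simp
      qed
    qed
  qed
  then have fgQ: "fg_module BB Q.Q"
    unfolding fg_module_def using QM.is_left_module S(1,2) Qc by (intro conjI exI[of _ "\<rho> ` S"]) auto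
  obtain x where x: "x \<in> N'" "x \<notin> N" using N(3) by blast
  have xz: "\<rho> x \<in> carrier Q.Q" "\<rho> x \<noteq> \<zero>\<^bsub>Q.Q\<^esub>" using x Qc Q.rho_zero_iff[of x] by auto
  have "GK BB Q.Q \<le> GK BB ?N'"
    by (rule GK_image[OF N'.kmod_axioms Q.image_kmod Q.module_map_rho]) (simp add: Qc)
  then have GKQ: "GK BB Q.Q = ereal (real n)"
    using GK_sub_eq[OF N(2) N'0] bernstein_inequality[OF Q.image_kmod xz] by (simp add: antisym)
  have "short_exact BB ?N (\<lambda>x. x) ?N' \<rho> Q.Q"
    unfolding short_exact_def
  proof (intro conjI)
    show "(\<lambda>x. x) \<in> LinearCombinations.module_hom BB ?N ?N'"
      using N(3) by (auto simp: LinearCombinations.module_hom_def)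
    show "\<rho> \<in> LinearCombinations.module_hom BB ?N' Q.Q" using Q.module_map_rho by (simp add: module_map_hom)
    show "(\<lambda>x. x) ` carrier ?N = {x \<in> carrier ?N'. \<rho> x = \<zero>\<^bsub>Q.Q\<^esub>}"
      using N(3) Q.rho_zero_iff by auto
  qed (use Qc in auto)
  then have "e ?N' = e ?N + e Q.Q"
    using e fgN fgQ GKQ GK_sub_eq[OF N(1,4)] GK_sub_eq[OF N(2) N'0] unfolding multiplicity_function_def by metis
  moreover have "1 \<le> e Q.Q"
    using e fgQ xz unfolding multiplicity_function_def nonzero_module_def by blast
  ultimately show ?thesis by simp
qed

text \<open>The count starts at the second member: the first may be zero, where e is not known,
  while the second is nonzero and has multiplicity at least 1. This still gives one unit per
  step.\<close>

lemma chain_le_multiplicity: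
  assumes e: "multiplicity_function BB e" and X: "sub_chain BB M l X"
  shows "l \<le> e M"
proof (cases l)
  case (Suc k)
  have Xs: "\<And>i. i \<le> l \<Longrightarrow> smod (X i)" "\<And>i. i < l \<Longrightarrow> X i \<subset> X (Suc i)" using X by (auto simp: sub_chain_def)
  have nz: "X (Suc i) \<noteq> {\<zero>\<^bsub>M\<^esub>}" if "i < l" for i
    using Xs(2)[OF that] M.smodD(2)[OF Xs(1)[of i]] that by auto
  have "Suc i \<le> e (M\<lparr>carrier := X (Suc i)\<rparr>)" if "i < l" for i
    using that
  proof (induction i)
    case 0
    have "nonzero_module (M\<lparr>carrier := X (Suc 0)\<rparr>)" using nz[OF 0] by (simp add: nonzero_module_def)
    then show ?case using e smod_fg[OF Xs(1)[of "Suc 0"]] 0 unfolding multiplicity_function_def by auto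
  next
    case (Suc i)
    then show ?case
      using multiplicity_strict[OF e Xs(1)[of "Suc i"] Xs(1)[of "Suc (Suc i)"] Xs(2)[of "Suc i"] nz[of i]] by simp
  qed
  then have le: "l \<le> e (M\<lparr>carrier := X l\<rparr>)" using Suc by auto
  have eqM: "M\<lparr>carrier := carrier M\<rparr> = M" by simp
  show ?thesis
  proof (cases "X l = carrier M")
    case True
    then show ?thesis using le eqM by simp
  next
    case False
    then have "X l \<subset> carrier M" using M.smodD(1)[OF Xs(1)[of l]] by blast
    then show ?thesis
      using multiplicity_strict[OF e Xs(1)[of l] smod_all] nz[of k] Suc le eqM by simp
  qed
qed simp

lemma length_le_multiplicity: "multiplicity_function BB e \<Longrightarrow> module_length BB M \<le> enat (e M)"
  unfolding module_length_sub_chain using chain_le_multiplicity by (intro SUP_least) auto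

lemma simple_if_multiplicity_1:
  assumes e: "multiplicity_function BB e" "e M = 1" and nz: "nonzero_module M"
  shows "simple_module BB M"
  unfolding simple_module_def
proof (intro conjI allI impI M.is_left_module nz)
  fix N assume N: "smod N"
  show "N = {\<zero>\<^bsub>M\<^esub>} \<or> N = carrier M"
  proof (rule ccontr)
    assume no: "\<not> ?thesis"
    have "sub_chain BB M 2 (\<lambda>i. if i = 0 then {\<zero>\<^bsub>M\<^esub>} else if i = 1 then N else carrier M)"
      using no N smod_zero smod_all M.smodD(1,2)[OF N] by (auto simp: sub_chain_def less_Suc_eq numeral_2_eq_2)
    from chain_le_multiplicity[OF e(1) this] e(2) show False by simp
  qed
qed

end

section \<open>Representations of monoid algebras\<close>

text \<open>Used for two algebras given by relations: words in the x and y acting on power series,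
  and pairs (a, b) acting on an algebra by x \<mapsto> a x b.\<close>

locale monoid_rep = P: monoid P + V: kspace V
  for P :: "'g monoid" and V :: "('k::field, 'v) module" +
  fixes \<tau> :: "'g \<Rightarrow> 'v \<Rightarrow> 'v"
  assumes klin_tau: "p \<in> carrier P \<Longrightarrow> klin V (carrier V) V (\<tau> p)"
    and tau_mult: "p \<in> carrier P \<Longrightarrow> q \<in> carrier P \<Longrightarrow> x \<in> carrier V \<Longrightarrow> \<tau> (p \<otimes>\<^bsub>P\<^esub> q) x = \<tau> p (\<tau> q x)"
    and tau_one: "x \<in> carrier V \<Longrightarrow> \<tau> \<one>\<^bsub>P\<^esub> x = x"
begin

abbreviation F where "F \<equiv> monoid_algebra P :: ('k, 'g \<Rightarrow> 'k) module"

sublocale F: kalg F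
  by (rule kalg_monoid_algebra) (rule P.monoid_axioms)

definition lin :: "('g \<Rightarrow> 'k) \<Rightarrow> 'v \<Rightarrow> 'v" where
  "lin f x = (\<Oplus>\<^bsub>V\<^esub>p\<in>{p. f p \<noteq> 0}. f p \<odot>\<^bsub>V\<^esub> \<tau> p x)"

lemma tau_in[simp]: "p \<in> carrier P \<Longrightarrow> x \<in> carrier V \<Longrightarrow> \<tau> p x \<in> carrier V"
  using klinD(1)[OF klin_tau] .

lemma supp_P: "f \<in> carrier F \<Longrightarrow> f p \<noteq> 0 \<Longrightarrow> p \<in> carrier P" "f \<in> carrier F \<Longrightarrow> finite {p. f p \<noteq> 0}"
  by (auto simp: monoid_algebra_sel(1))

lemma lin_superset:
  assumes "finite S" "S \<subseteq> carrier P" "{p. f p \<noteq> 0} \<subseteq> S" "x \<in> carrier V"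
  shows "lin f x = (\<Oplus>\<^bsub>V\<^esub>p\<in>S. f p \<odot>\<^bsub>V\<^esub> \<tau> p x)"
  unfolding lin_def using assms
  by (intro V.add.finprod_mono_neutral_cong_left) auto

lemma lin_in[simp]: "f \<in> carrier F \<Longrightarrow> x \<in> carrier V \<Longrightarrow> lin f x \<in> carrier V"
  unfolding lin_def using supp_P by (intro V.finsum_closed) auto

lemma lin_basis: "p \<in> carrier P \<Longrightarrow> x \<in> carrier V \<Longrightarrow> lin (basis_elt p) x = \<tau> p x"
  by (subst lin_superset[of "{p}"]) (auto simp: basis_elt_def)

lemma klin_lin: "x \<in> carrier V \<Longrightarrow> klin F (carrier F) V (\<lambda>f. lin f x)"
proof (rule klinI)
  assume x: "x \<in> carrier V"
  fix f and c :: 'k assume f: "f \<in> carrier F"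
  show "lin f x \<in> carrier V" using f x by simp
  let ?S = "{p. f p \<noteq> 0}"
  have S: "finite ?S" "?S \<subseteq> carrier P" using supp_P[OF f] by auto
  have tc: "(\<lambda>p. f p \<odot>\<^bsub>V\<^esub> \<tau> p x) \<in> ?S \<rightarrow> carrier V" for f :: "'g \<Rightarrow> 'k" using S x by auto
  have kc: "klin V (carrier V) V (\<lambda>v. c \<odot>\<^bsub>V\<^esub> v)"
    by (rule klinI) (simp_all add: V.smult_add_r V.smult_assoc[symmetric] mult.commute)
  have "lin (c \<odot>\<^bsub>F\<^esub> f) x = (\<Oplus>\<^bsub>V\<^esub>p\<in>?S. (c * f p) \<odot>\<^bsub>V\<^esub> \<tau> p x)"
    by (subst lin_superset[OF S _ x]) (auto simp: monoid_algebra_sel)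
  also have "\<dots> = (\<Oplus>\<^bsub>V\<^esub>p\<in>?S. c \<odot>\<^bsub>V\<^esub> (f p \<odot>\<^bsub>V\<^esub> \<tau> p x))"
    using S x by (intro V.finsum_cong') (auto simp: V.smult_assoc)
  also have "\<dots> = c \<odot>\<^bsub>V\<^esub> lin f x"
    using klin_finsum[OF kc V.kspace_axioms V.kspace_axioms S(1), of "\<lambda>p. f p \<odot>\<^bsub>V\<^esub> \<tau> p x"] tc[of f] by (simp add: lin_def)
  finally show "lin (c \<odot>\<^bsub>F\<^esub> f) x = c \<odot>\<^bsub>V\<^esub> lin f x" .
  fix h assume h: "h \<in> carrier F"
  let ?T = "?S \<union> {p. h p \<noteq> 0}"
  have T: "finite ?T" "?T \<subseteq> carrier P" using S supp_P[OF h] by auto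
  have "lin (f \<oplus>\<^bsub>F\<^esub> h) x = (\<Oplus>\<^bsub>V\<^esub>p\<in>?T. (f p + h p) \<odot>\<^bsub>V\<^esub> \<tau> p x)"
    by (subst lin_superset[OF T _ x]) (auto simp: monoid_algebra_sel)
  also have "\<dots> = (\<Oplus>\<^bsub>V\<^esub>p\<in>?T. f p \<odot>\<^bsub>V\<^esub> \<tau> p x \<oplus>\<^bsub>V\<^esub> h p \<odot>\<^bsub>V\<^esub> \<tau> p x)"
    using T x by (intro V.finsum_cong') (auto simp: V.smult_add_l)
  also have "\<dots> = (\<Oplus>\<^bsub>V\<^esub>p\<in>?T. f p \<odot>\<^bsub>V\<^esub> \<tau> p x) \<oplus>\<^bsub>V\<^esub> (\<Oplus>\<^bsub>V\<^esub>p\<in>?T. h p \<odot>\<^bsub>V\<^esub> \<tau> p x)"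
    using T x by (intro V.finsum_addf) auto
  also have "\<dots> = lin f x \<oplus>\<^bsub>V\<^esub> lin h x"
    using lin_superset[OF T _ x, of f] lin_superset[OF T _ x, of h] by auto
  finally show "lin (f \<oplus>\<^bsub>F\<^esub> h) x = lin f x \<oplus>\<^bsub>V\<^esub> lin h x" .
qed

lemma F_induct:
  assumes "f \<in> carrier F" "\<And>p. p \<in> carrier P \<Longrightarrow> Pr (basis_elt p)" "ksub F {f \<in> carrier F. Pr f}"
  shows "Pr f"
proof -
  have "basis_elt ` carrier P \<subseteq> {f \<in> carrier F. Pr f}"
  proof (rule image_subsetI, rule CollectI, rule conjI)
    show "basis_elt p \<in> carrier F" "Pr (basis_elt p)" if "p \<in> carrier P" for p
      using basis_elt_in[OF that] assms(2)[OF that] by auto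
  qed
  from kspan_least[OF this assms(3)] have "carrier F \<subseteq> {f \<in> carrier F. Pr f}" using monoid_algebra_span by blast
  then show ?thesis using assms(1) by blast
qed

lemma klin_eq_ksub:
  assumes "klin F (carrier F) V f" "klin F (carrier F) V h"
  shows "ksub F {x \<in> carrier F. f x = h x}"
  using klinD[OF assms(1)] klinD[OF assms(2)] F.ks.klin_zero[OF assms(1) V.kspace_axioms] F.ks.klin_zero[OF assms(2) V.kspace_axioms]
  by (auto simp: ksub_def)

lemma klin_lin_r: "f \<in> carrier F \<Longrightarrow> klin V (carrier V) V (lin f)"
proof -
  assume f: "f \<in> carrier F"
  have "lin f (x \<oplus>\<^bsub>V\<^esub> y) = lin f x \<oplus>\<^bsub>V\<^esub> lin f y" if "x \<in> carrier V" "y \<in> carrier V" for x y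
  proof (rule F_induct[OF f])
    have "klin F (carrier F) V (\<lambda>f. lin f x \<oplus>\<^bsub>V\<^esub> lin f y)"
      using that by (intro klinI) (auto simp: klinD[OF klin_lin] V.a_ac V.smult_add_r)
    then show "ksub F {f \<in> carrier F. lin f (x \<oplus>\<^bsub>V\<^esub> y) = lin f x \<oplus>\<^bsub>V\<^esub> lin f y}"
      using that by (intro klin_eq_ksub klin_lin) auto
  qed (use that in \<open>simp add: lin_basis klinD[OF klin_tau]\<close>)
  moreover have "lin f (c \<odot>\<^bsub>V\<^esub> x) = c \<odot>\<^bsub>V\<^esub> lin f x" if "x \<in> carrier V" for x c
  proof (rule F_induct[OF f])
    have "klin F (carrier F) V (\<lambda>f. c \<odot>\<^bsub>V\<^esub> lin f x)"
      using that by (intro klinI) (auto simp: klinD[OF klin_lin] V.smult_add_r V.smult_assoc[symmetric] mult.commute)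
    then show "ksub F {f \<in> carrier F. lin f (c \<odot>\<^bsub>V\<^esub> x) = c \<odot>\<^bsub>V\<^esub> lin f x}"
      using that by (intro klin_eq_ksub klin_lin) auto
  qed (use that in \<open>simp add: lin_basis klinD[OF klin_tau]\<close>)
  ultimately show ?thesis using f by (intro klinI) auto
qed

lemma lin_mult:
  assumes "f \<in> carrier F" "h \<in> carrier F" "x \<in> carrier V"
  shows "lin (f \<otimes>\<^bsub>F\<^esub> h) x = lin f (lin h x)"
proof -
  have 1: "lin (basis_elt p \<otimes>\<^bsub>F\<^esub> h) x = lin (basis_elt p) (lin h x)" if p: "p \<in> carrier P" for p
  proof (rule F_induct[OF assms(2)])
    have b: "basis_elt p \<in> carrier F" using basis_elt_in[OF p] .
    have k1: "klin F (carrier F) V (\<lambda>h. lin (basis_elt p \<otimes>\<^bsub>F\<^esub> h) x)"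
      using b assms(3) by (intro klinI) (simp_all add: F.r_distr F.smult_mult_r klinD[OF klin_lin[OF assms(3)]])
    have k2: "klin F (carrier F) V (\<lambda>h. lin (basis_elt p) (lin h x))"
      using b assms(3) by (intro klinI) (simp_all add: klinD[OF klin_lin_r[OF b]] klinD[OF klin_lin[OF assms(3)]])
    show "ksub F {h \<in> carrier F. lin (basis_elt p \<otimes>\<^bsub>F\<^esub> h) x = lin (basis_elt p) (lin h x)}"
      by (rule klin_eq_ksub[OF k1 k2])
  qed (use p assms(3) in \<open>simp add: basis_elt_mult lin_basis tau_mult\<close>)
  show ?thesis
  proof (rule F_induct[OF assms(1)])
    have k1: "klin F (carrier F) V (\<lambda>f. lin (f \<otimes>\<^bsub>F\<^esub> h) x)"
      using assms by (intro klinI) (simp_all add: F.l_distr F.smult_mult_l klinD[OF klin_lin[OF assms(3)]])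
    show "ksub F {f \<in> carrier F. lin (f \<otimes>\<^bsub>F\<^esub> h) x = lin f (lin h x)}"
      using assms by (intro klin_eq_ksub[OF k1] klin_lin) auto
  qed (rule 1)
qed

lemma lin_one: "x \<in> carrier V \<Longrightarrow> lin \<one>\<^bsub>F\<^esub> x = x"
  by (simp add: monoid_algebra_sel(2) lin_basis tau_one)

definition annih where "annih = {f \<in> carrier F. \<forall>x\<in>carrier V. lin f x = \<zero>\<^bsub>V\<^esub>}"

text \<open>Since this ideal is two-sided, the action descends to a quotient as soon as the defining
  relations act by zero.\<close>

lemma annih_ideal: "ideal annih F"
proof (rule idealI[OF F.is_ring])
  have z: "lin f \<zero>\<^bsub>V\<^esub> = \<zero>\<^bsub>V\<^esub>" if "f \<in> carrier F" for f
    using V.klin_zero[OF klin_lin_r[OF that] V.kspace_axioms] by simp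
  show "a \<in> annih \<Longrightarrow> x \<in> carrier F \<Longrightarrow> x \<otimes>\<^bsub>F\<^esub> a \<in> annih" for a x
    by (auto simp: annih_def lin_mult z)
  show "a \<in> annih \<Longrightarrow> x \<in> carrier F \<Longrightarrow> a \<otimes>\<^bsub>F\<^esub> x \<in> annih" for a x
    by (auto simp: annih_def lin_mult)
  have sub: "ksub F annih"
    using F.ks.klin_zero[OF klin_lin V.kspace_axioms]
    by (auto simp: annih_def ksub_def klinD[OF klin_lin])
  show "subgroup annih (add_monoid F)"
    using F.ks.ksub_neg[OF sub] ksubD[OF sub] by (intro F.ks.add.subgroupI) (auto simp: a_inv_def)
qed

lemma annih_diff:
  assumes "f \<in> carrier F" "h \<in> carrier F" "\<And>x. x \<in> carrier V \<Longrightarrow> lin f x = lin h x"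
  shows "f \<ominus>\<^bsub>F\<^esub> h \<in> annih"
proof -
  have "lin (f \<ominus>\<^bsub>F\<^esub> h) x = \<zero>\<^bsub>V\<^esub>" if "x \<in> carrier V" for x
    using klin_minus[OF klin_lin[OF that] F.ks.kspace_axioms V.kspace_axioms F.ks.ksub_carrier assms(1,2)] assms that
    by (simp add: a_minus_def V.r_neg)
  then show ?thesis using assms by (simp add: annih_def)
qed

lemma lin_quot:
  assumes "kquot F S" "S \<subseteq> annih" "f \<in> carrier F" "h \<in> carrier F" "kquot.proj F S f = kquot.proj F S h" "x \<in> carrier V"
  shows "lin f x = lin h x"
proof -
  interpret Q: kquot F S by fact
  have "f \<ominus>\<^bsub>F\<^esub> h \<in> annih"
    using Q.proj_eq[OF assms(3,4)] assms(5) Q.I_least[OF annih_ideal assms(2)] by blast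
  then have "lin (f \<ominus>\<^bsub>F\<^esub> h) x = \<zero>\<^bsub>V\<^esub>" using assms(6) by (simp add: annih_def)
  then have "lin f x \<ominus>\<^bsub>V\<^esub> lin h x = \<zero>\<^bsub>V\<^esub>"
    using klin_minus[OF klin_lin[OF assms(6)] F.ks.kspace_axioms V.kspace_axioms F.ks.ksub_carrier assms(3,4)] by simp
  then show ?thesis using assms by simp
qed

end


text \<open>Two scalar multiplications that agree on the carrier may differ outside it, as happens
  for the base space of the regular bimodule, so \<open>kspan_cong_ops\<close> does not
  apply.\<close>

lemma kspan_cong_carrier:
  assumes "kspace V" "kspace V'" "carrier V = carrier V'" "zero V = zero V'" "add V = add V'"
    "\<And>c x. x \<in> carrier V \<Longrightarrow> c \<odot>\<^bsub>V\<^esub> x = c \<odot>\<^bsub>V'\<^esub> x"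
  shows "ksub V W \<longleftrightarrow> ksub V' W" "S \<subseteq> carrier V \<Longrightarrow> kspan V S = kspan V' S"
    "fd_subspace V W \<longleftrightarrow> fd_subspace V' W"
proof -
  have sub: "ksub V W \<longleftrightarrow> ksub V' W" for W
    using assms(3-6) by (auto simp: ksub_def subset_iff)
  then show "ksub V W \<longleftrightarrow> ksub V' W" .
  have span: "kspan V S = kspan V' S" if "S \<subseteq> carrier V" for S
  proof
    show "kspan V S \<subseteq> kspan V' S"
      using kspace.kspan_sub[OF assms(2), of S] sub that assms(3) by (intro kspan_least) (auto intro: kspan_base)
    show "kspan V' S \<subseteq> kspan V S"
      using kspace.kspan_sub[OF assms(1), of S] sub that assms(3) by (intro kspan_least) (auto intro: kspan_base)
  qed
  then show "S \<subseteq> carrier V \<Longrightarrow> kspan V S = kspan V' S" .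
  show "fd_subspace V W \<longleftrightarrow> fd_subspace V' W"
    unfolding kspace.fd_iff[OF assms(1)] kspace.fd_iff[OF assms(2)] sub
    using span ksub_subset[of V' W] assms(3) by blast
qed

section \<open>The enveloping algebra\<close>

text \<open>Not a mere extension of \<^locale>\<open>kalg\<close>: interpreting \<open>monoid_rep\<close>, which contains another
  algebra, inside \<^locale>\<open>kalg\<close> itself would not terminate.\<close>

locale kalg_envelope = kalg R for R :: "('k::field, 'a) module" (structure)
begin

definition PP where "PP = R \<times>\<times> opposite_algebra R"

lemma PP_sel: "carrier PP = carrier R \<times> carrier R" "\<one>\<^bsub>PP\<^esub> = (\<one>, \<one>)"
  "(a, b) \<otimes>\<^bsub>PP\<^esub> (a', b') = (a \<otimes> a', b' \<otimes> b)"
  by (simp_all add: PP_def DirProd_def opposite_algebra_def)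

lemma PP_monoid: "monoid PP"
  by (rule monoidI) (auto simp: PP_sel m_assoc)

sublocale env: monoid_rep PP R "\<lambda>p x. fst p \<otimes> x \<otimes> snd p"
proof (intro monoid_rep.intro monoid_rep_axioms.intro PP_monoid ks.kspace_axioms)
  fix p assume "p \<in> carrier PP"
  then show "klin R (carrier R) R (\<lambda>x. fst p \<otimes> x \<otimes> snd p)"
    by (intro klinI) (auto simp: PP_sel l_distr r_distr smult_mult_l smult_mult_r)
qed (auto simp: PP_sel m_assoc)

abbreviation rels where "rels \<equiv> bilinear_relations R (opposite_algebra R)"
abbreviation Env where "Env \<equiv> enveloping_algebra R"

lemma rels_annih: "rels \<subseteq> env.annih"
proof -
  let ?F = "env.F"
  have bin: "basis_elt (a, b) \<in> carrier ?F" if "a \<in> carrier R" "b \<in> carrier R" for a b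
    using that by (intro basis_elt_in) (simp add: PP_sel)
  have lb: "env.lin (basis_elt (a, b)) x = a \<otimes> x \<otimes> b" if "a \<in> carrier R" "b \<in> carrier R" "x \<in> carrier R" for a b x
    using that env.lin_basis[of "(a, b)" x] by (simp add: PP_sel)
  have 1: "(f \<ominus>\<^bsub>?F\<^esub> g) \<ominus>\<^bsub>?F\<^esub> h \<in> env.annih"
    if "f \<in> carrier ?F" "g \<in> carrier ?F" "h \<in> carrier ?F" "\<And>x. x \<in> carrier R \<Longrightarrow> env.lin f x = env.lin g x \<oplus> env.lin h x" for f g h
  proof -
    have "(f \<ominus>\<^bsub>?F\<^esub> g) \<ominus>\<^bsub>?F\<^esub> h = f \<ominus>\<^bsub>?F\<^esub> (g \<oplus>\<^bsub>?F\<^esub> h)"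
      using that(1-3) by (simp add: a_minus_def env.F.ks.minus_add env.F.ks.a_assoc)
    then show ?thesis using that by (simp add: env.annih_diff klinD[OF env.klin_lin])
  qed
  have 2: "f \<ominus>\<^bsub>?F\<^esub> (c \<odot>\<^bsub>?F\<^esub> g) \<in> env.annih"
    if "f \<in> carrier ?F" "g \<in> carrier ?F" "\<And>x. x \<in> carrier R \<Longrightarrow> env.lin f x = c \<odot> env.lin g x" for f g c
    using that by (simp add: env.annih_diff klinD[OF env.klin_lin])
  show ?thesis
    unfolding bilinear_relations_def Let_def PP_def[symmetric]
    by (auto simp: opposite_algebra_def intro!: 1 2 bin simp: lb l_distr r_distr smult_mult_l smult_mult_r)
qed

lemma kquot_env: "kquot env.F rels"
  using rels_annih by (intro kquot.intro kquot_axioms.intro env.F.kalg_axioms) (auto simp: env.annih_def)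

sublocale Q: kquot env.F rels
  by (rule kquot_env)

lemma Env_eq: "Env = Q.A"
  by (simp add: enveloping_algebra_def tensor_algebra_def PP_def)

lemma kalg_Env: "kalg Env"
  unfolding Env_eq by (rule Q.kalg_A)

definition tens where "tens a b = Q.proj (basis_elt (a, b))"

lemma basis_in: "a \<in> carrier R \<Longrightarrow> b \<in> carrier R \<Longrightarrow> basis_elt (a, b) \<in> carrier env.F"
  by (intro basis_elt_in) (simp add: PP_sel)

lemma tens_in: "a \<in> carrier R \<Longrightarrow> b \<in> carrier R \<Longrightarrow> tens a b \<in> carrier Env"
  unfolding Env_eq Q.A_sel(1) tens_def using basis_in by blast

lemma tens_mult:
  assumes "a \<in> carrier R" "b \<in> carrier R" "a' \<in> carrier R" "b' \<in> carrier R"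
  shows "tens a b \<otimes>\<^bsub>Env\<^esub> tens a' b' = tens (a \<otimes> a') (b' \<otimes> b)"
  unfolding tens_def Env_eq using assms
  by (simp add: Q.proj_mult basis_in basis_elt_mult PP_sel)

lemma tens_one: "\<one>\<^bsub>Env\<^esub> = tens \<one> \<one>"
  by (simp add: Env_eq Q.A_sel(3) tens_def monoid_algebra_sel(2) PP_sel)

lemma Env_span: "carrier Env = kspan Env {tens a b | a b. a \<in> carrier R \<and> b \<in> carrier R}"
proof -
  have b: "basis_elt ` carrier PP \<subseteq> carrier env.F" by (rule image_subsetI) (rule basis_elt_in)
  have "carrier Env = Q.proj ` kspan env.F (basis_elt ` carrier PP)"
    unfolding Env_eq Q.A_sel(1) using monoid_algebra_span by blast
  also have "\<dots> = kspan Env (Q.proj ` basis_elt ` carrier PP)"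
    unfolding Env_eq using Q.kalg_A by (intro klin_kspan[OF Q.klin_proj env.F.ks.kspace_axioms _ b])
      (simp add: kalg_def kspace_def)
  also have "Q.proj ` basis_elt ` carrier PP = {tens a b | a b. a \<in> carrier R \<and> b \<in> carrier R}"
    by (auto simp: PP_sel tens_def)
  finally show ?thesis .
qed

lemma rels_mem:
  assumes "a \<in> carrier R" "a' \<in> carrier R" "b \<in> carrier R" "b' \<in> carrier R"
  shows "basis_elt (a \<oplus> a', b) \<ominus>\<^bsub>env.F\<^esub> basis_elt (a, b) \<ominus>\<^bsub>env.F\<^esub> basis_elt (a', b) \<in> rels"
    "basis_elt (a, b \<oplus> b') \<ominus>\<^bsub>env.F\<^esub> basis_elt (a, b) \<ominus>\<^bsub>env.F\<^esub> basis_elt (a, b') \<in> rels"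
    "basis_elt (c \<odot> a, b) \<ominus>\<^bsub>env.F\<^esub> (c \<odot>\<^bsub>env.F\<^esub> basis_elt (a, b)) \<in> rels"
    "basis_elt (a, c \<odot> b) \<ominus>\<^bsub>env.F\<^esub> (c \<odot>\<^bsub>env.F\<^esub> basis_elt (a, b)) \<in> rels"
proof -
  have o: "carrier (opposite_algebra R) = carrier R" "add (opposite_algebra R) = add R"
    "smult (opposite_algebra R) = smult R" by (simp_all add: opposite_algebra_def)
  note d = bilinear_relations_def Let_def PP_def[symmetric] o
  show "basis_elt (a \<oplus> a', b) \<ominus>\<^bsub>env.F\<^esub> basis_elt (a, b) \<ominus>\<^bsub>env.F\<^esub> basis_elt (a', b) \<in> rels"
    unfolding d by (rule UnI1, rule UnI1, rule UnI1, rule CollectI, intro exI conjI, rule refl) (fact assms)+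
  show "basis_elt (a, b \<oplus> b') \<ominus>\<^bsub>env.F\<^esub> basis_elt (a, b) \<ominus>\<^bsub>env.F\<^esub> basis_elt (a, b') \<in> rels"
    unfolding d by (rule UnI1, rule UnI1, rule UnI2, rule CollectI, intro exI conjI, rule refl) (fact assms)+
  show "basis_elt (c \<odot> a, b) \<ominus>\<^bsub>env.F\<^esub> (c \<odot>\<^bsub>env.F\<^esub> basis_elt (a, b)) \<in> rels"
    unfolding d by (rule UnI1, rule UnI2, rule CollectI, intro exI conjI, rule refl) (fact assms)+
  show "basis_elt (a, c \<odot> b) \<ominus>\<^bsub>env.F\<^esub> (c \<odot>\<^bsub>env.F\<^esub> basis_elt (a, b)) \<in> rels"
    unfolding d by (rule UnI2, rule CollectI, intro exI conjI, rule refl) (fact assms)+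
qed

lemma tens_rel:
  assumes "f \<in> carrier env.F" "g \<in> carrier env.F" "h \<in> carrier env.F" "(f \<ominus>\<^bsub>env.F\<^esub> g) \<ominus>\<^bsub>env.F\<^esub> h \<in> rels"
  shows "Q.proj f = Q.proj g \<oplus>\<^bsub>Env\<^esub> Q.proj h"
proof -
  have "(f \<ominus>\<^bsub>env.F\<^esub> g) \<ominus>\<^bsub>env.F\<^esub> h = f \<ominus>\<^bsub>env.F\<^esub> (g \<oplus>\<^bsub>env.F\<^esub> h)"
    using assms(1-3) by (simp add: a_minus_def env.F.ks.minus_add env.F.ks.a_assoc)
  then show ?thesis using assms Q.proj_gen[of f "g \<oplus>\<^bsub>env.F\<^esub> h"] by (simp add: Env_eq Q.proj_add)
qed

lemma klin_tens_l: "b \<in> carrier R \<Longrightarrow> klin R (carrier R) Env (\<lambda>a. tens a b)"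
proof (rule klinI)
  assume b: "b \<in> carrier R"
  fix x y and c :: 'k assume x: "x \<in> carrier R"
  show "tens x b \<in> carrier Env" by (rule tens_in[OF x b])
  have "basis_elt (c \<odot> x, b) \<ominus>\<^bsub>env.F\<^esub> (c \<odot>\<^bsub>env.F\<^esub> basis_elt (x, b)) \<in> rels"
    by (rule rels_mem(3)[OF x x b b])
  then show "tens (c \<odot> x) b = c \<odot>\<^bsub>Env\<^esub> tens x b"
    unfolding tens_def Env_eq using x b basis_in 
    by (subst Q.proj_smult) (simp_all only: Q.proj_gen basis_in ks.smult_in env.F.ks.smult_in)
  assume y: "y \<in> carrier R"
  have "basis_elt (x \<oplus> y, b) \<ominus>\<^bsub>env.F\<^esub> basis_elt (x, b) \<ominus>\<^bsub>env.F\<^esub> basis_elt (y, b) \<in> rels"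
    by (rule rels_mem(1)[OF x y b b])
  then show "tens (x \<oplus> y) b = tens x b \<oplus>\<^bsub>Env\<^esub> tens y b"
    unfolding tens_def using x y b basis_in by (intro tens_rel) auto
qed

lemma klin_tens_r: "a \<in> carrier R \<Longrightarrow> klin R (carrier R) Env (\<lambda>b. tens a b)"
proof (rule klinI)
  assume a: "a \<in> carrier R"
  fix x y and c :: 'k assume x: "x \<in> carrier R"
  show "tens a x \<in> carrier Env" by (rule tens_in[OF a x])
  have "basis_elt (a, c \<odot> x) \<ominus>\<^bsub>env.F\<^esub> (c \<odot>\<^bsub>env.F\<^esub> basis_elt (a, x)) \<in> rels"
    by (rule rels_mem(4)[OF a a x x])
  then show "tens a (c \<odot> x) = c \<odot>\<^bsub>Env\<^esub> tens a x"
    unfolding tens_def Env_eq using x a basis_in 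
    by (subst Q.proj_smult) (simp_all only: Q.proj_gen basis_in ks.smult_in env.F.ks.smult_in)
  assume y: "y \<in> carrier R"
  have "basis_elt (a, x \<oplus> y) \<ominus>\<^bsub>env.F\<^esub> basis_elt (a, x) \<ominus>\<^bsub>env.F\<^esub> basis_elt (a, y) \<in> rels"
    by (rule rels_mem(2)[OF a a x y])
  then show "tens a (x \<oplus> y) = tens a x \<oplus>\<^bsub>Env\<^esub> tens a y"
    unfolding tens_def using x y a basis_in by (intro tens_rel) auto
qed

abbreviation RM where "RM \<equiv> regular_bimodule R"

lemma RM_sel: "carrier RM = carrier R" "zero RM = zero R" "add RM = add R"
  by (simp_all add: regular_bimodule_def)

text \<open>All representatives of a coset act alike because the relations act by zero; the image
  under \<open>the_elem\<close> is therefore a singleton.\<close>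

lemma RM_act: "f \<in> carrier env.F \<Longrightarrow> x \<in> carrier R \<Longrightarrow> Q.proj f \<odot>\<^bsub>RM\<^esub> x = env.lin f x"
proof -
  assume f: "f \<in> carrier env.F" and x: "x \<in> carrier R"
  have "env.lin h x = env.lin f x" if h: "h \<in> Q.proj f" for h
  proof -
    obtain i where i: "i \<in> Q.I" "h = i \<oplus>\<^bsub>env.F\<^esub> f" using h unfolding Q.proj_def a_r_coset_def' by blast
    have ic: "i \<in> carrier env.F" using Q.I.a_Hcarr[OF i(1)] .
    have hc: "h \<in> carrier env.F" using i(2) ic f by simp
    have "h \<ominus>\<^bsub>env.F\<^esub> f = i"
      using i(2) ic f by (simp add: a_minus_def env.F.ks.a_assoc env.F.ks.r_neg)
    then have "Q.proj h = Q.proj f" using Q.proj_eq[OF hc f] i(1) by simp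
    then show ?thesis using env.lin_quot[OF kquot_env rels_annih hc f] x by blast
  qed
  moreover have "f \<in> Q.proj f" unfolding Q.proj_def using f by (rule Q.I.a_rcos_self)
  ultimately have "(\<lambda>f. env.lin f x) ` Q.proj f = {env.lin f x}"
    by (metis (no_types, lifting) empty_iff image_cong image_constant_conv)
  then show ?thesis by (simp add: regular_bimodule_def env.lin_def[abs_def])
qed

lemma RM_module: "kmod Env RM"
proof -
  interpret E: kalg Env by (rule kalg_Env)
  have ex: "C \<in> carrier Env \<Longrightarrow> \<exists>f\<in>carrier env.F. C = Q.proj f" for C unfolding Env_eq Q.A_sel(1) by blast
  have "abelian_group RM"
  proof (rule abelian_groupI)
    show "\<exists>y\<in>carrier RM. y \<oplus>\<^bsub>RM\<^esub> x = \<zero>\<^bsub>RM\<^esub>" if "x \<in> carrier RM" for x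
      using that ks.l_neg[of x] ks.a_inv_closed[of x] unfolding RM_sel by blast
  qed (auto simp: RM_sel ks.a_ac)
  moreover have "left_module_axioms Env RM"
  proof (rule left_module_axioms.intro)
    fix a b x assume "a \<in> carrier Env" "b \<in> carrier Env" and x: "x \<in> carrier RM"
    then obtain f h where fh: "f \<in> carrier env.F" "a = Q.proj f" "h \<in> carrier env.F" "b = Q.proj h"
      using ex[of a] ex[of b] by blast
    show "(a \<oplus>\<^bsub>Env\<^esub> b) \<odot>\<^bsub>RM\<^esub> x = a \<odot>\<^bsub>RM\<^esub> x \<oplus>\<^bsub>RM\<^esub> b \<odot>\<^bsub>RM\<^esub> x"
      using fh x unfolding Env_eq by (simp add: RM_sel Q.proj_add RM_act klinD[OF env.klin_lin])
    show "(a \<otimes>\<^bsub>Env\<^esub> b) \<odot>\<^bsub>RM\<^esub> x = a \<odot>\<^bsub>RM\<^esub> (b \<odot>\<^bsub>RM\<^esub> x)"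
      using fh x unfolding Env_eq by (simp add: RM_sel Q.proj_mult RM_act env.lin_mult)
  next
    fix a x y assume "a \<in> carrier Env" and xy: "x \<in> carrier RM" "y \<in> carrier RM"
    then obtain f where f: "f \<in> carrier env.F" "a = Q.proj f" using ex by blast
    show "a \<odot>\<^bsub>RM\<^esub> (x \<oplus>\<^bsub>RM\<^esub> y) = a \<odot>\<^bsub>RM\<^esub> x \<oplus>\<^bsub>RM\<^esub> a \<odot>\<^bsub>RM\<^esub> y"
      using f xy by (simp add: RM_sel RM_act klinD[OF env.klin_lin_r])
  next
    fix a x assume "a \<in> carrier Env" and x: "x \<in> carrier RM"
    then obtain f where f: "f \<in> carrier env.F" "a = Q.proj f" using ex by blast
    show "a \<odot>\<^bsub>RM\<^esub> x \<in> carrier RM" using f x by (simp add: RM_sel RM_act)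
  next
    fix x assume x: "x \<in> carrier RM"
    show "\<one>\<^bsub>Env\<^esub> \<odot>\<^bsub>RM\<^esub> x = x"
      using x unfolding Env_eq Q.A_sel(3) by (simp add: RM_sel RM_act env.lin_one)
  qed
  ultimately have "left_module Env RM" by (intro left_module.intro E.is_ring)
  then show ?thesis by (intro kmod.intro kmod_axioms.intro kalg_Env)
qed

lemma tens_act: "a \<in> carrier R \<Longrightarrow> b \<in> carrier R \<Longrightarrow> x \<in> carrier R \<Longrightarrow> tens a b \<odot>\<^bsub>RM\<^esub> x = a \<otimes> x \<otimes> b"
  using env.lin_basis[of "(a, b)" x] by (simp add: tens_def RM_act basis_in PP_sel)

lemma RM_scalar: "x \<in> carrier R \<Longrightarrow> (c \<odot>\<^bsub>Env\<^esub> \<one>\<^bsub>Env\<^esub>) \<odot>\<^bsub>RM\<^esub> x = c \<odot> x"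
  unfolding tens_one klinD(3)[OF klin_tens_l[OF one_closed] one_closed, of c, symmetric]
  by (simp add: tens_act smult_mult_l)

lemma RM_base:
  shows "ksub (base_space Env RM) W \<longleftrightarrow> ksub R W" "S \<subseteq> carrier R \<Longrightarrow> kspan (base_space Env RM) S = kspan R S"
    "fd_subspace (base_space Env RM) W \<longleftrightarrow> fd_subspace R W"
proof -
  interpret M: kmod Env RM by (rule RM_module)
  show "ksub (base_space Env RM) W \<longleftrightarrow> ksub R W" "S \<subseteq> carrier R \<Longrightarrow> kspan (base_space Env RM) S = kspan R S"
    "fd_subspace (base_space Env RM) W \<longleftrightarrow> fd_subspace R W"
    using kspan_cong_carrier[OF M.kspace_bs ks.kspace_axioms] by (simp_all add: RM_sel RM_scalar)
qed

end

section \<open>The filter dimension of the invariants\<close>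

context inv_alg
begin

sublocale BE: kalg_envelope BB
  by (intro kalg_envelope.intro BB.kalg_axioms)

sublocale EM: kmod BE.Env BE.RM
  by (rule BE.RM_module)

lemma RM_B[simp]: "carrier BE.RM = B" "\<zero>\<^bsub>BE.RM\<^esub> = \<zero>" "add BE.RM = add A"
  by (simp_all add: BE.RM_sel)

lemma tens_act: "a \<in> B \<Longrightarrow> b \<in> B \<Longrightarrow> x \<in> B \<Longrightarrow> BE.tens a b \<odot>\<^bsub>BE.RM\<^esub> x = a \<otimes> x \<otimes> b"
  using BE.tens_act[of a b x] by simp

lemma act_B: "r \<in> carrier BE.Env \<Longrightarrow> x \<in> B \<Longrightarrow> r \<odot>\<^bsub>BE.RM\<^esub> x \<in> B"
  using EM.act_closed[of r x] by simp

lemma bs_smult: "x \<in> B \<Longrightarrow> c \<odot>\<^bsub>EM.bs\<^esub> x = c \<odot> x"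
  using BE.RM_scalar[of x c] by simp

lemma ksub_act_left:
  assumes "r \<in> carrier BE.Env" "ksub A X"
  shows "ksub A {y \<in> B. r \<odot>\<^bsub>BE.RM\<^esub> y \<in> X}"
proof -
  have 1: "r \<odot>\<^bsub>BE.RM\<^esub> \<zero> = \<zero>" using EM.act_zero[OF assms(1)] by simp
  have 2: "r \<odot>\<^bsub>BE.RM\<^esub> (x \<oplus> y) = r \<odot>\<^bsub>BE.RM\<^esub> x \<oplus> r \<odot>\<^bsub>BE.RM\<^esub> y" if "x \<in> B" "y \<in> B" for x y
    using EM.lm.smult_r_distr[OF assms(1), of x y] that by simp
  have 3: "r \<odot>\<^bsub>BE.RM\<^esub> (c \<odot> x) = c \<odot> (r \<odot>\<^bsub>BE.RM\<^esub> x)" if "x \<in> B" for c x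
    using EM.act_scal[OF assms(1), of x c] that bs_smult[OF that] bs_smult[OF act_B[OF assms(1) that]] by simp
  show ?thesis
    unfolding ksub_def
    using ksubD[OF assms(2)] ksubD(2-4)[OF B_ksub] 1 2 3 by auto
qed

lemma ksub_act_right:
  assumes "x \<in> B" "ksub A X"
  shows "ksub BE.Env {r \<in> carrier BE.Env. r \<odot>\<^bsub>BE.RM\<^esub> x \<in> X}"
proof -
  have 1: "\<zero>\<^bsub>BE.Env\<^esub> \<odot>\<^bsub>BE.RM\<^esub> x = \<zero>" using EM.zero_act[of x] assms by simp
  have 2: "(r \<oplus>\<^bsub>BE.Env\<^esub> r') \<odot>\<^bsub>BE.RM\<^esub> x = r \<odot>\<^bsub>BE.RM\<^esub> x \<oplus> r' \<odot>\<^bsub>BE.RM\<^esub> x"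
    if "r \<in> carrier BE.Env" "r' \<in> carrier BE.Env" for r r'
    using EM.lm.smult_l_distr[OF that, of x] assms by simp
  have 3: "(c \<odot>\<^bsub>BE.Env\<^esub> r) \<odot>\<^bsub>BE.RM\<^esub> x = c \<odot> (r \<odot>\<^bsub>BE.RM\<^esub> x)" if "r \<in> carrier BE.Env" for c r
    using EM.scal_act[OF that, of x c] assms(1) bs_smult[OF act_B[OF that assms(1)]] by simp
  show ?thesis
    unfolding ksub_def
    using ksubD(2-4)[OF assms(2)] EM.A.ks.zero_closed EM.A.ks.a_closed EM.A.ks.smult_in 1 2 3 by auto
qed

definition sandwich where
  "sandwich p x = kspan A {\<beta> \<otimes> x \<otimes> \<beta>' | \<beta> \<beta>'. \<beta> \<in> Bf p \<and> \<beta>' \<in> Bf p}"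

lemma Bf_carrier: "b \<in> Bf d \<Longrightarrow> b \<in> carrier A"
  using Bf_B by (meson B_in subsetD)

lemma sandwich_ksub: "x \<in> B \<Longrightarrow> ksub A (sandwich p x)"
  unfolding sandwich_def using Bf_carrier by (intro ks.kspan_sub) auto

lemma sandwich_base: "\<beta> \<in> Bf p \<Longrightarrow> \<beta>' \<in> Bf p \<Longrightarrow> \<beta> \<otimes> x \<otimes> \<beta>' \<in> sandwich p x"
  unfolding sandwich_def by (rule kspan_base) blast

lemma sandwich_mono: "p \<le> q \<Longrightarrow> sandwich p x \<subseteq> sandwich q x"
  unfolding sandwich_def using Bf_mono[of p q] by (intro kspan_mono) blast

lemma sandwich_Bf: "x \<in> Bf q \<Longrightarrow> sandwich p x \<subseteq> Bf (2 * p + q)"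
  unfolding sandwich_def
proof (rule kspan_least[OF _ Bf_ksub], safe)
  fix \<beta> \<beta>' assume "x \<in> Bf q" "\<beta> \<in> Bf p" "\<beta>' \<in> Bf p"
  then have "\<beta> \<otimes> x \<otimes> \<beta>' \<in> Bf (p + q + p)" by (intro Bf_mult)
  moreover have "p + q + p = 2 * p + q" by simp
  ultimately show "\<beta> \<otimes> x \<otimes> \<beta>' \<in> Bf (2 * p + q)" by (simp only:)
qed

lemma sandwich_sandwich:
  assumes "x \<in> B" "\<beta> \<in> Bf q" "\<beta>' \<in> Bf q"
  shows "sandwich p (\<beta> \<otimes> x \<otimes> \<beta>') \<subseteq> sandwich (p + q) x"
  unfolding sandwich_def[of p]
proof (rule kspan_least[OF _ sandwich_ksub[OF assms(1)]], safe)
  fix \<gamma> \<gamma>' assume g: "\<gamma> \<in> Bf p" "\<gamma>' \<in> Bf p"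
  have "\<beta>' \<otimes> \<gamma>' \<in> Bf (p + q)" using Bf_mult[OF assms(3) g(2)] by (simp add: add.commute)
  then have "(\<gamma> \<otimes> \<beta>) \<otimes> x \<otimes> (\<beta>' \<otimes> \<gamma>') \<in> sandwich (p + q) x"
    by (rule sandwich_base[OF Bf_mult[OF g(1) assms(2)]])
  moreover have "(\<gamma> \<otimes> \<beta>) \<otimes> x \<otimes> (\<beta>' \<otimes> \<gamma>') = \<gamma> \<otimes> (\<beta> \<otimes> x \<otimes> \<beta>') \<otimes> \<gamma>'"
    using assms g by (simp add: m_assoc Bf_carrier)
  ultimately show "\<gamma> \<otimes> (\<beta> \<otimes> x \<otimes> \<beta>') \<otimes> \<gamma>' \<in> sandwich (p + q) x" by simp
qed

text \<open>An element of the enveloping algebra is a finite combination of tensors, whose entries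
  have bounded degree; hence one d serves all x.\<close>

lemma act_sandwich: "r \<in> carrier BE.Env \<Longrightarrow> \<exists>d. \<forall>x\<in>B. r \<odot>\<^bsub>BE.RM\<^esub> x \<in> sandwich d x"
proof -
  let ?Q = "\<lambda>d. {r \<in> carrier BE.Env. \<forall>x\<in>B. r \<odot>\<^bsub>BE.RM\<^esub> x \<in> sandwich d x}"
  have Qs: "ksub BE.Env (?Q d)" for d
  proof -
    have "ksub BE.Env {r \<in> carrier BE.Env. r \<odot>\<^bsub>BE.RM\<^esub> x \<in> sandwich d x}" if "x \<in> B" for x
      by (rule ksub_act_right[OF that sandwich_ksub[OF that]])
    then show ?thesis
      using EM.A.ks.zero_closed EM.A.ks.a_closed EM.A.ks.smult_in by (auto simp: ksub_def)
  qed
  have Qm: "?Q d \<subseteq> ?Q d'" if "d \<le> d'" for d d'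
    using sandwich_mono[OF that] by blast
  assume "r \<in> carrier BE.Env"
  then have "r \<in> kspan BE.Env {BE.tens a b | a b. a \<in> B \<and> b \<in> B}" using BE.Env_span by simp
  then have "\<exists>d. r \<in> ?Q d"
  proof (induction rule: kspan.induct)
    case kspan_zero
    then show ?case using ksubD(2)[OF Qs] by blast
  next
    case (kspan_base s)
    then obtain a b where s: "s = BE.tens a b" "a \<in> B" "b \<in> B" by blast
    obtain d1 d2 where "a \<in> Bf d1" "b \<in> Bf d2" using s Bf_exhaust by meson
    then have ab: "a \<in> Bf (max d1 d2)" "b \<in> Bf (max d1 d2)"
      using Bf_mono[of d1 "max d1 d2"] Bf_mono[of d2 "max d1 d2"] by auto
    have "s \<odot>\<^bsub>BE.RM\<^esub> x \<in> sandwich (max d1 d2) x" if "x \<in> B" for x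
      using sandwich_base[OF ab, of x] tens_act[OF s(2,3) that] s(1) by simp
    moreover have "s \<in> carrier BE.Env" using BE.tens_in[of a b] s by simp
    ultimately show ?case by blast
  next
    case (kspan_add x y)
    then obtain d1 d2 where "x \<in> ?Q d1" "y \<in> ?Q d2" by blast
    then have "x \<in> ?Q (max d1 d2)" "y \<in> ?Q (max d1 d2)"
      using Qm[of d1 "max d1 d2"] Qm[of d2 "max d1 d2"] by auto
    then show ?case using ksubD(3)[OF Qs] by blast
  next
    case (kspan_smult x c)
    then show ?case using ksubD(4)[OF Qs] by blast
  qed
  then show ?thesis by blast
qed

text \<open>One half of the comparison of filtrations: i factors from a finite-dimensional space
  widen the sandwich around x at most linearly in i.\<close>

lemma power_sandwich:
  assumes "finite S" "S \<subseteq> carrier BE.Env"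
  shows "\<exists>d. \<forall>i. \<forall>r\<in>space_power BE.Env (kspan BE.Env S) i. \<forall>x\<in>B. r \<odot>\<^bsub>BE.RM\<^esub> x \<in> sandwich (d * i) x"
proof -
  have "\<exists>d. \<forall>s\<in>S. \<forall>x\<in>B. s \<odot>\<^bsub>BE.RM\<^esub> x \<in> sandwich d x"
    using assms
  proof (induction S rule: finite_induct)
    case (insert s S)
    then obtain d1 d2 where d: "\<forall>s\<in>S. \<forall>x\<in>B. s \<odot>\<^bsub>BE.RM\<^esub> x \<in> sandwich d1 x" "\<forall>x\<in>B. s \<odot>\<^bsub>BE.RM\<^esub> x \<in> sandwich d2 x"
      using act_sandwich[of s] by auto
    have "\<forall>t\<in>insert s S. \<forall>x\<in>B. t \<odot>\<^bsub>BE.RM\<^esub> x \<in> sandwich (max d1 d2) x"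
      using d sandwich_mono[of d1 "max d1 d2"] sandwich_mono[of d2 "max d1 d2"] by fastforce
    then show ?case by blast
  qed simp
  then obtain d where d: "\<And>s x. s \<in> S \<Longrightarrow> x \<in> B \<Longrightarrow> s \<odot>\<^bsub>BE.RM\<^esub> x \<in> sandwich d x" by blast
  let ?V = "kspan BE.Env S"
  have V: "?V \<subseteq> carrier BE.Env" by (rule ksub_subset[OF EM.A.ks.kspan_sub[OF assms(2)]])
  have dV: "r \<odot>\<^bsub>BE.RM\<^esub> x \<in> sandwich d x" if "r \<in> ?V" "x \<in> B" for r x
  proof -
    have "?V \<subseteq> {r \<in> carrier BE.Env. r \<odot>\<^bsub>BE.RM\<^esub> x \<in> sandwich d x}"
      using assms(2) d that(2) by (intro kspan_least ksub_act_right sandwich_ksub) auto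
    then show ?thesis using that(1) by blast
  qed
  have "r \<odot>\<^bsub>BE.RM\<^esub> x \<in> sandwich (d * i) x" if "r \<in> space_power BE.Env ?V i" "x \<in> B" for r x i
    using that
  proof (induction i arbitrary: r x)
    case 0
    have "\<one>\<^bsub>BE.Env\<^esub> \<odot>\<^bsub>BE.RM\<^esub> x = \<one> \<otimes> x \<otimes> \<one>" using EM.lm.smult_one[of x] 0(2) by simp
    also have "\<dots> \<in> sandwich (d * 0) x" by (rule sandwich_base[OF Bf_one Bf_one])
    finally have "kspan BE.Env {\<one>\<^bsub>BE.Env\<^esub>} \<subseteq> {r \<in> carrier BE.Env. r \<odot>\<^bsub>BE.RM\<^esub> x \<in> sandwich (d * 0) x}"
      using 0(2) by (intro kspan_least ksub_act_right sandwich_ksub) auto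
    then show ?case using 0(1) EM.A.space_power_eq(1)[OF V] by blast
  next
    case (Suc i)
    have "kspan BE.Env {a \<otimes>\<^bsub>BE.Env\<^esub> b | a b. a \<in> ?V \<and> b \<in> space_power BE.Env ?V i}
        \<subseteq> {r \<in> carrier BE.Env. r \<odot>\<^bsub>BE.RM\<^esub> x \<in> sandwich (d * Suc i) x}"
    proof (rule kspan_least[OF _ ksub_act_right[OF Suc.prems(2) sandwich_ksub[OF Suc.prems(2)]]], safe)
      fix a b assume a: "a \<in> ?V" and b: "b \<in> space_power BE.Env ?V i"
      have ac: "a \<in> carrier BE.Env" using a V by blast
      have bc: "b \<in> carrier BE.Env" using b EM.A.space_power_subset[OF V] by blast
      show "a \<otimes>\<^bsub>BE.Env\<^esub> b \<in> carrier BE.Env" using ac bc by (rule EM.A.m_closed)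
      have "b \<odot>\<^bsub>BE.RM\<^esub> x \<in> sandwich (d * i) x" using Suc.IH[OF b Suc.prems(2)] .
      moreover have "sandwich (d * i) x \<subseteq> {y \<in> B. a \<odot>\<^bsub>BE.RM\<^esub> y \<in> sandwich (d * Suc i) x}"
        unfolding sandwich_def[of "d * i"]
      proof (rule kspan_least[OF _ ksub_act_left[OF ac sandwich_ksub[OF Suc.prems(2)]]], safe)
        fix \<beta> \<beta>' assume be: "\<beta> \<in> Bf (d * i)" "\<beta>' \<in> Bf (d * i)"
        show y: "\<beta> \<otimes> x \<otimes> \<beta>' \<in> B" using be Bf_B Suc.prems(2) by (intro B_mult) auto
        show "a \<odot>\<^bsub>BE.RM\<^esub> (\<beta> \<otimes> x \<otimes> \<beta>') \<in> sandwich (d * Suc i) x"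
          using dV[OF a y] sandwich_sandwich[OF Suc.prems(2) be, of d] by auto
      qed
      ultimately have "a \<odot>\<^bsub>BE.RM\<^esub> (b \<odot>\<^bsub>BE.RM\<^esub> x) \<in> sandwich (d * Suc i) x" by blast
      then show "(a \<otimes>\<^bsub>BE.Env\<^esub> b) \<odot>\<^bsub>BE.RM\<^esub> x \<in> sandwich (d * Suc i) x"
        using EM.lm.smult_assoc[OF ac bc, of x] Suc.prems(2) by simp
    qed
    then show ?case using Suc.prems(1) EM.A.space_power_eq(2)[OF V] by blast
  qed
  then show ?thesis by blast
qed

text \<open>Stated for an abstract filtration Q in order to cover both the powers of a generating
  space and, as a constant family, a subalgebra. The second tensor factor multiplies in the opposite
  order, which does no harm here.\<close>

lemma tens_power:
  assumes "V \<subseteq> B" and Q: "\<And>k. ksub BE.Env (Q k)" "\<And>i j r r'. r \<in> Q i \<Longrightarrow> r' \<in> Q j \<Longrightarrow> r \<otimes>\<^bsub>BE.Env\<^esub> r' \<in> Q (i + j)"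
    "\<one>\<^bsub>BE.Env\<^esub> \<in> Q 0" "\<And>a. a \<in> V \<Longrightarrow> BE.tens a \<one> \<in> Q N \<and> BE.tens \<one> a \<in> Q N"
    and "a \<in> space_power BB V k"
  shows "BE.tens a \<one> \<in> Q (N * k) \<and> BE.tens \<one> a \<in> Q (N * k)"
proof -
  have V: "V \<subseteq> carrier BB" using assms(1) by simp
  have sub: "ksub BB {a \<in> B. BE.tens a \<one> \<in> Q k \<and> BE.tens \<one> a \<in> Q k}" for k
  proof -
    have l: "klin BB (carrier BB) BE.Env (\<lambda>a. BE.tens a \<one>)" by (rule BE.klin_tens_l) (simp add: B_one)
    have r: "klin BB (carrier BB) BE.Env (\<lambda>a. BE.tens \<one> a)" by (rule BE.klin_tens_r) (simp add: B_one)
    have "BE.tens \<zero> \<one> = \<zero>\<^bsub>BE.Env\<^esub>" "BE.tens \<one> \<zero> = \<zero>\<^bsub>BE.Env\<^esub>"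
      using BB.ks.klin_zero[OF l EM.A.ks.kspace_axioms] BB.ks.klin_zero[OF r EM.A.ks.kspace_axioms]
        ksubD(2)[OF B_ksub] by simp_all
    then show ?thesis
      using klinD(2,3)[OF l] klinD(2,3)[OF r] ksubD(2-4)[OF Q(1)] ksubD(2-4)[OF B_ksub]
      by (auto simp: ksub_def)
  qed
  have "space_power BB V k \<subseteq> {a \<in> B. BE.tens a \<one> \<in> Q (N * k) \<and> BE.tens \<one> a \<in> Q (N * k)}"
  proof (induction k)
    case 0
    have "BE.tens \<one> \<one> \<in> Q 0" using Q(3) BE.tens_one by simp
    then show ?case
      unfolding BB.space_power_eq(1)[OF V] by (intro kspan_least[OF _ sub]) (auto simp: B_one)
  next
    case (Suc k)
    show ?case
      unfolding BB.space_power_eq(2)[OF V]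
    proof (rule kspan_least[OF _ sub], safe)
      fix a b assume a: "a \<in> V" and b: "b \<in> space_power BB V k"
      have aB: "a \<in> B" using a assms(1) by blast
      have bB: "b \<in> B" and bQ: "BE.tens b \<one> \<in> Q (N * k)" "BE.tens \<one> b \<in> Q (N * k)" using b Suc by auto
      show "a \<otimes>\<^bsub>BB\<^esub> b \<in> B" using aB bB by (simp add: B_mult)
      have "BE.tens a \<one> \<otimes>\<^bsub>BE.Env\<^esub> BE.tens b \<one> = BE.tens (a \<otimes>\<^bsub>BB\<^esub> b) \<one>"
        using BE.tens_mult[of a \<one> b \<one>] aB bB by (simp add: B_one)
      then show "BE.tens (a \<otimes>\<^bsub>BB\<^esub> b) \<one> \<in> Q (N * Suc k)"
        using Q(2)[of "BE.tens a \<one>" N "BE.tens b \<one>" "N * k"] Q(4)[OF a] bQ by simp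
      have "BE.tens \<one> b \<otimes>\<^bsub>BE.Env\<^esub> BE.tens \<one> a = BE.tens \<one> (a \<otimes>\<^bsub>BB\<^esub> b)"
        using BE.tens_mult[of \<one> b \<one> a] aB bB by (simp add: B_one)
      then show "BE.tens \<one> (a \<otimes>\<^bsub>BB\<^esub> b) \<in> Q (N * Suc k)"
        using Q(2)[of "BE.tens \<one> b" "N * k" "BE.tens \<one> a" N] Q(4)[OF a] bQ by (simp add: add.commute)
    qed
  qed
  then show ?thesis using assms(6) by blast
qed

lemma tens_split: "a \<in> B \<Longrightarrow> b \<in> B \<Longrightarrow> BE.tens a b = BE.tens a \<one> \<otimes>\<^bsub>BE.Env\<^esub> BE.tens \<one> b"
  using BE.tens_mult[of a \<one> \<one> b] by (simp add: B_one)

text \<open>The enveloping algebra maps onto B by acting on 1, and B is infinite-dimensional because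
  the dimensions of the \<open>Bf j\<close> are unbounded.\<close>

lemma Env_infinite: "\<not> vectorspace.fin_dim class_ring BE.Env"
proof
  assume fin: "vectorspace.fin_dim class_ring BE.Env"
  have up: "BE.Env\<lparr>carrier := carrier BE.Env\<rparr> = BE.Env" by simp
  have "fd_subspace BE.Env (carrier BE.Env)"
    using fin EM.A.ks.ksub_carrier unfolding fd_subspace_def EM.A.ks.ksub_iff up by simp
  then have "fd_subspace EM.bs ((\<lambda>r. r \<odot>\<^bsub>BE.RM\<^esub> \<one>) ` carrier BE.Env)"
    using EM.klin_act_r[of \<one> "carrier BE.Env"] B_one
    by (intro rank_nullity_sub(1)[OF EM.A.ks.kspace_axioms EM.kspace_bs]) auto
  moreover have "(\<lambda>r. r \<odot>\<^bsub>BE.RM\<^esub> \<one>) ` carrier BE.Env = B"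
  proof
    show "(\<lambda>r. r \<odot>\<^bsub>BE.RM\<^esub> \<one>) ` carrier BE.Env \<subseteq> B" using act_B B_one by auto
    show "B \<subseteq> (\<lambda>r. r \<odot>\<^bsub>BE.RM\<^esub> \<one>) ` carrier BE.Env"
    proof
      fix b assume b: "b \<in> B"
      then have "b = BE.tens b \<one> \<odot>\<^bsub>BE.RM\<^esub> \<one>" using tens_act[of b \<one> \<one>] B_one by simp
      moreover have "BE.tens b \<one> \<in> carrier BE.Env" using BE.tens_in[of b \<one>] b B_one by simp
      ultimately show "b \<in> (\<lambda>r. r \<odot>\<^bsub>BE.RM\<^esub> \<one>) ` carrier BE.Env" by blast
    qed
  qed
  ultimately have "fd_subspace BB B" using BE.RM_base(3) by simp
  then obtain d where d: "B \<subseteq> Bf d" using fd_Bf by blast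
  obtain K c0 where K: "\<And>j. (j + 1) ^ (2 * n) \<le> K * subspace_dim A (Bf (j + c0))" using dim_Bf_ge by blast
  let ?D = "subspace_dim A (Bf d)"
  have "subspace_dim A (Bf j) \<le> ?D" for j
    using Bf_B d by (intro ks.fd_mono(2)[OF Bf_fd Bf_ksub]) auto
  \<comment> \<open>The index j = K D makes the left-hand side exceed the bound K D.\<close>
  then have "(K * ?D + 1) ^ (2 * n) \<le> K * ?D" using K[of "K * ?D"] order_trans mult_le_mono2 by meson
  moreover have "K * ?D + 1 \<le> (K * ?D + 1) ^ (2 * n)" using n_pos by (intro self_le_power) auto
  ultimately show False by linarith
qed

lemma space_act_env:
  assumes "V \<subseteq> carrier BE.Env" "W \<subseteq> B"
  shows "space_act BE.Env BE.RM V W = kspan A {a \<odot>\<^bsub>BE.RM\<^esub> x | a x. a \<in> V \<and> x \<in> W}"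
    "ksub A (space_act BE.Env BE.RM V W)" "space_act BE.Env BE.RM V W \<subseteq> B"
proof -
  have Z: "{a \<odot>\<^bsub>BE.RM\<^esub> x | a x. a \<in> V \<and> x \<in> W} \<subseteq> B" using assms act_B by blast
  then show 1: "space_act BE.Env BE.RM V W = kspan A {a \<odot>\<^bsub>BE.RM\<^esub> x | a x. a \<in> V \<and> x \<in> W}"
    using EM.space_act_eq(1)[of V W] assms BE.RM_base(2)[of "{a \<odot>\<^bsub>BE.RM\<^esub> x | a x. a \<in> V \<and> x \<in> W}"] by simp
  show "space_act BE.Env BE.RM V W \<subseteq> B" unfolding 1 by (rule kspan_least[OF Z B_ksub])
  show "ksub A (space_act BE.Env BE.RM V W)" unfolding 1 using Z by (intro ks.kspan_sub) (meson B_in subset_iff)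
qed

lemma space_act_base: "V \<subseteq> carrier BE.Env \<Longrightarrow> W \<subseteq> B \<Longrightarrow> r \<in> V \<Longrightarrow> x \<in> W \<Longrightarrow> r \<odot>\<^bsub>BE.RM\<^esub> x \<in> space_act BE.Env BE.RM V W"
  unfolding space_act_env(1) by (rule kspan_base) blast

end

section \<open>The return function for arbitrary generators and an arbitrary generating
  subspace\<close>

locale fdim_data = inv_alg A m z zs Gr e0 n
  for A :: "('k::field_char_0, 'a) module" (structure) and m z zs Gr e0 n +
  fixes S and M0
  assumes data: "filter_dim_data (enveloping_algebra (A\<lparr>carrier := galois.B A Gr\<rparr>))
    (regular_bimodule (A\<lparr>carrier := galois.B A Gr\<rparr>)) S M0"
begin

definition R1 where "R1 = kspan BE.Env (insert \<one>\<^bsub>BE.Env\<^esub> S)"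

abbreviation Rp where "Rp \<equiv> space_power BE.Env R1"
abbreviation act where "act V W \<equiv> space_act BE.Env BE.RM V W"

lemma S: "finite S" "S \<subseteq> carrier BE.Env" "algebra_generated_by BE.Env S"
  using data by (auto simp: filter_dim_data_def algebra_generated_by_def)

lemma R1_sub: "R1 \<subseteq> carrier BE.Env"
  unfolding R1_def using S(2) by (intro ksub_subset[OF EM.A.ks.kspan_sub]) auto

lemma R1_eq: "LinearCombinations.module.span class_ring BE.Env (insert \<one>\<^bsub>BE.Env\<^esub> S) = R1"
  unfolding R1_def using S(2) by (intro EM.A.ks.kspan_eq) auto

lemma R1_one: "\<one>\<^bsub>BE.Env\<^esub> \<in> R1"
  unfolding R1_def by (rule kspan_base) simp

lemma Rp_sub: "Rp k \<subseteq> carrier BE.Env"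
  by (rule EM.A.space_power_subset[OF R1_sub])

lemma Rp_ksub: "ksub BE.Env (Rp k)"
  by (rule EM.A.space_power_eq(3)[OF R1_sub])

lemma Rp_mono: "i \<le> j \<Longrightarrow> Rp i \<subseteq> Rp j"
  by (rule EM.A.space_power_mono[OF R1_sub R1_one])

lemma Rp_mult: "r \<in> Rp i \<Longrightarrow> r' \<in> Rp j \<Longrightarrow> r \<otimes>\<^bsub>BE.Env\<^esub> r' \<in> Rp (i + j)"
  by (rule EM.A.space_power_mult[OF R1_sub])

lemma Rp_one: "\<one>\<^bsub>BE.Env\<^esub> \<in> Rp k"
proof -
  have "\<one>\<^bsub>BE.Env\<^esub> \<in> Rp 0" unfolding EM.A.space_power_eq(1)[OF R1_sub] by (rule kspan_base) simp
  then show ?thesis using Rp_mono[of 0 k] by blast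
qed

lemma Rp_exhaust: "r \<in> carrier BE.Env \<Longrightarrow> \<exists>k. r \<in> Rp k"
proof -
  let ?T = "\<Union>k. Rp k"
  have two: "\<exists>k. r \<in> Rp k \<and> r' \<in> Rp k" if rr: "r \<in> ?T" "r' \<in> ?T" for r r'
  proof -
    obtain i where "r \<in> Rp i" using rr(1) by blast
    moreover obtain j where "r' \<in> Rp j" using rr(2) by blast
    ultimately have "r \<in> Rp (max i j)" "r' \<in> Rp (max i j)"
      using Rp_mono[of i "max i j"] Rp_mono[of j "max i j"] by auto
    then show ?thesis by blast
  qed
  have "subring ?T BE.Env"
  proof (rule EM.A.subringI)
    show "?T \<subseteq> carrier BE.Env" using Rp_sub by blast
    show "\<one>\<^bsub>BE.Env\<^esub> \<in> ?T" using Rp_one by blast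
    show "\<ominus>\<^bsub>BE.Env\<^esub> h \<in> ?T" if "h \<in> ?T" for h
      using that EM.A.ks.ksub_neg[OF Rp_ksub] by blast
    show "h1 \<otimes>\<^bsub>BE.Env\<^esub> h2 \<in> ?T" if "h1 \<in> ?T" "h2 \<in> ?T" for h1 h2
      using two[OF that] Rp_mult by blast
    show "h1 \<oplus>\<^bsub>BE.Env\<^esub> h2 \<in> ?T" if "h1 \<in> ?T" "h2 \<in> ?T" for h1 h2
      using two[OF that] ksubD(3)[OF Rp_ksub] by blast
  qed
  moreover have "\<forall>c. \<forall>a\<in>?T. c \<odot>\<^bsub>BE.Env\<^esub> a \<in> ?T" using ksubD(4)[OF Rp_ksub] by blast
  moreover have "S \<subseteq> ?T"
  proof
    fix s assume "s \<in> S"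
    then have "s \<in> R1" unfolding R1_def by (intro kspan_base) simp
    then show "s \<in> ?T" using EM.A.space_power_base[OF R1_sub] by blast
  qed
  ultimately have "carrier BE.Env \<subseteq> ?T" using S(3) unfolding algebra_generated_by_def by meson
  then show "r \<in> carrier BE.Env \<Longrightarrow> \<exists>k. r \<in> Rp k" by blast
qed

text \<open>The converse of \<open>power_sandwich\<close>: tensors with entries of degree p are
  reached in linearly many steps, by \<open>Bf_power\<close> for each factor of a \<otimes> b = (a
  \<otimes> 1) (1 \<otimes> b).\<close>

lemma tens_Rp: "\<exists>N\<ge>1. \<forall>p a b. a \<in> Bf p \<longrightarrow> b \<in> Bf p \<longrightarrow> BE.tens a b \<in> Rp (N * (p + 2))"
proof -
  obtain d0 where d0: "\<And>j. Bf j \<subseteq> space_power BB (Bf d0) (j + 2)" using Bf_power by blast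
  obtain T where T: "finite T" "T \<subseteq> Bf d0" "kspan A T = Bf d0" using Bf_fd[of d0] by (auto simp: ks.fd_iff)
  have TB: "T \<subseteq> B" using T(2) Bf_B by blast
  have "\<exists>N. \<forall>t\<in>T. BE.tens t \<one> \<in> Rp N \<and> BE.tens \<one> t \<in> Rp N"
    using T(1) TB
  proof (induction T rule: finite_induct)
    case (insert t T)
    then obtain N1 where N1: "\<forall>t\<in>T. BE.tens t \<one> \<in> Rp N1 \<and> BE.tens \<one> t \<in> Rp N1" by auto
    obtain N2 where N2: "BE.tens t \<one> \<in> Rp N2" using Rp_exhaust[OF BE.tens_in[of t \<one>]] insert.prems B_one by auto
    obtain N3 where N3: "BE.tens \<one> t \<in> Rp N3" using Rp_exhaust[OF BE.tens_in[of \<one> t]] insert.prems B_one by auto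
    let ?N = "N1 + N2 + N3"
    have "Rp N1 \<subseteq> Rp ?N" by (rule Rp_mono) simp
    moreover have "Rp N2 \<subseteq> Rp ?N" by (rule Rp_mono) simp
    moreover have "Rp N3 \<subseteq> Rp ?N" by (rule Rp_mono) simp
    ultimately have "\<forall>s\<in>insert t T. BE.tens s \<one> \<in> Rp ?N \<and> BE.tens \<one> s \<in> Rp ?N" using N1 N2 N3 by blast
    then show ?case by blast
  qed simp
  then obtain N where N: "\<forall>t\<in>T. BE.tens t \<one> \<in> Rp N \<and> BE.tens \<one> t \<in> Rp N" by blast
  have VN: "BE.tens a \<one> \<in> Rp N \<and> BE.tens \<one> a \<in> Rp N" if "a \<in> Bf d0" for a
  proof -
    have l: "klin BB (carrier BB) BE.Env (\<lambda>a. BE.tens a \<one>)" by (rule BE.klin_tens_l) (simp add: B_one)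
    have r: "klin BB (carrier BB) BE.Env (\<lambda>a. BE.tens \<one> a)" by (rule BE.klin_tens_r) (simp add: B_one)
    have a: "a \<in> kspan BB T" using that T(3) by simp
    have T': "T \<subseteq> carrier BB" using TB by simp
    have "(\<lambda>a. BE.tens a \<one>) a \<in> kspan BE.Env ((\<lambda>a. BE.tens a \<one>) ` T)"
      using klin_kspan[OF l BB.ks.kspace_axioms EM.A.ks.kspace_axioms T'] a by blast
    moreover have "kspan BE.Env ((\<lambda>a. BE.tens a \<one>) ` T) \<subseteq> Rp N"
      using N by (intro kspan_least[OF _ Rp_ksub]) blast
    moreover have "(\<lambda>a. BE.tens \<one> a) a \<in> kspan BE.Env ((\<lambda>a. BE.tens \<one> a) ` T)"
      using klin_kspan[OF r BB.ks.kspace_axioms EM.A.ks.kspace_axioms T'] a by blast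
    moreover have "kspan BE.Env ((\<lambda>a. BE.tens \<one> a) ` T) \<subseteq> Rp N"
      using N by (intro kspan_least[OF _ Rp_ksub]) blast
    ultimately show ?thesis by blast
  qed
  \<comment> \<open>The factor 2 N pays for the two tensor factors; the summand 1 secures a positive
    constant.\<close>
  have "BE.tens a b \<in> Rp ((2 * N + 1) * (p + 2))" if "a \<in> Bf p" "b \<in> Bf p" for a b p
  proof -
    have ab: "a \<in> B" "b \<in> B" using that Bf_B by auto
    have "BE.tens a \<one> \<in> Rp (N * (p + 2)) \<and> BE.tens \<one> a \<in> Rp (N * (p + 2))"
      by (rule tens_power[OF Bf_B[of d0] Rp_ksub Rp_mult Rp_one VN subsetD[OF d0 that(1)]])
    moreover have "BE.tens b \<one> \<in> Rp (N * (p + 2)) \<and> BE.tens \<one> b \<in> Rp (N * (p + 2))"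
      by (rule tens_power[OF Bf_B[of d0] Rp_ksub Rp_mult Rp_one VN subsetD[OF d0 that(2)]])
    ultimately have "BE.tens a b \<in> Rp (N * (p + 2) + N * (p + 2))"
      using Rp_mult tens_split[OF ab] by metis
    moreover have "N * (p + 2) + N * (p + 2) \<le> (2 * N + 1) * (p + 2)" by simp
    ultimately show ?thesis using Rp_mono by blast
  qed
  then show ?thesis by (intro exI[of _ "2 * N + 1"]) auto
qed

lemma M0: "fd_subspace A M0" "M0 \<subseteq> B" "\<exists>q. M0 \<subseteq> Bf q" "submodule_gen BE.Env BE.RM M0 = B"
proof -
  have 1: "fd_subspace BB M0" using data BE.RM_base(3) by (simp add: filter_dim_data_def)
  then show "M0 \<subseteq> B" using BB.ks.fd_subset by simp
  then show "fd_subspace A M0" using ks.fd_carrier_update[OF B_ksub] 1 by blast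
  show "\<exists>q. M0 \<subseteq> Bf q" by (rule fd_Bf[OF 1])
  show "submodule_gen BE.Env BE.RM M0 = B" using data by (simp add: filter_dim_data_def)
qed

lemma act_act:
  assumes "W \<subseteq> B" "r \<in> Rp k" "x \<in> act (Rp j) W"
  shows "r \<odot>\<^bsub>BE.RM\<^esub> x \<in> act (Rp (k + j)) W"
proof -
  have rc: "r \<in> carrier BE.Env" using assms(2) Rp_sub by blast
  have "act (Rp j) W \<subseteq> {y \<in> B. r \<odot>\<^bsub>BE.RM\<^esub> y \<in> act (Rp (k + j)) W}"
    unfolding space_act_env(1)[OF Rp_sub[of j] assms(1)]
  proof (rule kspan_least[OF _ ksub_act_left[OF rc space_act_env(2)[OF Rp_sub assms(1)]]], safe)
    fix a x assume a: "a \<in> Rp j" and x: "x \<in> W"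
    have ac: "a \<in> carrier BE.Env" using a Rp_sub by blast
    have xB: "x \<in> B" using x assms(1) by blast
    show "a \<odot>\<^bsub>BE.RM\<^esub> x \<in> B" by (rule act_B[OF ac xB])
    have "(r \<otimes>\<^bsub>BE.Env\<^esub> a) \<odot>\<^bsub>BE.RM\<^esub> x \<in> act (Rp (k + j)) W"
      by (rule space_act_base[OF Rp_sub assms(1) Rp_mult[OF assms(2) a] x])
    then show "r \<odot>\<^bsub>BE.RM\<^esub> (a \<odot>\<^bsub>BE.RM\<^esub> x) \<in> act (Rp (k + j)) W"
      using EM.lm.smult_assoc[OF rc ac, of x] xB by simp
  qed
  then show ?thesis using assms(3) by blast
qed

lemma one_act_M0: "\<exists>c. \<one> \<in> act (Rp c) M0"
proof -
  have "\<one> \<in> kspan A {a \<odot>\<^bsub>BE.RM\<^esub> x | a x. a \<in> carrier BE.Env \<and> x \<in> M0}"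
    using B_one M0(4) EM.submodule_gen_eq(1)[of M0] M0(2) space_act_env(1)[OF subset_refl M0(2)]
      EM.space_act_eq(1)[OF subset_refl, of M0] by simp
  moreover have mono: "act (Rp i) M0 \<subseteq> act (Rp j) M0" if "i \<le> j" for i j
    unfolding space_act_env(1)[OF Rp_sub M0(2)] using Rp_mono[OF that] by (intro kspan_mono) blast
  have "x \<in> kspan A {a \<odot>\<^bsub>BE.RM\<^esub> x | a x. a \<in> carrier BE.Env \<and> x \<in> M0} \<Longrightarrow> \<exists>c. x \<in> act (Rp c) M0" for x
  proof (induction rule: kspan.induct)
    case kspan_zero
    then show ?case using ksubD(2)[OF space_act_env(2)[OF Rp_sub M0(2)]] by blast
  next
    case (kspan_base s)
    then obtain a x where s: "s = a \<odot>\<^bsub>BE.RM\<^esub> x" "a \<in> carrier BE.Env" "x \<in> M0" by blast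
    obtain c where "a \<in> Rp c" using Rp_exhaust[OF s(2)] by blast
    then show ?case using space_act_base[OF Rp_sub M0(2) _ s(3)] s(1) by blast
  next
    case (kspan_add x y)
    then obtain i j where "x \<in> act (Rp i) M0" "y \<in> act (Rp j) M0" by blast
    then have "x \<in> act (Rp (max i j)) M0" "y \<in> act (Rp (max i j)) M0"
      using mono[of i "max i j"] mono[of j "max i j"] by auto
    then show ?case using ksubD(3)[OF space_act_env(2)[OF Rp_sub M0(2)]] by blast
  next
    case (kspan_smult x c)
    then show ?case using ksubD(4)[OF space_act_env(2)[OF Rp_sub M0(2)]] by blast
  qed
  ultimately show ?thesis by blast
qed

abbreviation ret where "ret \<equiv> return_function BE.Env BE.RM R1 M0"

text \<open>A generating M' contains a nonzero b, of degree linear in i. Simplicity with linear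
  bounds returns from b to 1, and from there to M0, within linearly many steps.\<close>

lemma ret_le: "\<exists>C. \<forall>i. ret i \<le> enat (C * (i + 1) ^ 1)"
proof -
  obtain N where N: "\<And>p a b. a \<in> Bf p \<Longrightarrow> b \<in> Bf p \<Longrightarrow> BE.tens a b \<in> Rp (N * (p + 2))" using tens_Rp by blast
  obtain q where q: "M0 \<subseteq> Bf q" using M0(3) by blast
  have "\<exists>d. \<forall>i. \<forall>r\<in>Rp i. \<forall>x\<in>B. r \<odot>\<^bsub>BE.RM\<^esub> x \<in> sandwich (d * i) x"
    unfolding R1_def using S by (intro power_sandwich) auto
  then obtain d where d: "\<And>i r x. r \<in> Rp i \<Longrightarrow> x \<in> B \<Longrightarrow> r \<odot>\<^bsub>BE.RM\<^esub> x \<in> sandwich (d * i) x" by blast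
  define C where "C = N * (q + cK * (2 * d + q + 1) + 2)"
  have "ret i \<le> enat (C * (i + 1) ^ 1)" for i
  proof -
    define e where "e = 2 * (d * i) + q"
    define p where "p = q + cK * (e + 1)"
    have "M0 \<subseteq> act (Rp (N * (p + 2))) M'"
      if M': "fd_subspace EM.bs M'" "M' \<subseteq> act (Rp i) M0" "submodule_gen BE.Env BE.RM M' = carrier BE.RM" for M'
    proof -
      have M'B: "M' \<subseteq> B" using EM.bs.fd_subset[OF M'(1)] by simp
      have "\<exists>b\<in>M'. b \<noteq> \<zero>"
      proof (rule ccontr)
        assume "\<not> ?thesis"
        then have "M' \<subseteq> {\<zero>}" by blast
        moreover have "Module.submodule {\<zero>} BE.Env BE.RM"
          using EM.act_zero ksubD(2)[OF B_ksub] by (simp add: EM.smod_iff)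
        ultimately have "B \<subseteq> {\<zero>}" using EM.submodule_gen_least[of "{\<zero>}" M'] M'(3) by simp
        then show False using B_one one_neq_zero by blast
      qed
      then obtain b where b: "b \<in> M'" "b \<noteq> \<zero>" by blast
      have "act (Rp i) M0 \<subseteq> Bf e"
        unfolding space_act_env(1)[OF Rp_sub M0(2)]
      proof (rule kspan_least[OF _ Bf_ksub], safe)
        fix a x assume "a \<in> Rp i" "x \<in> M0"
        then show "a \<odot>\<^bsub>BE.RM\<^esub> x \<in> Bf e"
          unfolding e_def using d[of a i x] M0(2) q sandwich_Bf[of x q "d * i"] by blast
      qed
      then have be: "b \<in> Bf e" using b(1) M'(2) by blast
      have bB: "b \<in> B" using b(1) M'B by blast
      show ?thesis
      proof
        fix x assume x: "x \<in> M0"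
        have xq: "x \<in> Bf q" using x q by blast
        have xA: "x \<in> carrier A" by (rule Bf_carrier[OF xq])
        \<comment> \<open>Expand x = x 1 with 1 a combination of products \<beta> b \<beta>'; x
          joins the left factor and raises its degree by q.\<close>
        have "x \<otimes> \<one> \<in> (\<lambda>y. x \<otimes> y) ` kspan A {\<beta> \<otimes> b \<otimes> \<beta>' | \<beta> \<beta>'. \<beta> \<in> Bf (cK * (e + 1)) \<and> \<beta>' \<in> Bf (cK * (e + 1))}"
          by (rule imageI[OF sandwich_one[OF be b(2)]])
        also have "\<dots> = kspan A ((\<lambda>y. x \<otimes> y) ` {\<beta> \<otimes> b \<otimes> \<beta>' | \<beta> \<beta>'. \<beta> \<in> Bf (cK * (e + 1)) \<and> \<beta>' \<in> Bf (cK * (e + 1))})"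
          using bB Bf_carrier by (intro klin_kspan[OF klin_mult_l[OF xA subset_refl] ks.kspace_axioms ks.kspace_axioms]) auto
        also have "\<dots> \<subseteq> act (Rp (N * (p + 2))) M'"
        proof (rule kspan_least[OF _ space_act_env(2)[OF Rp_sub M'B]], safe)
          fix \<beta> \<beta>' assume be': "\<beta> \<in> Bf (cK * (e + 1))" "\<beta>' \<in> Bf (cK * (e + 1))"
          have 1: "x \<otimes> \<beta> \<in> Bf p" unfolding p_def by (rule Bf_mult[OF xq be'(1)])
          have 2: "\<beta>' \<in> Bf p" using be'(2) Bf_mono[of "cK * (e + 1)" p] by (auto simp: p_def)
          have 12: "x \<otimes> \<beta> \<in> B" "\<beta>' \<in> B" using 1 2 Bf_B by auto
          have "BE.tens (x \<otimes> \<beta>) \<beta>' \<odot>\<^bsub>BE.RM\<^esub> b \<in> act (Rp (N * (p + 2))) M'"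
            by (rule space_act_base[OF Rp_sub M'B N[OF 1 2] b(1)])
          moreover have "BE.tens (x \<otimes> \<beta>) \<beta>' \<odot>\<^bsub>BE.RM\<^esub> b = x \<otimes> (\<beta> \<otimes> b \<otimes> \<beta>')"
            using tens_act[OF 12 bB] xA Bf_carrier[OF be'(1)] Bf_carrier[OF be'(2)] bB by (simp add: m_assoc)
          ultimately show "x \<otimes> (\<beta> \<otimes> b \<otimes> \<beta>') \<in> act (Rp (N * (p + 2))) M'" by simp
        qed
        finally show "x \<in> act (Rp (N * (p + 2))) M'" using xA by simp
      qed
    qed
    then have ret: "ret i \<le> enat (N * (p + 2))"
      unfolding return_function_def by (intro Inf_lower) blast
    have "p + 2 \<le> (q + cK * (2 * d + q + 1) + 2) * (i + 1)"
      by (simp add: p_def e_def algebra_simps)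
    from mult_le_mono2[OF this, of N] have "N * (p + 2) \<le> C * (i + 1) ^ 1"
      unfolding C_def by (simp only: mult.assoc power_one_right)
    then have "enat (N * (p + 2)) \<le> enat (C * (i + 1) ^ 1)" by (simp only: enat_ord_simps)
    then show ?thesis by (rule order_trans[OF ret])
  qed
  then show ?thesis by blast
qed

text \<open>A finite infimum in \<open>enat\<close> comes from a nonempty set, and a nonempty set of
  this type contains its infimum.\<close>

lemma ret_attained:
  assumes "ret i = enat j" "fd_subspace EM.bs M'" "M' \<subseteq> act (Rp i) M0" "submodule_gen BE.Env BE.RM M' = carrier BE.RM"
  shows "M0 \<subseteq> act (Rp j) M'"
proof -
  let ?P = "\<lambda>j. \<forall>M'. fd_subspace EM.bs M' \<and> M' \<subseteq> act (Rp i) M0 \<and> submodule_gen BE.Env BE.RM M' = carrier BE.RM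
    \<longrightarrow> M0 \<subseteq> act (Rp j) M'"
  let ?X = "{enat j | j. ?P j}"
  have "Inf ?X = enat j" using assms(1) by (simp add: return_function_def)
  then have "?X \<noteq> {}" by (metis Inf_empty enat.distinct(1) top_enat_def)
  then have "Inf ?X \<in> ?X" unfolding Inf_enat_def by (metis (mono_tags, lifting) LeastI ex_in_conv)
  then show ?thesis using \<open>Inf ?X = enat j\<close> assms(2-4) by auto
qed

text \<open>With an exponent s < 1, the return from a b in B_t would end in a sandwich of width p of
  order t^s. By the hypothesis \<open>box\<close> this forces dim B_t to be of order at most t^(n (1
  + s)), too small against t^(2 n).\<close>

lemma ret_ge:
  assumes box: "\<And>p i. (p + 1) ^ n * (p + i + 1) ^ n < subspace_dim A (Bf i) \<Longrightarrow> \<exists>b\<in>Bf i. b \<noteq> \<zero> \<and> \<one> \<notin> sandwich p b"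
  shows "1 \<le> growth_exponent ret"
proof (rule ccontr)
  assume "\<not> ?thesis"
  then have "growth_exponent ret < ereal 1" by (simp add: one_ereal_def not_le)
  then obtain s0 where "growth_exponent ret < ereal s0" "ereal s0 < ereal 1" using ereal_dense2 by blast
  \<comment> \<open>A nonnegative exponent is needed for monotonicity of \<open>powr\<close> in the
    base.\<close>
  define s where "s = max s0 0"
  have s: "0 \<le> s" "s < 1" using \<open>ereal s0 < ereal 1\<close> by (auto simp: s_def)
  have "growth_exponent ret < ereal s"
    using \<open>growth_exponent ret < ereal s0\<close> by (rule less_le_trans) (simp add: s_def)
  from growth_exponent_less[OF this] obtain I0 where
    I0: "\<And>i. i \<ge> I0 \<Longrightarrow> ereal_of_enat (ret i) \<le> ereal (real i powr s)" by (auto simp: eventually_sequentially)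
  obtain N where N: "N \<ge> 1" "\<And>p a b. a \<in> Bf p \<Longrightarrow> b \<in> Bf p \<Longrightarrow> BE.tens a b \<in> Rp (N * (p + 2))" using tens_Rp by blast
  have "\<exists>d. \<forall>i. \<forall>r\<in>Rp i. \<forall>x\<in>B. r \<odot>\<^bsub>BE.RM\<^esub> x \<in> sandwich (d * i) x"
    unfolding R1_def using S by (intro power_sandwich) auto
  then obtain d where d: "\<And>i r x. r \<in> Rp i \<Longrightarrow> x \<in> B \<Longrightarrow> r \<odot>\<^bsub>BE.RM\<^esub> x \<in> sandwich (d * i) x" by blast
  obtain c where c: "\<one> \<in> act (Rp c) M0" using one_act_M0 by blast
  obtain K c0 where K: "K \<ge> 1" "\<And>j. (j + 1) ^ (2 * n) \<le> K * subspace_dim A (Bf (j + c0))" using dim_Bf_ge by blast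
  \<comment> \<open>Otherwise \<open>box\<close> gives b in \<open>Bf t\<close> with 1 outside its
    sandwich of width p. But the line through b competes in the return function at N (t + 2) + c, so
    j steps lead from it back to M0 and c more to 1; each of these steps widens the sandwich by d,
    hence p = d (c + j).\<close>
  have key: "subspace_dim A (Bf t) \<le> (p + 1) ^ n * (p + t + 1) ^ n"
    if ret: "ret (N * (t + 2) + c) = enat j" and p: "p = d * (c + j)" for t j p
  proof (rule ccontr)
    assume "\<not> ?thesis"
    then obtain b where b: "b \<in> Bf t" "b \<noteq> \<zero>" "\<one> \<notin> sandwich p b" using box[of p t] by auto
    have bB: "b \<in> B" using b(1) Bf_B by blast
    let ?M' = "kspan A {b}"
    have M'B: "?M' \<subseteq> B" using bB by (intro kspan_least[OF _ B_ksub]) simp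
    have fd: "fd_subspace EM.bs ?M'"
      using BB.ks.fd_kspan(1)[of "{b}"] bB BE.RM_base(3) by simp
    have "b = BE.tens b \<one> \<odot>\<^bsub>BE.RM\<^esub> \<one>" using tens_act[OF bB B_one B_one] bB by simp
    also have "\<dots> \<in> act (Rp (N * (t + 2) + c)) M0"
      by (rule act_act[OF M0(2) N(2)[OF b(1) Bf_one] c])
    finally have sub: "?M' \<subseteq> act (Rp (N * (t + 2) + c)) M0"
      by (intro kspan_least[OF _ space_act_env(2)[OF Rp_sub M0(2)]]) simp
    \<comment> \<open>The line through b generates the bimodule, again by simplicity with
      \<open>sandwich_one\<close>.\<close>
    have gen: "submodule_gen BE.Env BE.RM ?M' = carrier BE.RM"
    proof -
      let ?N = "submodule_gen BE.Env BE.RM ?M'"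
      have sm: "Module.submodule ?N BE.Env BE.RM" "?M' \<subseteq> ?N"
        using EM.submodule_gen_eq(2,3)[of ?M'] M'B by auto
      have bN: "b \<in> ?N" using sm(2) kspan_base[of b "{b}"] by blast
      have NA: "ksub A ?N"
        using EM.smodD(5)[OF sm(1)] BE.RM_base(1) ksub_subset[OF B_ksub] by (auto simp: ksub_def)
      have "kspan A {\<beta> \<otimes> b \<otimes> \<beta>' | \<beta> \<beta>'. \<beta> \<in> Bf (cK * (t + 1)) \<and> \<beta>' \<in> Bf (cK * (t + 1))} \<subseteq> ?N"
      proof (rule kspan_least[OF _ NA], safe)
        fix \<beta> \<beta>' assume "\<beta> \<in> Bf (cK * (t + 1))" "\<beta>' \<in> Bf (cK * (t + 1))"
        then have be: "\<beta> \<in> B" "\<beta>' \<in> B" using Bf_B by auto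
        have "BE.tens \<beta> \<beta>' \<odot>\<^bsub>BE.RM\<^esub> b \<in> ?N"
          using EM.smodD(4)[OF sm(1) _ bN] BE.tens_in[of \<beta> \<beta>'] be by simp
        then show "\<beta> \<otimes> b \<otimes> \<beta>' \<in> ?N" using tens_act[OF be bB] by simp
      qed
      then have one: "\<one> \<in> ?N" using sandwich_one[OF b(1,2)] by blast
      have "x \<in> ?N" if "x \<in> B" for x
      proof -
        have "BE.tens x \<one> \<odot>\<^bsub>BE.RM\<^esub> \<one> \<in> ?N"
          using EM.smodD(4)[OF sm(1) _ one] BE.tens_in[of x \<one>] that B_one by simp
        then show ?thesis using tens_act[OF that B_one B_one] that by simp
      qed
      moreover have "?N \<subseteq> B" using EM.smodD(1)[OF sm(1)] by auto
      ultimately show ?thesis by auto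
    qed
    have "M0 \<subseteq> act (Rp j) ?M'" by (rule ret_attained[OF ret fd sub gen])
    have "act (Rp c) M0 \<subseteq> act (Rp (c + j)) ?M'"
      unfolding space_act_env(1)[OF Rp_sub M0(2)]
    proof (rule kspan_least[OF _ space_act_env(2)[OF Rp_sub M'B]], safe)
      fix a x assume "a \<in> Rp c" "x \<in> M0"
      then show "a \<odot>\<^bsub>BE.RM\<^esub> x \<in> act (Rp (c + j)) ?M'"
        using act_act[OF M'B, of a c x j] \<open>M0 \<subseteq> act (Rp j) ?M'\<close> by blast
    qed
    also have "\<dots> \<subseteq> sandwich p b"
      unfolding space_act_env(1)[OF Rp_sub M'B]
    proof (rule kspan_least[OF _ sandwich_ksub[OF bB]], safe)
      fix a x assume a: "a \<in> Rp (c + j)" and x: "x \<in> ?M'"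
      have ac: "a \<in> carrier BE.Env" using a Rp_sub by blast
      have "?M' \<subseteq> {y \<in> B. a \<odot>\<^bsub>BE.RM\<^esub> y \<in> sandwich p b}"
        using d[OF a bB] bB by (intro kspan_least[OF _ ksub_act_left[OF ac sandwich_ksub[OF bB]]]) (simp add: p)
      then show "a \<odot>\<^bsub>BE.RM\<^esub> x \<in> sandwich p b" using x by blast
    qed
    finally show False using c b(3) by blast
  qed
  define C1 where "C1 = N * (c0 + 2) + c"
  define C2 where "C2 = real C1 powr s"
  define C3 where "C3 = real d * real c + real d * C2 + 1"
  define C4 where "C4 = real K * C3 * (C3 + real c0 + 1)"
  have C: "C2 \<ge> 0" "C3 \<ge> 1" "C4 \<ge> 0" by (auto simp: C2_def C3_def C4_def)
  \<comment> \<open>The n-th root of \<open>key\<close> at t = \<tau> + c0: p + 1 is of order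
    \<tau>^s and p + t + 1 of order \<tau>.\<close>
  have "real ((\<tau> + 1) ^ 2) \<le> C4 * real (\<tau> + 1) powr (1 + s)" if "\<tau> \<ge> I0" for \<tau>
  proof -
    define i where "i = N * (\<tau> + c0 + 2) + c"
    define X where "X = real (\<tau> + 1) powr s"
    have "1 * (\<tau> + c0 + 2) \<le> N * (\<tau> + c0 + 2)" using N(1) by (rule mult_le_mono1)
    then have "i \<ge> I0" using that by (simp add: i_def)
    have iC: "i \<le> C1 * (\<tau> + 1)" by (simp add: i_def C1_def algebra_simps)
    have X: "1 \<le> X" "X \<le> real (\<tau> + 1)"
      using s powr_mono[of s 1 "real (\<tau> + 1)"] ge_one_powr_ge_zero[of "real (\<tau> + 1)" s] by (auto simp: X_def)
    obtain j where j: "ret i = enat j" using I0[OF \<open>i \<ge> I0\<close>] by (cases "ret i") auto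
    have "real j \<le> real i powr s" using I0[OF \<open>i \<ge> I0\<close>] j by simp
    also have "\<dots> \<le> real (C1 * (\<tau> + 1)) powr s" by (rule powr_mono2[OF s(1) of_nat_0_le_iff of_nat_mono[OF iC]])
    also have "\<dots> = C2 * X" unfolding C2_def X_def of_nat_mult by (rule powr_mult)
    finally have jX: "real j \<le> C2 * X" .
    define p where "p = d * (c + j)"
    have "real (p + 1) = real d * real c + real d * real j + 1" by (simp add: p_def algebra_simps)
    also have "\<dots> \<le> real d * real c * X + real d * (C2 * X) + X"
      using X(1) jX mult_left_mono[OF X(1), of "real d * real c"] by (intro add_mono mult_left_mono) auto
    also have "\<dots> = C3 * X" by (simp add: C3_def algebra_simps)
    finally have pX: "real (p + 1) \<le> C3 * X" .
    have "real (p + (\<tau> + c0) + 1) = real (p + 1) + (real \<tau> + real c0)" by simp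
    also have "\<dots> \<le> C3 * real (\<tau> + 1) + (1 + real c0) * real (\<tau> + 1)"
    proof (intro add_mono)
      show "real (p + 1) \<le> C3 * real (\<tau> + 1)" using pX X(2) C(2) mult_left_mono[OF X(2), of C3] by linarith
      show "real \<tau> + real c0 \<le> (1 + real c0) * real (\<tau> + 1)" by (simp add: algebra_simps)
    qed
    also have "\<dots> = (C3 + real c0 + 1) * real (\<tau> + 1)" by (simp add: algebra_simps)
    finally have pX2: "real (p + (\<tau> + c0) + 1) \<le> (C3 + real c0 + 1) * real (\<tau> + 1)" .
    have "((\<tau> + 1)\<^sup>2) ^ n \<le> K * subspace_dim A (Bf (\<tau> + c0))" using K(2)[of \<tau>] by (simp add: power_mult)
    also have "\<dots> \<le> K * ((p + 1) ^ n * (p + (\<tau> + c0) + 1) ^ n)"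
      using key[of "\<tau> + c0" j p] j by (simp add: i_def p_def)
    \<comment> \<open>Enlarging K to K^n makes the right-hand side an n-th power, so that the root
      can be taken on both sides.\<close>
    also have "\<dots> \<le> K ^ n * ((p + 1) ^ n * (p + (\<tau> + c0) + 1) ^ n)"
      using K(1) n_pos self_le_power[of K n] by (intro mult_le_mono1) auto
    also have "\<dots> = (K * ((p + 1) * (p + (\<tau> + c0) + 1))) ^ n" by (simp only: power_mult_distrib)
    finally have "(\<tau> + 1)\<^sup>2 \<le> K * ((p + 1) * (p + (\<tau> + c0) + 1))"
      using n_pos by (subst (asm) power_mono_iff) auto
    then have "real ((\<tau> + 1)\<^sup>2) \<le> real (K * ((p + 1) * (p + (\<tau> + c0) + 1)))" by (rule of_nat_mono)
    also have "\<dots> = real K * (real (p + 1) * real (p + (\<tau> + c0) + 1))" by (simp only: of_nat_mult)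
    also have "\<dots> \<le> real K * ((C3 * X) * ((C3 + real c0 + 1) * real (\<tau> + 1)))"
      using pX pX2 C X by (intro mult_left_mono mult_mono) auto
    also have "\<dots> = C4 * (real (\<tau> + 1) * X)" by (simp add: C4_def algebra_simps)
    also have "real (\<tau> + 1) * X = real (\<tau> + 1) powr (1 + s)" by (simp add: X_def powr_add)
    finally show ?thesis .
  qed
  then have "\<forall>\<^sub>F \<tau> in sequentially. real ((\<tau> + 1) ^ 2) \<le> C4 * real (\<tau> + 1) powr (1 + s)"
    unfolding eventually_sequentially by blast
  then show False by (rule powr_growth_contradiction) (use s C in auto)
qed

end

context inv_alg
begin

theorem filter_dimension_1:
  assumes box: "\<And>p i. (p + 1) ^ n * (p + i + 1) ^ n < subspace_dim A (Bf i) \<Longrightarrow> \<exists>b\<in>Bf i. b \<noteq> \<zero> \<and> \<one> \<notin> sandwich p b"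
  shows "has_fdim BB 1"
  unfolding has_fdim_def has_filter_dimension_def
proof (intro conjI allI impI)
  show "left_module BE.Env BE.RM" by (rule EM.is_left_module)
  show "\<not> vectorspace.fin_dim class_ring BE.Env" by (rule Env_infinite)
  show "growth_exponent (return_function BE.Env BE.RM
      (LinearCombinations.module.span class_ring BE.Env (insert \<one>\<^bsub>BE.Env\<^esub> S)) M0) = 1"
    if data: "filter_dim_data BE.Env BE.RM S M0" for S M0
  proof -
    interpret fdim_data A m z zs Gr e0 n S M0
      by (intro fdim_data.intro inv_alg_axioms fdim_data_axioms.intro data)
    obtain C where "\<And>i. ret i \<le> enat (C * (i + 1) ^ 1)" using ret_le by blast
    from growth_exponent_le[OF this] have "growth_exponent ret \<le> 1" by (simp add: one_ereal_def)
    then show ?thesis unfolding R1_eq using ret_ge[OF box] by (rule antisym)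
  qed
  show "\<exists>S M0. filter_dim_data BE.Env BE.RM S M0"
  proof -
    obtain d0 where d0: "\<And>j. Bf j \<subseteq> space_power BB (Bf d0) (j + 2)" using Bf_power by blast
    obtain T where T: "finite T" "T \<subseteq> Bf d0" "kspan A T = Bf d0" using Bf_fd[of d0] by (auto simp: ks.fd_iff)
    have TB: "T \<subseteq> B" using T(2) Bf_B by blast
    let ?S = "(\<lambda>t. BE.tens t \<one>) ` T \<union> (\<lambda>t. BE.tens \<one> t) ` T"
    have "algebra_generated_by BE.Env ?S"
      unfolding algebra_generated_by_def
    proof (intro conjI allI impI)
      show "?S \<subseteq> carrier BE.Env" using TB BE.tens_in B_one by auto
      fix T' assume a: "subring T' BE.Env \<and> (\<forall>c. \<forall>a\<in>T'. c \<odot>\<^bsub>BE.Env\<^esub> a \<in> T') \<and> ?S \<subseteq> T'"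
      note T' = subringE[OF conjunct1[OF a]]
      have T's: "ksub BE.Env T'" using T' a by (auto simp: ksub_def)
      have V: "BE.tens v \<one> \<in> T' \<and> BE.tens \<one> v \<in> T'" if "v \<in> Bf d0" for v
      proof -
        have l: "klin BB (carrier BB) BE.Env (\<lambda>a. BE.tens a \<one>)" by (rule BE.klin_tens_l) (simp add: B_one)
        have r: "klin BB (carrier BB) BE.Env (\<lambda>a. BE.tens \<one> a)" by (rule BE.klin_tens_r) (simp add: B_one)
        have v: "v \<in> kspan BB T" using that T(3) by simp
        have Tc: "T \<subseteq> carrier BB" using TB by simp
        have "(\<lambda>a. BE.tens a \<one>) v \<in> kspan BE.Env ((\<lambda>a. BE.tens a \<one>) ` T)"
          using klin_kspan[OF l BB.ks.kspace_axioms EM.A.ks.kspace_axioms Tc] v by blast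
        moreover have "kspan BE.Env ((\<lambda>a. BE.tens a \<one>) ` T) \<subseteq> T'"
          using a by (intro kspan_least[OF _ T's]) blast
        moreover have "(\<lambda>a. BE.tens \<one> a) v \<in> kspan BE.Env ((\<lambda>a. BE.tens \<one> a) ` T)"
          using klin_kspan[OF r BB.ks.kspace_axioms EM.A.ks.kspace_axioms Tc] v by blast
        moreover have "kspan BE.Env ((\<lambda>a. BE.tens \<one> a) ` T) \<subseteq> T'"
          using a by (intro kspan_least[OF _ T's]) blast
        ultimately show ?thesis by blast
      qed
      have all: "BE.tens v \<one> \<in> T' \<and> BE.tens \<one> v \<in> T'" if vB: "v \<in> B" for v
      proof -
        obtain j where "v \<in> Bf j" using Bf_exhaust[OF vB] by blast
        then have "v \<in> space_power BB (Bf d0) (j + 2)" using d0 by blast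
        \<comment> \<open>The subalgebra is used as a constant filtration, for which the step size 0
          serves.\<close>
        then show ?thesis
          using tens_power[OF Bf_B[of d0], of "\<lambda>_. T'" 0 v "j + 2"] T's T'(6) T'(3) V by blast
      qed
      have "kspan BE.Env {BE.tens a b | a b. a \<in> carrier BB \<and> b \<in> carrier BB} \<subseteq> T'"
      proof (rule kspan_least[OF _ T's], safe)
        fix a b assume "a \<in> carrier BB" "b \<in> carrier BB"
        then show "BE.tens a b \<in> T'" using tens_split[of a b] T'(6) all by simp
      qed
      then show "carrier BE.Env \<subseteq> T'" using BE.Env_span by blast
    qed
    moreover have "fd_subspace EM.bs (kspan A {\<one>})"
      using BB.ks.fd_kspan(1)[of "{\<one>}"] B_one BE.RM_base(3) by simp
    moreover have "submodule_gen BE.Env BE.RM (kspan A {\<one>}) = carrier BE.RM"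
    proof -
      let ?N = "submodule_gen BE.Env BE.RM (kspan A {\<one>})"
      have "kspan A {\<one>} \<subseteq> carrier BE.RM" using B_one by (intro kspan_least) (auto simp: B_ksub)
      then have sm: "Module.submodule ?N BE.Env BE.RM" "kspan A {\<one>} \<subseteq> ?N"
        using EM.submodule_gen_eq(2,3)[of "kspan A {\<one>}"] by auto
      have one: "\<one> \<in> ?N" using sm(2) kspan_base[of \<one> "{\<one>}"] by blast
      have "x \<in> ?N" if "x \<in> B" for x
      proof -
        have "BE.tens x \<one> \<odot>\<^bsub>BE.RM\<^esub> \<one> \<in> ?N"
          using EM.smodD(4)[OF sm(1) _ one] BE.tens_in[of x \<one>] that B_one by simp
        then show ?thesis using tens_act[OF that B_one B_one] that by simp
      qed
      moreover have "?N \<subseteq> B" using EM.smodD(1)[OF sm(1)] by auto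
      ultimately show ?thesis by auto
    qed
    ultimately have "filter_dim_data BE.Env BE.RM ?S (kspan A {\<one>})"
      using T(1) by (simp add: filter_dim_data_def)
    then show ?thesis by blast
  qed
qed

lemma fg_kmod: "fg_module BB M \<Longrightarrow> kmod BB M"
  unfolding fg_module_def by (intro kmod.intro kmod_axioms.intro BB.kalg_axioms) blast

lemma bernstein: "fg_module BB M \<Longrightarrow> nonzero_module M \<Longrightarrow> ereal (real n) \<le> GK BB M"
proof -
  assume M: "fg_module BB M" "nonzero_module M"
  interpret M: kmod BB M by (rule fg_kmod[OF M(1)])
  obtain u where "u \<in> carrier M" "u \<noteq> \<zero>\<^bsub>M\<^esub>"
    using M(2) M.lm.M.zero_closed unfolding nonzero_module_def by blast
  then show ?thesis by (rule bernstein_inequality[OF M.kmod_axioms])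
qed

end

section \<open>The polynomial representation\<close>

text \<open>Functions \<open>\<alpha> \<mapsto> f \<alpha>\<close> of exponents \<open>\<alpha>\<close> are the coefficients of formal power series; the
  polynomials are those of finite support.\<close>

definition fock :: "('k::field, (nat \<Rightarrow> nat) \<Rightarrow> 'k) module" where
  "fock = \<lparr>carrier = UNIV, monoid.mult = (\<lambda>f g. f), one = (\<lambda>\<alpha>. 0), zero = (\<lambda>\<alpha>. 0),
     add = (\<lambda>f g \<alpha>. f \<alpha> + g \<alpha>), smult = (\<lambda>c f \<alpha>. c * f \<alpha>)\<rparr>"

lemma fock_sel[simp]: "carrier fock = UNIV" "\<zero>\<^bsub>fock\<^esub> = (\<lambda>\<alpha>. 0)"
  "f \<oplus>\<^bsub>fock\<^esub> g = (\<lambda>\<alpha>. f \<alpha> + g \<alpha>)" "c \<odot>\<^bsub>fock\<^esub> f = (\<lambda>\<alpha>. c * f \<alpha>)"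
  by (simp_all add: fock_def)

lemma kspace_fock: "kspace fock"
proof (rule kspaceI)
  show "\<exists>w\<in>carrier fock. v \<oplus>\<^bsub>fock\<^esub> w = \<zero>\<^bsub>fock\<^esub>" for v :: "(nat \<Rightarrow> nat) \<Rightarrow> 'a"
    by (rule bexI[of _ "\<lambda>\<alpha>. - v \<alpha>"]) auto
qed (auto simp: algebra_simps)

text \<open>Bounding the degree in each variable separately, rather than in total, makes the count a
  plain power. Exponents at indices from n on are pinned to 0 to keep the set finite.\<close>

definition box :: "nat \<Rightarrow> nat \<Rightarrow> (nat \<Rightarrow> nat) set" where
  "box n p = {\<alpha>. (\<forall>i<n. \<alpha> i \<le> p) \<and> (\<forall>i\<ge>n. \<alpha> i = 0)}"

lemma box_finite: "finite (box n p)" and box_card: "card (box n p) \<le> (p + 1) ^ n"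
proof -
  let ?E = "PiE {..<n} (\<lambda>_. {..p})"
  have fin: "finite ?E" by (rule finite_PiE) auto
  have sub: "box n p \<subseteq> (\<lambda>f i. if i < n then f i else 0) ` ?E"
  proof
    fix \<alpha> assume a: "\<alpha> \<in> box n p"
    then have "\<alpha> = (\<lambda>i. if i < n then restrict \<alpha> {..<n} i else 0)" by (auto simp: box_def)
    moreover have "restrict \<alpha> {..<n} \<in> ?E" using a by (auto simp: box_def)
    ultimately show "\<alpha> \<in> (\<lambda>f i. if i < n then f i else 0) ` ?E" by blast
  qed
  then show "finite (box n p)" using fin finite_surj by blast
  have "card (box n p) \<le> card ?E" using sub fin by (rule surj_card_le[rotated])
  then show "card (box n p) \<le> (p + 1) ^ n" by (simp add: card_PiE)
qed

lemma box_mono: "p \<le> q \<Longrightarrow> box n p \<subseteq> box n q"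
  by (force simp: box_def)

definition fbox :: "nat \<Rightarrow> nat \<Rightarrow> ((nat \<Rightarrow> nat) \<Rightarrow> 'k::field) set" where
  "fbox n p = {f. \<forall>\<alpha>. f \<alpha> \<noteq> 0 \<longrightarrow> \<alpha> \<in> box n p}"

lemma fbox_ksub: "ksub fock (fbox n p)"
  by (auto simp: ksub_def fbox_def) (metis add.right_neutral)

lemma fbox_mono: "p \<le> q \<Longrightarrow> fbox n p \<subseteq> fbox n q"
  using box_mono[of p q n] by (auto simp: fbox_def)

lemma fbox_span: "(fbox n p :: ((nat \<Rightarrow> nat) \<Rightarrow> 'k::field) set) \<subseteq> kspan fock (basis_elt ` box n p)"
proof
  fix f :: "(nat \<Rightarrow> nat) \<Rightarrow> 'k" assume f: "f \<in> fbox n p"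
  have "finite S \<Longrightarrow> S \<subseteq> box n p \<Longrightarrow> {\<alpha>. f \<alpha> \<noteq> 0} \<subseteq> S \<Longrightarrow> f \<in> kspan fock (basis_elt ` box n p)"
    for S and f :: "(nat \<Rightarrow> nat) \<Rightarrow> 'k"
  proof (induction S arbitrary: f rule: finite_induct)
    case empty
    then have "f = \<zero>\<^bsub>fock\<^esub>" by auto
    then show ?case using kspan_zero by metis
  next
    case (insert \<alpha> S)
    have "f(\<alpha> := 0) \<in> kspan fock (basis_elt ` box n p)" using insert.prems by (intro insert.IH) auto
    moreover have "f \<alpha> \<odot>\<^bsub>fock\<^esub> basis_elt \<alpha> \<in> kspan fock (basis_elt ` box n p)"
      using insert.prems by (intro kspan_smult kspan_base) auto
    ultimately have "f(\<alpha> := 0) \<oplus>\<^bsub>fock\<^esub> f \<alpha> \<odot>\<^bsub>fock\<^esub> basis_elt \<alpha> \<in> kspan fock (basis_elt ` box n p)"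
      by (rule kspan_add)
    moreover have "f(\<alpha> := 0) \<oplus>\<^bsub>fock\<^esub> f \<alpha> \<odot>\<^bsub>fock\<^esub> basis_elt \<alpha> = f" by (auto simp: basis_elt_def)
    ultimately show ?case by simp
  qed
  from this[OF box_finite[of n p], of f] show "f \<in> kspan fock (basis_elt ` box n p)"
    using f by (auto simp: fbox_def)
qed

lemma klin_vimage:
  assumes "klin V (carrier V) U f" "kspace V" "kspace U" "ksub U X"
  shows "ksub V {x \<in> carrier V. f x \<in> X}"
proof -
  interpret V: kspace V by fact
  have "f \<zero>\<^bsub>V\<^esub> = \<zero>\<^bsub>U\<^esub>" by (rule V.klin_zero[OF assms(1,3)]) auto
  then show ?thesis
    using klinD(2,3)[OF assms(1)] ksubD(2-4)[OF assms(4)] by (auto simp: ksub_def)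
qed

locale fock_rep = inv_alg A m z zs Gr e0 n
  for A :: "('k::field_char_0, 'a) module" (structure) and m z zs Gr e0 n +
  fixes act :: "'a \<Rightarrow> ((nat \<Rightarrow> nat) \<Rightarrow> 'k) \<Rightarrow> (nat \<Rightarrow> nat) \<Rightarrow> 'k"
  assumes klin_act: "klin A (carrier A) fock (\<lambda>a. act a v)"
    and klin_act_r: "a \<in> carrier A \<Longrightarrow> klin fock (carrier fock) fock (act a)"
    and act_mult: "a \<in> carrier A \<Longrightarrow> b \<in> carrier A \<Longrightarrow> act (a \<otimes> b) v = act a (act b v)"
    and act_one: "act \<one> v = v"
    and act_z: "i < m \<Longrightarrow> v \<in> fbox n j \<Longrightarrow> act (z i) v \<in> fbox n (Suc j)"
begin

text \<open>The coefficients of the polynomial 1.\<close>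

definition vac :: "(nat \<Rightarrow> nat) \<Rightarrow> 'k" where "vac = basis_elt (\<lambda>i. 0)"

lemma vac_fbox: "vac \<in> fbox n p"
  by (simp add: vac_def fbox_def basis_elt_def box_def)

lemma vac_nonzero: "vac \<noteq> \<zero>\<^bsub>fock\<^esub>"
  by (auto simp: vac_def basis_elt_def fun_eq_iff)

lemma act_fock_zero: "a \<in> carrier A \<Longrightarrow> act a \<zero>\<^bsub>fock\<^esub> = \<zero>\<^bsub>fock\<^esub>"
  by (rule kspace.klin_zero[OF kspace_fock klin_act_r kspace_fock]) auto

lemma act_fbox: "a \<in> F p \<Longrightarrow> v \<in> fbox n j \<Longrightarrow> act a v \<in> fbox n (p + j)"
proof -
  assume a: "a \<in> F p" and v: "v \<in> fbox n j"
  have w: "set w \<subseteq> {..<m} \<Longrightarrow> act (word w) v \<in> fbox n (length w + j)" for w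
  proof (induction w)
    case (Cons i w)
    then have iw: "i < m" "set w \<subseteq> {..<m}" by auto
    show ?case using act_z[OF iw(1) Cons.IH[OF iw(2)]] iw by (simp add: act_mult)
  qed (simp add: act_one v)
  have "F p \<subseteq> {a \<in> carrier A. act a v \<in> fbox n (p + j)}"
    unfolding G_def
  proof (rule kspan_least[OF _ klin_vimage[OF klin_act ks.kspace_axioms kspace_fock fbox_ksub]], safe)
    fix w assume "set w \<subseteq> {..<m}" "length w < Suc p"
    then show "word w \<in> carrier A" "act (word w) v \<in> fbox n (p + j)"
      using w[of w] fbox_mono[of "length w + j" "p + j" n] by auto
  qed
  then show ?thesis using a by blast
qed

lemma klin_coordinate: "W \<subseteq> carrier A \<Longrightarrow> klin A W field_space (\<lambda>a. act a v \<beta>)"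
  using klinD(2,3)[OF klin_act[of v]]
  by (intro klinI) (auto simp: field_space_def subset_iff)

lemma fbox_zeroI: "v \<in> fbox n p \<Longrightarrow> (\<And>\<beta>. \<beta> \<in> box n p \<Longrightarrow> v \<beta> = 0) \<Longrightarrow> v = \<zero>\<^bsub>fock\<^esub>"
  by (auto simp: fbox_def fun_eq_iff)

text \<open>An element of \<open>B\<^sub>i\<close> is determined on polynomials of degree at most \<open>p\<close> in each variable by a
  matrix of size \<open>(p + i + 1)\<^sup>n \<times> (p + 1)\<^sup>n\<close>.\<close>

lemma box_obstruction:
  assumes "(p + 1) ^ n * (p + i + 1) ^ n < subspace_dim A (Bf i)"
  shows "\<exists>b\<in>Bf i. b \<noteq> \<zero> \<and> \<one> \<notin> sandwich p b"
proof -
  let ?T = "box n p \<times> box n (i + p)"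
  have "card ?T \<le> (p + 1) ^ n * (p + i + 1) ^ n"
    using mult_le_mono[OF box_card[of n p] box_card[of n "i + p"]]
    by (simp add: card_cartesian_product add.commute)
  then have lt: "card ?T < subspace_dim A (Bf i)" using assms by linarith
  have "\<exists>b\<in>Bf i. b \<noteq> \<zero> \<and> (\<forall>t\<in>?T. act b (basis_elt (fst t)) (snd t) = 0)"
  proof (rule common_kernel_functionals[OF ks.kspace_axioms _ Bf_fd _ lt])
    show "finite ?T" using box_finite by blast
    show "klin A (Bf i) field_space (\<lambda>b. act b (basis_elt (fst t)) (snd t))" for t
      using Bf_carrier by (intro klin_coordinate) blast
  qed
  then obtain b where b: "b \<in> Bf i" "b \<noteq> \<zero>"
    "\<And>\<alpha> \<beta>. \<alpha> \<in> box n p \<Longrightarrow> \<beta> \<in> box n (i + p) \<Longrightarrow> act b (basis_elt \<alpha>) \<beta> = 0" by force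
  have bF: "b \<in> F i" "b \<in> carrier A" using b(1) Bf_carrier by (auto simp: Bf_def)
  have "fbox n p \<subseteq> {v \<in> carrier fock. act b v \<in> {\<zero>\<^bsub>fock\<^esub>}}"
  proof (rule order_trans[OF fbox_span kspan_least], safe)
    show "ksub fock {v \<in> carrier fock. act b v \<in> {\<zero>\<^bsub>fock\<^esub>}}"
      by (rule klin_vimage[OF klin_act_r[OF bF(2)] kspace_fock kspace_fock kspace.ksub_zero[OF kspace_fock]])
    fix \<alpha> assume a: "\<alpha> \<in> box n p"
    then have "basis_elt \<alpha> \<in> fbox n p" by (simp add: fbox_def basis_elt_def)
    then have "act b (basis_elt \<alpha>) \<in> fbox n (i + p)" by (rule act_fbox[OF bF(1)])
    then show "act b (basis_elt \<alpha>) = \<zero>\<^bsub>fock\<^esub>" using b(3)[OF a] by (rule fbox_zeroI)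
  qed simp
  then have kill: "act b v = \<zero>\<^bsub>fock\<^esub>" if "v \<in> fbox n p" for v using that by blast
  \<comment> \<open>\<beta>' \<open>vac\<close> has degree at most p and is killed by b, so every
    element of the sandwich annihilates \<open>vac\<close>, whereas 1 does not.\<close>
  have "sandwich p b \<subseteq> {a \<in> carrier A. act a vac \<in> {\<zero>\<^bsub>fock\<^esub>}}"
    unfolding sandwich_def
  proof (rule kspan_least[OF _ klin_vimage[OF klin_act ks.kspace_axioms kspace_fock kspace.ksub_zero[OF kspace_fock]]], safe)
    fix \<beta> \<beta>' assume be: "\<beta> \<in> Bf p" "\<beta>' \<in> Bf p"
    have c: "\<beta> \<in> carrier A" "\<beta>' \<in> carrier A" using be Bf_carrier by auto
    show "\<beta> \<otimes> b \<otimes> \<beta>' \<in> carrier A" using c bF by simp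
    have "vac \<in> fbox n 0" by (rule vac_fbox)
    then have "act \<beta>' vac \<in> fbox n p" using act_fbox[of \<beta>' p vac 0] be(2) by (simp add: Bf_def)
    then have "act b (act \<beta>' vac) = \<zero>\<^bsub>fock\<^esub>" by (rule kill)
    then show "act (\<beta> \<otimes> b \<otimes> \<beta>') vac = \<zero>\<^bsub>fock\<^esub>"
      using c bF by (simp only: act_mult m_closed act_fock_zero)
  qed
  then have "\<one> \<notin> sandwich p b" using act_one vac_nonzero by auto
  then show ?thesis using b by blast
qed

section \<open>A cyclic module of dimension n\<close>

definition regular :: "('a, 'a) module" where
  "regular = \<lparr>carrier = B, monoid.mult = (\<otimes>), one = \<one>, zero = \<zero>, add = (\<oplus>), smult = (\<otimes>)\<rparr>"

lemma regular_sel[simp]: "carrier regular = B" "\<zero>\<^bsub>regular\<^esub> = \<zero>" "add regular = add A" "smult regular = monoid.mult A"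
  by (simp_all add: regular_def)

lemma kmod_regular: "kmod BB regular"
proof -
  have "abelian_group regular"
  proof (rule abelian_groupI)
    show "\<exists>y\<in>carrier regular. y \<oplus>\<^bsub>regular\<^esub> x = \<zero>\<^bsub>regular\<^esub>" if "x \<in> carrier regular" for x
      using that ks.ksub_neg[OF B_ksub] ks.l_neg[of x] by auto
  qed (use ksubD(2,3)[OF B_ksub] in \<open>auto simp: ks.a_ac\<close>)
  then have "left_module BB regular"
    by (intro left_module.intro left_module_axioms.intro BB.is_ring) (auto simp: B_mult l_distr r_distr m_assoc)
  then show ?thesis by (intro kmod.intro kmod_axioms.intro BB.kalg_axioms)
qed

text \<open>The codomain of \<open>coset\<close> is the one over which the holonomic number ranges.\<close>

definition coset :: "'a \<Rightarrow> (nat \<Rightarrow> 'a) set" where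
  "coset b = {\<lambda>_. b' | b'. b' \<in> B \<and> act b' vac = act b vac}"

lemma coset_eq: "b \<in> B \<Longrightarrow> c \<in> B \<Longrightarrow> coset b = coset c \<longleftrightarrow> act b vac = act c vac"
proof
  assume "coset b = coset c" "b \<in> B"
  then have "(\<lambda>_. b) \<in> coset c" by (auto simp: coset_def)
  then show "act b vac = act c vac" by (auto simp: coset_def fun_eq_iff)
qed (simp add: coset_def)

lemma act_minus: "b \<in> carrier A \<Longrightarrow> c \<in> carrier A \<Longrightarrow> act (b \<ominus> c) v = \<zero>\<^bsub>fock\<^esub> \<longleftrightarrow> act b v = act c v"
proof -
  assume bc: "b \<in> carrier A" "c \<in> carrier A"
  have "(b \<ominus> c) \<oplus> c = b" using bc by (simp add: a_minus_def ks.a_assoc ks.l_neg)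
  then have "act b v = act (b \<ominus> c) v \<oplus>\<^bsub>fock\<^esub> act c v"
    using klinD(2)[OF klin_act[of v], of "b \<ominus> c" c] bc by simp
  then show ?thesis by (auto simp: fun_eq_iff)
qed

lemma coset_module: "kmod_image BB regular {b \<in> B. act b vac = \<zero>\<^bsub>fock\<^esub>} coset"
proof -
  interpret kmod BB regular by (rule kmod_regular)
  have "ksub A {b \<in> carrier A. act b vac \<in> {\<zero>\<^bsub>fock\<^esub>}}"
    by (rule klin_vimage[OF klin_act ks.kspace_axioms kspace_fock kspace.ksub_zero[OF kspace_fock]])
  from ks.ksub_Int[OF B_ksub this] have k: "ksub A {b \<in> B. act b vac = \<zero>\<^bsub>fock\<^esub>}"
    by (rule back_subst[of "ksub A"]) auto
  have sub: "Module.submodule {b \<in> B. act b vac = \<zero>\<^bsub>fock\<^esub>} BB regular"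
    unfolding smod_iff
  proof (intro conjI ballI)
    fix a x assume "a \<in> carrier BB" "x \<in> {b \<in> B. act b vac = \<zero>\<^bsub>fock\<^esub>}"
    then show "a \<odot>\<^bsub>regular\<^esub> x \<in> {b \<in> B. act b vac = \<zero>\<^bsub>fock\<^esub>}"
      using act_fock_zero[OF B_in[of a]] by (simp add: B_mult act_mult)
  qed (use ksubD(2,3)[OF k] in auto)
  have "coset x = coset y \<longleftrightarrow> x \<ominus>\<^bsub>regular\<^esub> y \<in> {b \<in> B. act b vac = \<zero>\<^bsub>fock\<^esub>}" if "x \<in> B" "y \<in> B" for x y
  proof -
    have "\<ominus>\<^bsub>regular\<^esub> y = \<ominus> y"
      using that ks.ksub_neg[OF B_ksub] by (intro lm.M.minus_equality) (auto simp: ks.l_neg)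
    then have "x \<ominus>\<^bsub>regular\<^esub> y = x \<ominus> y" by (simp add: a_minus_def)
    then show ?thesis
      using that coset_eq[OF that] act_minus[of x y vac] ks.ksub_minus[OF B_ksub that] by simp
  qed
  then show ?thesis
    by (intro kmod_image.intro kmod_image_axioms.intro kmod_regular sub) simp
qed

text \<open>The class of b is determined by the polynomial b \<open>vac\<close>. For b in
  \<open>Bf e\<close> that polynomial has at most (e + 1)^n coefficients, which bounds the growth of
  the quotient.\<close>

lemma holonomic_example:
  "fg_module BB (image_module regular coset)" "nonzero_module (image_module regular coset)"
  "GK BB (image_module regular coset) \<le> ereal (real n)"
proof -
  interpret I: kmod_image BB regular "{b \<in> B. act b vac = \<zero>\<^bsub>fock\<^esub>}" coset by (rule coset_module)
  interpret Q: kmod BB I.Q by (rule I.image_kmod)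
  have one: "coset \<one> \<in> carrier I.Q" using B_one by simp
  have "carrier I.Q \<subseteq> submodule_gen BB I.Q {coset \<one>}"
  proof
    fix x assume "x \<in> carrier I.Q"
    then obtain b where b: "b \<in> B" "x = coset b" by (auto simp: I.Q_carrier)
    have "x = b \<odot>\<^bsub>I.Q\<^esub> coset \<one>" using I.rho_act[of b \<one>] b B_one by simp
    then show "x \<in> submodule_gen BB I.Q {coset \<one>}"
      using b(1) Q.submodule_gen_single[OF one] by auto
  qed
  moreover have "submodule_gen BB I.Q {coset \<one>} \<subseteq> carrier I.Q"
    using Q.submodule_gen_least[of "carrier I.Q" "{coset \<one>}"] one by (auto simp: Q.smod_iff)
  ultimately have "submodule_gen BB I.Q {coset \<one>} = carrier I.Q" by blast
  then show "fg_module BB I.Q"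
    unfolding fg_module_def using one Q.is_left_module by (intro conjI exI[of _ "{coset \<one>}"]) auto
  have "coset \<one> \<noteq> \<zero>\<^bsub>I.Q\<^esub>" using I.rho_zero_iff[of \<one>] B_one act_one vac_nonzero by simp
  then show "nonzero_module I.Q" unfolding nonzero_module_def using one by blast
  have kl: "klin BB (carrier BB) Q.bs coset"
    using I.klin_rho by (auto simp: klin_def B_mult smult_mult_l)
  have klA: "klin A (Bf e) Q.bs coset" for e
    using kl Bf_B by (auto simp: klin_def subset_iff)
  have fdQ: "fd_subspace Q.bs (coset ` Bf e)" for e
    by (rule rank_nullity_sub(1)[OF ks.kspace_axioms Q.kspace_bs Bf_fd klA])
  have dimQ: "subspace_dim Q.bs (coset ` Bf e) \<le> (e + 1) ^ n" for e
  proof (rule ccontr)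
    assume "\<not> ?thesis"
    then have lt: "card (box n e) < subspace_dim Q.bs (coset ` Bf e)" using box_card[of n e] by linarith
    \<comment> \<open>A section of \<open>coset\<close> on \<open>Bf e\<close>. The polynomial
      \<open>act (?r q) vac\<close> is independent of the choice, so its coefficients are linear
      functionals on the quotient.\<close>
    let ?r = "\<lambda>q. SOME b. b \<in> Bf e \<and> coset b = q"
    have r: "act (?r q) vac = act b vac" if "b \<in> Bf e" "coset b = q" for b q
    proof -
      have "?r q \<in> Bf e \<and> coset (?r q) = q" by (rule someI[of _ b]) (use that in simp)
      then show ?thesis using coset_eq[of "?r q" b] that Bf_B by auto
    qed
    have "\<exists>q\<in>coset ` Bf e. q \<noteq> \<zero>\<^bsub>Q.bs\<^esub> \<and> (\<forall>\<beta>\<in>box n e. act (?r q) vac \<beta> = 0)"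
    proof (rule common_kernel_functionals[OF Q.kspace_bs box_finite fdQ _ lt])
      fix \<beta>
      have c: "klin A (Bf e) field_space (\<lambda>a. act a vac \<beta>)" using Bf_carrier by (intro klin_coordinate) blast
      show "klin Q.bs (coset ` Bf e) field_space (\<lambda>q. act (?r q) vac \<beta>)"
      proof (rule klinI)
        show "act (?r x) vac \<beta> \<in> carrier field_space" for x by (simp add: field_space_def)
        fix x assume "x \<in> coset ` Bf e"
        then obtain b where b: "b \<in> Bf e" "x = coset b" by blast
        show "act (?r (k \<odot>\<^bsub>Q.bs\<^esub> x)) vac \<beta> = k \<odot>\<^bsub>field_space\<^esub> act (?r x) vac \<beta>" for k
          using r[of b x] r[of "k \<odot> b" "k \<odot>\<^bsub>Q.bs\<^esub> x"] b klinD(3)[OF klA b(1), of k] klinD(3)[OF c b(1), of k]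
            ksubD(4)[OF Bf_ksub b(1), of k] by (simp del: base_space_sel)
        fix y assume "y \<in> coset ` Bf e"
        then obtain b' where b': "b' \<in> Bf e" "y = coset b'" by blast
        show "act (?r (x \<oplus>\<^bsub>Q.bs\<^esub> y)) vac \<beta> = act (?r x) vac \<beta> \<oplus>\<^bsub>field_space\<^esub> act (?r y) vac \<beta>"
          using r[of b x] r[of b' y] r[of "b \<oplus> b'" "x \<oplus>\<^bsub>Q.bs\<^esub> y"] b b' klinD(2)[OF klA b(1) b'(1)]
            klinD(2)[OF c b(1) b'(1)] ksubD(3)[OF Bf_ksub b(1) b'(1)] by (simp del: base_space_sel)
      qed
    qed
    then obtain b where b: "b \<in> Bf e" "coset b \<noteq> \<zero>\<^bsub>I.Q\<^esub>" "\<forall>\<beta>\<in>box n e. act (?r (coset b)) vac \<beta> = 0" by auto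
    have bB: "b \<in> B" "b \<in> F e" using b(1) by (auto simp: Bf_def)
    have "act b vac \<in> fbox n e" using act_fbox[OF bB(2) vac_fbox[of 0]] by simp
    then have "act b vac = \<zero>\<^bsub>fock\<^esub>" using b(3) r[OF b(1) refl] by (intro fbox_zeroI) auto
    then show False using I.rho_zero_iff[of b] bB(1) b(2) by simp
  qed
  show "GK BB I.Q \<le> ereal (real n)"
  proof (rule Q.GK_le)
    fix V W assume V: "fd_subspace BB V" and W: "fd_subspace Q.bs W"
    obtain d where d: "V \<subseteq> Bf d" using fd_Bf[OF V] by blast
    obtain S where S: "finite S" "S \<subseteq> W" "kspan Q.bs S = W" using W by (auto simp: Q.bs.fd_iff)
    have "S \<subseteq> coset ` B" using S(2) Q.bs.fd_subset[OF W] by (auto simp: I.Q_carrier)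
    then obtain T where T: "T \<subseteq> B" "finite T" "S = coset ` T" using finite_subset_image[OF S(1)] by blast
    have "fd_subspace BB (kspan BB T)" using BB.ks.fd_kspan(1)[of T] T by simp
    then obtain d' where d': "kspan BB T \<subseteq> Bf d'" using fd_Bf by blast
    have Wd: "W \<subseteq> coset ` Bf d'"
      unfolding S(3)[symmetric] T(3)
      using d' kspan_base[of _ T BB] by (intro kspan_least[OF _ Q.bs.fd_ksub[OF fdQ]]) blast
    have Vc: "V \<subseteq> carrier BB" using BB.ks.fd_subset[OF V] .
    have Wc: "W \<subseteq> carrier I.Q" using Q.bs.fd_subset[OF W] by simp
    have "subspace_dim Q.bs (space_act BB I.Q (space_power BB V i) W) \<le> (d + d' + 1) ^ n * (i + 1) ^ n" for i
    proof -
      have pc: "space_power BB V i \<subseteq> carrier BB" by (rule BB.space_power_subset[OF Vc])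
      have "space_act BB I.Q (space_power BB V i) W \<subseteq> coset ` Bf (d * i + d')"
        unfolding Q.space_act_eq(1)[OF pc Wc]
      proof (rule kspan_least[OF _ Q.bs.fd_ksub[OF fdQ]], safe)
        fix a x assume a: "a \<in> space_power BB V i" and x: "x \<in> W"
        obtain b where b: "b \<in> Bf d'" "x = coset b" using x Wd by blast
        have aB: "a \<in> Bf (d * i)" using a power_Bf[OF d, of i] by blast
        have "a \<odot>\<^bsub>I.Q\<^esub> x = coset (a \<otimes> b)" using I.rho_act[of a b] b aB Bf_B by auto
        then show "a \<odot>\<^bsub>I.Q\<^esub> x \<in> coset ` Bf (d * i + d')" using Bf_mult[OF aB b(1)] by blast
      qed
      then have "subspace_dim Q.bs (space_act BB I.Q (space_power BB V i) W) \<le> (d * i + d' + 1) ^ n"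
        by (rule order_trans[OF Q.bs.fd_mono(2)[OF fdQ Q.space_act_eq(2)[OF pc Wc]] dimQ])
      also have "\<dots> \<le> ((d + d' + 1) * (i + 1)) ^ n" by (intro power_mono) (auto simp: algebra_simps)
      finally show ?thesis by (simp only: power_mult_distrib)
    qed
    then show "growth_exponent (\<lambda>i. enat (subspace_dim Q.bs (space_act BB I.Q (space_power BB V i) W))) \<le> ereal (real n)"
      by (intro growth_exponent_le) (simp only: enat_ord_simps)
  qed
qed

lemma holonomic_number_eq: "holonomic_number BB = ereal (real n)"
proof (rule antisym)
  have "holonomic_number BB \<le> GK BB (image_module regular coset)"
    unfolding holonomic_number_def by (rule INF_lower) (use holonomic_example(1,2) in simp)
  also note holonomic_example(3)
  finally show "holonomic_number BB \<le> ereal (real n)" .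
  show "ereal (real n) \<le> holonomic_number BB"
    unfolding holonomic_number_def
  proof (rule INF_greatest, safe)
    fix M :: "('a, (nat \<Rightarrow> 'a) set) module" assume M: "fg_module BB M" "nonzero_module M"
    then show "ereal (real n) \<le> GK BB M" by (rule bernstein)
  qed
qed

end

section \<open>The Weyl algebra\<close>

text \<open>Multiplication by x_i and differentiation with respect to x_i, written on the
  coefficients of a power series.\<close>

fun gen_op :: "weyl_gen \<Rightarrow> ((nat \<Rightarrow> nat) \<Rightarrow> 'k::field) \<Rightarrow> (nat \<Rightarrow> nat) \<Rightarrow> 'k" where
  "gen_op (WX i) f = (\<lambda>\<alpha>. if \<alpha> i = 0 then 0 else f (\<alpha>(i := \<alpha> i - 1)))"
| "gen_op (WY i) f = (\<lambda>\<alpha>. of_nat (Suc (\<alpha> i)) * f (\<alpha>(i := Suc (\<alpha> i))))"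

lemma gen_op_comm: "gen_op (WX i) (gen_op (WX j) f) = gen_op (WX j) (gen_op (WX i) f)"
  "gen_op (WY i) (gen_op (WY j) f) = gen_op (WY j) (gen_op (WY i) f)"
  by (cases "i = j"; auto simp: fun_eq_iff fun_upd_twist)+

lemma gen_op_weyl: "gen_op (WY i) (gen_op (WX j) f) =
    (\<lambda>\<alpha>. gen_op (WX j) (gen_op (WY i) f) \<alpha> + (if i = j then f \<alpha> else 0))"
  by (cases "i = j") (auto simp: fun_eq_iff fun_upd_twist algebra_simps)

lemma klin_gen_op: "klin fock (carrier fock) fock (gen_op g)"
  by (cases g) (auto intro!: klinI simp: fun_eq_iff algebra_simps)

lemma gen_op_fbox: "f \<in> fbox n p \<Longrightarrow> g \<in> weyl_gens n \<Longrightarrow> gen_op g f \<in> fbox n (Suc p)"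
proof -
  assume f: "f \<in> fbox n p" and g: "g \<in> weyl_gens n"
  have "\<alpha> \<in> box n (Suc p)" if nz: "gen_op g f \<alpha> \<noteq> 0" for \<alpha>
  proof (cases g)
    case (WX i)
    then have "\<alpha>(i := \<alpha> i - 1) \<in> box n p" using nz f by (auto simp: fbox_def split: if_splits)
    then show ?thesis using g WX by (fastforce simp: box_def weyl_gens_def split: if_splits)
  next
    case (WY i)
    then have "\<alpha>(i := Suc (\<alpha> i)) \<in> box n p" using nz f by (auto simp: fbox_def)
    then show ?thesis using g WY by (fastforce simp: box_def weyl_gens_def split: if_splits)
  qed
  then show ?thesis by (auto simp: fbox_def)
qed

definition word_op :: "weyl_gen list \<Rightarrow> ((nat \<Rightarrow> nat) \<Rightarrow> 'k::field) \<Rightarrow> (nat \<Rightarrow> nat) \<Rightarrow> 'k" where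
  "word_op w = foldr gen_op w"

lemma monoid_rep_word: "monoid_rep (free_monoid S) (fock :: ('k::field, (nat \<Rightarrow> nat) \<Rightarrow> 'k) module) word_op"
proof (intro monoid_rep.intro monoid_rep_axioms.intro kspace_fock)
  show "monoid (free_monoid S)" by (rule monoidI) (auto simp: free_monoid_def)
  show "klin (fock :: ('k, (nat \<Rightarrow> nat) \<Rightarrow> 'k) module) (carrier fock) fock (word_op p)" for p :: "weyl_gen list"
  proof (induction p)
    case (Cons g p)
    have g: "klin fock (carrier fock) fock (gen_op g :: ((nat \<Rightarrow> nat) \<Rightarrow> 'k) \<Rightarrow> _)" by (rule klin_gen_op)
    show ?case
      by (intro klinI) (simp_all add: word_op_def klinD(2,3)[OF Cons.IH, unfolded word_op_def, simplified]
          klinD(2,3)[OF g, simplified] del: gen_op.simps)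
  qed (auto simp: word_op_def intro!: klinI)
qed (auto simp: free_monoid_def word_op_def)

locale weyl =
  fixes n :: nat and field_type :: "'k::field_char_0 itself"
begin

abbreviation Fm where "Fm \<equiv> free_monoid (weyl_gens n)"
abbreviation W where "W \<equiv> weyl_algebra n :: ('k, 'k weyl) module"
abbreviation e where "e \<equiv> weyl_elt n :: weyl_gen \<Rightarrow> 'k weyl"

sublocale rep: monoid_rep Fm "fock :: ('k, (nat \<Rightarrow> nat) \<Rightarrow> 'k) module" word_op
  by (rule monoid_rep_word)

lemma gens_in: "i < n \<Longrightarrow> WX i \<in> weyl_gens n" "i < n \<Longrightarrow> WY i \<in> weyl_gens n"
  by (auto simp: weyl_gens_def)

lemma gen_Fm: "g \<in> weyl_gens n \<Longrightarrow> [g] \<in> carrier Fm"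
  by (simp add: free_monoid_def)

lemma gen_in: "g \<in> weyl_gens n \<Longrightarrow> basis_elt [g] \<in> carrier rep.F"
  by (rule basis_elt_in[OF gen_Fm])

lemma gen_mult_in: "g \<in> weyl_gens n \<Longrightarrow> h \<in> weyl_gens n \<Longrightarrow> basis_elt [g] \<otimes>\<^bsub>rep.F\<^esub> basis_elt [h] \<in> carrier rep.F"
  by (intro rep.F.m_closed gen_in)

lemma lin_gen_mult: "g \<in> weyl_gens n \<Longrightarrow> h \<in> weyl_gens n \<Longrightarrow>
    rep.lin (basis_elt [g] \<otimes>\<^bsub>rep.F\<^esub> basis_elt [h]) v = gen_op g (gen_op h v)"
  by (simp add: rep.lin_mult gen_in rep.lin_basis gen_Fm word_op_def)

text \<open>Multiplications and partial derivatives satisfy the Weyl relations, so power series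
  carry an action of the Weyl algebra.\<close>

lemma relations_annih: "weyl_relations n \<subseteq> rep.annih"
proof -
  have 1: "basis_elt [g] \<otimes>\<^bsub>rep.F\<^esub> basis_elt [h] \<ominus>\<^bsub>rep.F\<^esub> basis_elt [h] \<otimes>\<^bsub>rep.F\<^esub> basis_elt [g] \<in> rep.annih"
    if "g \<in> weyl_gens n" "h \<in> weyl_gens n" "\<And>v :: (nat \<Rightarrow> nat) \<Rightarrow> 'k. gen_op g (gen_op h v) = gen_op h (gen_op g v)" for g h
    using that by (intro rep.annih_diff gen_mult_in) (simp_all add: lin_gen_mult)
  have 2: "(basis_elt [WY i] \<otimes>\<^bsub>rep.F\<^esub> basis_elt [WX j] \<ominus>\<^bsub>rep.F\<^esub> basis_elt [WX j] \<otimes>\<^bsub>rep.F\<^esub> basis_elt [WY i])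
      \<ominus>\<^bsub>rep.F\<^esub> (if i = j then \<one>\<^bsub>rep.F\<^esub> else \<zero>\<^bsub>rep.F\<^esub>) \<in> rep.annih" if ij: "i < n" "j < n" for i j
  proof -
    let ?yx = "basis_elt [WY i] \<otimes>\<^bsub>rep.F\<^esub> basis_elt [WX j]" and ?xy = "basis_elt [WX j] \<otimes>\<^bsub>rep.F\<^esub> basis_elt [WY i]"
    let ?d = "if i = j then \<one>\<^bsub>rep.F\<^esub> else \<zero>\<^bsub>rep.F\<^esub>"
    have c: "?yx \<in> carrier rep.F" "?xy \<in> carrier rep.F" "?d \<in> carrier rep.F"
      using gen_mult_in gens_in ij by auto
    have "?yx \<ominus>\<^bsub>rep.F\<^esub> (?xy \<oplus>\<^bsub>rep.F\<^esub> ?d) \<in> rep.annih"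
    proof (rule rep.annih_diff)
      fix v :: "(nat \<Rightarrow> nat) \<Rightarrow> 'k" assume v: "v \<in> carrier fock"
      have d: "rep.lin ?d v = (\<lambda>\<alpha>. if i = j then v \<alpha> else 0)"
        using rep.lin_one[OF v] rep.F.ks.klin_zero[OF rep.klin_lin[OF v] kspace_fock] by auto
      have "rep.lin (?xy \<oplus>\<^bsub>rep.F\<^esub> ?d) v = rep.lin ?xy v \<oplus>\<^bsub>fock\<^esub> rep.lin ?d v"
        by (rule klinD(2)[OF rep.klin_lin[OF v] c(2,3)])
      then show "rep.lin ?yx v = rep.lin (?xy \<oplus>\<^bsub>rep.F\<^esub> ?d) v"
        using ij by (simp only: d lin_gen_mult gens_in gen_op_weyl fock_sel(3))
    qed (use c in auto)
    moreover have "?yx \<ominus>\<^bsub>rep.F\<^esub> (?xy \<oplus>\<^bsub>rep.F\<^esub> ?d) = (?yx \<ominus>\<^bsub>rep.F\<^esub> ?xy) \<ominus>\<^bsub>rep.F\<^esub> ?d"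
      using c by (simp only: a_minus_def rep.F.ks.minus_add rep.F.ks.a_assoc rep.F.ks.a_inv_closed)
    ultimately show ?thesis by simp
  qed
  show ?thesis
    unfolding weyl_relations_def Let_def commutator_def free_algebra_def
  proof (intro Un_least subsetI)
    fix r assume "r \<in> {basis_elt [WX i] \<otimes>\<^bsub>rep.F\<^esub> basis_elt [WX j] \<ominus>\<^bsub>rep.F\<^esub> basis_elt [WX j] \<otimes>\<^bsub>rep.F\<^esub> basis_elt [WX i] | i j. i < n \<and> j < n}"
    then obtain i j where ij: "i < n" "j < n" and r: "r = basis_elt [WX i] \<otimes>\<^bsub>rep.F\<^esub> basis_elt [WX j] \<ominus>\<^bsub>rep.F\<^esub> basis_elt [WX j] \<otimes>\<^bsub>rep.F\<^esub> basis_elt [WX i]"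
      by blast
    show "r \<in> rep.annih" unfolding r by (rule 1[OF gens_in(1)[OF ij(1)] gens_in(1)[OF ij(2)] gen_op_comm(1)])
  next
    fix r assume "r \<in> {basis_elt [WY i] \<otimes>\<^bsub>rep.F\<^esub> basis_elt [WY j] \<ominus>\<^bsub>rep.F\<^esub> basis_elt [WY j] \<otimes>\<^bsub>rep.F\<^esub> basis_elt [WY i] | i j. i < n \<and> j < n}"
    then obtain i j where ij: "i < n" "j < n" and r: "r = basis_elt [WY i] \<otimes>\<^bsub>rep.F\<^esub> basis_elt [WY j] \<ominus>\<^bsub>rep.F\<^esub> basis_elt [WY j] \<otimes>\<^bsub>rep.F\<^esub> basis_elt [WY i]"
      by blast
    show "r \<in> rep.annih" unfolding r by (rule 1[OF gens_in(2)[OF ij(1)] gens_in(2)[OF ij(2)] gen_op_comm(2)])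
  next
    fix r assume "r \<in> {(basis_elt [WY i] \<otimes>\<^bsub>rep.F\<^esub> basis_elt [WX j] \<ominus>\<^bsub>rep.F\<^esub> basis_elt [WX j] \<otimes>\<^bsub>rep.F\<^esub> basis_elt [WY i])
      \<ominus>\<^bsub>rep.F\<^esub> (if i = j then \<one>\<^bsub>rep.F\<^esub> else \<zero>\<^bsub>rep.F\<^esub>) | i j. i < n \<and> j < n}"
    then show "r \<in> rep.annih" using 2 by blast
  qed
qed

lemma kquot_weyl: "kquot rep.F (weyl_relations n)"
  using relations_annih by (intro kquot.intro kquot_axioms.intro rep.F.kalg_axioms) (auto simp: rep.annih_def)

sublocale Q: kquot rep.F "weyl_relations n"
  by (rule kquot_weyl)

lemma W_eq: "W = Q.A"
  by (simp add: weyl_algebra_def free_algebra_def)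

lemma e_eq: "e g = Q.proj (basis_elt [g])"
  by (simp add: weyl_elt_def Q.proj_def free_algebra_def Let_def)

lemma kalg_W: "kalg W"
  unfolding W_eq by (rule Q.kalg_A)

sublocale kW: kalg W
  by (rule kalg_W)

lemma klin_proj: "klin rep.F (carrier rep.F) W Q.proj"
  unfolding W_eq by (rule Q.klin_proj)

lemma proj_mult: "x \<in> carrier rep.F \<Longrightarrow> y \<in> carrier rep.F \<Longrightarrow> Q.proj (x \<otimes>\<^bsub>rep.F\<^esub> y) = Q.proj x \<otimes>\<^bsub>W\<^esub> Q.proj y"
  unfolding W_eq by (rule Q.proj_mult[symmetric])

lemma W_one: "\<one>\<^bsub>W\<^esub> = Q.proj \<one>\<^bsub>rep.F\<^esub>" and W_zero: "\<zero>\<^bsub>W\<^esub> = Q.proj \<zero>\<^bsub>rep.F\<^esub>"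
  and W_carrier: "carrier W = Q.proj ` carrier rep.F"
  by (simp_all only: W_eq Q.A_sel)

lemma e_in: "g \<in> weyl_gens n \<Longrightarrow> e g \<in> carrier W"
  unfolding e_eq W_carrier by (rule imageI[OF gen_in])

lemma ad_e: "g \<in> weyl_gens n \<Longrightarrow> h \<in> weyl_gens n \<Longrightarrow>
    kW.ad (e g) (e h) = Q.proj (basis_elt [g] \<otimes>\<^bsub>rep.F\<^esub> basis_elt [h] \<ominus>\<^bsub>rep.F\<^esub> basis_elt [h] \<otimes>\<^bsub>rep.F\<^esub> basis_elt [g])"
  unfolding kW.ad_def e_eq
  by (simp only: proj_mult[symmetric] gen_in
      klin_minus[OF klin_proj rep.F.ks.kspace_axioms kW.ks.kspace_axioms rep.F.ks.ksub_carrier] gen_mult_in)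

lemma ad_comm:
  assumes "g \<in> weyl_gens n" "h \<in> weyl_gens n"
    "basis_elt [g] \<otimes>\<^bsub>rep.F\<^esub> basis_elt [h] \<ominus>\<^bsub>rep.F\<^esub> basis_elt [h] \<otimes>\<^bsub>rep.F\<^esub> basis_elt [g] \<in> weyl_relations n"
  shows "kW.ad (e g) (e h) = \<zero>\<^bsub>W\<^esub>"
proof -
  have "Q.proj (basis_elt [g] \<otimes>\<^bsub>rep.F\<^esub> basis_elt [h]) = Q.proj (basis_elt [h] \<otimes>\<^bsub>rep.F\<^esub> basis_elt [g])"
    using assms by (intro Q.proj_gen gen_mult_in)
  then have "e g \<otimes>\<^bsub>W\<^esub> e h = e h \<otimes>\<^bsub>W\<^esub> e g" using assms by (simp add: e_eq proj_mult gen_in)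
  then show ?thesis using assms e_in by (simp add: kW.ad_def a_minus_def kW.ks.r_neg)
qed

lemma ad_gens:
  assumes "i < n" "j < n"
  shows "kW.ad (e (WX i)) (e (WX j)) = \<zero>\<^bsub>W\<^esub>" "kW.ad (e (WY i)) (e (WY j)) = \<zero>\<^bsub>W\<^esub>"
    "kW.ad (e (WY i)) (e (WX j)) = (if i = j then \<one>\<^bsub>W\<^esub> else \<zero>\<^bsub>W\<^esub>)"
proof -
  note d = weyl_relations_def Let_def commutator_def free_algebra_def
  show "kW.ad (e (WX i)) (e (WX j)) = \<zero>\<^bsub>W\<^esub>"
  proof (rule ad_comm[OF gens_in(1)[OF assms(1)] gens_in(1)[OF assms(2)]])
    show "basis_elt [WX i] \<otimes>\<^bsub>rep.F\<^esub> basis_elt [WX j] \<ominus>\<^bsub>rep.F\<^esub> basis_elt [WX j] \<otimes>\<^bsub>rep.F\<^esub> basis_elt [WX i] \<in> weyl_relations n"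
      unfolding d by (rule UnI1, rule UnI1, rule CollectI, intro exI conjI, rule refl) (fact assms)+
  qed
  show "kW.ad (e (WY i)) (e (WY j)) = \<zero>\<^bsub>W\<^esub>"
  proof (rule ad_comm[OF gens_in(2)[OF assms(1)] gens_in(2)[OF assms(2)]])
    show "basis_elt [WY i] \<otimes>\<^bsub>rep.F\<^esub> basis_elt [WY j] \<ominus>\<^bsub>rep.F\<^esub> basis_elt [WY j] \<otimes>\<^bsub>rep.F\<^esub> basis_elt [WY i] \<in> weyl_relations n"
      unfolding d by (rule UnI1, rule UnI2, rule CollectI, intro exI conjI, rule refl) (fact assms)+
  qed
  have "Q.proj (basis_elt [WY i] \<otimes>\<^bsub>rep.F\<^esub> basis_elt [WX j] \<ominus>\<^bsub>rep.F\<^esub> basis_elt [WX j] \<otimes>\<^bsub>rep.F\<^esub> basis_elt [WY i])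
      = Q.proj (if i = j then \<one>\<^bsub>rep.F\<^esub> else \<zero>\<^bsub>rep.F\<^esub>)"
  proof (rule Q.proj_gen)
    show "(basis_elt [WY i] \<otimes>\<^bsub>rep.F\<^esub> basis_elt [WX j] \<ominus>\<^bsub>rep.F\<^esub> basis_elt [WX j] \<otimes>\<^bsub>rep.F\<^esub> basis_elt [WY i])
        \<ominus>\<^bsub>rep.F\<^esub> (if i = j then \<one>\<^bsub>rep.F\<^esub> else \<zero>\<^bsub>rep.F\<^esub>) \<in> weyl_relations n"
      unfolding d by (rule UnI2, rule CollectI, intro exI conjI, rule refl) (fact assms)+
    show "basis_elt [WY i] \<otimes>\<^bsub>rep.F\<^esub> basis_elt [WX j] \<ominus>\<^bsub>rep.F\<^esub> basis_elt [WX j] \<otimes>\<^bsub>rep.F\<^esub> basis_elt [WY i] \<in> carrier rep.F"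
      by (intro rep.F.ks.ksub_minus[OF rep.F.ks.ksub_carrier] gen_mult_in gens_in assms)
  qed simp
  then show "kW.ad (e (WY i)) (e (WX j)) = (if i = j then \<one>\<^bsub>W\<^esub> else \<zero>\<^bsub>W\<^esub>)"
    using ad_e[OF gens_in(2)[OF assms(1)] gens_in(1)[OF assms(2)]] by (simp add: W_one W_zero)
qed

definition z :: "nat \<Rightarrow> 'k weyl" where
  "z i = (if i < n then e (WX i) else e (WY (i - n)))"

text \<open>Dual to \<open>z\<close> for the commutator form.\<close>

definition zs :: "nat \<Rightarrow> 'k weyl" where
  "zs i = (if i < n then e (WY i) else \<ominus>\<^bsub>W\<^esub> e (WX (i - n)))"

lemma z_image: "z ` {..<2 * n} = e ` weyl_gens n"
proof
  show "z ` {..<2 * n} \<subseteq> e ` weyl_gens n"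
    using gens_in by (intro image_subsetI) (simp add: z_def)
  have "e (WX i) \<in> z ` {..<2 * n}" "e (WY i) \<in> z ` {..<2 * n}" if "i < n" for i
    using that image_eqI[of "e (WX i)" z i "{..<2 * n}"] image_eqI[of "e (WY i)" z "n + i" "{..<2 * n}"]
    by (simp_all add: z_def)
  then show "e ` weyl_gens n \<subseteq> z ` {..<2 * n}" by (auto simp: weyl_gens_def)
qed

lemma z_in: "i < 2 * n \<Longrightarrow> z i \<in> carrier W"
  using image_eqI[OF refl, of i "{..<2 * n}" z] image_subsetI[of "weyl_gens n" e, OF e_in] unfolding z_image by (simp add: subset_iff)

lemma ad_uminus: "a \<in> carrier W \<Longrightarrow> b \<in> carrier W \<Longrightarrow> kW.ad (\<ominus>\<^bsub>W\<^esub> a) b = kW.ad b a"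
  by (simp add: kW.ad_def a_minus_def kW.l_minus kW.r_minus kW.ks.a_comm)

lemma zs_comm: "i < 2 * n \<Longrightarrow> j < 2 * n \<Longrightarrow> kW.ad (zs i) (z j) = (if i = j then \<one>\<^bsub>W\<^esub> else \<zero>\<^bsub>W\<^esub>)"
proof -
  assume ij: "i < 2 * n" "j < 2 * n"
  note in_W = e_in[OF gens_in(1)] e_in[OF gens_in(2)]
  show ?thesis
  proof (cases "i < n")
    case i: True
    show ?thesis
    proof (cases "j < n")
      case True
      then show ?thesis using i by (simp add: z_def zs_def ad_gens(3))
    next
      case False
      then have "j - n < n" "i \<noteq> j" using ij i by auto
      then show ?thesis using i False by (simp add: z_def zs_def ad_gens(2))
    qed
  next
    case i: False
    then have i': "i - n < n" using ij by simp
    show ?thesis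
    proof (cases "j < n")
      case True
      then have "i \<noteq> j" using i by simp
      then show ?thesis using i i' True by (simp add: z_def zs_def ad_uminus in_W ad_gens(1))
    next
      case False
      then have j': "j - n < n" "j - n = i - n \<longleftrightarrow> i = j" using ij i by auto
      then show ?thesis using i i' False by (simp add: z_def zs_def ad_uminus in_W ad_gens(3))
    qed
  qed
qed

lemma ad_swap: "a \<in> carrier W \<Longrightarrow> b \<in> carrier W \<Longrightarrow> kW.ad a b = \<ominus>\<^bsub>W\<^esub> kW.ad b a"
  by (simp add: kW.ad_def a_minus_def kW.ks.minus_add kW.ks.a_comm)

text \<open>Each \<open>z i\<close> is, up to sign, some \<open>zs i'\<close>, so
  \<open>zs_comm\<close> already determines all commutators of generators.\<close>

lemma z_comm: "i < 2 * n \<Longrightarrow> j < 2 * n \<Longrightarrow> \<exists>c. kW.ad (z i) (z j) = c \<odot>\<^bsub>W\<^esub> \<one>\<^bsub>W\<^esub>"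
proof -
  assume ij: "i < 2 * n" "j < 2 * n"
  have 1: "\<exists>c. kW.ad (z i) (z j) = c \<odot>\<^bsub>W\<^esub> kW.ad (zs i') (z j)"
    if "zs i' = z i \<or> zs i' = \<ominus>\<^bsub>W\<^esub> z i" for i'
    using that
  proof
    assume "zs i' = z i"
    then show ?thesis using ij z_in by (intro exI[of _ 1]) simp
  next
    assume a: "zs i' = \<ominus>\<^bsub>W\<^esub> z i"
    then show ?thesis
      using ij z_in kW.ks.smult_neg1[of "kW.ad (z j) (z i)"] ad_swap[of "z i" "z j"]
      by (intro exI[of _ "-1"]) (simp add: ad_uminus)
  qed
  have "\<exists>i'<2 * n. zs i' = z i \<or> zs i' = \<ominus>\<^bsub>W\<^esub> z i"
  proof (cases "i < n")
    case True
    then show ?thesis by (intro exI[of _ "n + i"]) (simp add: z_def zs_def)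
  next
    case False
    moreover have "i - n < n" using ij False by simp
    ultimately show ?thesis by (intro exI[of _ "i - n"]) (simp add: z_def zs_def)
  qed
  then obtain i' where i': "i' < 2 * n" "zs i' = z i \<or> zs i' = \<ominus>\<^bsub>W\<^esub> z i" by blast
  from 1[OF i'(2)] obtain c where "kW.ad (z i) (z j) = c \<odot>\<^bsub>W\<^esub> kW.ad (zs i') (z j)" by blast
  then have "kW.ad (z i) (z j) = (if i' = j then c else 0) \<odot>\<^bsub>W\<^esub> \<one>\<^bsub>W\<^esub>" using ij i'(1) zs_comm by simp
  then show ?thesis by blast
qed

lemma proj_word: "w \<in> lists (weyl_gens n) \<Longrightarrow>
    \<exists>w'. set w' \<subseteq> {..<2 * n} \<and> Q.proj (basis_elt w) = foldr (\<lambda>i a. z i \<otimes>\<^bsub>W\<^esub> a) w' \<one>\<^bsub>W\<^esub>"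
proof (induction w)
  case Nil
  have "\<one>\<^bsub>W\<^esub> = Q.proj (basis_elt [])" by (simp add: W_one monoid_algebra_sel(2) free_monoid_def)
  then show ?case by (intro exI[of _ "[]"]) simp
next
  case (Cons g w)
  then have g: "g \<in> weyl_gens n" and w: "w \<in> lists (weyl_gens n)" by auto
  obtain w' where w': "set w' \<subseteq> {..<2 * n}" "Q.proj (basis_elt w) = foldr (\<lambda>i a. z i \<otimes>\<^bsub>W\<^esub> a) w' \<one>\<^bsub>W\<^esub>"
    using Cons.IH w by blast
  have "e g \<in> z ` {..<2 * n}" using g z_image by blast
  then obtain i where i: "i < 2 * n" "e g = z i" by auto
  have wF: "basis_elt w \<in> carrier rep.F" using w by (intro basis_elt_in) (simp add: free_monoid_def)
  have "basis_elt (g # w) = basis_elt [g] \<otimes>\<^bsub>rep.F\<^esub> basis_elt w"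
    by (simp add: basis_elt_mult free_monoid_def)
  then have "Q.proj (basis_elt (g # w)) = z i \<otimes>\<^bsub>W\<^esub> foldr (\<lambda>i a. z i \<otimes>\<^bsub>W\<^esub> a) w' \<one>\<^bsub>W\<^esub>"
    using proj_mult[OF gen_in[OF g] wF] i w' by (simp add: e_eq)
  then show ?case using w' i by (intro exI[of _ "i # w'"]) simp
qed

lemma W_gen: "carrier W \<subseteq> kspan W {foldr (\<lambda>i a. z i \<otimes>\<^bsub>W\<^esub> a) w \<one>\<^bsub>W\<^esub> | w. set w \<subseteq> {..<2 * n}}"
proof -
  have b: "basis_elt ` carrier Fm \<subseteq> carrier rep.F" by (rule image_subsetI) (rule basis_elt_in)
  have "carrier W = Q.proj ` kspan rep.F (basis_elt ` carrier Fm)"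
    unfolding W_carrier by (rule arg_cong[OF monoid_algebra_span])
  also have "\<dots> = kspan W (Q.proj ` basis_elt ` carrier Fm)"
    by (rule klin_kspan[OF klin_proj rep.F.ks.kspace_axioms kW.ks.kspace_axioms b])
  also have "\<dots> \<subseteq> kspan W {foldr (\<lambda>i a. z i \<otimes>\<^bsub>W\<^esub> a) w \<one>\<^bsub>W\<^esub> | w. set w \<subseteq> {..<2 * n}}"
  proof (rule kspan_mono, safe)
    fix w assume "w \<in> carrier Fm"
    then have "w \<in> lists (weyl_gens n)" by (simp add: free_monoid_def)
    from proj_word[OF this]
    show "\<exists>w'. Q.proj (basis_elt w) = foldr (\<lambda>i a. z i \<otimes>\<^bsub>W\<^esub> a) w' \<one>\<^bsub>W\<^esub> \<and> set w' \<subseteq> {..<2 * n}" by blast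
  qed
  finally show ?thesis .
qed

definition act :: "'k weyl \<Rightarrow> ((nat \<Rightarrow> nat) \<Rightarrow> 'k) \<Rightarrow> (nat \<Rightarrow> nat) \<Rightarrow> 'k" where
  "act C = rep.lin (SOME f. f \<in> carrier rep.F \<and> Q.proj f = C)"

lemma act_proj: "f \<in> carrier rep.F \<Longrightarrow> act (Q.proj f) v = rep.lin f v"
proof -
  assume f: "f \<in> carrier rep.F"
  let ?f = "SOME h. h \<in> carrier rep.F \<and> Q.proj h = Q.proj f"
  have h: "?f \<in> carrier rep.F \<and> Q.proj ?f = Q.proj f" by (rule someI[of _ f]) (use f in simp)
  show ?thesis unfolding act_def
    by (rule rep.lin_quot[OF kquot_weyl relations_annih conjunct1[OF h] f conjunct2[OF h]]) simp
qed

lemma act_e: "g \<in> weyl_gens n \<Longrightarrow> act (e g) v = gen_op g v"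
  unfolding e_eq by (simp add: act_proj gen_in rep.lin_basis gen_Fm word_op_def)

lemma W_ex: "a \<in> carrier W \<Longrightarrow> \<exists>f\<in>carrier rep.F. a = Q.proj f"
  unfolding W_carrier by blast

lemma klin_act: "klin W (carrier W) fock (\<lambda>a. act a v)"
proof (rule klinI)
  have k: "klin rep.F (carrier rep.F) fock (\<lambda>f. rep.lin f v)" by (rule rep.klin_lin) simp
  fix a b and c :: 'k assume a: "a \<in> carrier W"
  obtain f where f: "f \<in> carrier rep.F" "a = Q.proj f" using W_ex[OF a] by blast
  show "act a v \<in> carrier fock" by simp
  show "act (c \<odot>\<^bsub>W\<^esub> a) v = c \<odot>\<^bsub>fock\<^esub> act a v"
    unfolding f(2) klinD(3)[OF klin_proj f(1), symmetric]
    using f(1) klinD(3)[OF k f(1)] by (simp only: act_proj rep.F.ks.smult_in)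
  assume b: "b \<in> carrier W"
  obtain h where h: "h \<in> carrier rep.F" "b = Q.proj h" using W_ex[OF b] by blast
  show "act (a \<oplus>\<^bsub>W\<^esub> b) v = act a v \<oplus>\<^bsub>fock\<^esub> act b v"
    unfolding f(2) h(2) klinD(2)[OF klin_proj f(1) h(1), symmetric]
    using f(1) h(1) klinD(2)[OF k f(1) h(1)] by (simp only: act_proj rep.F.ks.a_closed)
qed

lemma klin_act_r: "a \<in> carrier W \<Longrightarrow> klin fock (carrier fock) fock (act a)"
proof -
  assume "a \<in> carrier W"
  then obtain f where f: "f \<in> carrier rep.F" "a = Q.proj f" using W_ex by blast
  have "act a = rep.lin f" using act_proj[OF f(1)] f(2) by (simp add: fun_eq_iff)
  then show ?thesis using rep.klin_lin_r[OF f(1)] by simp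
qed

lemma act_mult: "a \<in> carrier W \<Longrightarrow> b \<in> carrier W \<Longrightarrow> act (a \<otimes>\<^bsub>W\<^esub> b) v = act a (act b v)"
proof -
  assume "a \<in> carrier W" "b \<in> carrier W"
  then obtain f h where f: "f \<in> carrier rep.F" "a = Q.proj f" and h: "h \<in> carrier rep.F" "b = Q.proj h"
    using W_ex[of a] W_ex[of b] by blast
  show ?thesis
    unfolding f(2) h(2) proj_mult[OF f(1) h(1), symmetric]
    by (simp add: act_proj f(1) h(1) rep.lin_mult)
qed

lemma act_one: "act \<one>\<^bsub>W\<^esub> v = v"
  unfolding W_one by (simp add: act_proj rep.lin_one)

lemma act_z: "i < 2 * n \<Longrightarrow> v \<in> fbox n j \<Longrightarrow> act (z i) v \<in> fbox n (Suc j)"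
proof -
  assume "i < 2 * n" and v: "v \<in> fbox n j"
  then have "z i \<in> e ` weyl_gens n" using z_image by blast
  then obtain g where "g \<in> weyl_gens n" "z i = e g" by blast
  then show ?thesis using gen_op_fbox[OF v] by (simp add: act_e del: gen_op.simps)
qed

lemma weyl_like: "weyl_like W (2 * n) z zs"
proof (intro weyl_like.intro weyl_like_axioms.intro kalg_W z_in z_comm zs_comm W_gen)
  show "zs i \<in> kspan W (z ` {..<2 * n})" if "i < 2 * n" for i
  proof (cases "i < n")
    case True
    have "e (WY i) \<in> z ` {..<2 * n}" unfolding z_image using gens_in(2)[OF True] by blast
    then show ?thesis using True kspan_base by (simp add: zs_def)
  next
    case False
    have "i - n < n" using that False by simp
    then have "e (WX (i - n)) \<in> z ` {..<2 * n}" unfolding z_image using gens_in(1) by blast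
    then have "e (WX (i - n)) \<in> kspan W (z ` {..<2 * n})" by (rule kspan_base)
    moreover have "ksub W (kspan W (z ` {..<2 * n}))"
      by (rule kW.ks.kspan_sub, rule image_subsetI) (simp add: z_in)
    ultimately have "\<ominus>\<^bsub>W\<^esub> e (WX (i - n)) \<in> kspan W (z ` {..<2 * n})" by (rule kW.ks.ksub_neg[rotated])
    then show ?thesis using False by (simp add: zs_def)
  qed
  \<comment> \<open>The relations could a priori collapse the algebra; 1 acting as the identity on a
    nonzero space excludes it.\<close>
  show "\<one>\<^bsub>W\<^esub> \<noteq> \<zero>\<^bsub>W\<^esub>"
  proof
    assume "\<one>\<^bsub>W\<^esub> = \<zero>\<^bsub>W\<^esub>"
    then have "(\<lambda>\<alpha>. 1) = act \<zero>\<^bsub>W\<^esub> (\<lambda>\<alpha>. 1)" using act_one[of "\<lambda>\<alpha>. 1"] by simp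
    also have "\<dots> = \<zero>\<^bsub>fock\<^esub>" by (rule kW.ks.klin_zero[OF klin_act kspace_fock]) auto
    finally show False by (simp add: fun_eq_iff)
  qed
qed

sublocale WL: weyl_like W "2 * n" z zs
  by (rule weyl_like)

lemma linear_part: "weyl_linear_part n = WL.U"
  unfolding weyl_linear_part_def WL.U_def z_image
  using e_in by (intro kW.ks.kspan_eq) blast

end

section \<open>Finite groups of symplectic automorphisms\<close>

locale symplectic_group = weyl n "TYPE('k::field_char_0)" for n +
  fixes G :: "('k::field_char_0 weyl \<Rightarrow> 'k weyl) set"
  assumes n_ge: "n \<ge> 1" and G_group: "subgroup G (BijGroup (carrier W))" and G_fin: "finite G"
    and G_symplectic: "g \<in> G \<Longrightarrow> symplectic n g"
begin

definition e0 :: "'k weyl \<Rightarrow> 'k weyl" where "e0 = (\<lambda>a\<in>carrier W. a)"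

lemma g_bij: "g \<in> G \<Longrightarrow> g \<in> extensional (carrier W)" "g \<in> G \<Longrightarrow> bij_betw g (carrier W) (carrier W)"
  using subgroup.subset[OF G_group] by (auto simp: BijGroup_def Bij_def)

lemma g_iso: "g \<in> G \<Longrightarrow> g \<in> ring_iso W W"
  using G_symplectic by (simp add: symplectic_def algebra_automorphism_def)

lemma G_klin: "g \<in> G \<Longrightarrow> klin W (carrier W) W g"
  using G_symplectic ring_iso_memE[OF g_iso] by (intro klinI) (auto simp: symplectic_def algebra_automorphism_def)

lemma G_U: "g \<in> G \<Longrightarrow> u \<in> WL.U \<Longrightarrow> g u \<in> WL.U"
  using G_symplectic linear_part by (auto simp: symplectic_def)

lemma e0_G: "e0 \<in> G"
  using subgroup.one_closed[OF G_group] by (simp add: BijGroup_def e0_def)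

text \<open>Composition with h is injective on G because h is a bijection and the members of G are
  extensional; finiteness makes it a permutation.\<close>

lemma G_left: "h \<in> G \<Longrightarrow> \<exists>\<phi>. bij_betw \<phi> G G \<and> (\<forall>g\<in>G. \<forall>a\<in>carrier W. \<phi> g a = h (g a))"
proof -
  assume h: "h \<in> G"
  let ?\<phi> = "compose (carrier W) h"
  have cl: "?\<phi> g \<in> G" if "g \<in> G" for g
  proof -
    have "h \<in> Bij (carrier W)" "g \<in> Bij (carrier W)"
      using subgroup.subset[OF G_group] h that by (auto simp: BijGroup_def)
    then show ?thesis using subgroup.m_closed[OF G_group h that] by (simp add: BijGroup_def)
  qed
  have gc: "g a \<in> carrier W" if "g \<in> G" "a \<in> carrier W" for g a
    using g_bij(2)[OF that(1)] that(2) by (rule bij_betwE[THEN bspec])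
  have "inj_on ?\<phi> G"
  proof (rule inj_onI)
    fix g g' assume g: "g \<in> G" "g' \<in> G" "?\<phi> g = ?\<phi> g'"
    show "g = g'"
    proof (rule extensionalityI[OF g_bij(1)[OF g(1)] g_bij(1)[OF g(2)]])
      fix a assume a: "a \<in> carrier W"
      have "h (g a) = h (g' a)" using fun_cong[OF g(3), of a] a by (simp add: compose_def)
      then show "g a = g' a"
        using bij_betw_imp_inj_on[OF g_bij(2)[OF h]] gc[OF g(1) a] gc[OF g(2) a] by (simp add: inj_on_eq_iff)
    qed
  qed
  moreover have "?\<phi> ` G \<subseteq> G" using cl by blast
  ultimately have "bij_betw ?\<phi> G G" using endo_inj_surj[OF G_fin] by (simp add: bij_betw_def)
  then show ?thesis by (intro exI[of _ ?\<phi>]) (simp add: compose_def)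
qed

lemma G_faithful:
  assumes "g \<in> G" "\<And>i. i < 2 * n \<Longrightarrow> g (z i) = z i"
  shows "g = e0"
proof (rule extensionalityI[OF g_bij(1)[OF assms(1)]])
  show "e0 \<in> extensional (carrier W)" by (rule g_bij(1)[OF e0_G])
  fix a assume a: "a \<in> carrier W"
  have w: "set w \<subseteq> {..<2 * n} \<Longrightarrow> g (WL.word w) = WL.word w" for w
    using assms ring_iso_memE(2,4)[OF g_iso[OF assms(1)]] z_in by (induction w) auto
  have "ksub W {a \<in> carrier W. g a = a}"
    using kW.ks.klin_zero[OF G_klin[OF assms(1)] kW.ks.kspace_axioms] klinD(2,3)[OF G_klin[OF assms(1)]]
    by (auto simp: ksub_def)
  then have "kspan W {WL.word w | w. set w \<subseteq> {..<2 * n}} \<subseteq> {a \<in> carrier W. g a = a}"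
    using w by (intro kspan_least) auto
  then show "g a = e0 a" using W_gen a by (auto simp: e0_def WL.word_def)
qed

sublocale I: inv_alg W "2 * n" z zs G e0 n
proof (intro inv_alg.intro galois.intro galois_axioms.intro inv_alg_axioms.intro weyl_like)
  show "e0 a = a" if "a \<in> carrier W" for a using that by (simp add: e0_def)
  show "\<And>g a b. g \<in> G \<Longrightarrow> a \<in> carrier W \<Longrightarrow> b \<in> carrier W \<Longrightarrow> g (a \<otimes>\<^bsub>W\<^esub> b) = g a \<otimes>\<^bsub>W\<^esub> g b"
    by (rule ring_iso_memE(2)[OF g_iso])
  show "\<And>g. g \<in> G \<Longrightarrow> g \<one>\<^bsub>W\<^esub> = \<one>\<^bsub>W\<^esub>" by (rule ring_iso_memE(4)[OF g_iso])
qed (fact G_fin G_klin G_U e0_G G_left G_faithful n_ge refl)+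

sublocale R: fock_rep W "2 * n" z zs G e0 n act
  by (intro fock_rep.intro I.inv_alg_axioms fock_rep_axioms.intro klin_act klin_act_r act_mult act_one act_z)

lemma invariants: "invariant_algebra W G = I.BB"
  unfolding invariant_algebra_def I.B_def by (rule refl)

end

theorem theorem5p7:
  fixes n :: nat
    and G :: "('k::field_char_0 weyl \<Rightarrow> 'k weyl) set"
    and B :: "('k, 'k weyl) module"
  assumes "n \<ge> 1"
    and "subgroup G (BijGroup (carrier (weyl_algebra n)))"
    and "finite G"
    and "\<forall>\<sigma>\<in>G. symplectic n \<sigma>"
    and "B = invariant_algebra (weyl_algebra n) G"
  shows "(has_fdim B 1 \<and>
          holonomic_number B = ereal (real n) \<and>
          (\<forall>M :: ('k weyl, 'm) module.
             fg_module B M \<and> nonzero_module M \<longrightarrow> ereal (real n) \<le> GK B M)) \<and>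
         (\<forall>M :: ('k weyl, 'm) module.
             nonzero_module M \<and> holonomic B M \<longrightarrow>
               cyclic_module B M \<and> torsion_module B M \<and> module_length B M < \<infinity> \<and>
               (\<forall>e. multiplicity_function B e \<longrightarrow>
                  module_length B M \<le> enat (e M) \<and>
                  (e M = 1 \<longrightarrow> simple_module B M)))"
proof -
  interpret symplectic_group n G
    using assms by (intro symplectic_group.intro) auto
  have B: "B = I.BB" using assms(5) invariants by simp
  have fdim: "has_fdim I.BB 1" by (rule I.filter_dimension_1) (rule R.box_obstruction)
  have "cyclic_module I.BB M \<and> torsion_module I.BB M \<and> module_length I.BB M < \<infinity> \<and>
      (\<forall>e. multiplicity_function I.BB e \<longrightarrow> module_length I.BB M \<le> enat (e M) \<and> (e M = 1 \<longrightarrow> simple_module I.BB M))"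
    if M: "nonzero_module M" "holonomic I.BB M" for M :: "('k weyl, 'm) module"
  proof -
    have fg: "fg_module I.BB M" and GK: "GK I.BB M \<le> ereal (real n)"
      using M(2) R.holonomic_number_eq by (auto simp: holonomic_def)
    interpret H: holonomic_module W "2 * n" z zs G e0 n M
      by (intro holonomic_module.intro holonomic_module_axioms.intro I.inv_moduleI I.fg_kmod fg GK)
    show ?thesis
      using H.cyclic H.torsion H.module_length_finite H.length_le_multiplicity H.simple_if_multiplicity_1 M(1) by blast
  qed
  then show ?thesis unfolding B using fdim R.holonomic_number_eq I.bernstein by blast
qed

end
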